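(* Let $d,\ell\in\mathbb{N}$ with $\ell\ge 1$ and let $\sigma>0$. There are constants $c,C>0$ depending only on $d$, $\ell$ and $\sigma$ (in particular not on the mesh size, not on $\alpha=\min a/\max a$ and not on $\beta$) such that the following holds. Let $\mathcal{T}$ be a conforming simplicial mesh of a polyhedral domain $\Omega\subset\mathbb{R}^d$ with shape parameter bounded by $\sigma$, let $a$ be a uniformly positive function on $\Omega$ that is constant on every $K\in\mathcal{T}$, and let $\beta>0$. Assume that $a$ satisfies the quasi-monotonicity property. For $u\in H^1(\Omega)$ set $$L(u)=\inf_{v\in S^{\ell,0}(\mathcal{T})}\|a^{1/2}\nabla(u-v)\|_{L^2(\Omega)}^2+\inf_{w\in S^{\ell,0}(\mathcal{T})}\beta\|u-w\|_{L^2(\Omega)}^2,$$ $$R(u)=\sum_{F\in\mathcal{F}_\Omega}\ \inf_{Q\in S^{\ell,0}(\mathcal{T})|_{\omega_F}}\beta\|u-Q\|_{L^2(\omega_F)}^2+\sum_{K\in\mathcal{T}}\ \inf_{P\in\mathbb{P}_\ell(K)}\|a^{1/2}\nabla(u-P)\|_{L^2(K)}^2 .$$ Then, for every $u\in H^1(\Omega)$, $c\,R(u)\le L(u)\le C\,R(u)$.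
   Context: Elements $K\in\mathcal{T}$ are (closed) $d$-simplices. The mesh has shape parameter bounded by $\sigma$ if $\sup_{K\in\mathcal{T}}h_K/\rho_K\le\sigma$, where $h_K=\mathrm{diam}(K)$ and $\rho_K$ is the maximum diameter of a ball inscribed in $K$. $\mathbb{P}_\ell(K)$ is the space of polynomials of total degree at most $\ell$ on $K$, and $S^{\ell,0}(\mathcal{T})$ is the space of functions $v\in C^0(\Omega)$ with $v|_K\in\mathbb{P}_\ell(K)$ for all $K\in\mathcal{T}$. $\mathcal{F}_\Omega$ is the set of interior $(d-1)$-dimensional faces of $\mathcal{T}$; for $F\in\mathcal{F}_\Omega$, $\omega_F$ is the union of the two elements sharing $F$, and $S^{\ell,0}(\mathcal{T})|_{\omega_F}$ is the space of restrictions to $\omega_F$ of functions in $S^{\ell,0}(\mathcal{T})$. Nodes: for a simplex $K$ with vertices $a_0,\dots,a_d$, $\mathcal{N}_K=\{\sum_{i=0}^d\frac{\alpha_i}{\ell}a_i:\alpha\in\mathbb{N}_0^{d+1},\ \sum_i\alpha_i=\ell\}$, and $\mathcal{N}=\bigcup_{K\in\mathcal{T}}\mathcal{N}_K$. The nodal basis $\{\phi_z\}_{z\in\mathcal{N}}$ of $S^{\ell,0}(\mathcal{T})$ is given by $\phi_z(y)=\delta_{yz}$ for $y,z\in\mathcal{N}$, and $\omega_z=\mathrm{supp}(\phi_z)$. Quasi-monotonicity: write $a_K$ for the value of $a$ on $K$. For $z\in\mathcal{N}$ and elements $K,\widetilde K\subset\omega_z$, a monotone path from $K$ to $\widetilde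 K$ is a finite sequence of elements $K_0,\dots,K_m\subset\omega_z$ with $K_0=K$, $K_m=\widetilde K$, such that for $n=0,\dots,m-1$ one has $K_n\cap K_{n+1}\in\mathcal{F}_\Omega$ and $a_{K_n}\le a_{K_{n+1}}$. The function $a$ satisfies the quasi-monotonicity property if for every $z\in\mathcal{N}$ and all elements $K,\widetilde K\subset\omega_z$ with $a_K\le a_{\widetilde K}$ there exists a monotone path from $K$ to $\widetilde K$.
   Formalization: The upper bound L(u) ≤ C R(u) is stated only for meshes with at least one interior face (at least two elements); on a one-element mesh R(u) does not depend on β while L(u) grows with β, so it fails there. The lower bound is stated for all meshes. *)

theory Defs
  imports "HOL-Analysis.Analysis"
begin

text \<open>
  The space \<open>\<real>\<^sup>d\<close> is an arbitrary Euclidean space \<^typ>\<open>'a::euclidean_space\<close> with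
  \<open>d = DIM('a) \<ge> 1\<close>. A function on a set \<open>D\<close> is represented by any total function with the
  prescribed values on \<open>D\<close>; its values off \<open>D\<close> are irrelevant.
\<close>

section \<open>\<open>L\<^sup>2\<close> and \<open>H\<^sup>1\<close>\<close>

definition L2 :: "'a::euclidean_space set \<Rightarrow> ('a \<Rightarrow> 'b::euclidean_space) set" where
  "L2 D = {f. f \<in> borel_measurable (lebesgue_on D) \<and>
              integrable (lebesgue_on D) (\<lambda>x. (norm (f x))\<^sup>2)}"

definition L2_norm_on :: "'a::euclidean_space set \<Rightarrow> ('a \<Rightarrow> 'b::euclidean_space) \<Rightarrow> real" where
  "L2_norm_on D f = sqrt (LINT x|lebesgue_on D. (norm (f x))\<^sup>2)"

primrec Ck :: "nat \<Rightarrow> ('a::euclidean_space \<Rightarrow> real) \<Rightarrow> bool" where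
  "Ck 0 f \<longleftrightarrow> continuous_on UNIV f"
| "Ck (Suc k) f \<longleftrightarrow> f differentiable_on UNIV \<and>
     (\<forall>b\<in>Basis. Ck k (\<lambda>x. frechet_derivative f (at x) b))"

definition supp_in :: "'a::euclidean_space set \<Rightarrow> ('a \<Rightarrow> real) \<Rightarrow> 'a set" where
  "supp_in D f = closure {x \<in> D. f x \<noteq> 0}"

definition test_functions :: "'a::euclidean_space set \<Rightarrow> ('a \<Rightarrow> real) set" where
  "test_functions D =
     {\<phi>. (\<forall>k. Ck k \<phi>) \<and> compact (supp_in UNIV \<phi>) \<and> supp_in UNIV \<phi> \<subseteq> D}"

definition is_weak_gradient ::
    "'a::euclidean_space set \<Rightarrow> ('a \<Rightarrow> real) \<Rightarrow> ('a \<Rightarrow> 'a) \<Rightarrow> bool" where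
  "is_weak_gradient D u g \<longleftrightarrow> g \<in> L2 D \<and>
     (\<forall>\<phi>\<in>test_functions D. \<forall>b\<in>Basis.
        (LINT x|lebesgue_on D. u x * frechet_derivative \<phi> (at x) b)
        = - (LINT x|lebesgue_on D. (g x \<bullet> b) * \<phi> x))"

definition H1 :: "'a::euclidean_space set \<Rightarrow> ('a \<Rightarrow> real) set" where
  "H1 D = {u \<in> L2 D. \<exists>g. is_weak_gradient D u g}"

text \<open>The weak gradient is only determined up to null sets; a representative is chosen.\<close>

definition wgrad :: "'a::euclidean_space set \<Rightarrow> ('a \<Rightarrow> real) \<Rightarrow> 'a \<Rightarrow> 'a" where
  "wgrad D u = (SOME g. is_weak_gradient D u g)"

section \<open>Meshes\<close>

text \<open>
  The condition on \<^term>\<open>interior (closure \<Omega>)\<close> says that \<open>\<Omega>\<close> has no slits or punctures;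
  the boundary need not be Lipschitz.
\<close>

definition polyhedral_domain :: "'a::euclidean_space set \<Rightarrow> bool" where
  "polyhedral_domain \<Omega> \<longleftrightarrow> open \<Omega> \<and> connected \<Omega> \<and> bounded \<Omega> \<and> \<Omega> \<noteq> {} \<and>
     interior (closure \<Omega>) = \<Omega> \<and>
     (\<exists>\<P>. finite \<P> \<and> (\<forall>P\<in>\<P>. polytope P) \<and> closure \<Omega> = \<Union>\<P>)"

definition conforming_mesh :: "'a::euclidean_space set set \<Rightarrow> 'a set \<Rightarrow> bool" where
  "conforming_mesh \<T> \<Omega> \<longleftrightarrow> triangulation \<T> \<and> (\<forall>K\<in>\<T>. int DIM('a) simplex K) \<and>
     \<Union>\<T> = closure \<Omega>"

definition inball_diameter :: "'a::euclidean_space set \<Rightarrow> real" where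
  "inball_diameter K = Sup {diameter (cball x r) | x r. 0 \<le> r \<and> cball x r \<subseteq> K}"

definition shape_bounded :: "real \<Rightarrow> 'a::euclidean_space set set \<Rightarrow> bool" where
  "shape_bounded \<sigma> \<T> \<longleftrightarrow> (\<forall>K\<in>\<T>. diameter K / inball_diameter K \<le> \<sigma>)"

definition interior_faces :: "'a::euclidean_space set set \<Rightarrow> 'a set \<Rightarrow> 'a set set" where
  "interior_faces \<T> \<Omega> = {F. (\<exists>K\<in>\<T>. F facet_of K) \<and> \<not> F \<subseteq> frontier \<Omega>}"

definition face_patch :: "'a::euclidean_space set set \<Rightarrow> 'a set \<Rightarrow> 'a set" where
  "face_patch \<T> F = \<Union>{K\<in>\<T>. F facet_of K}"

section \<open>Polynomials and finite elements\<close>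

definition multi_indices :: "nat \<Rightarrow> ('a::euclidean_space \<Rightarrow> nat) set" where
  "multi_indices l = {\<alpha> \<in> Basis \<rightarrow>\<^sub>E {..l}. (\<Sum>b\<in>Basis. \<alpha> b) \<le> l}"

definition Poly :: "nat \<Rightarrow> 'a::euclidean_space set \<Rightarrow> ('a \<Rightarrow> real) set" where
  "Poly l K = {p. \<exists>c. \<forall>x\<in>K. p x = (\<Sum>\<alpha>\<in>multi_indices l. c \<alpha> * (\<Prod>b\<in>Basis. (x \<bullet> b) ^ \<alpha> b))}"

definition cpw_poly ::
    "nat \<Rightarrow> 'a::euclidean_space set set \<Rightarrow> 'a set \<Rightarrow> ('a \<Rightarrow> real) set" where
  "cpw_poly l \<T> \<Omega> = {v. continuous_on \<Omega> v \<and> (\<forall>K\<in>\<T>. v \<in> Poly l K)}"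

definition restrictions :: "('a \<Rightarrow> real) set \<Rightarrow> 'a set \<Rightarrow> ('a \<Rightarrow> real) set" where
  "restrictions S \<omega> = {q. \<exists>v\<in>S. \<forall>x\<in>\<omega>. q x = v x}"

definition element_nodes :: "nat \<Rightarrow> 'a::euclidean_space set \<Rightarrow> 'a set" where
  "element_nodes l K =
     {(\<Sum>v | v extreme_point_of K. (real (\<alpha> v) / real l) *\<^sub>R v) | \<alpha> :: 'a \<Rightarrow> nat.
        (\<Sum>v | v extreme_point_of K. \<alpha> v) = l}"

definition nodes :: "nat \<Rightarrow> 'a::euclidean_space set set \<Rightarrow> 'a set" where
  "nodes l \<T> = (\<Union>K\<in>\<T>. element_nodes l K)"

text \<open>The values of the nodal basis function on the closure of \<open>\<Omega>\<close> are unique.\<close>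

definition nodal_basis ::
    "nat \<Rightarrow> 'a::euclidean_space set set \<Rightarrow> 'a set \<Rightarrow> 'a \<Rightarrow> 'a \<Rightarrow> real" where
  "nodal_basis l \<T> \<Omega> z =
     (SOME \<phi>. \<phi> \<in> cpw_poly l \<T> \<Omega> \<and> (\<forall>y\<in>nodes l \<T>. \<phi> y = (if y = z then 1 else 0)))"

definition node_patch ::
    "nat \<Rightarrow> 'a::euclidean_space set set \<Rightarrow> 'a set \<Rightarrow> 'a \<Rightarrow> 'a set" where
  "node_patch l \<T> \<Omega> z = supp_in (closure \<Omega>) (nodal_basis l \<T> \<Omega> z)"

section \<open>The coefficient\<close>

definition uniformly_positive :: "'a set \<Rightarrow> ('a \<Rightarrow> real) \<Rightarrow> bool" where
  "uniformly_positive \<Omega> a \<longleftrightarrow> (\<exists>\<delta>>0. \<forall>x\<in>\<Omega>. \<delta> \<le> a x)"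

text \<open>
  Closed elements overlap in faces, where \<open>a\<close> may jump; hence \<open>a\<close> is required to be constant only
  on the interiors of the elements. Its values on the (null) union of the element boundaries play
  no role.
\<close>

definition elementwise_constant :: "'a::euclidean_space set set \<Rightarrow> ('a \<Rightarrow> real) \<Rightarrow> bool" where
  "elementwise_constant \<T> a \<longleftrightarrow> (\<forall>K\<in>\<T>. a constant_on interior K)"

definition element_value :: "('a::euclidean_space \<Rightarrow> real) \<Rightarrow> 'a set \<Rightarrow> real" where
  "element_value a K = (THE c. \<forall>x\<in>interior K. a x = c)"

definition monotone_path ::
    "'a::euclidean_space set set \<Rightarrow> 'a set \<Rightarrow> ('a \<Rightarrow> real) \<Rightarrow> 'a set \<Rightarrow>
     nat \<Rightarrow> (nat \<Rightarrow> 'a set) \<Rightarrow> 'a set \<Rightarrow> 'a set \<Rightarrow> bool" where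
  "monotone_path \<T> \<Omega> a \<omega> m P K K' \<longleftrightarrow>
     P 0 = K \<and> P m = K' \<and> (\<forall>n\<le>m. P n \<in> \<T> \<and> P n \<subseteq> \<omega>) \<and>
     (\<forall>n<m. P n \<inter> P (Suc n) \<in> interior_faces \<T> \<Omega> \<and>
            element_value a (P n) \<le> element_value a (P (Suc n)))"

definition quasi_monotone ::
    "nat \<Rightarrow> 'a::euclidean_space set set \<Rightarrow> 'a set \<Rightarrow> ('a \<Rightarrow> real) \<Rightarrow> bool" where
  "quasi_monotone l \<T> \<Omega> a \<longleftrightarrow>
     (\<forall>z\<in>nodes l \<T>. \<forall>K\<in>\<T>. \<forall>K'\<in>\<T>.
        K \<subseteq> node_patch l \<T> \<Omega> z \<and> K' \<subseteq> node_patch l \<T> \<Omega> z \<and>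
        element_value a K \<le> element_value a K' \<longrightarrow>
        (\<exists>m P. monotone_path \<T> \<Omega> a (node_patch l \<T> \<Omega> z) m P K K'))"

section \<open>Global and local best errors\<close>

definition global_error ::
    "nat \<Rightarrow> 'a::euclidean_space set set \<Rightarrow> 'a set \<Rightarrow> ('a \<Rightarrow> real) \<Rightarrow> real \<Rightarrow> ('a \<Rightarrow> real) \<Rightarrow> real" where
  "global_error l \<T> \<Omega> a \<beta> u =
     (INF v\<in>cpw_poly l \<T> \<Omega>.
        (L2_norm_on \<Omega> (\<lambda>x. sqrt (a x) *\<^sub>R wgrad \<Omega> (\<lambda>y. u y - v y) x))\<^sup>2) +
     (INF w\<in>cpw_poly l \<T> \<Omega>. \<beta> * (L2_norm_on \<Omega> (\<lambda>x. u x - w x))\<^sup>2)"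

text \<open>
  Weak gradients live on open sets, so on the closed element \<open>K\<close> the gradient is the one on
  \<^term>\<open>interior K\<close>, which differs from \<open>K\<close> by a null set.
\<close>

definition local_error ::
    "nat \<Rightarrow> 'a::euclidean_space set set \<Rightarrow> 'a set \<Rightarrow> ('a \<Rightarrow> real) \<Rightarrow> real \<Rightarrow> ('a \<Rightarrow> real) \<Rightarrow> real" where
  "local_error l \<T> \<Omega> a \<beta> u =
     (\<Sum>F\<in>interior_faces \<T> \<Omega>.
        INF q\<in>restrictions (cpw_poly l \<T> \<Omega>) (face_patch \<T> F).
          \<beta> * (L2_norm_on (face_patch \<T> F) (\<lambda>x. u x - q x))\<^sup>2) +
     (\<Sum>K\<in>\<T>.
        INF p\<in>Poly l K.
          (L2_norm_on (interior K)
             (\<lambda>x. sqrt (a x) *\<^sub>R wgrad (interior K) (\<lambda>y. u y - p y) x))\<^sup>2)"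

end

theory Submission
  imports Defs
begin

text \<open>
  For the upper bound, near-best local polynomials \<open>\<pi>\<^sub>K\<close> are glued together by taking the value at each
  node \<open>z\<close> from one element \<open>K\<^sub>z\<close> of largest coefficient. Every element of the patch of \<open>z\<close> is joined to
  \<open>K\<^sub>z\<close> by a monotone path of bounded length, so the nodal error telescopes into jumps
  \<open>\<pi>\<^sub>K z - \<pi>\<^sub>K\<^sub>' z\<close> across facets, and monotonicity allows the weight \<open>a\<^sub>K\<close> to be moved along the path.

  In the \<open>L\<^sup>2\<close> part \<open>\<pi>\<^sub>K\<close> is the best approximation on one face patch containing \<open>K\<close>; approximations on
  face patches are continuous across the facet, so the jumps are bounded by face patch errors. In the
  gradient part \<open>\<pi>\<^sub>K\<close> is normalised by a weighted mean, and the jump across a facet is tested with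
  polynomials that vanish on the boundary of the union of the two elements. All bounds then come from
  explicit polynomial identities in barycentric coordinates, in place of trace and Poincare inequalities
  and of compactness arguments.

  The lower bound follows by restriction, as an element has at most \<open>2\<^sup>d\<^sup>+\<^sup>1\<close> facets.
\<close>

text \<open>All constants must be uniform over the simplices of a given shape and over all
  coefficients. A packing argument bounds the number of elements at a node and thereby the length of
  the paths. The two infima in L are independent, so the gluing is done twice through the one lemma
  \<open>node_average\<close>: with weight vol K for the L2 part and a_K vol K / h_K^2 for the
  gradient part.

  On the line, neighbours may have arbitrarily different diameters. The jump bound is therefore
  arranged so that each element contributes its own diameter and volume.

  If no facet is interior, the mesh is a single element and the first sum of R is empty. Then L
  grows with beta while R does not, so no uniform C exists; the upper bound is stated for meshes
  with an interior facet. Connectedness of the domain then gives every element one.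

  The test functions across a facet are piecewise polynomials that vanish only on the boundary of
  the patch, while weak gradients are defined by smooth functions with compact support inside the
  domain. Dilation followed by mollification closes this gap.\<close>

section \<open>Smooth functions\<close>

lemma Ck_SucI:
  assumes "\<And>x. (f has_derivative f' x) (at x)" "\<And>b. b \<in> Basis \<Longrightarrow> Ck k (\<lambda>x. f' x b)"
  shows "Ck (Suc k) f"
proof -
  have "frechet_derivative f (at x) = f' x" for x
    using frechet_derivative_at[OF assms(1)] by simp
  then show ?thesis
    using assms by (auto simp: differentiable_on_def differentiable_def)
qed

lemma Ck_Suc_has_derivative:
  assumes "Ck (Suc k) f"
  shows "(f has_derivative frechet_derivative f (at x)) (at x)"
  using assms by (auto simp: differentiable_on_def frechet_derivative_works)

lemma Ck_Suc_imp: "Ck (Suc k) f \<Longrightarrow> Ck k f"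
proof (induction k arbitrary: f)
  case 0
  then show ?case by (auto simp: differentiable_imp_continuous_on)
next
  case (Suc k)
  have "f differentiable_on UNIV" using Suc.prems by simp
  moreover have "Ck k (\<lambda>x. frechet_derivative f (at x) b)" if "b \<in> Basis" for b
    using Suc.prems Suc.IH that Ck.simps(2) by metis
  ultimately show ?case by simp
qed

lemma Ck_imp_continuous_on: "Ck k f \<Longrightarrow> continuous_on S f"
proof (induction k)
  case 0
  then show ?case using continuous_on_subset by auto
qed (use Ck_Suc_imp in blast)

lemma Ck_const: "Ck k (\<lambda>x. c)"
proof (induction k arbitrary: c)
  case (Suc k)
  show ?case by (rule Ck_SucI[where f' = "\<lambda>x h. 0"]) (use Suc in auto)
qed simp

lemma Ck_add: "Ck k f \<Longrightarrow> Ck k g \<Longrightarrow> Ck k (\<lambda>x. f x + g x)"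
proof (induction k arbitrary: f g)
  case (Suc k)
  note d = Suc.prems[THEN Ck_Suc_has_derivative]
  show ?case
    by (rule Ck_SucI, rule has_derivative_add[OF d]) (use Suc in auto)
qed (auto intro: continuous_intros)

lemma Ck_mult: "Ck k f \<Longrightarrow> Ck k g \<Longrightarrow> Ck k (\<lambda>x. f x * g x)"
proof (induction k arbitrary: f g)
  case (Suc k)
  note d = Suc.prems[THEN Ck_Suc_has_derivative]
  show ?case
    by (rule Ck_SucI, rule has_derivative_mult[OF d])
      (use Suc Ck_Suc_imp[OF Suc.prems(1)] Ck_Suc_imp[OF Suc.prems(2)] in \<open>auto intro!: Ck_add\<close>)
qed (auto intro: continuous_intros)

lemma Ck_prod: "(\<And>i. i \<in> I \<Longrightarrow> Ck k (f i)) \<Longrightarrow> Ck k (\<lambda>x. \<Prod>i\<in>I. f i x)"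
  by (induction I rule: infinite_finite_induct) (auto intro: Ck_const Ck_mult)

text \<open>The outer function comes with the sequence \<open>H\<close> of its successive
  derivatives: one chain rule step replaces \<open>H j\<close> by \<open>H (Suc j)\<close> and
  multiplies by a derivative of f, so the induction runs over all j at once.\<close>

lemma Ck_compose:
  assumes H: "\<And>j t. (H j has_real_derivative H (Suc j) t) (at t)"
  shows "Ck k f \<Longrightarrow> Ck k (\<lambda>x. H j (f x :: real))"
proof (induction k arbitrary: f j)
  case 0
  have "continuous_on UNIV (H j)"
    by (intro continuous_at_imp_continuous_on ballI DERIV_isCont[OF H])
  then show ?case using 0 by (auto intro: continuous_on_compose2)
next
  case (Suc k)
  note d = Suc.prems[THEN Ck_Suc_has_derivative]
  have "((\<lambda>x. H j (f x)) has_derivative (\<lambda>h. H (Suc j) (f x) * frechet_derivative f (at x) h)) (at x)" for x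
    using has_derivative_compose[OF d H[unfolded has_field_derivative_def]]
    by (simp add: mult.commute)
  then show ?case
    by (rule Ck_SucI) (use Suc Ck_Suc_imp[OF Suc.prems] in \<open>auto intro!: Ck_mult\<close>)
qed

lemma Ck_inner: "Ck k (\<lambda>x. x \<bullet> e)"
proof (cases k)
  case (Suc m)
  show ?thesis unfolding Suc
    by (rule Ck_SucI[where f' = "\<lambda>x h. h \<bullet> e"]) (auto intro!: derivative_eq_intros Ck_const)
qed (auto intro: continuous_intros)

lemma Ck_affine: "Ck k (\<lambda>x. x \<bullet> e + c)"
  by (intro Ck_add Ck_inner Ck_const)

text \<open>The derivatives of \<open>exp (- 1 / t)\<close> for \<open>t > 0\<close> all have the form \<open>p (1 / t) exp (- 1 / t)\<close>
  with a polynomial \<open>p\<close>.\<close>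

definition flat_poly :: "real poly \<Rightarrow> real \<Rightarrow> real" where
  "flat_poly p t = (if t > 0 then poly p (1/t) * exp (- (1/t)) else 0)"

lemma poly_exp_tendsto_0: "((\<lambda>s::real. poly p s * exp (- s)) \<longlongrightarrow> 0) at_top"
proof -
  have "((\<lambda>s::real. \<Sum>i\<le>degree p. coeff p i * (s ^ i / exp s)) \<longlongrightarrow> (\<Sum>i\<le>degree p. coeff p i * 0)) at_top"
    by (intro tendsto_intros tendsto_power_div_exp_0)
  then show ?thesis by (simp add: poly_altdef sum_distrib_right exp_minus divide_inverse mult.assoc)
qed

text \<open>With s = 1/t and ds/dt = - s^2, the derivative of p(s) exp(-s) is s^2 (p - p')(s)
  exp(-s); \<open>[:0,0,1:]\<close> is the factor s^2. At t = 0 the right difference quotient is s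
  p(s) exp(-s), which tends to 0.\<close>

lemma flat_poly_derivative:
  "(flat_poly p has_real_derivative flat_poly ([:0,0,1:] * (p - pderiv p)) t) (at t)"
proof (cases t "0::real" rule: linorder_cases)
  case less
  have "eventually (\<lambda>x. x < 0) (nhds t)"
    using less eventually_nhds_in_open[of "{..<0}" t] by simp
  then have "eventually (\<lambda>x. flat_poly p x = 0) (nhds t)"
    by eventually_elim (simp add: flat_poly_def)
  then show ?thesis
    using less DERIV_cong_ev[of t t "flat_poly p" "\<lambda>x. 0"] by (simp add: flat_poly_def)
next
  case greater
  have "eventually (\<lambda>x. x > 0) (nhds t)"
    using greater eventually_nhds_in_open[of "{0<..}" t] by simp
  then have e: "eventually (\<lambda>x. flat_poly p x = poly p (1/x) * exp (- (1/x))) (nhds t)"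
    by eventually_elim (simp add: flat_poly_def)
  have "((\<lambda>x. poly p (1/x) * exp (- (1/x))) has_real_derivative
      (poly p (1/t) - poly (pderiv p) (1/t)) * (1/t^2) * exp (- (1/t))) (at t)"
    using greater
    by (auto intro!: derivative_eq_intros DERIV_chain2[OF poly_DERIV] simp: field_simps power2_eq_square)
  then have "((\<lambda>x. poly p (1/x) * exp (- (1/x))) has_real_derivative
      flat_poly ([:0,0,1:] * (p - pderiv p)) t) (at t)"
    using greater by (simp add: flat_poly_def power2_eq_square field_simps)
  then show ?thesis using DERIV_cong_ev[OF refl e refl] by blast
next
  case equal
  have "((\<lambda>h. flat_poly p h / h) \<longlongrightarrow> 0) (at_right 0)"
  proof -
    have "((\<lambda>s::real. poly ([:0,1:] * p) s * exp (- s)) \<longlongrightarrow> 0) at_top"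
      by (rule poly_exp_tendsto_0)
    then have "((\<lambda>h::real. poly ([:0,1:] * p) (inverse h) * exp (- inverse h)) \<longlongrightarrow> 0) (at_right 0)"
      by (rule filterlim_compose[OF _ filterlim_inverse_at_top_right])
    then show ?thesis
      by (rule Lim_transform_eventually)
        (auto simp: flat_poly_def eventually_at_right_less field_simps
          intro!: eventually_mono[OF eventually_at_right_less[of 0]])
  qed
  moreover have "((\<lambda>h. flat_poly p h / h) \<longlongrightarrow> 0) (at_left 0)"
    by (rule Lim_transform_eventually[OF tendsto_const])
      (auto simp: flat_poly_def eventually_at intro!: exI[of _ 1])
  ultimately have "((\<lambda>h. flat_poly p h / h) \<longlongrightarrow> 0) (at 0)"
    by (simp add: filterlim_split_at_real filterlim_at_split)
  then show ?thesis using equal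
    by (simp add: has_field_derivative_iff flat_poly_def)
qed

section \<open>The flat function and smooth bumps on boxes\<close>

definition flat :: "real \<Rightarrow> real" where "flat t = (if t > 0 then exp (- (1/t)) else 0)"

lemma Ck_flat: "Ck k f \<Longrightarrow> Ck k (\<lambda>x. flat (f x))"
proof -
  define P where "P j = ((\<lambda>p. [:0,0,1:] * (p - pderiv p)) ^^ j) (1 :: real poly)" for j
  have "(flat_poly (P j) has_real_derivative flat_poly (P (Suc j)) t) (at t)" for j t
    using flat_poly_derivative[of "P j" t] by (simp add: P_def)
  moreover have "flat = flat_poly (P 0)" by (auto simp: flat_def flat_poly_def P_def)
  ultimately show "Ck k f \<Longrightarrow> Ck k (\<lambda>x. flat (f x))"
    using Ck_compose[of "\<lambda>j. flat_poly (P j)" k f 0] by simp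
qed

lemma flat_nonneg: "0 \<le> flat t" and flat_pos: "0 < t \<Longrightarrow> 0 < flat t"
  and flat_le_1: "flat t \<le> 1" and flat_0: "t \<le> 0 \<Longrightarrow> flat t = 0"
  by (auto simp: flat_def)

lemma flat_scaled_tendsto: "t > 0 \<Longrightarrow> (\<lambda>n. flat (real n * t)) \<longlonglongrightarrow> 1"
proof -
  assume t: "t > 0"
  have "(\<lambda>n. exp (- (1/t * (1 / real n)))) \<longlonglongrightarrow> exp (- (1/t * 0))"
    by (intro tendsto_intros lim_1_over_n)
  then have "(\<lambda>n. exp (- (1/t * (1 / real n)))) \<longlonglongrightarrow> 1" by simp
  then show ?thesis
    by (rule Lim_transform_eventually)
      (use t in \<open>auto simp: flat_def field_simps intro!: eventually_sequentiallyI[of 1]\<close>)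
qed

text \<open>The parameter n steepens the sides: for growing n the bumps tend to the indicator of the
  open box, which lets them replace indicators in \<open>fundamental_lemma_variations\<close>. The
  case n = 1 is the profile of the mollifier.\<close>

definition box_bump :: "'a::euclidean_space \<Rightarrow> 'a \<Rightarrow> real \<Rightarrow> 'a \<Rightarrow> real" where
  "box_bump a b n x = (\<Prod>i\<in>Basis. flat (n * ((x - a) \<bullet> i)) * flat (n * ((b - x) \<bullet> i)))"

lemma Ck_box_bump: "Ck k (box_bump a b n)"
proof -
  have "Ck k (\<lambda>x. \<Prod>i\<in>Basis. flat (x \<bullet> (n *\<^sub>R i) + - (n * (a \<bullet> i))) * flat (x \<bullet> (- (n *\<^sub>R i)) + n * (b \<bullet> i)))"
    by (intro Ck_prod Ck_mult Ck_flat Ck_affine)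
  moreover have "box_bump a b n = (\<lambda>x. \<Prod>i\<in>Basis. flat (x \<bullet> (n *\<^sub>R i) + - (n * (a \<bullet> i))) * flat (x \<bullet> (- (n *\<^sub>R i)) + n * (b \<bullet> i)))"
    by (auto simp: box_bump_def inner_diff_left algebra_simps intro!: prod.cong)
  ultimately show ?thesis by simp
qed

lemma box_bump_nonneg: "0 \<le> box_bump a b n x"
  by (auto simp: box_bump_def intro!: prod_nonneg mult_nonneg_nonneg flat_nonneg)

lemma box_bump_le_1: "box_bump a b n x \<le> 1"
  unfolding box_bump_def
  by (intro prod_le_1 conjI mult_nonneg_nonneg mult_le_one flat_nonneg flat_le_1)

lemma box_bump_pos: "n > 0 \<Longrightarrow> x \<in> box a b \<Longrightarrow> 0 < box_bump a b n x"
  by (auto simp: box_bump_def mem_box inner_diff_left intro!: prod_pos flat_pos mult_pos_pos)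

lemma box_bump_eq_0: "n \<ge> 0 \<Longrightarrow> x \<notin> box a b \<Longrightarrow> box_bump a b n x = 0"
  unfolding box_bump_def mem_box
  by (rule prod_zero)
    (auto simp: inner_diff_left not_less mult_le_0_iff intro!: flat_0 dest: linorder_not_less[THEN iffD1])

lemma box_bump_tendsto: "(\<lambda>n. box_bump a b (real n) x) \<longlonglongrightarrow> indicator (box a b) x"
proof (cases "x \<in> box a b")
  case True
  then have "(\<lambda>n. box_bump a b (real n) x) \<longlonglongrightarrow> (\<Prod>i\<in>(Basis::'a set). 1 * 1)"
    unfolding box_bump_def
    by (intro tendsto_prod tendsto_mult flat_scaled_tendsto) (auto simp: mem_box inner_diff_left)
  then show ?thesis using True by simp
qed (simp add: box_bump_eq_0)

lemma test_functionsI: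
  assumes "\<And>k. Ck k \<phi>" "compact S" "S \<subseteq> D" "\<And>x. x \<notin> S \<Longrightarrow> \<phi> x = 0"
  shows "\<phi> \<in> test_functions D"
proof -
  have "supp_in UNIV \<phi> \<subseteq> S"
    unfolding supp_in_def using assms by (intro closure_minimal) (auto intro: compact_imp_closed)
  then show ?thesis
    using assms compact_Int_closed[of S "supp_in UNIV \<phi>"]
    by (auto simp: test_functions_def supp_in_def Int_absorb1)
qed

lemma box_bump_test:
  assumes "cbox a b \<subseteq> D" shows "n \<ge> 0 \<Longrightarrow> box_bump a b n \<in> test_functions D"
  by (rule test_functionsI[OF Ck_box_bump, of "cbox a b"])
    (use assms box_subset_cbox[of a b] in \<open>auto intro: box_bump_eq_0\<close>)

section \<open>Weak gradients\<close>

lemma integral_lebesgue_on_eq: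
  fixes f :: "'a::euclidean_space \<Rightarrow> 'b::euclidean_space"
  assumes "D \<in> sets lebesgue"
  shows "(LINT x|lebesgue_on D. f x) = (LINT x:D|lebesgue. f x)"
    and "integrable (lebesgue_on D) f \<longleftrightarrow> set_integrable lebesgue D f"
  using assms by (auto simp: integral_restrict_space set_lebesgue_integral_def
      integrable_restrict_space set_integrable_def)

lemma set_integrable_lebesgue_open_subset:
  fixes f :: "'a::euclidean_space \<Rightarrow> 'b::euclidean_space"
  assumes "set_integrable lebesgue D f" "open U" "U \<subseteq> D"
  shows "set_integrable lebesgue U f"
  by (rule set_integrable_subset[OF assms(1)]) (use assms in auto)

lemma set_integrable_mult_bounded:
  fixes f g :: "'a::euclidean_space \<Rightarrow> real"
  assumes f: "set_integrable lebesgue D f" and g: "g \<in> borel_measurable lebesgue"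
    and b: "\<And>x. x \<in> D \<Longrightarrow> \<bar>g x\<bar> \<le> B"
  shows "set_integrable lebesgue D (\<lambda>x. f x * g x)"
  unfolding set_integrable_def
proof (rule Bochner_Integration.integrable_bound)
  show "integrable lebesgue (\<lambda>x. B *\<^sub>R (indicator D x *\<^sub>R f x))"
    using f unfolding set_integrable_def by (intro integrable_scaleR_right)
  have "(\<lambda>x. (indicator D x *\<^sub>R f x) * g x) \<in> borel_measurable lebesgue"
    using f g unfolding set_integrable_def by (intro borel_measurable_times) auto
  then show "(\<lambda>x. indicator D x *\<^sub>R (f x * g x)) \<in> borel_measurable lebesgue"
    by (simp add: mult.assoc)
  show "AE x in lebesgue. norm (indicator D x *\<^sub>R (f x * g x)) \<le> norm (B *\<^sub>R indicator D x *\<^sub>R f x)"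
  proof (rule AE_I2)
    fix x
    have "\<bar>f x\<bar> * \<bar>g x\<bar> \<le> \<bar>B\<bar> * \<bar>f x\<bar>" if "x \<in> D"
      using b[OF that] by (subst mult.commute) (intro mult_right_mono, auto)
    then show "norm (indicator D x *\<^sub>R (f x * g x)) \<le> norm (B *\<^sub>R indicator D x *\<^sub>R f x)"
      by (auto simp: indicator_def abs_mult)
  qed
qed

text \<open>Bumps approximate the indicator of a box boundedly, so the integral of f over every
  closed box inside D vanishes. Lebesgue differentiation over shrinking cubes then gives f = 0
  outside a null set.\<close>

lemma fundamental_lemma_variations:
  fixes f :: "'a::euclidean_space \<Rightarrow> real"
  assumes D: "open D" and f: "set_integrable lebesgue D f"
    and t: "\<And>\<phi>. \<phi> \<in> test_functions D \<Longrightarrow> (LINT x:D|lebesgue. f x * \<phi> x) = 0"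
  shows "negligible {x \<in> D. f x \<noteq> 0}"
proof -
  define F where "F = (\<lambda>x. indicator D x *\<^sub>R f x)"
  have F: "integrable lebesgue F" using f by (simp add: F_def set_integrable_def)
  have Fm: "F \<in> borel_measurable lebesgue" using F by auto
  have box0: "integral (cbox a b) F = 0" if ab: "cbox a b \<subseteq> D" for a b
  proof -
    have "(\<lambda>n. LINT x|lebesgue. F x * box_bump a b (real n) x) \<longlonglongrightarrow> (LINT x|lebesgue. F x * indicator (box a b) x)"
    proof (rule integral_dominated_convergence)
      show "integrable lebesgue (\<lambda>x. norm (F x))" using F by simp
      show "(\<lambda>x. F x * box_bump a b (real n) x) \<in> borel_measurable lebesgue" for n
        using Fm continuous_imp_measurable_on_sets_lebesgue[OF Ck_imp_continuous_on[OF Ck_box_bump[of 0]], of UNIV]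
        by (intro borel_measurable_times) (auto simp: lebesgue_on_UNIV_eq)
      show "AE x in lebesgue. norm (F x * box_bump a b (real n) x) \<le> norm (F x)" for n
        using box_bump_le_1[of a b "real n"] box_bump_nonneg[of a b "real n"]
        by (auto simp: abs_mult intro!: mult_left_le)
    qed (use Fm in \<open>auto intro!: tendsto_intros box_bump_tendsto borel_measurable_times borel_measurable_indicator\<close>)
    moreover have "(LINT x|lebesgue. F x * box_bump a b (real n) x) = 0" for n
      using t[OF box_bump_test[OF ab, of n]] by (simp add: F_def set_lebesgue_integral_def mult.assoc)
    ultimately have "(LINT x|lebesgue. F x * indicator (box a b) x) = 0"
      by (simp add: LIMSEQ_const_iff)
    then have "(LINT x:box a b|lebesgue. F x) = 0"
      by (simp add: set_lebesgue_integral_def mult.commute)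
    moreover have "set_integrable lebesgue (box a b) F"
      by (rule set_integrable_subset[of _ UNIV]) (use F in \<open>auto simp: set_integrable_def\<close>)
    ultimately show ?thesis
      using set_lebesgue_integral_eq_integral(2)[of "box a b" F] integral_open_interval by metis
  qed
  have "F integrable_on cbox a b" for a b
    by (rule set_lebesgue_integral_eq_integral(1), rule set_integrable_subset[of _ UNIV])
      (use F in \<open>auto simp: set_integrable_def\<close>)
  then obtain N where N: "negligible N" and lim:
    "\<And>x e. \<lbrakk>x \<notin> N; 0 < e\<rbrakk> \<Longrightarrow> \<exists>d>0. \<forall>h. 0 < h \<and> h < d \<longrightarrow>
         norm(integral (cbox x (x + h *\<^sub>R One)) F /\<^sub>R h ^ DIM('a) - F x) < e"
    using integrable_ccontinuous_explicit by blast
  have "f x = 0" if x: "x \<in> D" "x \<notin> N" for x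
  proof (rule ccontr)
    assume "f x \<noteq> 0"
    then have "\<bar>F x\<bar> > 0" using x by (simp add: F_def)
    then obtain d where d: "d > 0" "\<And>h. 0 < h \<and> h < d \<Longrightarrow>
        norm(integral (cbox x (x + h *\<^sub>R One)) F /\<^sub>R h ^ DIM('a) - F x) < \<bar>F x\<bar>"
      using lim[OF x(2)] by blast
    obtain r where r: "r > 0" "cball x r \<subseteq> D" using D x open_contains_cball by blast
    \<comment> \<open>The points of the cube of side h at x are within h times the dimension of x
      (bound by the 1-norm), so the second term keeps the cube inside D.\<close>
    define h where "h = min (d/2) (r / real DIM('a))"
    have h: "0 < h" "h < d" "h * DIM('a) \<le> r"
      using d r by (auto simp: h_def min_def field_simps)
    have "cbox x (x + h *\<^sub>R One) \<subseteq> cball x r"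
    proof
      fix y assume y: "y \<in> cbox x (x + h *\<^sub>R One)"
      have "norm (y - x) \<le> (\<Sum>i\<in>Basis. \<bar>(y - x) \<bullet> i\<bar>)" by (rule norm_le_l1)
      also have "\<dots> \<le> (\<Sum>i\<in>(Basis::'a set). h)"
        using y by (intro sum_mono) (auto simp: mem_box inner_diff_left inner_add_left abs_le_iff)
      finally show "y \<in> cball x r" using h by (simp add: dist_norm norm_minus_commute mult.commute)
    qed
    then have "integral (cbox x (x + h *\<^sub>R One)) F = 0" using r box0 by blast
    then show False using d(2)[of h] h by simp
  qed
  then have "{x \<in> D. f x \<noteq> 0} \<subseteq> N" by auto
  then show ?thesis using N negligible_subset by blast
qed

section \<open>Lipschitz functions and their gradients\<close>

lemma continuous_borel_measurable_lebesgue: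
  fixes f :: "'a::euclidean_space \<Rightarrow> 'b::euclidean_space"
  assumes "continuous_on UNIV f" shows "f \<in> borel_measurable lebesgue"
  by (intro measurable_completion) (use borel_measurable_continuous_onI[OF assms] in simp)

text \<open>Difference quotients of a function with bounded support have integral 0 because Lebesgue
  measure is invariant under translation. The Lipschitz constant dominates them, so their limit, the
  directional derivative, has integral 0 too. This replaces the divergence theorem
  throughout.\<close>

lemma integral_deriv_lipschitz_eq_0:
  fixes f :: "'a::euclidean_space \<Rightarrow> real"
  assumes lip: "L-lipschitz_on UNIV f" and S: "bounded S" "\<And>x. x \<notin> S \<Longrightarrow> f x = 0"
    and N: "negligible N" "\<And>x. x \<in> N \<Longrightarrow> D x = 0"
    and der: "\<And>x. x \<notin> N \<Longrightarrow> (f has_derivative (\<lambda>h. D x \<bullet> h)) (at x)"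
  shows "integrable lebesgue (\<lambda>x. D x \<bullet> e)" and "(LINT x|lebesgue. D x \<bullet> e) = 0"
    and "\<And>x. \<bar>D x \<bullet> e\<bar> \<le> L * norm e"
proof -
  define q where "q n x = (f (x + inverse (Suc n) *\<^sub>R e) - f x) * real (Suc n)" for n x
  \<comment> \<open>Setting the quotients to 0 on N, as D is there, makes them converge everywhere;
    measurability of the limit follows at once.\<close>
  define q' where "q' n x = (if x \<in> N then 0 else q n x)" for n x
  have L0: "L \<ge> 0" using lip lipschitz_on_def by blast
  have fc: "continuous_on UNIV f" using lip lipschitz_on_continuous_on by blast
  have Nn: "N \<in> null_sets lebesgue" using N negligible_iff_null_sets by blast
  obtain B where B: "B > 0" "S \<subseteq> ball 0 B" using S(1) bounded_subset_ballD by blast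
  \<comment> \<open>The difference quotients shift by at most the norm of e, so one ball contains
    the supports of all of them.\<close>
  define B' where "B' = B + norm e"
  have lim: "(\<lambda>n. q' n x) \<longlonglongrightarrow> D x \<bullet> e" for x
  proof (cases "x \<in> N")
    case False
    have "((\<lambda>t. (f (x + t *\<^sub>R e) - f x) / t) \<longlongrightarrow> D x \<bullet> e) (at 0)"
    proof -
      have "((\<lambda>t. f (x + t *\<^sub>R e)) has_derivative (\<lambda>t. D x \<bullet> (t *\<^sub>R e))) (at 0)"
        by (rule has_derivative_compose[of "\<lambda>t. x + t *\<^sub>R e" "\<lambda>t. t *\<^sub>R e" 0 UNIV f])
          (use der[OF False] in \<open>auto intro!: derivative_eq_intros\<close>)
      moreover have "(\<lambda>t. D x \<bullet> (t *\<^sub>R e)) = (*) (D x \<bullet> e)" by (auto simp: mult.commute)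
      ultimately have "((\<lambda>t. f (x + t *\<^sub>R e)) has_real_derivative (D x \<bullet> e)) (at 0)"
        by (simp add: has_field_derivative_def)
      then show ?thesis by (simp add: has_field_derivative_iff)
    qed
    moreover have "filterlim (\<lambda>n. inverse (real (Suc n))) (at 0) sequentially"
      using LIMSEQ_inverse_real_of_nat by (intro filterlim_atI) auto
    ultimately have "(\<lambda>n. (f (x + inverse (real (Suc n)) *\<^sub>R e) - f x) / inverse (real (Suc n))) \<longlonglongrightarrow> D x \<bullet> e"
      using filterlim_compose by blast
    then show ?thesis using False by (simp add: q'_def q_def divide_inverse)
  qed (simp add: q'_def N)
  have qb: "\<bar>q' n x\<bar> \<le> L * norm e" for n x
  proof -
    have "\<bar>f (x + inverse (Suc n) *\<^sub>R e) - f x\<bar> \<le> L * norm (inverse (real (Suc n)) *\<^sub>R e)"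
      using lipschitz_onD[OF lip, of "x + inverse (Suc n) *\<^sub>R e" x] by (simp add: dist_norm)
    then have "\<bar>q n x\<bar> \<le> L * norm (inverse (real (Suc n)) *\<^sub>R e) * real (Suc n)"
      unfolding q_def abs_mult by (intro mult_mono) auto
    also have "\<dots> = L * norm e" by (simp add: field_simps)
    finally show ?thesis using L0 by (auto simp: q'_def)
  qed
  have q0: "q' n x = 0" if "x \<notin> ball 0 B'" for n x
  proof -
    have "norm (inverse (real (Suc n)) *\<^sub>R e) \<le> norm e"
      by (simp add: mult_left_le_one_le inverse_le_1_iff)
    then have "norm (x + inverse (real (Suc n)) *\<^sub>R e) \<ge> B"
      using that norm_diff_ineq[of x "inverse (real (Suc n)) *\<^sub>R e"] by (simp add: B'_def)
    moreover have "norm x \<ge> B" using that norm_ge_zero[of e] unfolding B'_def mem_ball dist_0_norm not_less by linarith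
    ultimately have "x + inverse (real (Suc n)) *\<^sub>R e \<notin> S" "x \<notin> S"
      using B(2) by (auto simp: subset_iff)
    then show ?thesis using S(2) by (simp add: q'_def q_def)
  qed
  have qc: "continuous_on UNIV (q n)" for n
    unfolding q_def by (intro continuous_intros continuous_on_compose2[OF fc]) auto
  have qm: "q' n \<in> borel_measurable lebesgue" for n
    unfolding q'_def using Nn continuous_borel_measurable_lebesgue[OF qc]
    by (intro measurable_If) auto
  have bi: "integrable lebesgue (\<lambda>x::'a. L * norm e * indicator (ball 0 B') x)"
    by (intro integrable_mult_right integrable_real_indicator) (use emeasure_lborel_ball_finite[of "0::'a" B'] in auto)
  have Dm: "(\<lambda>x. D x \<bullet> e) \<in> borel_measurable lebesgue"
    by (rule borel_measurable_LIMSEQ_metric[OF qm lim])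
  have bnd: "AE x in lebesgue. norm (q' n x) \<le> L * norm e * indicator (ball 0 B') x" for n
    using qb q0 by (intro AE_I2) (auto simp: indicator_def)
  have al: "AE x in lebesgue. (\<lambda>n. q' n x) \<longlonglongrightarrow> D x \<bullet> e" using lim by simp
  show "integrable lebesgue (\<lambda>x. D x \<bullet> e)"
    by (rule integrable_dominated_convergence[OF Dm qm bi al bnd])
  have l: "(\<lambda>n. LINT x|lebesgue. q' n x) \<longlonglongrightarrow> (LINT x|lebesgue. D x \<bullet> e)"
    by (rule integral_dominated_convergence[OF Dm qm bi al bnd])
  have "(LINT x|lebesgue. q' n x) = 0" for n
  proof -
    have fi: "integrable lborel f"
    proof (rule integrableI_bounded_set[where A = "cball 0 B" and B = "L * 2 * B"])
      show "AE x in lborel. x \<notin> cball 0 B \<longrightarrow> f x = 0" using B S(2) by (intro AE_I2) force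
      show "AE x in lborel. x \<in> cball 0 B \<longrightarrow> norm (f x) \<le> L * 2 * B"
      proof (intro AE_I2 impI)
        fix x :: 'a assume x: "x \<in> cball 0 B"
        \<comment> \<open>The point B b has norm B, hence lies outside the open ball and outside S,
          where f is 0. Comparing with it bounds f on the whole ball.\<close>
        obtain b :: 'a where b: "b \<in> Basis" by (meson nonempty_Basis ex_in_conv)
        have "f (B *\<^sub>R b) = 0" using b B S(2)[of "B *\<^sub>R b"] by force
        then have "\<bar>f x\<bar> \<le> L * dist x (B *\<^sub>R b)"
          using lipschitz_onD[OF lip, of x "B *\<^sub>R b"] by (simp add: dist_real_def)
        also have "\<dots> \<le> L * (2 * B)"
          using b B x L0 norm_triangle_ineq4[of x "B *\<^sub>R b"]
          by (intro mult_left_mono) (auto simp: dist_norm)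
        finally show "norm (f x) \<le> L * 2 * B" by simp
      qed
    qed (use borel_measurable_continuous_onI[OF fc] emeasure_lborel_cball_finite[of "0::'a" B] in auto)
    define c where "c = inverse (real (Suc n)) *\<^sub>R e"
    have "integrable (distr lborel borel ((+) c)) f" using fi by (simp add: lborel_distr_plus)
    then have i2: "integrable lborel (\<lambda>x. f (c + x))"
      using borel_measurable_continuous_onI[OF fc] by (subst (asm) integrable_distr_eq) auto
    have "(LINT x|lborel. f (c + x)) = (LINT x|lborel. f x)"
      using integral_distr[of "(+) c" lborel borel f] borel_measurable_continuous_onI[OF fc]
      by (simp add: lborel_distr_plus)
    then have "(LINT x|lborel. q n x) = 0"
      using fi i2 by (simp add: q_def c_def add.commute)
    then have "(LINT x|lebesgue. q n x) = 0"
      using integral_completion[of "q n" lborel] borel_measurable_continuous_onI[OF qc[of n]] by simp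
    moreover have "(LINT x|lebesgue. q' n x) = (LINT x|lebesgue. q n x)"
    proof (rule integral_cong_AE)
      show "AE x in lebesgue. q' n x = q n x"
        using AE_not_in[OF Nn] by eventually_elim (simp add: q'_def)
    qed (use qm continuous_borel_measurable_lebesgue[OF qc] in auto)
    ultimately show ?thesis by simp
  qed
  then show "(LINT x|lebesgue. D x \<bullet> e) = 0"
    using l by (simp add: LIMSEQ_const_iff)
  show "\<bar>D x \<bullet> e\<bar> \<le> L * norm e" for x
    by (rule LIMSEQ_le_const2[OF tendsto_rabs[OF lim]]) (use qb in auto)
qed

lemma inner_onorm_le: "onorm (\<lambda>h. g \<bullet> h) \<le> norm (g :: 'a::euclidean_space)"
  by (rule onorm_bound) (auto simp: Cauchy_Schwarz_ineq2)

lemma lipschitz_of_gradient: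
  fixes p :: "'a::euclidean_space \<Rightarrow> real"
  assumes d: "\<And>x. (p has_derivative (\<lambda>h. G x \<bullet> h)) (at x)"
    and G: "continuous_on UNIV G" and K: "compact K" "convex K"
  obtains L where "L-lipschitz_on K p"
proof -
  have "bounded (G ` K)"
    by (intro compact_imp_bounded compact_continuous_image continuous_on_subset[OF G] K) auto
  then obtain B where B: "\<And>x. x \<in> K \<Longrightarrow> norm (G x) \<le> B" "B > 0"
    unfolding bounded_pos by auto
  have "B-lipschitz_on K p"
  proof (rule bounded_derivative_imp_lipschitz[where f' = "\<lambda>x h. G x \<bullet> h"])
    show "onorm (\<lambda>h. G x \<bullet> h) \<le> B" if "x \<in> K" for x
      using inner_onorm_le[of "G x"] B(1)[OF that] by linarith
  qed (use d K B in \<open>auto intro: has_derivative_at_withinI\<close>)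
  then show ?thesis using that by blast
qed

definition grad :: "('a::euclidean_space \<Rightarrow> real) \<Rightarrow> 'a \<Rightarrow> 'a" where
  "grad f x = (\<Sum>b\<in>Basis. frechet_derivative f (at x) b *\<^sub>R b)"

lemma grad_inner:
  assumes "(f has_derivative f') (at x)" shows "grad f x \<bullet> h = f' h"
proof -
  interpret linear f' using assms has_derivative_linear by blast
  have "f' h = f' (\<Sum>b\<in>Basis. (h \<bullet> b) *\<^sub>R b)" by (simp add: euclidean_representation)
  also have "\<dots> = (\<Sum>b\<in>Basis. f' b * (b \<bullet> h))"
    by (simp add: sum scale inner_commute[of h] mult.commute)
  also have "\<dots> = grad f x \<bullet> h"
    using frechet_derivative_at[OF assms] by (simp add: grad_def inner_sum_left)
  finally show ?thesis by simp
qed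

lemma has_derivative_grad:
  "f differentiable (at x) \<Longrightarrow> (f has_derivative (\<lambda>h. grad f x \<bullet> h)) (at x)"
  using grad_inner by (metis (no_types, lifting) ext differentiable_def)

lemma grad_eqI: "(f has_derivative (\<lambda>h. g \<bullet> h)) (at x) \<Longrightarrow> grad f x = g"
  by (rule euclidean_eqI) (simp add: grad_inner)

lemma Ck_has_derivative_grad: "Ck (Suc k) f \<Longrightarrow> (f has_derivative (\<lambda>h. grad f x \<bullet> h)) (at x)"
  by (rule has_derivative_grad) (auto simp: differentiable_on_def)

lemma Ck_continuous_grad: "Ck (Suc k) f \<Longrightarrow> continuous_on UNIV (grad f)"
  unfolding grad_def by (intro continuous_intros) (auto intro: Ck_imp_continuous_on)

lemma grad_eq_0:
  assumes "closed S" "x \<notin> S" "\<And>y. y \<notin> S \<Longrightarrow> f y = 0" shows "grad f x = 0"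
proof (rule grad_eqI)
  show "(f has_derivative (\<lambda>h. 0 \<bullet> h)) (at x)"
    by (rule has_derivative_transform_within_open[of "\<lambda>x. 0" _ _ _ "-S"]) (use assms in auto)
qed

lemma compact_support_bounded:
  fixes h :: "'a::metric_space \<Rightarrow> 'b::real_normed_vector"
  assumes "continuous_on UNIV h" "compact S" "\<And>x. x \<notin> S \<Longrightarrow> h x = 0"
  obtains B where "B > 0" "\<And>x. norm (h x) \<le> B"
proof -
  have "bounded (h ` S)"
    by (intro compact_imp_bounded compact_continuous_image continuous_on_subset[OF assms(1)] assms) auto
  then obtain B where B: "\<And>x. x \<in> S \<Longrightarrow> norm (h x) \<le> B" "B > 0"
    unfolding bounded_pos by auto
  have "norm (h x) \<le> B" for x using B assms(3)[of x] by (cases "x \<in> S") auto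
  then show ?thesis using B that by blast
qed

lemma Ck_compact_support_lipschitz:
  assumes "Ck (Suc 0) f" "compact S" "\<And>x. x \<notin> S \<Longrightarrow> f x = 0"
  obtains L where "L-lipschitz_on UNIV f"
proof -
  have z: "grad f x = 0" if "x \<notin> S" for x
    using compact_imp_closed[OF assms(2)] that assms(3) by (rule grad_eq_0)
  obtain B where B: "B > 0" "\<And>x. norm (grad f x) \<le> B"
    using compact_support_bounded[OF Ck_continuous_grad[OF assms(1)] assms(2) z] by blast
  have "B-lipschitz_on UNIV f"
  proof (rule bounded_derivative_imp_lipschitz[where f' = "\<lambda>x h. grad f x \<bullet> h"])
    show "onorm (\<lambda>h. grad f x \<bullet> h) \<le> B" for x
      using inner_onorm_le[of "grad f x"] B(2)[of x] by linarith
  qed (use Ck_has_derivative_grad[OF assms(1)] B in auto)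
  then show ?thesis using that by blast
qed

lemma lipschitz_on_mult_bounded:
  fixes f g :: "'a::metric_space \<Rightarrow> real"
  assumes "L-lipschitz_on S f" "M-lipschitz_on S g" "\<And>x. x \<in> S \<Longrightarrow> \<bar>f x\<bar> \<le> A" "\<And>x. x \<in> S \<Longrightarrow> \<bar>g x\<bar> \<le> B"
    "A \<ge> 0" "B \<ge> 0"
  shows "(L * B + A * M)-lipschitz_on S (\<lambda>x. f x * g x)"
proof (rule lipschitz_onI)
  fix x y assume xy: "x \<in> S" "y \<in> S"
  have "\<bar>f x * g x - f y * g y\<bar> = \<bar>(f x - f y) * g x + f y * (g x - g y)\<bar>" by (simp add: algebra_simps)
  also have "\<dots> \<le> \<bar>f x - f y\<bar> * \<bar>g x\<bar> + \<bar>f y\<bar> * \<bar>g x - g y\<bar>"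
    using abs_triangle_ineq abs_mult by metis
  also have "\<dots> \<le> (L * dist x y) * B + A * (M * dist x y)"
    using assms xy lipschitz_onD[OF assms(1) xy] lipschitz_onD[OF assms(2) xy]
      lipschitz_on_nonneg[OF assms(1)] lipschitz_on_nonneg[OF assms(2)]
    by (intro add_mono mult_mono) (auto simp: dist_real_def)
  finally show "dist (f x * g x) (f y * g y) \<le> (L * B + A * M) * dist x y"
    by (simp add: dist_real_def algebra_simps)
qed (use assms lipschitz_on_nonneg in \<open>auto intro!: add_nonneg_nonneg mult_nonneg_nonneg\<close>)

subsection \<open>Mollification\<close>

lemma integral_pos_on_box:
  fixes f :: "'a::euclidean_space \<Rightarrow> real"
  assumes "integrable lebesgue f" "\<And>x. 0 \<le> f x" "\<And>x. x \<in> box a b \<Longrightarrow> 0 < f x" "box a b \<noteq> {}"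
  shows "0 < (LINT x|lebesgue. f x)"
proof -
  have "(LINT x|lebesgue. f x) \<noteq> 0"
  proof
    assume "(LINT x|lebesgue. f x) = 0"
    then have "AE x in lebesgue. f x = 0"
      using integral_nonneg_eq_0_iff_AE[OF assms(1)] assms(2) by auto
    then have "AE x in lebesgue. x \<notin> box a b"
      by eventually_elim (use assms(3) in force)
    then have "negligible (box a b)"
      using AE_iff_null_sets[of "box a b" lebesgue] by (simp add: negligible_iff_null_sets)
    then show False using assms(4) open_not_negligible by blast
  qed
  then show ?thesis using integral_nonneg_AE[of f lebesgue] assms(2) by (simp add: order_le_neq_trans)
qed

lemma integrable_continuous_compact_support:
  fixes h :: "'a::euclidean_space \<Rightarrow> real"
  assumes h: "continuous_on UNIV h" "\<And>x. x \<notin> cbox a b \<Longrightarrow> h x = 0"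
  shows "integrable lebesgue h" "(LINT x|lebesgue. h x) = integral (cbox a b) h"
proof -
  have s: "set_integrable lebesgue (cbox a b) h"
    using absolutely_integrable_continuous continuous_on_subset[OF h(1)] by blast
  have e: "(\<lambda>x. indicator (cbox a b) x *\<^sub>R h x) = h" using h(2) by (auto simp: indicator_def fun_eq_iff)
  show "integrable lebesgue h" using s unfolding set_integrable_def e .
  show "(LINT x|lebesgue. h x) = integral (cbox a b) h"
    using set_lebesgue_integral_eq_integral(2)[OF s] unfolding set_lebesgue_integral_def e .
qed

text \<open>Evenness turns \<open>k (x - y)\<close> as a function of y into a translate of k, so
  that convolution weights also have integral 1.\<close>

definition is_mollifier :: "real \<Rightarrow> ('a::euclidean_space \<Rightarrow> real) \<Rightarrow> bool" where
  "is_mollifier e k \<longleftrightarrow> (\<forall>j. Ck j k) \<and> (\<forall>x. 0 \<le> k x) \<and> (\<forall>x. k (- x) = k x) \<and>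
     (\<forall>x. x \<notin> cball 0 e \<longrightarrow> k x = 0) \<and> (LINT x|lebesgue. k x) = 1"

lemma mollifier_exists:
  assumes "e > 0" obtains k :: "'a::euclidean_space \<Rightarrow> real" where "is_mollifier e k"
proof -
  \<comment> \<open>A cube of half side e / d lies in the ball of radius e, since the norm is at
    most the sum of the d coordinates.\<close>
  define c where "c = e / DIM('a)"
  have c: "c > 0" using assms by (simp add: c_def)
  define f :: "'a \<Rightarrow> real" where "f = box_bump (- c *\<^sub>R One) (c *\<^sub>R One) 1"
  define I where "I = (LINT x|lebesgue. f x)"
  have z: "f x = 0" if "x \<notin> box (- c *\<^sub>R One) (c *\<^sub>R One)" for x
    using that by (simp add: f_def box_bump_eq_0)
  have fi: "integrable lebesgue f"
    by (rule integrable_continuous_compact_support[OF _ z])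
      (use box_subset_cbox in \<open>auto simp: f_def intro: Ck_imp_continuous_on[OF Ck_box_bump[of 0]]\<close>)
  have I: "I > 0" unfolding I_def
    by (rule integral_pos_on_box[OF fi, of "- c *\<^sub>R One" "c *\<^sub>R One"])
      (use c in \<open>auto simp: f_def box_bump_nonneg box_bump_pos box_ne_empty\<close>)
  have "is_mollifier e (\<lambda>x. inverse I * f x)" unfolding is_mollifier_def
  proof (intro conjI allI impI)
    show "Ck j (\<lambda>x. inverse I * f x)" for j
      by (intro Ck_mult Ck_const) (simp add: f_def Ck_box_bump)
    show "inverse I * f (- x) = inverse I * f x" for x
      by (auto simp: f_def box_bump_def inner_diff_left algebra_simps intro!: prod.cong)
    show "inverse I * f x = 0" if "x \<notin> cball 0 e" for x
    proof -
      have "x \<notin> box (- c *\<^sub>R One) (c *\<^sub>R One)"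
      proof
        assume x: "x \<in> box (- c *\<^sub>R One) (c *\<^sub>R One)"
        have "norm x \<le> (\<Sum>i\<in>Basis. \<bar>x \<bullet> i\<bar>)" by (rule norm_le_l1)
        also have "\<dots> \<le> (\<Sum>i\<in>(Basis::'a set). c)"
          using x by (intro sum_mono) (force simp: mem_box abs_le_iff)
        finally show False using that by (simp add: c_def)
      qed
      then show ?thesis using z by simp
    qed
    show "0 \<le> inverse I * f x" for x using I by (simp add: f_def box_bump_nonneg)
    show "(LINT x|lebesgue. inverse I * f x) = 1" using I by (simp add: I_def)
  qed
  then show ?thesis using that by blast
qed

text \<open>Derivatives fall on the kernel alone, so f need only be continuous. A partial derivative
  is again an integral of this kind, with kernel \<open>\<lambda>x. grad k x \<bullet> b\<close>;
  for that reason the induction generalises over all smooth kernels.\<close>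

lemma Ck_mollify:
  fixes f k :: "'a::euclidean_space \<Rightarrow> real"
  assumes f: "continuous_on UNIV f"
  shows "(\<And>i. Ck i k) \<Longrightarrow> Ck j (\<lambda>x. integral (cbox A B) (\<lambda>y. f y * k (x - y)))"
    and "(\<And>i. Ck i k) \<Longrightarrow> ((\<lambda>x. integral (cbox A B) (\<lambda>y. f y * k (x - y))) has_derivative
       (\<lambda>h. integral (cbox A B) (\<lambda>y. f y * (grad k (x - y) \<bullet> h)))) (at x)"
proof -
  have der: "((\<lambda>x. integral (cbox A B) (\<lambda>y. f y * k (x - y))) has_derivative
       (\<lambda>h. integral (cbox A B) (\<lambda>y. f y * (grad k (x - y) \<bullet> h)))) (at x)"
    if k: "\<And>i. Ck i k" for k x
  proof -
    have kc: "continuous_on UNIV k" "continuous_on UNIV (grad k)"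
      using Ck_imp_continuous_on[OF k] Ck_continuous_grad[OF k] by auto
    define fx where "fx x t = f t *\<^sub>R blinfun_inner_left (grad k (x - t))" for x t
    have c: "continuous_on (UNIV \<times> cbox A B) (\<lambda>(x, t). fx x t)"
      unfolding fx_def case_prod_unfold
      by (intro continuous_intros bounded_linear.continuous_on[OF bounded_linear_blinfun_inner_left]
          continuous_on_compose2[OF f] continuous_on_compose2[OF kc(2)]) auto
    have "((\<lambda>x. integral (cbox A B) (\<lambda>y. f y * k (x - y))) has_derivative integral (cbox A B) (fx x)) (at x within UNIV)"
    proof (rule leibniz_rule[OF _ _ c])
      fix x t
      have "((\<lambda>x. k (x - t)) has_derivative (\<lambda>h. grad k (x - t) \<bullet> h)) (at x)"
        by (rule has_derivative_compose[of "\<lambda>x. x - t" "\<lambda>h. h", OF _ Ck_has_derivative_grad[OF k]])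
          (auto intro!: derivative_eq_intros)
      then show "((\<lambda>x. f t * k (x - t)) has_derivative blinfun_apply (fx x t)) (at x within UNIV)"
        by (auto simp: fx_def scaleR_blinfun.rep_eq inner_commute intro: has_derivative_mult_right)
    qed (auto intro!: integrable_continuous continuous_intros continuous_on_compose2[OF f] continuous_on_compose2[OF kc(1)])
    moreover have "blinfun_apply (integral (cbox A B) (fx x)) = (\<lambda>h. integral (cbox A B) (\<lambda>y. f y * (grad k (x - y) \<bullet> h)))"
    proof
      fix h
      have "fx x integrable_on cbox A B"
        unfolding fx_def by (intro integrable_continuous continuous_intros
            bounded_linear.continuous_on[OF bounded_linear_blinfun_inner_left]
          continuous_on_compose2[OF f] continuous_on_compose2[OF kc(2)]) auto
      then show "integral (cbox A B) (fx x) h = integral (cbox A B) (\<lambda>y. f y * (grad k (x - y) \<bullet> h))"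
        by (subst blinfun_apply_integral) (auto simp: fx_def scaleR_blinfun.rep_eq inner_commute)
    qed
    ultimately show ?thesis by simp
  qed
  show "(\<And>i. Ck i k) \<Longrightarrow> ((\<lambda>x. integral (cbox A B) (\<lambda>y. f y * k (x - y))) has_derivative
       (\<lambda>h. integral (cbox A B) (\<lambda>y. f y * (grad k (x - y) \<bullet> h)))) (at x)"
    by (rule der)
  show "(\<And>i. Ck i k) \<Longrightarrow> Ck j (\<lambda>x. integral (cbox A B) (\<lambda>y. f y * k (x - y)))"
  proof (induction j arbitrary: k)
    case 0
    have "continuous_on (UNIV \<times> cbox A B) (\<lambda>(x, y). f y * k (x - y))"
      unfolding case_prod_unfold
      by (intro continuous_intros continuous_on_compose2[OF f]
          continuous_on_compose2[OF Ck_imp_continuous_on[OF 0, of UNIV]]) auto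
    then show ?case using integral_continuous_on_param by auto
  next
    case (Suc j)
    show ?case
    proof (rule Ck_SucI[OF der[OF Suc.prems]])
      fix b :: 'a assume b: "b \<in> Basis"
      have "Ck i (\<lambda>x. grad k x \<bullet> b)" for i
        using Suc.prems[of "Suc i"] b grad_inner[OF Ck_Suc_has_derivative[OF Suc.prems]] by simp
      then show "Ck j (\<lambda>x. integral (cbox A B) (\<lambda>y. f y * (grad k (x - y) \<bullet> b)))"
        using Suc.IH by blast
    qed
  qed
qed

text \<open>Convergence is asserted at points of continuity of a bounded measurable h: the gradients
  to which this is applied are continuous outside a null set.\<close>

lemma mollifier_tendsto:
  fixes h :: "'a::euclidean_space \<Rightarrow> real"
  assumes k: "\<And>n. is_mollifier (d / real (Suc n)) (k n)" and d: "d > 0"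
    and h: "h \<in> borel_measurable lebesgue" "\<And>x. \<bar>h x\<bar> \<le> B"
  shows "isCont h x \<Longrightarrow> (\<lambda>n. LINT y|lebesgue. h y * k n (x - y)) \<longlonglongrightarrow> h x"
    and "\<bar>LINT y|lebesgue. h y * k n (x - y)\<bar> \<le> B"
    and "integrable lebesgue (\<lambda>y. h y * k n (x - y))"
proof -
  have kc: "continuous_on UNIV (k n)" for n
    using k[of n] Ck_imp_continuous_on by (auto simp: is_mollifier_def)
  have kx: "integrable lebesgue (\<lambda>y. k n (x - y))" "(LINT y|lebesgue. k n (x - y)) = 1" for n x
  proof -
    have ks: "k n (x - y) = k n (- x + y)" for x y
      using k[of n] unfolding is_mollifier_def by (metis add.commute minus_diff_eq uminus_add_conv_diff)
    have km: "k n \<in> borel_measurable borel" using borel_measurable_continuous_onI[OF kc] .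
    \<comment> \<open>A function that is not integrable has integral 0 by convention, so the
      normalisation to 1 already forces integrability.\<close>
    have kl: "integrable lborel (k n)"
    proof (rule ccontr)
      assume "\<not> integrable lborel (k n)"
      then have "\<not> integrable lebesgue (k n)" using integrable_completion[of "k n" lborel] km by simp
      then have "(LINT x|lebesgue. k n x) = 0" by (rule not_integrable_integral_eq)
      then show False using k[of n] by (simp add: is_mollifier_def)
    qed
    have "integrable (distr lborel borel ((+) (-x))) (k n)" using kl by (simp add: lborel_distr_plus)
    then have i2: "integrable lborel (\<lambda>y. k n (- x + y))"
      using km by (subst (asm) integrable_distr_eq) auto
    then show "integrable lebesgue (\<lambda>y. k n (x - y))"
      unfolding ks using km by (subst integrable_completion) auto
    have "(LINT y|lborel. k n (- x + y)) = (LINT x|lborel. k n x)"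
      using integral_distr[of "(+) (-x)" lborel borel "k n"] km by (simp add: lborel_distr_plus)
    then show "(LINT y|lebesgue. k n (x - y)) = 1"
      using integral_completion[of "\<lambda>y. k n (- x + y)" lborel] integral_completion[of "k n" lborel]
        k[of n] km unfolding ks is_mollifier_def by simp
  qed
  have k0: "0 \<le> k n z" for n z using k[of n] by (simp add: is_mollifier_def)
  have bb: "norm (h y * k n (x - y)) \<le> norm (B * k n (x - y))" for n x y
    using k0[of n "x - y"] h(2)[of y] by (auto simp: abs_mult intro!: mult_right_mono)
  have hi: "integrable lebesgue (\<lambda>y. h y * k n (x - y))" for n x
    by (rule Bochner_Integration.integrable_bound[of _ "\<lambda>y. B * k n (x - y)"])
      (use h(1) bb borel_measurable_integrable[OF kx(1)] kx(1) in \<open>auto intro!: borel_measurable_times\<close>)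
  then show "integrable lebesgue (\<lambda>y. h y * k n (x - y))" .
  have B0: "B \<ge> 0" using h(2)[of 0] abs_ge_zero order_trans by blast
  have "\<bar>LINT y|lebesgue. h y * k n (x - y)\<bar> \<le> (LINT y|lebesgue. \<bar>h y * k n (x - y)\<bar>)"
    by (rule integral_abs_bound)
  also have "\<dots> \<le> (LINT y|lebesgue. B * k n (x - y))"
    using bb k0 B0 by (intro integral_mono integrable_abs hi integrable_mult_right kx) auto
  finally show "\<bar>LINT y|lebesgue. h y * k n (x - y)\<bar> \<le> B" using kx(2) by simp
  show "(\<lambda>n. LINT y|lebesgue. h y * k n (x - y)) \<longlonglongrightarrow> h x" if c: "isCont h x"
  proof (rule LIMSEQ_I)
    fix r :: real assume r: "r > 0"
    obtain s where s: "s > 0" "\<And>y. dist y x < s \<Longrightarrow> dist (h y) (h x) < r / 2"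
      using c r unfolding continuous_at_eps_delta by (metis half_gt_zero)
    obtain n0 where n0: "d / s < real n0" using reals_Archimedean2 by blast
    have "norm ((LINT y|lebesgue. h y * k n (x - y)) - h x) < r" if n: "n \<ge> n0" for n
    proof -
      have ds: "d / real (Suc n) < s"
      proof -
        have "d < s * real n0" using n0 s by (simp add: field_simps)
        also have "\<dots> \<le> s * real (Suc n)" using n s by (intro mult_left_mono) auto
        finally show ?thesis by (simp add: pos_divide_less_eq del: of_nat_Suc)
      qed
      have "(LINT y|lebesgue. h y * k n (x - y)) - h x = (LINT y|lebesgue. (h y - h x) * k n (x - y))"
        using hi[of n x] kx[where n=n and x=x] by (simp add: left_diff_distrib)
      also have "\<bar>\<dots>\<bar> \<le> (LINT y|lebesgue. \<bar>(h y - h x) * k n (x - y)\<bar>)" by (rule integral_abs_bound)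
      also have "\<dots> \<le> (LINT y|lebesgue. r / 2 * k n (x - y))"
      proof (rule integral_mono)
        show "integrable lebesgue (\<lambda>y. \<bar>(h y - h x) * k n (x - y)\<bar>)"
          using hi[of n x] kx(1)[of n x] by (intro integrable_abs) (simp add: left_diff_distrib)
        fix y
        show "\<bar>(h y - h x) * k n (x - y)\<bar> \<le> r / 2 * k n (x - y)"
        proof (cases "x - y \<in> cball 0 (d / real (Suc n))")
          case True
          then have "dist (h y) (h x) < r / 2" using s(2)[of y] ds by (simp add: dist_norm norm_minus_commute)
          then show ?thesis using k0[of n "x - y"] mult_right_mono[of "\<bar>h y - h x\<bar>" "r / 2" "k n (x - y)"]
            by (simp add: abs_mult dist_real_def)
        qed (use k[of n] in \<open>simp add: is_mollifier_def\<close>)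
      qed (use kx in auto)
      finally show ?thesis using kx(2) r by simp
    qed
    then show "\<exists>no. \<forall>n\<ge>no. norm ((LINT y|lebesgue. h y * k n (x - y)) - h x) < r" by blast
  qed
qed

subsection \<open>Lipschitz test functions\<close>

text \<open>A version of \<open>is_weak_gradient\<close> with integrability in place of square
  integrability and with the gradient as one vector. It passes to open subsets and to differences
  without estimates.\<close>

definition weak_grad :: "'a::euclidean_space set \<Rightarrow> ('a \<Rightarrow> real) \<Rightarrow> ('a \<Rightarrow> 'a) \<Rightarrow> bool" where
  "weak_grad D u g \<longleftrightarrow> set_integrable lebesgue D u \<and> set_integrable lebesgue D g \<and>
     (\<forall>\<phi>\<in>test_functions D. \<forall>b\<in>Basis.
        (LINT x:D|lebesgue. u x * (grad \<phi> x \<bullet> b)) = - (LINT x:D|lebesgue. (g x \<bullet> b) * \<phi> x))"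

lemma set_integrable_inner:
  assumes "set_integrable lebesgue D (g :: 'a::euclidean_space \<Rightarrow> 'a)"
  shows "set_integrable lebesgue D (\<lambda>x. g x \<bullet> e)"
proof -
  have "integrable lebesgue (\<lambda>x. (indicator D x *\<^sub>R g x) \<bullet> e)"
    using assms unfolding set_integrable_def by (rule integrable_inner_left)
  then show ?thesis by (simp add: set_integrable_def)
qed

lemma set_integral_dominated_limit:
  fixes p q0 :: "'a::euclidean_space \<Rightarrow> real"
  assumes N: "negligible N" and p: "set_integrable lebesgue D p"
    and q: "\<And>n. q n \<in> borel_measurable lebesgue" "\<And>n x. \<bar>q n x\<bar> \<le> E"
      "\<And>x. x \<notin> N \<Longrightarrow> (\<lambda>n. q n x) \<longlonglongrightarrow> q0 x" "q0 \<in> borel_measurable lebesgue"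
  shows "(\<lambda>n. LINT x:D|lebesgue. p x * q n x) \<longlonglongrightarrow> (LINT x:D|lebesgue. p x * q0 x)"
  unfolding set_lebesgue_integral_def
proof (rule integral_dominated_convergence)
  have pm: "(\<lambda>x. indicator D x *\<^sub>R p x) \<in> borel_measurable lebesgue"
    using p by (auto simp: set_integrable_def)
  show "integrable lebesgue (\<lambda>x. E * norm (indicator D x *\<^sub>R p x))"
    using p unfolding set_integrable_def by (intro integrable_mult_right integrable_norm)
  have m: "(\<lambda>x. (indicator D x *\<^sub>R p x) * q' x) \<in> borel_measurable lebesgue"
    if "q' \<in> borel_measurable lebesgue" for q' using pm that by (rule borel_measurable_times)
  show "(\<lambda>x. indicator D x *\<^sub>R (p x * q0 x)) \<in> borel_measurable lebesgue"
    using m[OF q(4)] by (simp add: mult.assoc)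
  show "(\<lambda>x. indicator D x *\<^sub>R (p x * q n x)) \<in> borel_measurable lebesgue" for n
    using m[OF q(1)] by (simp add: mult.assoc)
  show "AE x in lebesgue. norm (indicator D x *\<^sub>R (p x * q n x)) \<le> E * norm (indicator D x *\<^sub>R p x)" for n
  proof (rule AE_I2)
    fix x show "norm (indicator D x *\<^sub>R (p x * q n x)) \<le> E * norm (indicator D x *\<^sub>R p x)"
      using mult_right_mono[OF q(2)[of n x], of "\<bar>p x\<bar>"] by (auto simp: indicator_def abs_mult mult.commute)
  qed
  have "N \<in> null_sets lebesgue" using N by (simp add: negligible_iff_null_sets)
  from AE_not_in[OF this] show "AE x in lebesgue. (\<lambda>n. indicator D x *\<^sub>R (p x * q n x)) \<longlonglongrightarrow> indicator D x *\<^sub>R (p x * q0 x)"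
    by eventually_elim (intro tendsto_intros q(3))
qed

text \<open>The mollified f is a smooth test function, and its gradient is the mollification of D.
  Both converge boundedly, f everywhere and D outside N, so the defining identity passes to the
  limit.\<close>

lemma weak_grad_lipschitz_compact:
  fixes u f :: "'a::euclidean_space \<Rightarrow> real"
  assumes wk: "weak_grad \<Omega> u g" and \<Omega>: "open \<Omega>" and S: "compact S" "S \<subseteq> \<Omega>"
    and lip: "L-lipschitz_on UNIV f" and f0: "\<And>x. x \<notin> S \<Longrightarrow> f x = 0"
    and N: "negligible N" "\<And>x. x \<in> N \<Longrightarrow> D x = 0"
    and der: "\<And>x. x \<notin> N \<Longrightarrow> (f has_derivative (\<lambda>h. D x \<bullet> h)) (at x)"
    and Dc: "\<And>x. x \<notin> N \<Longrightarrow> isCont D x" and b: "b \<in> Basis"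
  shows "(LINT x:\<Omega>|lebesgue. u x * (D x \<bullet> b)) = - (LINT x:\<Omega>|lebesgue. (g x \<bullet> b) * f x)"
proof -
  have ui: "set_integrable lebesgue \<Omega> u" and gi: "set_integrable lebesgue \<Omega> (\<lambda>x. g x \<bullet> b)"
    using wk set_integrable_inner by (auto simp: weak_grad_def)
  obtain d where d: "d > 0" "(\<Union>x\<in>S. cball x d) \<subseteq> \<Omega>"
    using compact_subset_open_imp_cball_epsilon_subset[OF S(1) \<Omega> S(2)] by blast
  obtain A where A: "S \<subseteq> cbox (- A) A"
    using bounded_subset_cbox_symmetric compact_imp_bounded S by blast
  have fc: "continuous_on UNIV f" using lip lipschitz_on_continuous_on by blast
  obtain B where B: "B > 0" "\<And>x. \<bar>f x\<bar> \<le> B"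
    using compact_support_bounded[OF fc S(1) f0] by (metis real_norm_def)
  note D0 = integral_deriv_lipschitz_eq_0[OF lip compact_imp_bounded[OF S(1)] f0 N der]
  have Db: "\<bar>D x \<bullet> b\<bar> \<le> L" for x using D0(3)[of x b] b by simp
  have Dm: "(\<lambda>x. D x \<bullet> b) \<in> borel_measurable lebesgue" using D0(1)[of b] by auto
  have fm: "f \<in> borel_measurable lebesgue" using continuous_borel_measurable_lebesgue[OF fc] .
  have "\<exists>k. is_mollifier (d / real (Suc n)) (k :: 'a \<Rightarrow> real)" for n
    using mollifier_exists[of "d / real (Suc n)"] d by (metis divide_pos_pos of_nat_0_less_iff zero_less_Suc)
  then obtain k :: "nat \<Rightarrow> 'a \<Rightarrow> real" where k: "\<And>n. is_mollifier (d / real (Suc n)) (k n)" by metis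
  have kC: "Ck j (k n)" for j n using k by (auto simp: is_mollifier_def)
  have k0: "k n x = 0" if "x \<notin> cball 0 (d / real (Suc n))" for n x
    using k that by (auto simp: is_mollifier_def)
  define F where "F n = (\<lambda>x. integral (cbox (- A) A) (\<lambda>y. f y * k n (x - y)))" for n
  have F1: "F n x = (LINT y|lebesgue. f y * k n (x - y))" for n x
    unfolding F_def
    by (rule integrable_continuous_compact_support(2)[symmetric])
      (use f0 A in \<open>auto intro!: continuous_intros continuous_on_compose2[OF fc]
         continuous_on_compose2[OF Ck_imp_continuous_on[OF kC[of 0], of UNIV]]\<close>)
  have F2: "grad (F n) x \<bullet> b = (LINT y|lebesgue. (D y \<bullet> b) * k n (x - y))" for n x
  proof -
    have "grad (F n) x \<bullet> b = integral (cbox (- A) A) (\<lambda>y. f y * (grad (k n) (x - y) \<bullet> b))"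
      unfolding F_def by (rule grad_inner[OF Ck_mollify(2)[OF fc kC]])
    also have "\<dots> = (LINT y|lebesgue. f y * (grad (k n) (x - y) \<bullet> b))"
      by (rule integrable_continuous_compact_support(2)[symmetric])
        (use f0 A in \<open>auto intro!: continuous_intros continuous_on_compose2[OF fc]
         continuous_on_compose2[OF Ck_continuous_grad[OF kC[of "Suc 0"]]]\<close>)
    also have "\<dots> = (LINT y|lebesgue. (D y \<bullet> b) * k n (x - y))"
    proof -
      \<comment> \<open>The derivative is moved from the kernel to f by applying
        \<open>integral_deriv_lipschitz_eq_0\<close> to the product of f with the reflected kernel;
        the minus sign comes from differentiating \<open>k n (x - y)\<close> in y.\<close>
      define w where "w = (\<lambda>y. f y * k n (x - y))"
      define Dw where "Dw = (\<lambda>y. if y \<in> N then 0 else k n (x - y) *\<^sub>R D y - f y *\<^sub>R grad (k n) (x - y))"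
      have kc: "compact (cball (0::'a) (d / real (Suc n)))" by simp
      obtain M where M: "M-lipschitz_on UNIV (k n)"
        using Ck_compact_support_lipschitz[OF kC kc k0] by blast
      have "M-lipschitz_on UNIV (\<lambda>y. k n (x - y))"
      proof (rule lipschitz_onI)
        show "dist (k n (x - y)) (k n (x - z)) \<le> M * dist y z" for y z
          using lipschitz_onD[OF M, of "x - y" "x - z"] by (simp add: dist_norm norm_minus_commute)
      qed (rule lipschitz_on_nonneg[OF M])
      moreover obtain C where C: "C > 0" "\<And>x. norm (k n x) \<le> C"
        using compact_support_bounded[OF Ck_imp_continuous_on[OF kC[of 0]] kc k0] by blast
      ultimately have "(L * C + B * M)-lipschitz_on UNIV w"
        unfolding w_def using B lip C by (intro lipschitz_on_mult_bounded) auto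
      moreover have "w y = 0" if "y \<notin> S" for y using f0 that by (simp add: w_def)
      moreover have "(w has_derivative (\<lambda>h. Dw y \<bullet> h)) (at y)" if y: "y \<notin> N" for y
      proof -
        have "((\<lambda>y. k n (x - y)) has_derivative (\<lambda>h. grad (k n) (x - y) \<bullet> (- h))) (at y)"
          by (rule has_derivative_compose[of "\<lambda>y. x - y" "\<lambda>h. - h", OF _ Ck_has_derivative_grad[OF kC]])
            (auto intro!: derivative_eq_intros)
        from has_derivative_mult[OF der[OF y] this] show ?thesis
          unfolding w_def Dw_def using y
          by (rule_tac has_derivative_eq_rhs) (auto simp: inner_diff_left fun_eq_iff)
      qed
      moreover have "Dw y = 0" if "y \<in> N" for y using that by (simp add: Dw_def)
      ultimately have Z: "integrable lebesgue (\<lambda>x. Dw x \<bullet> b)" "(LINT y|lebesgue. Dw y \<bullet> b) = 0"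
        using integral_deriv_lipschitz_eq_0[OF _ compact_imp_bounded[OF S(1)] _ N(1)] by blast+
      have i1: "integrable lebesgue (\<lambda>y. (D y \<bullet> b) * k n (x - y))"
        by (rule mollifier_tendsto(3)[OF k d(1) Dm Db])
      have i2: "integrable lebesgue (\<lambda>y. f y * (grad (k n) (x - y) \<bullet> b))"
        by (rule integrable_continuous_compact_support(1))
          (use f0 A in \<open>auto intro!: continuous_intros continuous_on_compose2[OF fc]
           continuous_on_compose2[OF Ck_continuous_grad[OF kC[of "Suc 0"]]]\<close>)
      have "(LINT y|lebesgue. Dw y \<bullet> b) = (LINT y|lebesgue. (D y \<bullet> b) * k n (x - y) - f y * (grad (k n) (x - y) \<bullet> b))"
      proof (rule integral_cong_AE)
        have "N \<in> null_sets lebesgue" using N(1) by (simp add: negligible_iff_null_sets)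
        from AE_not_in[OF this] show "AE y in lebesgue. Dw y \<bullet> b = (D y \<bullet> b) * k n (x - y) - f y * (grad (k n) (x - y) \<bullet> b)"
          by eventually_elim (simp add: Dw_def inner_diff_left)
      qed (use Z i1 i2 in \<open>auto intro!: borel_measurable_diff\<close>)
      then show ?thesis using Z i1 i2 by simp
    qed
    finally show ?thesis .
  qed
  have Ft: "F n \<in> test_functions \<Omega>" for n
  proof (rule test_functionsI)
    show "Ck j (F n)" for j unfolding F_def by (rule Ck_mollify(1)[OF fc kC])
    show "compact {x + y |x y. x \<in> S \<and> y \<in> cball 0 d}" by (rule compact_sums[OF S(1)]) simp
    show "{x + y |x y. x \<in> S \<and> y \<in> cball 0 d} \<subseteq> \<Omega>"
      using d(2) by (force simp: dist_norm)
    fix x assume x: "x \<notin> {x + y |x y. x \<in> S \<and> y \<in> cball 0 d}"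
    have "f y * k n (x - y) = 0" for y
    proof (cases "y \<in> S")
      case True
      then have "x - y \<notin> cball 0 d"
        using x by (auto simp del: mem_cball intro: exI[of _ y] exI[of _ "x - y"])
      moreover have "d / real (Suc n) \<le> d" using d(1) by (simp add: field_simps)
      ultimately show ?thesis by (simp add: k0)
    qed (simp add: f0)
    then have "(\<lambda>y. f y * k n (x - y)) = (\<lambda>y. 0)" by (rule ext)
    then show "F n x = 0" unfolding F_def by simp
  qed
  have eq: "(LINT x:\<Omega>|lebesgue. u x * (grad (F n) x \<bullet> b)) = - (LINT x:\<Omega>|lebesgue. (g x \<bullet> b) * F n x)" for n
    using wk Ft b by (auto simp: weak_grad_def)
  have FC: "Ck j (F n)" for j n unfolding F_def by (rule Ck_mollify(1)[OF fc kC])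
  have "(\<lambda>n. LINT x:\<Omega>|lebesgue. u x * (grad (F n) x \<bullet> b)) \<longlonglongrightarrow> (LINT x:\<Omega>|lebesgue. u x * (D x \<bullet> b))"
  proof (rule set_integral_dominated_limit[OF N(1) ui, of _ L])
    show "(\<lambda>x. grad (F n) x \<bullet> b) \<in> borel_measurable lebesgue" for n
      by (intro continuous_borel_measurable_lebesgue continuous_intros Ck_continuous_grad[OF FC])
    show "\<bar>grad (F n) x \<bullet> b\<bar> \<le> L" for n x
      unfolding F2 by (rule mollifier_tendsto(2)[OF k d(1) Dm Db])
    show "(\<lambda>n. grad (F n) x \<bullet> b) \<longlonglongrightarrow> D x \<bullet> b" if "x \<notin> N" for x
      unfolding F2 by (rule mollifier_tendsto(1)[OF k d(1) Dm Db]) (intro continuous_intros Dc that)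
  qed (rule Dm)
  moreover have "(\<lambda>n. - (LINT x:\<Omega>|lebesgue. (g x \<bullet> b) * F n x)) \<longlonglongrightarrow> - (LINT x:\<Omega>|lebesgue. (g x \<bullet> b) * f x)"
  proof (intro tendsto_minus set_integral_dominated_limit[OF N(1) gi, of _ B])
    show "F n \<in> borel_measurable lebesgue" for n
      by (rule continuous_borel_measurable_lebesgue[OF Ck_imp_continuous_on[OF FC[of 0]]])
    show "\<bar>F n x\<bar> \<le> B" for n x
      unfolding F1 by (rule mollifier_tendsto(2)[OF k d(1) fm B(2)])
    show "(\<lambda>n. F n x) \<longlonglongrightarrow> f x" for x
      unfolding F1 by (rule mollifier_tendsto(1)[OF k d(1) fm B(2)])
        (use fc in \<open>auto simp: continuous_on_eq_continuous_at\<close>)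
  qed (rule fm)
  ultimately show ?thesis unfolding eq by (rule LIMSEQ_unique)
qed

lemma negligible_homothety:
  fixes N :: "'a::euclidean_space set"
  assumes "negligible N" shows "negligible ((\<lambda>x. m + t *\<^sub>R (x - m)) ` N)"
  by (rule negligible_differentiable_image_negligible[OF _ assms])
    (auto simp: differentiable_on_def intro!: derivative_intros)

text \<open>A Lipschitz function vanishing outside a star-shaped set \<open>S\<close> is a limit of dilations
  supported in the interior of \<open>S\<close>.\<close>

lemma weak_grad_lipschitz_star:
  fixes u f :: "'a::euclidean_space \<Rightarrow> real"
  assumes wk: "weak_grad \<Omega> u g" and \<Omega>: "open \<Omega>" and S: "compact S" "interior S \<subseteq> \<Omega>"
    and star: "\<And>x t. x \<in> S \<Longrightarrow> 0 < t \<Longrightarrow> t < 1 \<Longrightarrow> m + t *\<^sub>R (x - m) \<in> interior S"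
    and lip: "L-lipschitz_on UNIV f" and f0: "\<And>x. x \<notin> S \<Longrightarrow> f x = 0"
    and N: "negligible N" "\<And>x. x \<in> N \<Longrightarrow> D x = 0"
    and der: "\<And>x. x \<notin> N \<Longrightarrow> (f has_derivative (\<lambda>h. D x \<bullet> h)) (at x)"
    and Dc: "\<And>x. x \<notin> N \<Longrightarrow> isCont D x" and b: "b \<in> Basis"
  shows "(LINT x:\<Omega>|lebesgue. u x * (D x \<bullet> b)) = - (LINT x:\<Omega>|lebesgue. (g x \<bullet> b) * f x)"
proof -
  have ui: "set_integrable lebesgue \<Omega> u" and gi: "set_integrable lebesgue \<Omega> (\<lambda>x. g x \<bullet> b)"
    using wk set_integrable_inner by (auto simp: weak_grad_def)
  have fc: "continuous_on UNIV f" using lip lipschitz_on_continuous_on by blast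
  obtain B where B: "B > 0" "\<And>x. \<bar>f x\<bar> \<le> B"
    using compact_support_bounded[OF fc S(1) f0] by (metis real_norm_def)
  have L0: "L \<ge> 0" using lip lipschitz_on_nonneg by blast
  note D0 = integral_deriv_lipschitz_eq_0[OF lip compact_imp_bounded[OF S(1)] f0 N der]
  have Db: "\<bar>D x \<bullet> b\<bar> \<le> L" for x using D0(3)[of x b] b by simp
  have Dm: "(\<lambda>x. D x \<bullet> b) \<in> borel_measurable lebesgue" using D0(1)[of b] by auto
  \<comment> \<open>Composing with an expansion by a factor above 1 shrinks the support: it becomes
    the copy of S scaled by 1 / t about m, which \<open>star\<close> places in the interior of
    S.\<close>
  define t :: "nat \<Rightarrow> real" where "t n = 1 + 1 / real (Suc n)" for n
  have t1: "t n > 1" "t n \<le> 2" for n by (auto simp: t_def)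
  define \<tau> where "\<tau> n = (\<lambda>x. m + t n *\<^sub>R (x - m))" for n
  define \<tau>' where "\<tau>' n = (\<lambda>x. m + (1 / t n) *\<^sub>R (x - m))" for n
  have inv: "\<tau> n (\<tau>' n x) = x" "\<tau>' n (\<tau> n x) = x" for n x
    using t1(1)[of n] by (auto simp: \<tau>_def \<tau>'_def)
  have tl: "t \<longlonglongrightarrow> 1" unfolding t_def[abs_def] using LIMSEQ_inverse_real_of_nat[THEN tendsto_add[OF tendsto_const[of 1]]]
    by (simp add: inverse_eq_divide)
  have \<tau>l: "(\<lambda>n. \<tau> n x) \<longlonglongrightarrow> x" for x
  proof -
    have "(\<lambda>n. \<tau> n x) \<longlonglongrightarrow> m + 1 *\<^sub>R (x - m)" unfolding \<tau>_def by (intro tendsto_intros tl)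
    then show ?thesis by simp
  qed
  have eq: "(LINT x:\<Omega>|lebesgue. u x * ((t n *\<^sub>R D (\<tau> n x)) \<bullet> b)) = - (LINT x:\<Omega>|lebesgue. (g x \<bullet> b) * f (\<tau> n x))"
    "integrable lebesgue (\<lambda>x. (t n *\<^sub>R D (\<tau> n x)) \<bullet> b)" for n
  proof -
    have N': "negligible (\<tau>' n ` N)" unfolding \<tau>'_def by (rule negligible_homothety[OF N(1)])
    have inN: "x \<in> \<tau>' n ` N \<longleftrightarrow> \<tau> n x \<in> N" for x using inv by (metis image_iff)
    have lip': "(L * t n)-lipschitz_on UNIV (\<lambda>x. f (\<tau> n x))"
    proof (rule lipschitz_onI)
      fix x y
      have "dist (f (\<tau> n x)) (f (\<tau> n y)) \<le> L * dist (\<tau> n x) (\<tau> n y)" using lipschitz_onD[OF lip] by simp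
      also have "dist (\<tau> n x) (\<tau> n y) = t n * dist x y"
        using t1(1)[of n] by (simp add: \<tau>_def dist_norm scaleR_diff_right[symmetric])
      finally show "dist (f (\<tau> n x)) (f (\<tau> n y)) \<le> L * t n * dist x y" by simp
    qed (use L0 t1(1)[of n] in simp)
    have cS: "compact (\<tau>' n ` S)"
      by (rule compact_continuous_image[OF _ S(1)]) (auto simp: \<tau>'_def intro!: continuous_intros)
    have SS: "\<tau>' n ` S \<subseteq> \<Omega>" using star[of _ "1 / t n"] t1(1)[of n] S(2) by (auto simp: \<tau>'_def)
    have z: "f (\<tau> n x) = 0" if "x \<notin> \<tau>' n ` S" for x using f0 inv that by (metis image_eqI)
    have d: "((\<lambda>x. f (\<tau> n x)) has_derivative (\<lambda>h. (t n *\<^sub>R D (\<tau> n x)) \<bullet> h)) (at x)" if "x \<notin> \<tau>' n ` N" for x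
    proof -
      have "(\<tau> n has_derivative (\<lambda>h. t n *\<^sub>R h)) (at x)"
        unfolding \<tau>_def by (auto intro!: derivative_eq_intros)
      from has_derivative_compose[OF this der[of "\<tau> n x"]] that inN show ?thesis by simp
    qed
    have c: "isCont (\<lambda>x. t n *\<^sub>R D (\<tau> n x)) x" if "x \<notin> \<tau>' n ` N" for x
    proof -
      have "isCont (\<tau> n) x" unfolding \<tau>_def by (intro continuous_intros)
      moreover have "isCont D (\<tau> n x)" using Dc that inN by blast
      ultimately have "isCont (\<lambda>x. D (\<tau> n x)) x" by (rule isCont_o2)
      then show ?thesis by (rule isCont_scaleR[OF continuous_const])
    qed
    have N0: "t n *\<^sub>R D (\<tau> n x) = 0" if "x \<in> \<tau>' n ` N" for x using that inN N(2) by simp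
    show "(LINT x:\<Omega>|lebesgue. u x * ((t n *\<^sub>R D (\<tau> n x)) \<bullet> b)) = - (LINT x:\<Omega>|lebesgue. (g x \<bullet> b) * f (\<tau> n x))"
      by (rule weak_grad_lipschitz_compact[OF wk \<Omega> cS SS lip' z N' N0 d c b])
    show "integrable lebesgue (\<lambda>x. (t n *\<^sub>R D (\<tau> n x)) \<bullet> b)"
      by (rule integral_deriv_lipschitz_eq_0(1)[OF lip' compact_imp_bounded[OF cS] z N' N0 d])
  qed
  have "(\<lambda>n. LINT x:\<Omega>|lebesgue. u x * ((t n *\<^sub>R D (\<tau> n x)) \<bullet> b)) \<longlonglongrightarrow> (LINT x:\<Omega>|lebesgue. u x * (D x \<bullet> b))"
  proof (rule set_integral_dominated_limit[OF N(1) ui, of _ "2 * L"])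
    show "\<bar>(t n *\<^sub>R D (\<tau> n x)) \<bullet> b\<bar> \<le> 2 * L" for n x
      using mult_mono[OF t1(2)[of n] Db[of "\<tau> n x"]] t1(1)[of n] by (simp add: abs_mult)
    show "(\<lambda>n. (t n *\<^sub>R D (\<tau> n x)) \<bullet> b) \<longlonglongrightarrow> D x \<bullet> b" if "x \<notin> N" for x
    proof -
      have "(\<lambda>n. D (\<tau> n x)) \<longlonglongrightarrow> D x" using Dc[OF that] \<tau>l by (rule isCont_tendsto_compose)
      from tendsto_inner[OF tendsto_scaleR[OF tl this] tendsto_const] show ?thesis by simp
    qed
  qed (use Dm borel_measurable_integrable[OF eq(2)] in blast)+
  moreover have "(\<lambda>n. - (LINT x:\<Omega>|lebesgue. (g x \<bullet> b) * f (\<tau> n x))) \<longlonglongrightarrow> - (LINT x:\<Omega>|lebesgue. (g x \<bullet> b) * f x)"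
  proof (intro tendsto_minus set_integral_dominated_limit[OF N(1) gi, of _ B])
    show "(\<lambda>x. f (\<tau> n x)) \<in> borel_measurable lebesgue" for n
      by (intro continuous_borel_measurable_lebesgue continuous_on_compose2[OF fc])
        (auto simp: \<tau>_def intro!: continuous_intros)
    show "(\<lambda>n. f (\<tau> n x)) \<longlonglongrightarrow> f x" for x
      using \<tau>l by (intro isCont_tendsto_compose[of _ f]) (use fc in \<open>auto simp: continuous_on_eq_continuous_at\<close>)
  qed (use B continuous_borel_measurable_lebesgue[OF fc] in auto)
  ultimately show ?thesis unfolding eq(1) by (rule LIMSEQ_unique)
qed

subsection \<open>Piecewise smooth functions\<close>

text \<open>Along a segment, the preimages of the pieces and of the zero set are finitely many
  closed sets that cover the parameter interval, with the same Lipschitz bound on each. The zero set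
  takes care of everything outside the pieces.\<close>

lemma piecewise_C1_lipschitz:
  fixes f :: "'a::euclidean_space \<Rightarrow> real"
  assumes fin: "finite \<K>" and cc: "\<And>K. K \<in> \<K> \<Longrightarrow> compact K" "\<And>K. K \<in> \<K> \<Longrightarrow> convex K"
    and p: "\<And>K. K \<in> \<K> \<Longrightarrow> Ck (Suc 0) (p K)"
    and fc: "continuous_on UNIV f" and fp: "\<And>K x. K \<in> \<K> \<Longrightarrow> x \<in> K \<Longrightarrow> f x = p K x"
    and f0: "\<And>x. x \<notin> \<Union>\<K> \<Longrightarrow> f x = 0"
  obtains L where "L-lipschitz_on UNIV f"
proof -
  have "\<exists>L. L-lipschitz_on K (p K)" if "K \<in> \<K>" for K
    using lipschitz_of_gradient[OF Ck_has_derivative_grad[OF p] Ck_continuous_grad[OF p] cc] that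
    by metis
  then obtain M where M: "\<And>K. K \<in> \<K> \<Longrightarrow> (M K)-lipschitz_on K (p K)" by metis
  define L where "L = (\<Sum>K\<in>\<K>. M K)"
  have MleL: "M K \<le> L" if "K \<in> \<K>" for K
    unfolding L_def using fin that lipschitz_on_nonneg[OF M] by (intro member_le_sum) auto
  have L0: "L \<ge> 0" unfolding L_def using lipschitz_on_nonneg[OF M] by (intro sum_nonneg) auto
  define Z where "Z = {x. f x = 0}"
  have Z: "closed Z" unfolding Z_def
    using continuous_closed_preimage_constant[OF fc, of 0] by simp
  have cl: "closed K" if "K \<in> insert Z \<K>" for K using that Z cc compact_imp_closed by blast
  have li: "L-lipschitz_on K f" if "K \<in> insert Z \<K>" for K
  proof (cases "K \<in> \<K>")
    case True
    then have "(M K)-lipschitz_on K f" using M[OF True] fp by (simp add: lipschitz_on_def)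
    then show ?thesis using lipschitz_on_le MleL[OF True] by blast
  next
    case False
    then have "K = Z" using that by simp
    then show ?thesis using L0 by (intro lipschitz_onI) (auto simp: Z_def)
  qed
  have "L-lipschitz_on UNIV f"
  proof (rule lipschitz_onI[OF _ L0])
    fix x y :: 'a
    define \<gamma> where "\<gamma> = (\<lambda>s::real. x + s *\<^sub>R (y - x))"
    have \<gamma>c: "continuous_on UNIV \<gamma>" unfolding \<gamma>_def by (intro continuous_intros)
    have "(L * dist x y)-lipschitz_on {0..1} (\<lambda>s. f (\<gamma> s))"
    proof (rule lipschitz_on_closed_Union[where I = "insert Z \<K>" and U = "\<lambda>K. \<gamma> -` K"])
      fix K assume K: "K \<in> insert Z \<K>"
      show "closed (\<gamma> -` K)"
        by (rule closed_vimage[OF cl[OF K] \<gamma>c])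
      show "(L * dist x y)-lipschitz_on (\<gamma> -` K) (\<lambda>s. f (\<gamma> s))"
      proof (rule lipschitz_onI)
        fix s t assume st: "s \<in> \<gamma> -` K" "t \<in> \<gamma> -` K"
        have "dist (f (\<gamma> s)) (f (\<gamma> t)) \<le> L * dist (\<gamma> s) (\<gamma> t)"
          using lipschitz_onD[OF li[OF K]] st by simp
        also have "dist (\<gamma> s) (\<gamma> t) = dist x y * dist s t"
          by (simp add: \<gamma>_def dist_norm scaleR_diff_left[symmetric] norm_minus_commute)
        finally show "dist (f (\<gamma> s)) (f (\<gamma> t)) \<le> L * dist x y * dist s t" by (simp add: mult.assoc)
      qed (use L0 in simp)
    next
      have "\<gamma> s \<in> \<Union>(insert Z \<K>)" for s using f0 by (cases "\<gamma> s \<in> \<Union>\<K>") (auto simp: Z_def)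
      then show "{0..1} \<subseteq> (\<Union>K\<in>insert Z \<K>. \<gamma> -` K)" by auto
    qed (use fin L0 in auto)
    from lipschitz_onD[OF this, of 0 1] show "dist (f x) (f y) \<le> L * dist x y"
      by (simp add: \<gamma>_def dist_norm)
  qed
  then show ?thesis using that by blast
qed

text \<open>With disjoint interiors at most one term is nonzero. The value on the common boundaries
  is 0, which is the convention that the lemmas on Lipschitz functions ask for on the exceptional
  null set.\<close>

definition pw_grad :: "'a::euclidean_space set set \<Rightarrow> ('a set \<Rightarrow> 'a \<Rightarrow> real) \<Rightarrow> 'a \<Rightarrow> 'a" where
  "pw_grad \<K> p x = (\<Sum>K\<in>\<K>. indicator (interior K) x *\<^sub>R grad (p K) x)"

lemma sum_indicator_disjoint:
  fixes h :: "'b \<Rightarrow> 'c::real_vector"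
  assumes "finite I" "i \<in> I" "x \<in> A i" "\<And>j. j \<in> I \<Longrightarrow> j \<noteq> i \<Longrightarrow> A i \<inter> A j = {}"
  shows "(\<Sum>j\<in>I. indicator (A j) x *\<^sub>R h j) = h i"
proof -
  have "(\<Sum>j\<in>I. indicator (A j) x *\<^sub>R h j) = (\<Sum>j\<in>I. if j = i then h i else 0)"
    using assms by (intro sum.cong) (auto simp: indicator_def)
  then show ?thesis using assms by simp
qed

lemma pw_grad_interior:
  assumes "finite \<K>" "K \<in> \<K>" "x \<in> interior K"
    and "\<And>J. J \<in> \<K> \<Longrightarrow> J \<noteq> K \<Longrightarrow> interior K \<inter> interior J = {}"
  shows "pw_grad \<K> p x = grad (p K) x"
  unfolding pw_grad_def by (rule sum_indicator_disjoint) (use assms in auto)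

lemma skeleton_negligible:
  fixes \<K> :: "'a::euclidean_space set set"
  assumes "finite \<K>" "\<And>K. K \<in> \<K> \<Longrightarrow> compact K" "\<And>K. K \<in> \<K> \<Longrightarrow> convex K"
  shows "negligible (\<Union>\<K> - (\<Union>K\<in>\<K>. interior K))"
proof (rule negligible_subset)
  show "negligible (\<Union>K\<in>\<K>. frontier K)"
    using assms negligible_convex_frontier by (intro negligible_Union) auto
  show "\<Union>\<K> - (\<Union>K\<in>\<K>. interior K) \<subseteq> (\<Union>K\<in>\<K>. frontier K)"
    using closure_subset by (fastforce simp: frontier_def)
qed

lemma set_integral_sum:
  fixes h :: "'i \<Rightarrow> 'a \<Rightarrow> real"
  assumes "\<And>i. i \<in> I \<Longrightarrow> set_integrable M A (h i)"
  shows "set_integrable M A (\<lambda>x. \<Sum>i\<in>I. h i x)"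
    and "(LINT x:A|M. \<Sum>i\<in>I. h i x) = (\<Sum>i\<in>I. LINT x:A|M. h i x)"
  using assms
  by (induction I rule: infinite_finite_induct)
    (auto simp: set_integral_add set_lebesgue_integral_def set_integrable_def distrib_left)

locale pieces =
  fixes \<K> :: "'a::euclidean_space set set"
  assumes fin: "finite \<K>" and compact: "\<And>K. K \<in> \<K> \<Longrightarrow> compact K" and convex: "\<And>K. K \<in> \<K> \<Longrightarrow> convex K"
    and disjoint: "\<And>K J. K \<in> \<K> \<Longrightarrow> J \<in> \<K> \<Longrightarrow> J \<noteq> K \<Longrightarrow> interior K \<inter> interior J = {}"
begin

definition skeleton where "skeleton = \<Union>\<K> - (\<Union>K\<in>\<K>. interior K)"

lemma negligible_skeleton: "negligible skeleton"
  unfolding skeleton_def by (rule skeleton_negligible[OF fin compact convex])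

lemma compact_Union: "compact (\<Union>\<K>)"
  using fin compact by (intro compact_Union) auto

context
  fixes f :: "'a \<Rightarrow> real" and p :: "'a set \<Rightarrow> 'a \<Rightarrow> real"
  assumes p: "\<And>K. K \<in> \<K> \<Longrightarrow> Ck (Suc 0) (p K)"
    and fc: "continuous_on UNIV f" and fp: "\<And>K x. K \<in> \<K> \<Longrightarrow> x \<in> K \<Longrightarrow> f x = p K x"
    and f0: "\<And>x. x \<notin> \<Union>\<K> \<Longrightarrow> f x = 0"
begin

lemma pw_grad_skeleton: "x \<in> skeleton \<Longrightarrow> pw_grad \<K> p x = 0"
  unfolding pw_grad_def skeleton_def by (intro sum.neutral) auto

lemma pw_has_derivative:
  assumes "x \<notin> skeleton"
  shows "(f has_derivative (\<lambda>h. pw_grad \<K> p x \<bullet> h)) (at x)" and "isCont (pw_grad \<K> p) x"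
proof -
  have "(f has_derivative (\<lambda>h. pw_grad \<K> p x \<bullet> h)) (at x) \<and> isCont (pw_grad \<K> p) x"
  proof (cases "x \<in> \<Union>\<K>")
    case True
    then obtain K where K: "K \<in> \<K>" "x \<in> interior K" using assms by (auto simp: skeleton_def)
    have eq: "pw_grad \<K> p y = grad (p K) y" if "y \<in> interior K" for y
      using pw_grad_interior[OF fin K(1) that] disjoint K by blast
    have "(f has_derivative (\<lambda>h. grad (p K) x \<bullet> h)) (at x)"
      by (rule has_derivative_transform_within_open[OF Ck_has_derivative_grad[OF p[OF K(1)]] open_interior K(2)])
        (use fp K(1) interior_subset in \<open>metis subsetD\<close>)
    moreover have "isCont (pw_grad \<K> p) x"
    proof -
      have "isCont (grad (p K)) x"
        using Ck_continuous_grad[OF p[OF K(1)]] by (simp add: continuous_on_eq_continuous_at)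
      moreover have "eventually (\<lambda>y. pw_grad \<K> p y = grad (p K) y) (nhds x)"
        using eventually_nhds_in_open[OF open_interior K(2)] by eventually_elim (rule eq)
      ultimately show ?thesis using isCont_cong by blast
    qed
    ultimately show ?thesis using eq K(2) by simp
  next
    case False
    have z: "pw_grad \<K> p y = 0" if "y \<in> - \<Union>\<K>" for y
      unfolding pw_grad_def using that interior_subset by (intro sum.neutral) (auto simp: indicator_def)
    have op: "open (- \<Union>\<K>)" using compact_imp_closed[OF compact_Union] by auto
    have "(f has_derivative (\<lambda>h. 0)) (at x)"
      by (rule has_derivative_transform_within_open[of "\<lambda>x. 0", OF _ op]) (use False f0 in auto)
    moreover have "isCont (pw_grad \<K> p) x"
    proof -
      have "eventually (\<lambda>y. pw_grad \<K> p y = 0) (nhds x)"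
        using eventually_nhds_in_open[OF op, of x] False by (auto elim!: eventually_mono simp: z)
      then show ?thesis using isCont_cong[of "pw_grad \<K> p" "\<lambda>x. 0"] by auto
    qed
    ultimately show ?thesis using z[of x] False by simp
  qed
  then show "(f has_derivative (\<lambda>h. pw_grad \<K> p x \<bullet> h)) (at x)" "isCont (pw_grad \<K> p) x" by auto
qed

lemma set_integrable_mult_piece:
  fixes u h :: "'a \<Rightarrow> real"
  assumes "set_integrable lebesgue D u" "interior K \<subseteq> D" "K \<in> \<K>" "continuous_on UNIV h"
  shows "set_integrable lebesgue (interior K) (\<lambda>x. u x * h x)"
proof -
  have "bounded (h ` K)"
    using continuous_on_subset[OF assms(4)] compact[OF assms(3)] by (intro compact_imp_bounded compact_continuous_image) auto
  then obtain B where "\<And>x. x \<in> K \<Longrightarrow> \<bar>h x\<bar> \<le> B" by (auto simp: bounded_iff)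
  then show ?thesis
    using interior_subset[of K] set_integrable_lebesgue_open_subset[OF assms(1) open_interior assms(2)]
      continuous_borel_measurable_lebesgue[OF assms(4)]
    by (intro set_integrable_mult_bounded) auto
qed

lemma set_integral_pieces:
  fixes h :: "'a \<Rightarrow> real"
  assumes "\<And>K. K \<in> \<K> \<Longrightarrow> set_integrable lebesgue (interior K) h"
  shows "(LINT x:(\<Union>K\<in>\<K>. interior K)|lebesgue. h x) = (\<Sum>K\<in>\<K>. LINT x:interior K|lebesgue. h x)"
  using assms fin disjoint
  by (intro set_integral_finite_Union) (auto simp: disjoint_family_on_def)

text \<open>The divergence theorem for constant directions: f is continuous across the pieces and
  vanishes outside, so neither interfaces nor the outer boundary contribute.\<close>

lemma integral_pw_grad_eq_0: "(\<Sum>K\<in>\<K>. LINT x:interior K|lebesgue. grad (p K) x \<bullet> e) = 0"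
proof -
  obtain L where L: "L-lipschitz_on UNIV f"
    by (rule piecewise_C1_lipschitz[of \<K> p f]) (use fin compact convex p fc fp f0 in auto)
  note z = integral_deriv_lipschitz_eq_0[OF L compact_imp_bounded[OF compact_Union] f0
      negligible_skeleton pw_grad_skeleton pw_has_derivative(1), where e = e]
  have i: "set_integrable lebesgue (interior K) (\<lambda>x. pw_grad \<K> p x \<bullet> e)" for K
    by (rule set_integrable_lebesgue_open_subset[of UNIV]) (use z(1) in \<open>auto simp: set_integrable_def\<close>)
  have "(\<Sum>K\<in>\<K>. LINT x:interior K|lebesgue. grad (p K) x \<bullet> e) = (\<Sum>K\<in>\<K>. LINT x:interior K|lebesgue. pw_grad \<K> p x \<bullet> e)"
    by (intro sum.cong refl set_lebesgue_integral_cong ballI)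
      (use pw_grad_interior[OF fin] disjoint in \<open>auto\<close>)
  also have "\<dots> = (LINT x:(\<Union>K\<in>\<K>. interior K)|lebesgue. pw_grad \<K> p x \<bullet> e)"
    by (rule set_integral_pieces[symmetric, OF i])
  also have "\<dots> = (LINT x|lebesgue. pw_grad \<K> p x \<bullet> e)"
    unfolding set_lebesgue_integral_def
    by (rule Bochner_Integration.integral_cong) (auto simp: indicator_def pw_grad_def)
  finally show ?thesis using z(2) by simp
qed

text \<open>Integration by parts against a test function given piece by piece. Continuity of f makes
  it Lipschitz with gradient \<open>pw_grad\<close>, and the star-shaped union allows it to be
  nonzero right up to the boundary.\<close>

lemma weak_grad_pw:
  assumes wk: "weak_grad \<Omega> u g" and \<Omega>: "open \<Omega>" and S: "interior (\<Union>\<K>) \<subseteq> \<Omega>"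
    and star: "\<And>x t. x \<in> \<Union>\<K> \<Longrightarrow> 0 < t \<Longrightarrow> t < 1 \<Longrightarrow> m + t *\<^sub>R (x - m) \<in> interior (\<Union>\<K>)"
  shows "(\<Sum>K\<in>\<K>. LINT x:interior K|lebesgue. u x * (grad (p K) x \<bullet> e) + (g x \<bullet> e) * p K x) = 0"
proof -
  have sub: "interior K \<subseteq> \<Omega>" if "K \<in> \<K>" for K
    using S interior_mono[of K "\<Union>\<K>"] that by blast
  obtain L where L: "L-lipschitz_on UNIV f"
    by (rule piecewise_C1_lipschitz[of \<K> p f]) (use fin compact convex p fc fp f0 in auto)
  have ui: "set_integrable lebesgue \<Omega> u" and gi: "set_integrable lebesgue \<Omega> (\<lambda>x. g x \<bullet> e)" for e
    using wk set_integrable_inner by (auto simp: weak_grad_def)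
  have i1: "set_integrable lebesgue (interior K) (\<lambda>x. u x * (grad (p K) x \<bullet> e))" if "K \<in> \<K>" for K e
    by (rule set_integrable_mult_piece[OF ui sub[OF that] that])
      (intro continuous_intros Ck_continuous_grad[OF p[OF that]])
  have i2: "set_integrable lebesgue (interior K) (\<lambda>x. (g x \<bullet> e) * p K x)" if "K \<in> \<K>" for K e
    by (rule set_integrable_mult_piece[OF gi sub[OF that] that])
      (rule Ck_imp_continuous_on[OF p[OF that]])
  have i1': "set_integrable lebesgue (interior K) (\<lambda>x. u x * (pw_grad \<K> p x \<bullet> e))" if "K \<in> \<K>" for K e
    by (rule set_integrable_cong[THEN iffD1, OF refl refl _ i1[OF that]])
      (use pw_grad_interior[OF fin that] disjoint[OF that] in auto)
  have i2': "set_integrable lebesgue (interior K) (\<lambda>x. (g x \<bullet> e) * f x)" if "K \<in> \<K>" for K e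
    by (rule set_integrable_cong[THEN iffD1, OF refl refl _ i2[OF that]])
      (use fp[OF that] interior_subset in force)
  have basis: "(\<Sum>K\<in>\<K>. LINT x:interior K|lebesgue. u x * (grad (p K) x \<bullet> b) + (g x \<bullet> b) * p K x) = 0"
    if b: "b \<in> Basis" for b
  proof -
    have "(LINT x:\<Omega>|lebesgue. u x * (pw_grad \<K> p x \<bullet> b)) = - (LINT x:\<Omega>|lebesgue. (g x \<bullet> b) * f x)"
      by (rule weak_grad_lipschitz_star[OF wk \<Omega> compact_Union S star L f0 negligible_skeleton
            pw_grad_skeleton pw_has_derivative b])
    moreover have "(LINT x:\<Omega>|lebesgue. u x * (pw_grad \<K> p x \<bullet> b)) = (LINT x:(\<Union>K\<in>\<K>. interior K)|lebesgue. u x * (pw_grad \<K> p x \<bullet> b))"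
      unfolding set_lebesgue_integral_def using sub
      by (intro Bochner_Integration.integral_cong) (auto simp: indicator_def pw_grad_def)
    moreover have "(LINT x:\<Omega>|lebesgue. (g x \<bullet> b) * f x) = (LINT x:(\<Union>K\<in>\<K>. interior K)|lebesgue. (g x \<bullet> b) * f x)"
      unfolding set_lebesgue_integral_def
    proof (rule integral_cong_AE)
      have "(\<lambda>x. (indicator \<Omega> x *\<^sub>R (g x \<bullet> b)) * f x) \<in> borel_measurable lebesgue"
        using gi continuous_borel_measurable_lebesgue[OF fc] by (intro borel_measurable_times) (auto simp: set_integrable_def)
      then show "(\<lambda>x. indicator \<Omega> x *\<^sub>R ((g x \<bullet> b) * f x)) \<in> borel_measurable lebesgue" by (simp add: mult.assoc)
      have "open (\<Union>K\<in>\<K>. interior K)" by auto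
      then have oU: "(\<Union>K\<in>\<K>. interior K) \<in> sets lebesgue" by auto
      have "(\<lambda>x. indicator (\<Union>K\<in>\<K>. interior K) x * ((indicator \<Omega> x *\<^sub>R (g x \<bullet> b)) * f x)) \<in> borel_measurable lebesgue"
        using gi continuous_borel_measurable_lebesgue[OF fc]
        by (intro borel_measurable_times borel_measurable_indicator oU) (auto simp: set_integrable_def)
      moreover have "(\<lambda>x. indicator (\<Union>K\<in>\<K>. interior K) x * ((indicator \<Omega> x *\<^sub>R (g x \<bullet> b)) * f x)) = (\<lambda>x. indicator (\<Union>K\<in>\<K>. interior K) x *\<^sub>R ((g x \<bullet> b) * f x))"
        using sub by (auto simp: fun_eq_iff indicator_def)
      ultimately show "(\<lambda>x. indicator (\<Union>K\<in>\<K>. interior K) x *\<^sub>R ((g x \<bullet> b) * f x)) \<in> borel_measurable lebesgue" by simp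
      have "skeleton \<in> null_sets lebesgue" using negligible_skeleton by (simp add: negligible_iff_null_sets)
      from AE_not_in[OF this] show "AE x in lebesgue. indicator \<Omega> x *\<^sub>R ((g x \<bullet> b) * f x) = indicator (\<Union>K\<in>\<K>. interior K) x *\<^sub>R ((g x \<bullet> b) * f x)"
        by eventually_elim (use sub f0 in \<open>auto simp: indicator_def skeleton_def\<close>)
    qed
    ultimately have "(\<Sum>K\<in>\<K>. LINT x:interior K|lebesgue. u x * (pw_grad \<K> p x \<bullet> b)) + (\<Sum>K\<in>\<K>. LINT x:interior K|lebesgue. (g x \<bullet> b) * f x) = 0"
      by (simp add: set_integral_pieces[OF i1'] set_integral_pieces[OF i2'])
    moreover have "(LINT x:interior K|lebesgue. u x * (pw_grad \<K> p x \<bullet> b)) = (LINT x:interior K|lebesgue. u x * (grad (p K) x \<bullet> b))" if "K \<in> \<K>" for K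
      using pw_grad_interior[OF fin that] disjoint[OF that] by (intro set_lebesgue_integral_cong) auto
    moreover have "(LINT x:interior K|lebesgue. (g x \<bullet> b) * f x) = (LINT x:interior K|lebesgue. (g x \<bullet> b) * p K x)" if "K \<in> \<K>" for K
      using fp[OF that] interior_subset by (intro set_lebesgue_integral_cong) auto
    ultimately show ?thesis by (simp add: sum.distrib set_integral_add(2) i1 i2)
  qed
  \<comment> \<open>Weak derivatives are defined along the basis vectors only; a general direction,
    such as an edge of a simplex, is expanded in the basis.\<close>
  have r: "a \<bullet> e = (\<Sum>b\<in>Basis. (e \<bullet> b) * (a \<bullet> b))" for a :: 'a
    by (subst euclidean_inner) (simp add: mult.commute)
  have "(LINT x:interior K|lebesgue. u x * (grad (p K) x \<bullet> e) + (g x \<bullet> e) * p K x)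
      = (\<Sum>b\<in>Basis. (e \<bullet> b) * (LINT x:interior K|lebesgue. u x * (grad (p K) x \<bullet> b) + (g x \<bullet> b) * p K x))"
    if K: "K \<in> \<K>" for K
  proof -
    have "(LINT x:interior K|lebesgue. u x * (grad (p K) x \<bullet> e) + (g x \<bullet> e) * p K x)
      = (LINT x:interior K|lebesgue. \<Sum>b\<in>Basis. (e \<bullet> b) * (u x * (grad (p K) x \<bullet> b) + (g x \<bullet> b) * p K x))"
      by (subst r[of "grad (p K) _"], subst r[of "g _"])
        (simp add: sum_distrib_left sum_distrib_right sum.distrib[symmetric] algebra_simps)
    also have "\<dots> = (\<Sum>b\<in>Basis. (LINT x:interior K|lebesgue. (e \<bullet> b) * (u x * (grad (p K) x \<bullet> b) + (g x \<bullet> b) * p K x)))"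
      by (intro set_integral_sum(2) set_integrable_mult_right set_integral_add(1) i1 i2 K)
    finally show ?thesis by simp
  qed
  then have "(\<Sum>K\<in>\<K>. LINT x:interior K|lebesgue. u x * (grad (p K) x \<bullet> e) + (g x \<bullet> e) * p K x)
      = (\<Sum>b\<in>Basis. (e \<bullet> b) * (\<Sum>K\<in>\<K>. LINT x:interior K|lebesgue. u x * (grad (p K) x \<bullet> b) + (g x \<bullet> b) * p K x))"
    by (simp add: sum_distrib_left) (rule sum.swap)
  then show ?thesis using basis by simp
qed

end

end

subsection \<open>Calculus of weak gradients\<close>

lemma test_functionsD:
  assumes "\<phi> \<in> test_functions D"
  shows "Ck k \<phi>" "compact (supp_in UNIV \<phi>)" "supp_in UNIV \<phi> \<subseteq> D"
    "x \<notin> supp_in UNIV \<phi> \<Longrightarrow> \<phi> x = 0" "x \<notin> supp_in UNIV \<phi> \<Longrightarrow> grad \<phi> x = 0"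
proof -
  show *: "Ck k \<phi>" "compact (supp_in UNIV \<phi>)" "supp_in UNIV \<phi> \<subseteq> D"
    using assms by (auto simp: test_functions_def)
  have z: "y \<notin> supp_in UNIV \<phi> \<Longrightarrow> \<phi> y = 0" for y
    using closure_subset by (force simp: supp_in_def)
  then show "x \<notin> supp_in UNIV \<phi> \<Longrightarrow> \<phi> x = 0" .
  show "x \<notin> supp_in UNIV \<phi> \<Longrightarrow> grad \<phi> x = 0"
    using z *(2) by (intro grad_eq_0[of "supp_in UNIV \<phi>"]) (auto intro: compact_imp_closed)
qed

lemma set_integrable_mult_test:
  fixes f :: "'a::euclidean_space \<Rightarrow> real"
  assumes "set_integrable lebesgue D f" "\<phi> \<in> test_functions E"
  shows "set_integrable lebesgue D (\<lambda>x. f x * \<phi> x)"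
    and "set_integrable lebesgue D (\<lambda>x. f x * (grad \<phi> x \<bullet> b))"
proof -
  note t = test_functionsD[OF assms(2)]
  have c: "continuous_on UNIV \<phi>" "continuous_on UNIV (\<lambda>x. grad \<phi> x \<bullet> b)"
    using Ck_imp_continuous_on[OF t(1)] Ck_continuous_grad[OF t(1)] by (auto intro: continuous_intros)
  obtain B where "\<And>x. norm (\<phi> x) \<le> B" using compact_support_bounded[OF c(1) t(2,4)] by blast
  then show "set_integrable lebesgue D (\<lambda>x. f x * \<phi> x)"
    using assms(1) continuous_borel_measurable_lebesgue[OF c(1)] by (intro set_integrable_mult_bounded) auto
  have "grad \<phi> x \<bullet> b = 0" if "x \<notin> supp_in UNIV \<phi>" for x using t(5)[OF that] by simp
  then obtain B where "\<And>x. norm (grad \<phi> x \<bullet> b) \<le> B" using compact_support_bounded[OF c(2) t(2)] by blast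
  then show "set_integrable lebesgue D (\<lambda>x. f x * (grad \<phi> x \<bullet> b))"
    using assms(1) continuous_borel_measurable_lebesgue[OF c(2)] by (intro set_integrable_mult_bounded) auto
qed

lemma weak_grad_subset:
  assumes wk: "weak_grad D u g" and D': "open D'" "D' \<subseteq> D" shows "weak_grad D' u g"
  unfolding weak_grad_def
proof (intro conjI ballI)
  show "set_integrable lebesgue D' u" "set_integrable lebesgue D' g"
    using wk D' set_integrable_lebesgue_open_subset by (auto simp: weak_grad_def)
  fix \<phi> and b :: 'a assume \<phi>: "\<phi> \<in> test_functions D'" and b: "b \<in> Basis"
  note t = test_functionsD[OF \<phi>]
  have "\<phi> \<in> test_functions D" using \<phi> D' by (auto simp: test_functions_def)
  then have "(LINT x:D|lebesgue. u x * (grad \<phi> x \<bullet> b)) = - (LINT x:D|lebesgue. (g x \<bullet> b) * \<phi> x)"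
    using wk b by (auto simp: weak_grad_def)
  moreover have "(LINT x:D|lebesgue. u x * (grad \<phi> x \<bullet> b)) = (LINT x:D'|lebesgue. u x * (grad \<phi> x \<bullet> b))"
    unfolding set_lebesgue_integral_def
  proof (rule Bochner_Integration.integral_cong[OF refl])
    fix x show "indicator D x *\<^sub>R (u x * (grad \<phi> x \<bullet> b)) = indicator D' x *\<^sub>R (u x * (grad \<phi> x \<bullet> b))"
    proof -
      have "x \<notin> D' \<Longrightarrow> grad \<phi> x = 0" using t(3) t(5)[of x] by blast
      then show ?thesis using D' by (auto simp: indicator_def)
    qed
  qed
  moreover have "(LINT x:D|lebesgue. (g x \<bullet> b) * \<phi> x) = (LINT x:D'|lebesgue. (g x \<bullet> b) * \<phi> x)"
    unfolding set_lebesgue_integral_def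
  proof (rule Bochner_Integration.integral_cong[OF refl])
    fix x show "indicator D x *\<^sub>R ((g x \<bullet> b) * \<phi> x) = indicator D' x *\<^sub>R ((g x \<bullet> b) * \<phi> x)"
      using t(3) t(4)[of x] D' by (cases "x \<in> D'") (auto simp: indicator_def)
  qed
  ultimately show "(LINT x:D'|lebesgue. u x * (grad \<phi> x \<bullet> b)) = - (LINT x:D'|lebesgue. (g x \<bullet> b) * \<phi> x)"
    by simp
qed

lemma weak_grad_diff:
  assumes u: "weak_grad D u g" and v: "weak_grad D v h"
  shows "weak_grad D (\<lambda>x. u x - v x) (\<lambda>x. g x - h x)"
  unfolding weak_grad_def
proof (intro conjI ballI)
  have i: "set_integrable lebesgue D u" "set_integrable lebesgue D v" "set_integrable lebesgue D g" "set_integrable lebesgue D h"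
    using u v by (auto simp: weak_grad_def)
  then show "set_integrable lebesgue D (\<lambda>x. u x - v x)" "set_integrable lebesgue D (\<lambda>x. g x - h x)"
    by (blast intro: set_integral_diff(1))+
  fix \<phi> and b :: 'a assume \<phi>: "\<phi> \<in> test_functions D" and b: "b \<in> Basis"
  note j = set_integrable_mult_test[OF _ \<phi>]
  have e: "(LINT x:D|lebesgue. u x * (grad \<phi> x \<bullet> b)) = - (LINT x:D|lebesgue. (g x \<bullet> b) * \<phi> x)"
    "(LINT x:D|lebesgue. v x * (grad \<phi> x \<bullet> b)) = - (LINT x:D|lebesgue. (h x \<bullet> b) * \<phi> x)"
    using u v \<phi> b by (auto simp: weak_grad_def)
  have "(LINT x:D|lebesgue. (u x - v x) * (grad \<phi> x \<bullet> b)) = (LINT x:D|lebesgue. u x * (grad \<phi> x \<bullet> b)) - (LINT x:D|lebesgue. v x * (grad \<phi> x \<bullet> b))"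
    unfolding left_diff_distrib by (intro set_integral_diff(2) j(2) i)
  moreover have "(LINT x:D|lebesgue. ((g x - h x) \<bullet> b) * \<phi> x) = (LINT x:D|lebesgue. (g x \<bullet> b) * \<phi> x) - (LINT x:D|lebesgue. (h x \<bullet> b) * \<phi> x)"
    unfolding left_diff_distrib inner_diff_left by (intro set_integral_diff(2) j(1) set_integrable_inner i)
  ultimately show "(LINT x:D|lebesgue. (u x - v x) * (grad \<phi> x \<bullet> b)) = - (LINT x:D|lebesgue. ((g x - h x) \<bullet> b) * \<phi> x)"
    using e by simp
qed

lemma weak_grad_unique:
  assumes D: "open D" and g: "weak_grad D u g" and h: "weak_grad D u h"
  shows "negligible {x \<in> D. g x \<noteq> h x}"
proof -
  have z: "negligible {x \<in> D. (g x - h x) \<bullet> b \<noteq> 0}" if b: "b \<in> Basis" for b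
  proof (rule fundamental_lemma_variations[OF D])
    have i: "set_integrable lebesgue D (\<lambda>x. g x \<bullet> b)" "set_integrable lebesgue D (\<lambda>x. h x \<bullet> b)"
      using g h set_integrable_inner by (auto simp: weak_grad_def)
    then show "set_integrable lebesgue D (\<lambda>x. (g x - h x) \<bullet> b)"
      unfolding inner_diff_left by (intro set_integral_diff(1))
    fix \<phi> assume \<phi>: "\<phi> \<in> test_functions D"
    have "(LINT x:D|lebesgue. ((g x - h x) \<bullet> b) * \<phi> x) = (LINT x:D|lebesgue. (g x \<bullet> b) * \<phi> x) - (LINT x:D|lebesgue. (h x \<bullet> b) * \<phi> x)"
      unfolding left_diff_distrib inner_diff_left by (intro set_integral_diff(2) set_integrable_mult_test(1)[OF _ \<phi>] i)
    then show "(LINT x:D|lebesgue. ((g x - h x) \<bullet> b) * \<phi> x) = 0"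
      using g h \<phi> b by (auto simp: weak_grad_def)
  qed
  have "negligible (\<Union>b\<in>Basis. {x \<in> D. (g x - h x) \<bullet> b \<noteq> 0})"
    by (rule negligible_Union) (use z in auto)
  moreover have "{x \<in> D. g x \<noteq> h x} \<subseteq> (\<Union>b\<in>Basis. {x \<in> D. (g x - h x) \<bullet> b \<noteq> 0})"
    by (auto simp: inner_diff_left intro: euclidean_eqI)
  ultimately show ?thesis using negligible_subset by blast
qed

section \<open>Square integrable functions and the chosen weak gradient\<close>

lemma set_integrable_const_bounded:
  assumes "D \<in> sets lebesgue" "bounded D" shows "set_integrable lebesgue D (\<lambda>x. c::real)"
proof -
  have "D \<in> lmeasurable" using assms bounded_set_imp_lmeasurable by blast
  then have "integrable lebesgue (\<lambda>x. c * indicator D x)"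
    by (intro integrable_mult_right integrable_real_indicator) (auto simp: fmeasurable_def)
  then show ?thesis by (simp add: set_integrable_def mult.commute)
qed

lemma L2_iff:
  fixes f :: "'a::euclidean_space \<Rightarrow> 'b::euclidean_space"
  assumes D: "D \<in> sets lebesgue"
  shows "f \<in> L2 D \<longleftrightarrow> (\<lambda>x. indicator D x *\<^sub>R f x) \<in> borel_measurable lebesgue \<and>
    set_integrable lebesgue D (\<lambda>x. (norm (f x))\<^sup>2)"
  using D by (simp add: L2_def integral_lebesgue_on_eq borel_measurable_restrict_space_iff mult.commute)

lemma L2_imp_set_integrable:
  fixes f :: "'a::euclidean_space \<Rightarrow> 'b::euclidean_space"
  assumes f: "f \<in> L2 D" and D: "D \<in> sets lebesgue" "bounded D"
  shows "set_integrable lebesgue D f"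
  unfolding set_integrable_def
proof (rule Bochner_Integration.integrable_bound)
  have "set_integrable lebesgue D (\<lambda>x. 1 + (norm (f x))\<^sup>2)"
    using f D set_integrable_const_bounded by (intro set_integral_add(1)) (auto simp: L2_iff)
  then show "integrable lebesgue (\<lambda>x. indicator D x *\<^sub>R (1 + (norm (f x))\<^sup>2))"
    by (simp add: set_integrable_def)
  have "norm (f x) \<le> 1 + (norm (f x))\<^sup>2" for x
    using sum_power2_ge_zero[of "norm (f x) - 1" "norm (f x)"] by (simp add: power2_eq_square algebra_simps)
  then show "AE x in lebesgue. norm (indicator D x *\<^sub>R f x) \<le> norm (indicator D x *\<^sub>R (1 + (norm (f x))\<^sup>2))"
    by (intro AE_I2) (auto simp: indicator_def)
qed (use f D in \<open>simp add: L2_iff\<close>)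

lemma norm_diff_sq_le: "(norm (a - b))\<^sup>2 \<le> 2 * (norm a)\<^sup>2 + 2 * (norm b)\<^sup>2"
  for a b :: "'a::real_normed_vector"
proof -
  have "(norm (a - b))\<^sup>2 \<le> (norm a + norm b)\<^sup>2" by (intro power_mono norm_triangle_ineq4) auto
  also have "\<dots> \<le> 2 * (norm a)\<^sup>2 + 2 * (norm b)\<^sup>2"
    using sum_squares_bound[of "norm a" "norm b"] by (simp add: power2_sum)
  finally show ?thesis .
qed

lemma L2_diff:
  fixes f g :: "'a::euclidean_space \<Rightarrow> 'b::euclidean_space"
  assumes f: "f \<in> L2 D" and g: "g \<in> L2 D" and D: "D \<in> sets lebesgue"
  shows "(\<lambda>x. f x - g x) \<in> L2 D"
  unfolding L2_iff[OF D]
proof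
  have m: "(\<lambda>x. indicator D x *\<^sub>R f x) \<in> borel_measurable lebesgue" "(\<lambda>x. indicator D x *\<^sub>R g x) \<in> borel_measurable lebesgue"
    using f g D by (auto simp: L2_iff)
  then show d: "(\<lambda>x. indicator D x *\<^sub>R (f x - g x)) \<in> borel_measurable lebesgue"
    unfolding scaleR_diff_right by (rule borel_measurable_diff)
  show "set_integrable lebesgue D (\<lambda>x. (norm (f x - g x))\<^sup>2)"
    unfolding set_integrable_def
  proof (rule Bochner_Integration.integrable_bound)
    have "set_integrable lebesgue D (\<lambda>x. 2 * (norm (f x))\<^sup>2 + 2 * (norm (g x))\<^sup>2)"
      using f g D by (intro set_integral_add(1) set_integrable_mult_right) (auto simp: L2_iff)
    then show "integrable lebesgue (\<lambda>x. indicator D x *\<^sub>R (2 * (norm (f x))\<^sup>2 + 2 * (norm (g x))\<^sup>2))"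
      by (simp add: set_integrable_def)
    have "(\<lambda>x. (norm (indicator D x *\<^sub>R (f x - g x)))\<^sup>2) \<in> borel_measurable lebesgue"
      using d by measurable
    moreover have "(\<lambda>x. (norm (indicator D x *\<^sub>R (f x - g x)))\<^sup>2) = (\<lambda>x. indicator D x *\<^sub>R (norm (f x - g x))\<^sup>2)"
      by (auto simp: indicator_def fun_eq_iff)
    ultimately show "(\<lambda>x. indicator D x *\<^sub>R (norm (f x - g x))\<^sup>2) \<in> borel_measurable lebesgue" by simp
    have "(norm (f x - g x))\<^sup>2 \<le> 2 * (norm (f x))\<^sup>2 + 2 * (norm (g x))\<^sup>2" for x
      by (rule norm_diff_sq_le)
    then show "AE x in lebesgue. norm (indicator D x *\<^sub>R (norm (f x - g x))\<^sup>2)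
      \<le> norm (indicator D x *\<^sub>R (2 * (norm (f x))\<^sup>2 + 2 * (norm (g x))\<^sup>2))"
      by (intro AE_I2) (auto simp: indicator_def)
  qed
qed

lemma L2_bounded:
  fixes f :: "'a::euclidean_space \<Rightarrow> 'b::euclidean_space"
  assumes D: "D \<in> sets lebesgue" "bounded D"
    and m: "(\<lambda>x. indicator D x *\<^sub>R f x) \<in> borel_measurable lebesgue" and B: "\<And>x. x \<in> D \<Longrightarrow> norm (f x) \<le> B"
  shows "f \<in> L2 D"
  unfolding L2_iff[OF D(1)]
proof
  show "set_integrable lebesgue D (\<lambda>x. (norm (f x))\<^sup>2)"
    unfolding set_integrable_def
  proof (rule Bochner_Integration.integrable_bound)
    show "integrable lebesgue (\<lambda>x. indicator D x *\<^sub>R B\<^sup>2)"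
      using set_integrable_const_bounded[OF D] by (simp add: set_integrable_def)
    have "(\<lambda>x. (norm (indicator D x *\<^sub>R f x))\<^sup>2) \<in> borel_measurable lebesgue"
      using m by measurable
    moreover have "(\<lambda>x. (norm (indicator D x *\<^sub>R f x))\<^sup>2) = (\<lambda>x. indicator D x *\<^sub>R (norm (f x))\<^sup>2)"
      by (auto simp: indicator_def fun_eq_iff)
    ultimately show "(\<lambda>x. indicator D x *\<^sub>R (norm (f x))\<^sup>2) \<in> borel_measurable lebesgue" by simp
    show "AE x in lebesgue. norm (indicator D x *\<^sub>R (norm (f x))\<^sup>2) \<le> norm (indicator D x *\<^sub>R B\<^sup>2)"
      using B by (intro AE_I2) (auto simp: indicator_def intro!: power_mono)
  qed
qed (rule m)

lemma L2_norm_on_sq: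
  assumes "D \<in> sets lebesgue"
  shows "(L2_norm_on D f)\<^sup>2 = (LINT x:D|lebesgue. (norm (f x))\<^sup>2)"
  using integral_lebesgue_on_eq(1)[OF assms, of "\<lambda>x. (norm (f x))\<^sup>2"]
    Bochner_Integration.integral_nonneg[of "lebesgue_on D" "\<lambda>x. (norm (f x))\<^sup>2"]
  by (simp add: L2_norm_on_def)

lemma is_weak_gradient_imp_weak_grad:
  assumes D: "open D" "bounded D" and u: "set_integrable lebesgue D u" and g: "is_weak_gradient D u g"
  shows "weak_grad D u g"
proof -
  have Ds: "D \<in> sets lebesgue" using D by auto
  have "set_integrable lebesgue D g"
    using L2_imp_set_integrable[OF _ Ds D(2)] g by (auto simp: is_weak_gradient_def)
  moreover have "(LINT x:D|lebesgue. u x * (grad \<phi> x \<bullet> b)) = - (LINT x:D|lebesgue. (g x \<bullet> b) * \<phi> x)"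
    if \<phi>: "\<phi> \<in> test_functions D" and b: "b \<in> Basis" for \<phi> b
  proof -
    have "frechet_derivative \<phi> (at x) b = grad \<phi> x \<bullet> b" for x
      using grad_inner[OF Ck_Suc_has_derivative[OF test_functionsD(1)[OF \<phi>]]] by simp
    moreover have "(LINT x:D|lebesgue. u x * frechet_derivative \<phi> (at x) b) = - (LINT x:D|lebesgue. (g x \<bullet> b) * \<phi> x)"
      using g \<phi> b by (auto simp: is_weak_gradient_def integral_lebesgue_on_eq(1)[OF Ds])
    ultimately show ?thesis by simp
  qed
  ultimately show ?thesis using u by (auto simp: weak_grad_def)
qed

lemma weak_grad_imp_is_weak_gradient:
  assumes D: "open D" and u: "weak_grad D u g" and g: "g \<in> L2 D"
  shows "is_weak_gradient D u g"
  unfolding is_weak_gradient_def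
proof (intro conjI ballI g)
  have Ds: "D \<in> sets lebesgue" using D by auto
  fix \<phi> and b :: 'a assume \<phi>: "\<phi> \<in> test_functions D" and b: "b \<in> Basis"
  have "frechet_derivative \<phi> (at x) b = grad \<phi> x \<bullet> b" for x
    using grad_inner[OF Ck_Suc_has_derivative[OF test_functionsD(1)[OF \<phi>]]] by simp
  then show "(LINT x|lebesgue_on D. u x * frechet_derivative \<phi> (at x) b) = - (LINT x|lebesgue_on D. (g x \<bullet> b) * \<phi> x)"
    using u \<phi> b by (simp add: weak_grad_def integral_lebesgue_on_eq(1)[OF Ds])
qed

text \<open>\<open>wgrad\<close> is a choice about which only the specification is known. A square
  integrable g makes the choice meaningful, and uniqueness identifies it with g up to a null
  set.\<close>

lemma wgrad_ae_eq:
  assumes D: "open D" "bounded D" and u: "weak_grad D u g" and g: "g \<in> L2 D"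
  shows "negligible {x \<in> D. wgrad D u x \<noteq> g x}"
proof -
  have "is_weak_gradient D u (wgrad D u)"
    unfolding wgrad_def
    using weak_grad_imp_is_weak_gradient[OF D(1) u g] by (metis someI_ex)
  then have "weak_grad D u (wgrad D u)"
    using is_weak_gradient_imp_weak_grad[OF D] u by (auto simp: weak_grad_def)
  then show ?thesis using weak_grad_unique[OF D(1)] u by blast
qed

context pieces
begin

lemma pw_grad_L2:
  assumes \<Omega>: "open \<Omega>" "bounded \<Omega>" and p: "\<And>K. K \<in> \<K> \<Longrightarrow> Ck (Suc 0) (p K)"
  shows "pw_grad \<K> p \<in> L2 \<Omega>"
proof -
  have s: "\<Omega> \<in> sets lebesgue" using \<Omega> by auto
  have m: "(\<lambda>x. indicator \<Omega> x *\<^sub>R pw_grad \<K> p x) \<in> borel_measurable lebesgue"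
    unfolding pw_grad_def scaleR_sum_right scaleR_scaleR
    using p s by (intro borel_measurable_sum borel_measurable_scaleR borel_measurable_times borel_measurable_indicator
        continuous_borel_measurable_lebesgue Ck_continuous_grad[OF p]) auto
  have "\<exists>B. \<forall>x\<in>K. norm (grad (p K) x) \<le> B" if "K \<in> \<K>" for K
  proof -
    have "bounded (grad (p K) ` K)"
      using compact[OF that] continuous_on_subset[OF Ck_continuous_grad[OF p[OF that]]]
      by (intro compact_imp_bounded compact_continuous_image) auto
    then show ?thesis by (auto simp: bounded_iff)
  qed
  then obtain B where B: "\<And>K x. K \<in> \<K> \<Longrightarrow> x \<in> K \<Longrightarrow> norm (grad (p K) x) \<le> B K" by metis
  have "norm (pw_grad \<K> p x) \<le> (\<Sum>K\<in>\<K>. \<bar>B K\<bar>)" for x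
  proof -
    have "norm (pw_grad \<K> p x) \<le> (\<Sum>K\<in>\<K>. norm (indicator (interior K) x *\<^sub>R grad (p K) x))"
      unfolding pw_grad_def by (rule norm_sum)
    also have "\<dots> \<le> (\<Sum>K\<in>\<K>. \<bar>B K\<bar>)"
    proof (rule sum_mono)
      fix K assume "K \<in> \<K>"
      then show "norm (indicator (interior K) x *\<^sub>R grad (p K) x) \<le> \<bar>B K\<bar>"
        using B[of K x] interior_subset[of K] by (auto simp: indicator_def)
    qed
    finally show ?thesis .
  qed
  then show ?thesis using L2_bounded[OF s \<Omega>(2) m] by blast
qed

text \<open>For a test function \<open>\<phi>\<close>, the product of v and \<open>\<phi>\<close> is
  continuous and piecewise smooth, so the integrals of its elementwise derivatives sum to 0. The
  product rule turns this into the identity that defines a weak gradient.\<close>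

lemma pw_weak_grad:
  assumes \<Omega>: "open \<Omega>" "bounded \<Omega>" and sub: "\<Omega> \<subseteq> \<Union>\<K>" "\<And>K. K \<in> \<K> \<Longrightarrow> interior K \<subseteq> \<Omega>"
    and p: "\<And>K. K \<in> \<K> \<Longrightarrow> Ck (Suc 0) (p K)"
    and vc: "continuous_on \<Omega> v" and vp: "\<And>K x. K \<in> \<K> \<Longrightarrow> x \<in> K \<Longrightarrow> x \<in> \<Omega> \<Longrightarrow> v x = p K x"
  shows "weak_grad \<Omega> v (pw_grad \<K> p)"
  unfolding weak_grad_def
proof (intro conjI ballI)
  have s: "\<Omega> \<in> sets lebesgue" using \<Omega> by auto
  have "\<exists>B. \<forall>x\<in>K. norm (p K x) \<le> B" if "K \<in> \<K>" for K
  proof -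
    have "bounded (p K ` K)"
      using compact[OF that] Ck_imp_continuous_on[OF p[OF that]]
      by (intro compact_imp_bounded compact_continuous_image) auto
    then show ?thesis by (auto simp: bounded_iff)
  qed
  then obtain B where B: "\<And>K x. K \<in> \<K> \<Longrightarrow> x \<in> K \<Longrightarrow> norm (p K x) \<le> B K" by metis
  have "v \<in> L2 \<Omega>"
  proof (rule L2_bounded[OF s \<Omega>(2)])
    show "(\<lambda>x. indicator \<Omega> x *\<^sub>R v x) \<in> borel_measurable lebesgue"
      using continuous_imp_measurable_on_sets_lebesgue[OF vc s] s
      by (simp add: borel_measurable_restrict_space_iff)
    show "norm (v x) \<le> (\<Sum>K\<in>\<K>. \<bar>B K\<bar>)" if x: "x \<in> \<Omega>" for x
    proof -
      obtain K where K: "K \<in> \<K>" "x \<in> K" using x sub by auto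
      have "norm (v x) \<le> \<bar>B K\<bar>" using B[OF K] vp[OF K x] by simp
      also have "\<dots> \<le> (\<Sum>K\<in>\<K>. \<bar>B K\<bar>)" using fin K(1) by (intro member_le_sum) auto
      finally show ?thesis .
    qed
  qed
  then show vi: "set_integrable lebesgue \<Omega> v" by (rule L2_imp_set_integrable[OF _ s \<Omega>(2)])
  show gi: "set_integrable lebesgue \<Omega> (pw_grad \<K> p)"
    by (rule L2_imp_set_integrable[OF pw_grad_L2[OF \<Omega> p] s \<Omega>(2)])
  fix \<phi> and b :: 'a assume \<phi>: "\<phi> \<in> test_functions \<Omega>" and b: "b \<in> Basis"
  note t = test_functionsD[OF \<phi>]
  \<comment> \<open>v is continuous on the open domain only; extending the product by 0 is
    continuous because \<open>\<phi>\<close> has compact support inside.\<close>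
  define f where "f = (\<lambda>x. if x \<in> \<Omega> then v x * \<phi> x else 0)"
  define q where "q K = (\<lambda>x. p K x * \<phi> x)" for K
  have \<phi>0: "\<phi> x = 0" if "x \<notin> \<Omega>" for x using t(3,4) that by blast
  have q: "Ck (Suc 0) (q K)" if "K \<in> \<K>" for K unfolding q_def by (intro Ck_mult p that t(1))
  have fc: "continuous_on UNIV f"
  proof -
    have "continuous_on \<Omega> f"
      using continuous_on_mult[OF vc Ck_imp_continuous_on[OF t(1)[of 0]]]
      by (subst continuous_on_cong[OF refl, of \<Omega> f "\<lambda>x. v x * \<phi> x"]) (auto simp: f_def)
    moreover have "continuous_on (- supp_in UNIV \<phi>) f"
      by (subst continuous_on_cong[OF refl, of _ f "\<lambda>x. 0"]) (auto simp: f_def t(4))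
    moreover have "open (- supp_in UNIV \<phi>)" using compact_imp_closed[OF t(2)] by auto
    ultimately have "continuous_on (\<Omega> \<union> - supp_in UNIV \<phi>) f" using \<Omega> by (intro continuous_on_open_Un)
    moreover have "\<Omega> \<union> - supp_in UNIV \<phi> = UNIV" using t(3) by auto
    ultimately show ?thesis by simp
  qed
  have fp: "f x = q K x" if "K \<in> \<K>" "x \<in> K" for K x using vp[OF that] \<phi>0 by (auto simp: f_def q_def)
  have f0: "f x = 0" if "x \<notin> \<Union>\<K>" for x using that sub by (auto simp: f_def)
  have z: "(\<Sum>K\<in>\<K>. LINT x:interior K|lebesgue. grad (q K) x \<bullet> b) = 0"
    by (rule integral_pw_grad_eq_0[of q f]) (use q fc fp f0 in auto)
  have i1: "set_integrable lebesgue \<Omega> (\<lambda>x. v x * (grad \<phi> x \<bullet> b))"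
    by (rule set_integrable_mult_test(2)[OF vi \<phi>])
  have i2: "set_integrable lebesgue \<Omega> (\<lambda>x. (pw_grad \<K> p x \<bullet> b) * \<phi> x)"
    by (rule set_integrable_mult_test(1)[OF set_integrable_inner[OF gi] \<phi>])
  define F where "F = (\<lambda>x. v x * (grad \<phi> x \<bullet> b) + (pw_grad \<K> p x \<bullet> b) * \<phi> x)"
  have Fi: "set_integrable lebesgue \<Omega> F" unfolding F_def by (rule set_integral_add(1)[OF i1 i2])
  have "(LINT x:\<Omega>|lebesgue. F x) = (LINT x:(\<Union>K\<in>\<K>. interior K)|lebesgue. F x)"
    unfolding set_lebesgue_integral_def
  proof (rule integral_cong_AE)
    show m: "(\<lambda>x. indicator \<Omega> x *\<^sub>R F x) \<in> borel_measurable lebesgue"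
      using Fi by (auto simp: set_integrable_def)
    have "skeleton \<in> null_sets lebesgue" using negligible_skeleton by (simp add: negligible_iff_null_sets)
    from AE_not_in[OF this] show ae: "AE x in lebesgue. indicator \<Omega> x *\<^sub>R F x = indicator (\<Union>K\<in>\<K>. interior K) x *\<^sub>R F x"
      by eventually_elim (use sub in \<open>auto simp: indicator_def skeleton_def\<close>)
    show "(\<lambda>x. indicator (\<Union>K\<in>\<K>. interior K) x *\<^sub>R F x) \<in> borel_measurable lebesgue"
      by (rule borel_measurable_AE[OF m ae])
  qed
  also have "\<dots> = (\<Sum>K\<in>\<K>. LINT x:interior K|lebesgue. F x)"
    by (rule set_integral_pieces[OF _ fc])
      (use fp f0 q set_integrable_lebesgue_open_subset[OF Fi open_interior sub(2)] in auto)
  also have "\<dots> = (\<Sum>K\<in>\<K>. LINT x:interior K|lebesgue. grad (q K) x \<bullet> b)"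
  proof (intro sum.cong refl set_lebesgue_integral_cong allI)
    fix K x assume K: "K \<in> \<K>"
    show "interior K \<in> sets lebesgue" by auto
    have "F x = grad (q K) x \<bullet> b" if x: "x \<in> interior K"
    proof -
      have "(q K has_derivative (\<lambda>h. p K x * (grad \<phi> x \<bullet> h) + (grad (p K) x \<bullet> h) * \<phi> x)) (at x)"
        unfolding q_def
        by (rule has_derivative_mult[OF Ck_has_derivative_grad[OF p[OF K]] Ck_has_derivative_grad[OF t(1)]])
      then have "grad (q K) x \<bullet> b = p K x * (grad \<phi> x \<bullet> b) + (grad (p K) x \<bullet> b) * \<phi> x"
        by (rule grad_inner)
      moreover have "v x = p K x" using vp[OF K] x sub(2)[OF K] interior_subset by blast
      moreover have "pw_grad \<K> p x = grad (p K) x" using pw_grad_interior[OF fin K x] disjoint[OF K] by blast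
      ultimately show ?thesis by (simp add: F_def)
    qed
    then show "x \<in> interior K \<longrightarrow> F x = grad (q K) x \<bullet> b" by blast
  qed
  finally show "(LINT x:\<Omega>|lebesgue. v x * (grad \<phi> x \<bullet> b)) = - (LINT x:\<Omega>|lebesgue. (pw_grad \<K> p x \<bullet> b) * \<phi> x)"
    using z i1 i2 by (simp add: F_def set_integral_add(2))
qed

end

section \<open>Barycentric coordinates\<close>

text \<open>The coordinate vector is pinned to 0 off V, so the coordinates of a point with respect
  to different simplices can be compared as total functions.\<close>

definition bary :: "'a::euclidean_space set \<Rightarrow> 'a \<Rightarrow> 'a \<Rightarrow> real" where
  "bary V x = (SOME t. (\<forall>v. v \<notin> V \<longrightarrow> t v = 0) \<and> sum t V = 1 \<and> (\<Sum>v\<in>V. t v *\<^sub>R v) = x)"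

text \<open>The coordinate of v is affine in the point; its increments from the origin along the
  basis vectors are the components of its constant gradient.\<close>

definition bgrad :: "'a::euclidean_space set \<Rightarrow> 'a \<Rightarrow> 'a" where
  "bgrad V v = (\<Sum>b\<in>Basis. (bary V b v - bary V 0 v) *\<^sub>R b)"

definition full_simplex :: "'a::euclidean_space set \<Rightarrow> bool" where
  "full_simplex V \<longleftrightarrow> \<not> affine_dependent V \<and> card V = Suc DIM('a)"

context
  fixes V :: "'a::euclidean_space set"
  assumes V: "full_simplex V"
begin

lemma full_simplex_finite: "finite V"
  using V by (auto simp: full_simplex_def intro: card_ge_0_finite)

lemma bary_props: "v \<notin> V \<Longrightarrow> bary V x v = 0" "sum (bary V x) V = 1" "(\<Sum>v\<in>V. bary V x v *\<^sub>R v) = x"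
proof -
  have "aff_dim V = DIM('a)"
    using V aff_dim_affine_independent[of V] by (auto simp: full_simplex_def)
  then have "affine hull V = UNIV" by (simp add: aff_dim_eq_full)
  then obtain t where t: "sum t V = 1" "(\<Sum>v\<in>V. t v *\<^sub>R v) = x"
    unfolding affine_hull_finite[OF full_simplex_finite] by blast
  define t' where "t' v = (if v \<in> V then t v else 0)" for v
  have "(\<forall>v. v \<notin> V \<longrightarrow> t' v = 0) \<and> sum t' V = 1 \<and> (\<Sum>v\<in>V. t' v *\<^sub>R v) = x"
    using t by (auto simp: t'_def cong: sum.cong)
  then have "(\<forall>v. v \<notin> V \<longrightarrow> bary V x v = 0) \<and> sum (bary V x) V = 1 \<and> (\<Sum>v\<in>V. bary V x v *\<^sub>R v) = x"
    unfolding bary_def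
    by (rule someI[of "\<lambda>t. (\<forall>v. v \<notin> V \<longrightarrow> t v = 0) \<and> sum t V = 1 \<and> (\<Sum>v\<in>V. t v *\<^sub>R v) = x"])
  then show "v \<notin> V \<Longrightarrow> bary V x v = 0" "sum (bary V x) V = 1" "(\<Sum>v\<in>V. bary V x v *\<^sub>R v) = x" by auto
qed

lemma bary_unique:
  assumes "sum t V = 1" "(\<Sum>v\<in>V. t v *\<^sub>R v) = x" "v \<in> V"
  shows "bary V x v = t v"
proof (rule ccontr)
  assume n: "bary V x v \<noteq> t v"
  have "sum (\<lambda>v. bary V x v - t v) V = 0" using assms bary_props(2) by (simp add: sum_subtractf)
  moreover have "(\<Sum>v\<in>V. (bary V x v - t v) *\<^sub>R v) = 0"
    using assms bary_props(3) by (simp add: sum_subtractf scaleR_diff_left)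
  ultimately have "affine_dependent V"
    using n assms(3) by (subst affine_dependent_explicit_finite[OF full_simplex_finite]) fastforce
  then show False using V by (simp add: full_simplex_def)
qed

lemma bary_vertex: "w \<in> V \<Longrightarrow> v \<in> V \<Longrightarrow> bary V w v = (if v = w then 1 else 0)"
  using bary_unique[of "\<lambda>v. if v = w then 1 else 0" w v] full_simplex_finite
  by (simp add: if_distrib[of "\<lambda>c. c *\<^sub>R _"] sum.delta' cong: if_cong)

lemma bary_convex_combination:
  "bary V (x + s *\<^sub>R (y - x)) v = bary V x v + s * (bary V y v - bary V x v)"
proof (cases "v \<in> V")
  case True
  show ?thesis
    by (rule bary_unique[OF _ _ True])
      (simp_all add: sum.distrib sum_subtractf bary_props scaleR_add_left scaleR_diff_left
        flip: sum_distrib_left scaleR_scaleR scaleR_sum_right)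
qed (simp add: bary_props)

lemma bary_affine: "bary V y v = bary V x v + bgrad V v \<bullet> (y - x)"
proof (cases "v \<in> V")
  case True
  define f where "f x = bary V x v - bary V 0 v" for x
  have "linear f"
  proof (rule linearI)
    fix x y :: 'a and c :: real
    have "bary V (x + y) v = bary V x v + bary V y v - bary V 0 v"
      by (rule bary_unique[OF _ _ True])
        (simp_all add: sum.distrib sum_subtractf bary_props scaleR_add_left scaleR_diff_left)
    then show "f (x + y) = f x + f y" by (simp add: f_def)
    have "bary V (0 + c *\<^sub>R (x - 0)) v = bary V 0 v + c * (bary V x v - bary V 0 v)"
      by (rule bary_convex_combination)
    then show "f (c *\<^sub>R x) = c *\<^sub>R f x" by (simp add: f_def)
  qed
  then interpret linear f .
  have eq: "f x = bgrad V v \<bullet> x" for x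
  proof -
    have "f x = f (\<Sum>b\<in>Basis. (x \<bullet> b) *\<^sub>R b)" by (simp add: euclidean_representation)
    also have "\<dots> = (\<Sum>b\<in>Basis. f b * (b \<bullet> x))" by (simp add: sum scale inner_commute[of x] mult.commute)
    also have "\<dots> = bgrad V v \<bullet> x" by (simp add: bgrad_def f_def inner_sum_left)
    finally show ?thesis .
  qed
  have "f y - f x = bgrad V v \<bullet> (y - x)" by (simp add: eq inner_diff_right)
  then show ?thesis by (simp add: f_def)
qed (simp add: bary_props bgrad_def)

lemma bary_has_derivative: "((\<lambda>x. bary V x v) has_derivative (\<lambda>h. bgrad V v \<bullet> h)) (at x)"
proof -
  have "(\<lambda>x. bary V x v) = (\<lambda>x. bary V 0 v + bgrad V v \<bullet> x)"
    by (rule ext, subst bary_affine[of _ v 0]) simp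
  then show ?thesis by (auto intro!: derivative_eq_intros)
qed

lemma Ck_bary: "Ck k (\<lambda>x. bary V x v)"
proof -
  have "(\<lambda>x. bary V x v) = (\<lambda>x. x \<bullet> bgrad V v + bary V 0 v)"
    by (rule ext, subst bary_affine[of _ v 0]) (simp add: inner_commute)
  then show ?thesis using Ck_affine by metis
qed

lemma continuous_bary: "continuous_on S (\<lambda>x. bary V x v)"
  by (rule Ck_imp_continuous_on[OF Ck_bary[of 0]])

lemma mem_simplex_iff: "x \<in> convex hull V \<longleftrightarrow> (\<forall>v\<in>V. 0 \<le> bary V x v)"
proof
  assume "x \<in> convex hull V"
  then obtain t where t: "\<forall>v\<in>V. 0 \<le> t v" "sum t V = 1" "(\<Sum>v\<in>V. t v *\<^sub>R v) = x"
    unfolding convex_hull_finite[OF full_simplex_finite] by blast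
  then show "\<forall>v\<in>V. 0 \<le> bary V x v" using bary_unique[OF t(2,3)] by simp
next
  assume "\<forall>v\<in>V. 0 \<le> bary V x v"
  then show "x \<in> convex hull V"
    unfolding convex_hull_finite[OF full_simplex_finite] using bary_props by blast
qed

lemma bary_le_1: "x \<in> convex hull V \<Longrightarrow> bary V x v \<le> 1"
proof (cases "v \<in> V")
  assume v: "v \<in> V" and x: "x \<in> convex hull V"
  have "bary V x v \<le> sum (bary V x) V"
    using v x full_simplex_finite by (intro member_le_sum) (auto simp: mem_simplex_iff)
  then show ?thesis using bary_props by simp
qed (simp add: bary_props)

lemma bgrad_nonzero: assumes v: "v \<in> V" shows "bgrad V v \<noteq> 0"
proof
  assume 0: "bgrad V v = 0"
  have "V \<noteq> {v}" using V by (auto simp: full_simplex_def)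
  then obtain w where w: "w \<in> V" "w \<noteq> v" using v by blast
  show False using bary_affine[of w v v] bary_vertex[OF w(1) v] bary_vertex[OF v v] w 0 by simp
qed

lemma mem_interior_simplex_iff: "x \<in> interior (convex hull V) \<longleftrightarrow> (\<forall>v\<in>V. 0 < bary V x v)"
proof
  assume x: "x \<in> interior (convex hull V)"
  show "\<forall>v\<in>V. 0 < bary V x v"
  proof
    fix v assume v: "v \<in> V"
    obtain e where e: "e > 0" "ball x e \<subseteq> convex hull V" using x mem_interior by blast
    \<comment> \<open>A step of length e / 2 against the gradient stays in the ball and lowers the
      coordinate strictly, to a value that is still nonnegative.\<close>
    define s where "s = e / (2 * norm (bgrad V v))"
    have s: "s > 0" using e bgrad_nonzero[OF v] by (simp add: s_def)
    have "x - s *\<^sub>R bgrad V v \<in> ball x e" using e bgrad_nonzero[OF v] by (simp add: dist_norm s_def)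
    then have "0 \<le> bary V (x - s *\<^sub>R bgrad V v) v" using e v mem_simplex_iff by blast
    also have "\<dots> = bary V x v - s * (norm (bgrad V v))\<^sup>2"
      using bary_affine[of "x - s *\<^sub>R bgrad V v" v x] by (simp add: power2_norm_eq_inner)
    finally show "0 < bary V x v" using s bgrad_nonzero[OF v]
      by (smt (verit) mult_pos_pos zero_less_power2 norm_eq_zero)
  qed
next
  assume x: "\<forall>v\<in>V. 0 < bary V x v"
  have "open (\<Inter>v\<in>V. {x. 0 < bary V x v})"
    using full_simplex_finite by (intro open_INT ballI open_Collect_less continuous_bary continuous_on_const) auto
  moreover have "(\<Inter>v\<in>V. {x. 0 < bary V x v}) \<subseteq> convex hull V"
    using mem_simplex_iff by (force intro: less_imp_le)
  ultimately show "x \<in> interior (convex hull V)" using x by (intro interiorI) auto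
qed

text \<open>Going from the centre of an inscribed ball to its boundary along the gradient raises the
  coordinate by r times the norm of the gradient, while coordinates on the simplex stay between 0
  and 1.\<close>

lemma bgrad_norm_le:
  assumes "cball c r \<subseteq> convex hull V" "r > 0" shows "norm (bgrad V v) \<le> 1 / r"
proof (cases "bgrad V v = 0")
  case False
  define y where "y = c + (r / norm (bgrad V v)) *\<^sub>R bgrad V v"
  have "y \<in> cball c r" "c \<in> cball c r" using assms False by (auto simp: y_def dist_norm)
  then have "y \<in> convex hull V" "c \<in> convex hull V" using assms by auto
  then have "bary V y v \<le> 1" "0 \<le> bary V c v"
    using bary_le_1[of y v] by (cases "v \<in> V"; simp add: mem_simplex_iff bary_props)+
  moreover have "bary V y v = bary V c v + r * norm (bgrad V v)"
    using bary_affine[of y v c] False by (simp add: y_def power2_norm_eq_inner[symmetric] power2_eq_square)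
  ultimately show ?thesis using assms(2) by (simp add: field_simps)
qed (use assms in simp)

lemma bary_subset:
  assumes "C \<subseteq> V" "sum t C = 1" "(\<Sum>v\<in>C. t v *\<^sub>R v) = x"
  shows "v \<in> C \<Longrightarrow> bary V x v = t v" "v \<notin> C \<Longrightarrow> bary V x v = 0"
proof -
  define t' where "t' v = (if v \<in> C then t v else 0)" for v
  have "sum t' V = sum t C" "(\<Sum>v\<in>V. t' v *\<^sub>R v) = (\<Sum>v\<in>C. t v *\<^sub>R v)"
    using assms(1) full_simplex_finite
    by (auto simp: t'_def if_distrib[of "\<lambda>c. c *\<^sub>R _"] Int_absorb1 sum.If_cases cong: if_cong)
  then have *: "v \<in> V \<Longrightarrow> bary V x v = t' v" for v using bary_unique[of t' x v] assms by simp
  show "v \<in> C \<Longrightarrow> bary V x v = t v" using * assms(1) by (auto simp: t'_def)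
  show "v \<notin> C \<Longrightarrow> bary V x v = 0" using * bary_props(1) by (cases "v \<in> V") (auto simp: t'_def)
qed

lemma bary_face:
  assumes "C \<subseteq> V" "x \<in> convex hull C"
  shows "v \<notin> C \<Longrightarrow> bary V x v = 0" "sum (bary V x) C = 1" "(\<Sum>v\<in>C. bary V x v *\<^sub>R v) = x"
proof -
  have fC: "finite C" using assms full_simplex_finite finite_subset by blast
  obtain t where t: "sum t C = 1" "(\<Sum>v\<in>C. t v *\<^sub>R v) = x"
    using assms(2) unfolding convex_hull_finite[OF fC] by blast
  note b = bary_subset[OF assms(1) t]
  show "v \<notin> C \<Longrightarrow> bary V x v = 0" by (rule b(2))
  show "sum (bary V x) C = 1" using b(1) t by (metis sum.cong)
  show "(\<Sum>v\<in>C. bary V x v *\<^sub>R v) = x" using b(1) t by (metis (mono_tags, lifting) sum.cong)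
qed

end

section \<open>Lagrange interpolation\<close>

text \<open>Polynomials of total degree at most n, generated so that the degree grows by
  multiplication with one coordinate. The interpolation theorem is proved by this induction;
  \<open>Poly_iff\<close> links it with the monomial expansions.\<close>

inductive polyd :: "nat \<Rightarrow> ('a::euclidean_space \<Rightarrow> real) \<Rightarrow> bool" where
  polyd_const: "polyd n (\<lambda>x. c)"
| polyd_add: "polyd n f \<Longrightarrow> polyd n g \<Longrightarrow> polyd n (\<lambda>x. f x + g x)"
| polyd_Suc: "polyd n f \<Longrightarrow> b \<in> Basis \<Longrightarrow> polyd (Suc n) (\<lambda>x. (x \<bullet> b) * f x)"

lemma polyd_scale: "polyd n f \<Longrightarrow> polyd n (\<lambda>x. c * f x)"
proof (induction rule: polyd.induct)
  case (polyd_Suc n f b)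
  from polyd.polyd_Suc[OF polyd_Suc.IH polyd_Suc.hyps(2)] show ?case by (simp add: mult.left_commute)
qed (auto simp: distrib_left intro: polyd.intros)

lemma polyd_mono: "polyd n f \<Longrightarrow> n \<le> m \<Longrightarrow> polyd m f"
proof (induction arbitrary: m rule: polyd.induct)
  case (polyd_Suc n f b)
  then show ?case by (cases m) (auto intro: polyd.polyd_Suc)
qed (auto intro: polyd.intros)

lemma polyd_sum: "(\<And>i. i \<in> I \<Longrightarrow> polyd n (f i)) \<Longrightarrow> polyd n (\<lambda>x. \<Sum>i\<in>I. f i x)"
  by (induction I rule: infinite_finite_induct) (auto intro: polyd.intros)

lemma polyd_mult_affine:
  assumes "polyd n f" shows "polyd (Suc n) (\<lambda>x. (x \<bullet> g + c) * f x)"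
proof -
  have "polyd (Suc n) (\<lambda>x. (\<Sum>b\<in>Basis. (g \<bullet> b) * ((x \<bullet> b) * f x)) + c * f x)"
    using assms by (intro polyd_add polyd_sum polyd_scale polyd_Suc polyd_mono[OF assms]) auto
  moreover have "(\<Sum>b\<in>Basis. (g \<bullet> b) * ((x \<bullet> b) * f x)) + c * f x = (x \<bullet> g + c) * f x" for x
  proof -
    have "(\<Sum>b\<in>Basis. (g \<bullet> b) * ((x \<bullet> b) * f x)) = (\<Sum>b\<in>Basis. (x \<bullet> b) * (g \<bullet> b)) * f x"
      unfolding sum_distrib_right by (intro sum.cong) auto
    then show ?thesis by (simp add: euclidean_inner[of x g] distrib_right)
  qed
  ultimately show ?thesis by simp
qed

lemma polyd_prod_affine:
  "finite I \<Longrightarrow> polyd (card I) (\<lambda>x. \<Prod>i\<in>I. (x \<bullet> g i + c i))"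
  by (induction I rule: finite_induct) (auto intro: polyd_const polyd_mult_affine)

lemma polyd_power: "b \<in> Basis \<Longrightarrow> polyd n f \<Longrightarrow> polyd (n + k) (\<lambda>x. (x \<bullet> b) ^ k * f x)"
proof (induction k)
  case (Suc k)
  from polyd_Suc[OF Suc.IH[OF Suc.prems] Suc.prems(1)] show ?case by (simp add: mult.assoc)
qed simp

lemma polyd_monomial: "B \<subseteq> Basis \<Longrightarrow> finite B \<Longrightarrow> polyd (sum \<alpha> B) (\<lambda>x. \<Prod>b\<in>B. (x \<bullet> b) ^ \<alpha> b)"
proof (induction B rule: infinite_finite_induct)
  case (insert b B)
  then have "polyd (sum \<alpha> B + \<alpha> b) (\<lambda>x. (x \<bullet> b) ^ \<alpha> b * (\<Prod>b\<in>B. (x \<bullet> b) ^ \<alpha> b))"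
    by (intro polyd_power) auto
  then show ?case using insert by (simp add: add.commute)
qed (auto intro: polyd_const)

lemma Ck_polyd: "polyd n f \<Longrightarrow> Ck k f"
  by (induction rule: polyd.induct) (auto intro: Ck_const Ck_add Ck_mult Ck_inner)

lemma finite_multi_indices: "finite (multi_indices n)"
  by (rule finite_subset[of _ "Basis \<rightarrow>\<^sub>E {..n}"]) (auto simp: multi_indices_def intro: finite_PiE)

lemma Poly_iff:
  fixes p :: "'a::euclidean_space \<Rightarrow> real"
  shows "p \<in> Poly n K \<longleftrightarrow> (\<exists>q. polyd n q \<and> (\<forall>x\<in>K. p x = q x))"
proof
  assume "p \<in> Poly n K"
  then obtain c where c: "\<And>x. x \<in> K \<Longrightarrow> p x = (\<Sum>\<alpha>\<in>multi_indices n. c \<alpha> * (\<Prod>b\<in>Basis. (x \<bullet> b) ^ \<alpha> b))"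
    by (auto simp: Poly_def)
  have "polyd n (\<lambda>x::'a. \<Sum>\<alpha>\<in>multi_indices n. c \<alpha> * (\<Prod>b\<in>Basis. (x \<bullet> b) ^ \<alpha> b))"
    by (intro polyd_sum polyd_scale polyd_mono[OF polyd_monomial]) (auto simp: multi_indices_def)
  then show "\<exists>q. polyd n q \<and> (\<forall>x\<in>K. p x = q x)" using c by blast
next
  define P where "P n = {f. \<exists>c. \<forall>x::'a. f x = (\<Sum>\<alpha>\<in>multi_indices n. c \<alpha> * (\<Prod>b\<in>Basis. (x \<bullet> b) ^ \<alpha> b))}" for n
  have mono: "(\<lambda>x. c * (\<Prod>b\<in>Basis. (x \<bullet> b) ^ \<alpha> b)) \<in> P n" if "\<alpha> \<in> multi_indices n" for \<alpha> n c
    unfolding P_def using that finite_multi_indices[of n, where 'a = 'a]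
    by (auto intro!: exI[of _ "\<lambda>\<beta>. if \<beta> = \<alpha> then c else 0"] simp: if_distrib[of "\<lambda>c. c * _"] cong: if_cong)
  have add: "(\<lambda>x. f x + g x) \<in> P n" if fg: "f \<in> P n" "g \<in> P n" for f g n
  proof -
    obtain c where c: "\<And>x. f x = (\<Sum>\<alpha>\<in>multi_indices n. c \<alpha> * (\<Prod>b\<in>Basis. (x \<bullet> b) ^ \<alpha> b))"
      using fg(1) by (auto simp: P_def)
    obtain d where "\<And>x. g x = (\<Sum>\<alpha>\<in>multi_indices n. d \<alpha> * (\<Prod>b\<in>Basis. (x \<bullet> b) ^ \<alpha> b))"
      using fg(2) by (auto simp: P_def)
    with c show ?thesis unfolding P_def
      by (auto intro!: exI[of _ "\<lambda>\<alpha>. c \<alpha> + d \<alpha>"] simp: distrib_right sum.distrib)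
  qed
  have zero: "(\<lambda>x. 0) \<in> P n" for n unfolding P_def by (auto intro: exI[of _ "\<lambda>\<alpha>. 0"])
  have sums: "(\<lambda>x. \<Sum>i\<in>I. f i x) \<in> P n" if "\<And>i. i \<in> I \<Longrightarrow> f i \<in> P n" for f n and I :: "('a \<Rightarrow> nat) set"
    using that by (induction I rule: infinite_finite_induct) (auto intro: zero add)
  have "q \<in> P n" if "polyd n q" for n and q :: "'a \<Rightarrow> real"
    using that
  proof (induction rule: polyd.induct)
    case (polyd_const n c)
    have "restrict (\<lambda>b. 0) Basis \<in> multi_indices n" by (auto simp: multi_indices_def)
    from mono[OF this, of c] show ?case by simp
  next
    case (polyd_Suc n f b)
    then obtain c where c: "\<And>x. f x = (\<Sum>\<alpha>\<in>multi_indices n. c \<alpha> * (\<Prod>b\<in>Basis. (x \<bullet> b) ^ \<alpha> b))"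
      by (auto simp: P_def)
    have "(\<lambda>x. c \<alpha> * (\<Prod>i\<in>Basis. (x \<bullet> i) ^ (\<alpha>(b := Suc (\<alpha> b))) i)) \<in> P (Suc n)"
      if \<alpha>: "\<alpha> \<in> multi_indices n" for \<alpha>
    proof (rule mono)
      have "(\<Sum>i\<in>Basis. (\<alpha>(b := Suc (\<alpha> b))) i) = Suc (\<Sum>i\<in>Basis. \<alpha> i)"
        using polyd_Suc.hyps(2) by (simp add: sum.remove[of Basis b])
      then show "\<alpha>(b := Suc (\<alpha> b)) \<in> multi_indices (Suc n)"
        using \<alpha> polyd_Suc.hyps(2) by (auto simp: multi_indices_def PiE_iff extensional_def intro: le_SucI)
    qed
    then have "(\<lambda>x. \<Sum>\<alpha>\<in>multi_indices n. c \<alpha> * (\<Prod>i\<in>Basis. (x \<bullet> i) ^ (\<alpha>(b := Suc (\<alpha> b))) i)) \<in> P (Suc n)"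
      by (rule sums)
    moreover have "(\<Prod>i\<in>Basis. (x \<bullet> i) ^ (\<alpha>(b := Suc (\<alpha> b))) i) = (x \<bullet> b) * (\<Prod>i\<in>Basis. (x \<bullet> i) ^ \<alpha> i)" for x :: 'a and \<alpha>
      using polyd_Suc.hyps(2) by (simp add: prod.remove[of Basis b])
    ultimately show ?case by (simp add: c sum_distrib_left mult.left_commute)
  qed (rule add)
  moreover assume "\<exists>q. polyd n q \<and> (\<forall>x\<in>K. p x = q x)"
  ultimately show "p \<in> Poly n K" unfolding Poly_def P_def by fastforce
qed

section \<open>The Lagrange basis\<close>

definition lidx :: "'a set \<Rightarrow> ('a \<Rightarrow> nat) \<Rightarrow> ('a \<times> nat) set" where
  "lidx V \<gamma> = Sigma V (\<lambda>v. {..<\<gamma> v})"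

definition lfac :: "'a set \<Rightarrow> nat \<Rightarrow> 'a \<times> nat \<Rightarrow> ('a \<Rightarrow> real) \<Rightarrow> real" where
  "lfac V l i t = (real l * t (fst i) - real (snd i) * sum t V) / (real (snd i) + 1)"

text \<open>The Lagrange basis in barycentric coordinates, made homogeneous of degree \<open>l\<close>: for \<open>\<Sum>v\<in>V. t v = 1\<close> the
  factors are \<open>(l t\<^sub>v - j) / (j + 1)\<close>.\<close>

definition lag :: "'a set \<Rightarrow> nat \<Rightarrow> ('a \<Rightarrow> nat) \<Rightarrow> ('a \<Rightarrow> real) \<Rightarrow> real" where
  "lag V l \<gamma> t = (\<Prod>i\<in>lidx V \<gamma>. lfac V l i t)"

text \<open>Vanishing off V makes an index of a face literally an index of every simplex that
  contains the face.\<close>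

definition lindices :: "'a set \<Rightarrow> nat \<Rightarrow> ('a \<Rightarrow> nat) set" where
  "lindices V l = {\<gamma>. (\<forall>v. v \<notin> V \<longrightarrow> \<gamma> v = 0) \<and> sum \<gamma> V = l}"

definition lnode :: "'a::real_vector set \<Rightarrow> nat \<Rightarrow> ('a \<Rightarrow> nat) \<Rightarrow> 'a" where
  "lnode V l \<gamma> = (\<Sum>v\<in>V. (real (\<gamma> v) / real l) *\<^sub>R v)"

lemma finite_lidx: "finite V \<Longrightarrow> finite (lidx V \<gamma>)" by (simp add: lidx_def)

lemma card_lidx: "finite V \<Longrightarrow> \<gamma> \<in> lindices V l \<Longrightarrow> card (lidx V \<gamma>) = l"
  by (simp add: lidx_def lindices_def)

lemma lindices_le: "finite V \<Longrightarrow> \<gamma> \<in> lindices V l \<Longrightarrow> \<gamma> v \<le> l"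
  by (cases "v \<in> V") (auto simp: lindices_def intro: member_le_sum)

lemma finite_lindices:
  assumes "finite V" shows "finite (lindices V l)" "card (lindices V l) \<le> Suc l ^ card V"
proof -
  have s: "lindices V l \<subseteq> (\<lambda>f v. if v \<in> V then f v else 0) ` (V \<rightarrow>\<^sub>E {..l})"
  proof
    fix \<gamma> assume g: "\<gamma> \<in> lindices V l"
    then have "restrict \<gamma> V \<in> V \<rightarrow>\<^sub>E {..l}" using lindices_le[OF assms] by auto
    moreover have "\<gamma> = (\<lambda>v. if v \<in> V then restrict \<gamma> V v else 0)" using g by (auto simp: lindices_def)
    ultimately show "\<gamma> \<in> (\<lambda>f v. if v \<in> V then f v else 0) ` (V \<rightarrow>\<^sub>E {..l})" by blast
  qed
  have f: "finite (V \<rightarrow>\<^sub>E {..l})" using assms by (intro finite_PiE) auto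
  then show "finite (lindices V l)" using s finite_subset by blast
  have "card (lindices V l) \<le> card (V \<rightarrow>\<^sub>E {..l})"
    using card_mono[OF finite_imageI[OF f] s] card_image_le[OF f] by (rule order_trans)
  then show "card (lindices V l) \<le> Suc l ^ card V" using assms by (simp add: card_PiE)
qed

lemma lag_fun_upd:
  assumes "finite V" "v \<in> V"
  shows "lag V l (\<gamma>(v := Suc (\<gamma> v))) t = lfac V l (v, \<gamma> v) t * lag V l \<gamma> t"
proof -
  have "lidx V (\<gamma>(v := Suc (\<gamma> v))) = insert (v, \<gamma> v) (lidx V \<gamma>)"
    using assms by (auto simp: lidx_def split: if_splits)
  moreover have "(v, \<gamma> v) \<notin> lidx V \<gamma>" by (simp add: lidx_def)
  ultimately show ?thesis using assms by (simp add: lag_def finite_lidx)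
qed

text \<open>At its own node the factors multiply to the product over v of \<open>\<gamma>\<close> v!
  / \<open>\<gamma>\<close> v! = 1. At another node some coordinate is smaller, since both indices
  have the same sum, and the factor belonging to that value vanishes.\<close>

lemma lag_node:
  assumes V: "finite V" and l: "l > 0" and g: "\<gamma> \<in> lindices V l" "\<gamma>' \<in> lindices V l"
  shows "lag V l \<gamma> (\<lambda>v. real (\<gamma>' v) / real l) = (if \<gamma> = \<gamma>' then 1 else 0)"
proof -
  have s: "(\<Sum>v\<in>V. real (\<gamma>' v) / real l) = 1"
    using g l by (simp add: lindices_def sum_divide_distrib[symmetric] flip: of_nat_sum)
  show ?thesis
  proof (cases "\<gamma> = \<gamma>'")
    case True
    have ff: "(\<Prod>j<k. (real k - real j) / (real j + 1)) = 1" for k :: nat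
    proof -
      have "(\<Prod>j<k. real k - real j) = (\<Prod>j<k. real (k - Suc j) + 1)" by (intro prod.cong) auto
      also have "\<dots> = (\<Prod>j<k. real j + 1)" by (rule prod.nat_diff_reindex[of "\<lambda>j. real j + 1"])
      finally show ?thesis by (simp add: prod_dividef prod_zero_iff)
    qed
    have "lag V l \<gamma> (\<lambda>v. real (\<gamma>' v) / real l) = (\<Prod>v\<in>V. \<Prod>j<\<gamma> v. (real (\<gamma> v) - real j) / (real j + 1))"
      using True l V s unfolding lag_def lidx_def
      by (subst prod.Sigma) (auto simp: lfac_def case_prod_unfold intro!: prod.cong)
    also have "\<dots> = 1" by (simp add: ff)
    finally show ?thesis using True by simp
  next
    case False
    have "\<exists>v\<in>V. \<gamma>' v < \<gamma> v"
    proof (rule ccontr)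
      assume "\<not> ?thesis"
      then have le: "\<And>v. v \<in> V \<Longrightarrow> \<gamma> v \<le> \<gamma>' v" by force
      obtain w where w: "\<gamma> w \<noteq> \<gamma>' w" using False by auto
      then have "w \<in> V" using g unfolding lindices_def by (metis (mono_tags, lifting) mem_Collect_eq)
      then have "sum \<gamma> V < sum \<gamma>' V" using V le w by (intro sum_strict_mono_ex1) (auto intro: le_neq_trans)
      then show False using g by (simp add: lindices_def)
    qed
    then obtain v where v: "v \<in> V" "\<gamma>' v < \<gamma> v" by blast
    have "(v, \<gamma>' v) \<in> lidx V \<gamma>" using v by (simp add: lidx_def)
    moreover have "lfac V l (v, \<gamma>' v) (\<lambda>v. real (\<gamma>' v) / real l) = 0" using l s by (simp add: lfac_def)
    ultimately have "lag V l \<gamma> (\<lambda>v. real (\<gamma>' v) / real l) = 0"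
      unfolding lag_def using finite_lidx[OF V] by (metis prod_zero)
    then show ?thesis using False by simp
  qed
qed

text \<open>Multiplication by a coordinate maps the span of Lagrange functions of index sum at most
  k to that for k + 1, so the span contains all polynomials. Functions of lower index sum are then
  expressed by those of sum l. Evaluation at the nodes gives the coefficients.\<close>

theorem lagrange_interpolation:
  fixes V :: "'a::euclidean_space set"
  assumes V: "finite V" and l: "l > 0" and p: "polyd l p" and t: "sum t V = 1"
  shows "p (\<Sum>v\<in>V. t v *\<^sub>R v) = (\<Sum>\<gamma>\<in>lindices V l. p (lnode V l \<gamma>) * lag V l \<gamma> t)"
proof -
  define \<Gamma> where "\<Gamma> k = (\<Union>j\<le>k. lindices V j)" for k
  have fin: "finite (\<Gamma> k)" for k using finite_lindices[OF V] by (auto simp: \<Gamma>_def)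
  define sp where "sp A h \<longleftrightarrow> (\<exists>c. \<forall>t. sum t V = 1 \<longrightarrow> h t = (\<Sum>\<gamma>\<in>A. c \<gamma> * lag V l \<gamma> t))"
    for A and h :: "('a \<Rightarrow> real) \<Rightarrow> real"
  have sp_add: "sp A (\<lambda>t. f t + g t)" if fg: "sp A f" "sp A g" for A f g
  proof -
    obtain c where c: "\<And>t. sum t V = 1 \<Longrightarrow> f t = (\<Sum>\<gamma>\<in>A. c \<gamma> * lag V l \<gamma> t)"
      using fg(1) unfolding sp_def by blast
    obtain d where "\<And>t. sum t V = 1 \<Longrightarrow> g t = (\<Sum>\<gamma>\<in>A. d \<gamma> * lag V l \<gamma> t)"
      using fg(2) unfolding sp_def by blast
    with c show ?thesis unfolding sp_def
      by (intro exI[of _ "\<lambda>\<gamma>. c \<gamma> + d \<gamma>"]) (auto simp: distrib_right sum.distrib)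
  qed
  have sp_scale: "sp A (\<lambda>t. k * f t)" if f: "sp A f" for A f k
  proof -
    obtain c where "\<And>t. sum t V = 1 \<Longrightarrow> f t = (\<Sum>\<gamma>\<in>A. c \<gamma> * lag V l \<gamma> t)"
      using f unfolding sp_def by blast
    then show ?thesis unfolding sp_def
      by (intro exI[of _ "\<lambda>\<gamma>. k * c \<gamma>"]) (auto simp: sum_distrib_left mult.assoc)
  qed
  have sp_0: "sp A (\<lambda>t. 0)" for A unfolding sp_def by (intro exI[of _ "\<lambda>\<gamma>. 0"]) auto
  have sp_sum: "sp A (\<lambda>t. \<Sum>i\<in>I. f i t)" if "\<And>i. i \<in> I \<Longrightarrow> sp A (f i)" for A f and I :: "'i set"
    using that by (induction I rule: infinite_finite_induct) (auto intro: sp_0 sp_add)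
  have sp_cong: "sp A f" if "sp A g" "\<And>t. sum t V = 1 \<Longrightarrow> f t = g t" for A f g
    using that unfolding sp_def by auto
  have sp_base: "sp A (lag V l \<gamma>)" if "\<gamma> \<in> A" "finite A" for A \<gamma>
    unfolding sp_def using that
    by (intro exI[of _ "\<lambda>\<beta>. if \<beta> = \<gamma> then 1 else 0"]) (auto simp: if_distrib[of "\<lambda>c. c * _"] cong: if_cong)
  have sp_rep: "sp B f" if f: "sp A f" "\<And>\<gamma>. \<gamma> \<in> A \<Longrightarrow> sp B (lag V l \<gamma>)" for A B f
  proof -
    obtain c where "\<And>t. sum t V = 1 \<Longrightarrow> f t = (\<Sum>\<gamma>\<in>A. c \<gamma> * lag V l \<gamma> t)"
      using f(1) unfolding sp_def by blast
    moreover have "sp B (\<lambda>t. \<Sum>\<gamma>\<in>A. c \<gamma> * lag V l \<gamma> t)"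
      by (intro sp_sum sp_scale f(2))
    ultimately show ?thesis using sp_cong by blast
  qed
  have upd: "\<gamma>(v := Suc (\<gamma> v)) \<in> lindices V (Suc j)" if "\<gamma> \<in> lindices V j" "v \<in> V" for \<gamma> v j
    using that V by (auto simp: lindices_def sum.remove[of V v])
  \<comment> \<open>On coordinate sum 1 the next factor is (l t_v - \<open>\<gamma>\<close> v) /
    (\<open>\<gamma>\<close> v + 1); solving for t_v expresses t_v times a Lagrange function by its
    successor and itself.\<close>
  have mult: "sp (\<Gamma> (Suc k)) (\<lambda>t. t v * lag V l \<gamma> t)" if v: "v \<in> V" and g: "\<gamma> \<in> \<Gamma> k" for v \<gamma> k
  proof -
    obtain j where j: "j \<le> k" "\<gamma> \<in> lindices V j" using g by (auto simp: \<Gamma>_def)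
    have "Suc j \<in> {..Suc k}" "j \<in> {..Suc k}" using j by auto
    then have i: "\<gamma>(v := Suc (\<gamma> v)) \<in> \<Gamma> (Suc k)" "\<gamma> \<in> \<Gamma> (Suc k)"
      using upd[OF j(2) v] j(2) unfolding \<Gamma>_def by blast+
    have "sp (\<Gamma> (Suc k)) (\<lambda>t. ((real (\<gamma> v) + 1) / real l) * lag V l (\<gamma>(v := Suc (\<gamma> v))) t + (real (\<gamma> v) / real l) * lag V l \<gamma> t)"
      by (intro sp_add sp_scale sp_base i fin)
    then show ?thesis
    proof (rule sp_cong)
      fix t :: "'a \<Rightarrow> real" assume t: "sum t V = 1"
      have "(real (\<gamma> v) + 1) / real l * lfac V l (v, \<gamma> v) t = (real l * t v - real (\<gamma> v)) / real l"
        by (simp add: lfac_def t)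
      then have "(real (\<gamma> v) + 1) / real l * lag V l (\<gamma>(v := Suc (\<gamma> v))) t
          = (real l * t v - real (\<gamma> v)) / real l * lag V l \<gamma> t"
        by (simp only: lag_fun_upd[OF V v] flip: mult.assoc)
      then show "t v * lag V l \<gamma> t = (real (\<gamma> v) + 1) / real l * lag V l (\<gamma>(v := Suc (\<gamma> v))) t + real (\<gamma> v) / real l * lag V l \<gamma> t"
        using l by (simp add: field_simps)
    qed
  qed
  have mult': "sp (\<Gamma> (Suc k)) (\<lambda>t. t v * h t)" if v: "v \<in> V" and h: "sp (\<Gamma> k) h" for v h k
  proof -
    obtain c where c: "\<And>t. sum t V = 1 \<Longrightarrow> h t = (\<Sum>\<gamma>\<in>\<Gamma> k. c \<gamma> * lag V l \<gamma> t)"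
      using h unfolding sp_def by blast
    have "sp (\<Gamma> (Suc k)) (\<lambda>t. \<Sum>\<gamma>\<in>\<Gamma> k. c \<gamma> * (t v * lag V l \<gamma> t))"
      by (intro sp_sum sp_scale mult[OF v])
    then show ?thesis by (rule sp_cong) (simp add: c sum_distrib_left mult.left_commute)
  qed
  have "sp (\<Gamma> k) (\<lambda>t. p (\<Sum>v\<in>V. t v *\<^sub>R v))" if "polyd k p" for k and p :: "'a \<Rightarrow> real"
    using that
  proof (induction rule: polyd.induct)
    case (polyd_const n c)
    have "(\<lambda>v. 0) \<in> \<Gamma> n" by (auto simp: \<Gamma>_def lindices_def intro!: bexI[of _ 0])
    from sp_scale[OF sp_base[OF this fin], of c] show ?case
      by (rule sp_cong) (simp add: lag_def lidx_def)
  next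
    case (polyd_Suc n f b)
    have "sp (\<Gamma> (Suc n)) (\<lambda>t. \<Sum>v\<in>V. (v \<bullet> b) * (t v * f (\<Sum>v\<in>V. t v *\<^sub>R v)))"
      by (intro sp_sum sp_scale mult' polyd_Suc.IH)
    then show ?case
      by (rule sp_cong) (simp add: inner_sum_left sum_distrib_left sum_distrib_right mult_ac)
  qed (rule sp_add)
  then have 1: "sp (\<Gamma> l) (\<lambda>t. p (\<Sum>v\<in>V. t v *\<^sub>R v))" using p by blast
  \<comment> \<open>Summing (\<open>\<gamma>\<close> v + 1) times the successor in direction v over
    all v gives (l - j) times the function itself, so index sum j is reduced to index sum j + 1 as
    long as j < l.\<close>
  have raise: "sp (lindices V l) (lag V l \<gamma>)" if "\<gamma> \<in> lindices V j" "j \<le> l" for \<gamma> j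
    using that
  proof (induction "l - j" arbitrary: \<gamma> j)
    case 0
    then show ?case using finite_lindices[OF V] by (intro sp_base) auto
  next
    case (Suc k)
    have "sp (lindices V l) (\<lambda>t. (1 / (real l - real j)) * (\<Sum>v\<in>V. (real (\<gamma> v) + 1) * lag V l (\<gamma>(v := Suc (\<gamma> v))) t))"
      using Suc upd by (intro sp_scale sp_sum Suc.hyps(1)[of "Suc j"]) auto
    then show ?case
    proof (rule sp_cong)
      fix t :: "'a \<Rightarrow> real" assume t: "sum t V = 1"
      have "(\<Sum>v\<in>V. (real (\<gamma> v) + 1) * lag V l (\<gamma>(v := Suc (\<gamma> v))) t) = (\<Sum>v\<in>V. (real l * t v - real (\<gamma> v)) * lag V l \<gamma> t)"
        by (intro sum.cong) (auto simp: lag_fun_upd[OF V] lfac_def t field_simps)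
      also have "\<dots> = (real l - real j) * lag V l \<gamma> t"
        using Suc.prems(1) t
        by (simp add: sum_distrib_right[symmetric] sum_subtractf sum_distrib_left[symmetric] lindices_def flip: of_nat_sum)
      finally show "lag V l \<gamma> t = (1 / (real l - real j)) * (\<Sum>v\<in>V. (real (\<gamma> v) + 1) * lag V l (\<gamma>(v := Suc (\<gamma> v))) t)"
        using Suc.hyps(2) by simp
    qed
  qed
  have "sp (lindices V l) (\<lambda>t. p (\<Sum>v\<in>V. t v *\<^sub>R v))"
    by (rule sp_rep[OF 1]) (auto simp: \<Gamma>_def intro: raise)
  then obtain c where c: "\<And>t. sum t V = 1 \<Longrightarrow> p (\<Sum>v\<in>V. t v *\<^sub>R v) = (\<Sum>\<gamma>\<in>lindices V l. c \<gamma> * lag V l \<gamma> t)"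
    unfolding sp_def by blast
  have "c \<gamma>' = p (lnode V l \<gamma>')" if g: "\<gamma>' \<in> lindices V l" for \<gamma>'
  proof -
    have "(\<Sum>v\<in>V. real (\<gamma>' v) / real l) = 1"
      using g l by (simp add: lindices_def sum_divide_distrib[symmetric] flip: of_nat_sum)
    from c[OF this] have "p (lnode V l \<gamma>') = (\<Sum>\<gamma>\<in>lindices V l. c \<gamma> * (if \<gamma> = \<gamma>' then 1 else 0))"
      unfolding lnode_def using lag_node[OF V l _ g] by (simp cong: sum.cong)
    also have "\<dots> = c \<gamma>'"
      using g finite_lindices[OF V] by (simp add: if_distrib[of "\<lambda>x. _ * x"] cong: if_cong)
    finally show ?thesis by simp
  qed
  then show ?thesis using c[OF t] by simp
qed

section \<open>Estimates on a simplex\<close>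

lemma set_integrable_continuous_interior:
  fixes f :: "'a::euclidean_space \<Rightarrow> real"
  assumes "bounded S" "continuous_on UNIV f" shows "set_integrable lebesgue (interior S) f"
proof -
  obtain a b where "S \<subseteq> cbox a b" using bounded_subset_cbox_symmetric[OF assms(1)] by metis
  then have "interior S \<subseteq> cbox a b" using interior_subset by blast
  moreover have "set_integrable lebesgue (cbox a b) f"
    by (rule absolutely_integrable_continuous[OF continuous_on_subset[OF assms(2)]]) simp
  ultimately show ?thesis using set_integrable_lebesgue_open_subset open_interior by blast
qed

text \<open>Dividing every factor by M leaves factors bounded by 1, for which the products differ by
  at most the sum of the differences.\<close>

lemma abs_prod_diff_le:
  fixes a b :: "'i \<Rightarrow> real"
  assumes "finite I" "\<And>i. i \<in> I \<Longrightarrow> \<bar>a i\<bar> \<le> M" "\<And>i. i \<in> I \<Longrightarrow> \<bar>b i\<bar> \<le> M"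
    "\<And>i. i \<in> I \<Longrightarrow> \<bar>a i - b i\<bar> \<le> \<delta>" "M \<ge> 1"
  shows "\<bar>(\<Prod>i\<in>I. a i) - (\<Prod>i\<in>I. b i)\<bar> \<le> real (card I) * M ^ card I * \<delta>"
proof -
  have "norm ((\<Prod>i\<in>I. a i / M) - (\<Prod>i\<in>I. b i / M)) \<le> (\<Sum>i\<in>I. norm (a i / M - b i / M))"
    using assms by (intro norm_prod_diff) auto
  also have "\<dots> \<le> (\<Sum>i\<in>I. \<delta>)"
  proof (rule sum_mono)
    fix i assume i: "i \<in> I"
    have "norm (a i / M - b i / M) = \<bar>a i - b i\<bar> / M" using assms(5) by (simp flip: diff_divide_distrib)
    also have "\<dots> \<le> \<bar>a i - b i\<bar>" using assms(5) by (simp add: divide_le_eq mult_left_le_one_le mult_le_cancel_left1)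
    finally show "norm (a i / M - b i / M) \<le> \<delta>" using assms(4)[OF i] by linarith
  qed
  finally have "\<bar>(\<Prod>i\<in>I. a i) - (\<Prod>i\<in>I. b i)\<bar> / M ^ card I \<le> real (card I) * \<delta>"
    using assms(5) by (simp add: prod_dividef flip: diff_divide_distrib)
  then show ?thesis using assms(5) by (simp add: pos_divide_le_eq mult_ac)
qed

lemma prod_abs_le:
  fixes a :: "'i \<Rightarrow> real"
  assumes "\<And>i. i \<in> I \<Longrightarrow> \<bar>a i\<bar> \<le> M" "M \<ge> 1"
  shows "\<bar>\<Prod>i\<in>I. a i\<bar> \<le> M ^ card I"
  unfolding abs_prod using prod_mono[of I "\<lambda>i. \<bar>a i\<bar>" "\<lambda>i. M"] assms by simp

lemma grad_prod:
  assumes "\<And>i. i \<in> I \<Longrightarrow> (f i has_derivative (\<lambda>h. G i \<bullet> h)) (at x)"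
  shows "grad (\<lambda>x. \<Prod>i\<in>I. f i x) x \<bullet> e = (\<Sum>i\<in>I. (G i \<bullet> e) * (\<Prod>j\<in>I - {i}. f j x))"
  by (rule grad_inner[OF has_derivative_prod[OF assms]])

lemma grad_prod_bound:
  assumes "\<And>i. i \<in> I \<Longrightarrow> (f i has_derivative (\<lambda>h. G i \<bullet> h)) (at x)" "finite I"
    and "\<And>i. i \<in> I \<Longrightarrow> \<bar>f i x\<bar> \<le> M" "\<And>i. i \<in> I \<Longrightarrow> norm (G i) \<le> B" "M \<ge> 1" "B \<ge> 0"
  shows "norm (grad (\<lambda>x. \<Prod>i\<in>I. f i x) x) \<le> real (card I) * B * M ^ card I"
proof -
  define g where "g = (\<Sum>i\<in>I. (\<Prod>j\<in>I - {i}. f j x) *\<^sub>R G i)"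
  have "grad (\<lambda>x. \<Prod>i\<in>I. f i x) x = g"
    by (rule euclidean_eqI) (simp add: grad_prod[OF assms(1)] g_def inner_sum_left mult.commute)
  moreover have "norm g \<le> (\<Sum>i\<in>I. M ^ card I * B)"
    unfolding g_def
  proof (rule order_trans[OF norm_sum sum_mono])
    fix i assume i: "i \<in> I"
    have "\<bar>\<Prod>j\<in>I - {i}. f j x\<bar> \<le> M ^ card (I - {i})" using assms by (intro prod_abs_le) auto
    also have "\<dots> \<le> M ^ card I" using assms by (intro power_increasing card_mono) auto
    finally show "norm ((\<Prod>j\<in>I - {i}. f j x) *\<^sub>R G i) \<le> M ^ card I * B"
      using assms(4)[OF i] assms(5) by (simp add: mult_mono)
  qed
  ultimately show ?thesis by (simp add: mult_ac)
qed

lemma power2_sum_le: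
  fixes a :: "'i \<Rightarrow> real" assumes "finite I"
  shows "(\<Sum>i\<in>I. a i)\<^sup>2 \<le> real (card I) * (\<Sum>i\<in>I. (a i)\<^sup>2)"
  using Cauchy_Schwarz_ineq_sum[of "\<lambda>i. 1" a I] by simp

lemma lag_cong: "(\<And>v. v \<in> V \<Longrightarrow> t v = t' v) \<Longrightarrow> lag V l \<gamma> t = lag V l \<gamma> t'"
proof -
  assume *: "\<And>v. v \<in> V \<Longrightarrow> t v = t' v"
  then have "sum t V = sum t' V" by (intro sum.cong) auto
  then show ?thesis using * by (auto simp: lag_def lfac_def lidx_def intro!: prod.cong)
qed

lemma lfac_abs_le:
  assumes "finite V" "\<gamma> \<in> lindices V l" "i \<in> lidx V \<gamma>" "\<And>v. v \<in> V \<Longrightarrow> 0 \<le> t v" "sum t V \<le> 1"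
  shows "\<bar>lfac V l i t\<bar> \<le> real l"
proof -
  obtain v j where i: "i = (v, j)" "v \<in> V" "j < \<gamma> v" using assms(3) by (auto simp: lidx_def)
  have jl: "real j \<le> real l" using lindices_le[OF assms(1,2), of v] i by simp
  have s: "0 \<le> sum t V" "t v \<le> sum t V" using assms i by (auto intro: sum_nonneg member_le_sum)
  have "\<bar>real l * t v - real j * sum t V\<bar> \<le> real l"
  proof (rule abs_leI)
    have "real l * t v \<le> real l * 1" using s assms(5) by (intro mult_left_mono) auto
    moreover have "0 \<le> real j * sum t V" using s by simp
    ultimately show "real l * t v - real j * sum t V \<le> real l" by simp
    have "real j * sum t V \<le> real l * 1" using s assms(5) jl by (intro mult_mono) auto
    moreover have "0 \<le> real l * t v" using assms(4) i by simp
    ultimately show "- (real l * t v - real j * sum t V) \<le> real l" by simp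
  qed
  then have "\<bar>real l * t v - real j * sum t V\<bar> / (real j + 1) \<le> real l / 1" by (intro frac_le) auto
  then show ?thesis by (simp add: lfac_def i)
qed

lemma lag_abs_le:
  assumes "finite V" "\<gamma> \<in> lindices V l" "\<And>v. v \<in> V \<Longrightarrow> 0 \<le> t v" "sum t V \<le> 1" "l > 0"
  shows "\<bar>lag V l \<gamma> t\<bar> \<le> real l ^ l"
  using prod_abs_le[of "lidx V \<gamma>" "\<lambda>i. lfac V l i t" "real l"] lfac_abs_le[OF assms(1,2) _ assms(3,4)] assms(5)
  by (simp add: lag_def card_lidx[OF assms(1,2)])

text \<open>There are l factors, each bounded by l and moving by at most 2 l
  \<open>\<delta>\<close>; this gives l times l^l times 2 l \<open>\<delta>\<close>. Sums at most 1
  are allowed because C may be a proper face of the simplex that carries the coordinates.\<close>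

lemma lag_diff_le:
  assumes "finite V" "\<gamma> \<in> lindices V l" "l > 0"
    and t: "\<And>v. v \<in> V \<Longrightarrow> 0 \<le> t v" "sum t V \<le> 1" and t': "\<And>v. v \<in> V \<Longrightarrow> 0 \<le> t' v" "sum t' V \<le> 1"
    and d: "\<And>v. v \<in> V \<Longrightarrow> \<bar>t v - t' v\<bar> \<le> \<delta>" "\<bar>sum t V - sum t' V\<bar> \<le> \<delta>"
  shows "\<bar>lag V l \<gamma> t - lag V l \<gamma> t'\<bar> \<le> 2 * real l ^ (l + 2) * \<delta>"
proof -
  have "\<bar>lfac V l i t - lfac V l i t'\<bar> \<le> 2 * real l * \<delta>" if "i \<in> lidx V \<gamma>" for i
  proof -
    obtain v j where i: "i = (v, j)" "v \<in> V" "j < \<gamma> v" using \<open>i \<in> lidx V \<gamma>\<close> by (auto simp: lidx_def)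
    have jl: "real j \<le> real l" using lindices_le[OF assms(1,2), of v] i by simp
    have d0: "\<delta> \<ge> 0" using d(2) by linarith
    have "lfac V l i t - lfac V l i t' = (real l * (t v - t' v) - real j * (sum t V - sum t' V)) / (real j + 1)"
      unfolding lfac_def i fst_conv snd_conv diff_divide_distrib[symmetric] by (simp add: algebra_simps)
    then have "\<bar>lfac V l i t - lfac V l i t'\<bar> = \<bar>real l * (t v - t' v) - real j * (sum t V - sum t' V)\<bar> / (real j + 1)"
      by simp
    also have "\<dots> \<le> (real l * \<delta> + real l * \<delta>) / 1"
    proof (rule frac_le)
      have "\<bar>real l * (t v - t' v)\<bar> \<le> real l * \<delta>" using d(1)[OF i(2)] by (simp add: abs_mult mult_left_mono)
      moreover have "\<bar>real j * (sum t V - sum t' V)\<bar> \<le> real l * \<delta>"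
        unfolding abs_mult using d(2) jl by (intro mult_mono) auto
      ultimately show "\<bar>real l * (t v - t' v) - real j * (sum t V - sum t' V)\<bar> \<le> real l * \<delta> + real l * \<delta>" by linarith
    qed (use d0 in auto)
    finally show ?thesis by (simp add: mult_ac)
  qed
  then have "\<bar>lag V l \<gamma> t - lag V l \<gamma> t'\<bar> \<le> real (card (lidx V \<gamma>)) * real l ^ card (lidx V \<gamma>) * (2 * real l * \<delta>)"
    unfolding lag_def using lfac_abs_le[OF assms(1,2)] t t' assms(1,3)
    by (intro abs_prod_diff_le) (auto simp: finite_lidx)
  then show ?thesis by (simp add: card_lidx[OF assms(1,2)] mult_ac power2_eq_square)
qed

lemma lnode_sum:
  assumes "\<gamma> \<in> lindices V l" "l > 0" shows "(\<Sum>v\<in>V. real (\<gamma> v) / real l) = 1"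
  using assms by (simp add: lindices_def sum_divide_distrib[symmetric] flip: of_nat_sum)

definition lfac_grad :: "'a::euclidean_space set \<Rightarrow> 'a set \<Rightarrow> nat \<Rightarrow> 'a \<times> nat \<Rightarrow> 'a" where
  "lfac_grad V C l i = (1 / (real (snd i) + 1)) *\<^sub>R (real l *\<^sub>R bgrad V (fst i) - real (snd i) *\<^sub>R (\<Sum>v\<in>C. bgrad V v))"

text \<open>Chosen so that the number of nodes, at most (l+1)^(d+1), times the possible change 2
  l^(l+2) \<open>node_eps\<close> of a Lagrange function is at most 1/2.\<close>

definition node_eps :: "nat \<Rightarrow> nat \<Rightarrow> real" where
  "node_eps d l = 1 / (4 * real (Suc l) ^ Suc d * real (Suc l) ^ (l + 2))"

definition lfac_const :: "'a::euclidean_space set \<Rightarrow> 'a set \<Rightarrow> nat \<Rightarrow> 'a \<times> nat \<Rightarrow> real" where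
  "lfac_const V C l i = lfac C l i (bary V 0)"

lemma node_eps: "0 < node_eps d l" "node_eps d l \<le> 1"
proof -
  have "1 \<le> 4 * real (Suc l) ^ Suc d * real (Suc l) ^ (l + 2)"
  proof -
    have "1 \<le> real (Suc l) ^ Suc d" "1 \<le> real (Suc l) ^ (l + 2)"
      by (rule one_le_power; simp)+
    then have "1 \<le> 4 * real (Suc l) ^ Suc d" "1 \<le> real (Suc l) ^ (l + 2)" by linarith+
    from mult_mono[OF this] show ?thesis by (simp del: power_Suc of_nat_Suc)
  qed
  then show "0 < node_eps d l" "node_eps d l \<le> 1" unfolding node_eps_def by (auto simp del: power_Suc)
qed

text \<open>The constant of \<open>weighted_lower_bound\<close>: (\<open>node_eps\<close> / 2)^d is
  the volume ratio of the homothetic copy, \<open>node_eps\<close> / (2 (d + 1)) bounds every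
  barycentric coordinate on it from below, and 1/2 is the share of the largest coefficient that
  survives.\<close>

definition cw :: "nat \<Rightarrow> nat \<Rightarrow> real" where
  "cw d l = (node_eps d l / 2) ^ d * ((node_eps d l / (2 * (real d + 1))) ^ Suc d / 2)\<^sup>2"

lemma cw_pos: "cw d l > 0"
  using node_eps(1)[of d l] by (simp add: cw_def)

lemma abs_midpoint_diff_le:
  "0 \<le> b \<Longrightarrow> b \<le> 1 \<Longrightarrow> 0 \<le> a \<Longrightarrow> a \<le> 1 \<Longrightarrow> 0 \<le> c \<Longrightarrow> c \<le> 1 \<Longrightarrow> \<bar>(a + b) / 2 - c\<bar> \<le> (1::real)"
  by (simp add: abs_le_iff field_simps)

context
  fixes V :: "'a::euclidean_space set"
  assumes V: "full_simplex V"
begin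

lemma bary_lnode:
  assumes "C \<subseteq> V" "\<gamma> \<in> lindices C l" "l > 0"
  shows "bary V (lnode C l \<gamma>) v = real (\<gamma> v) / real l"
  using bary_subset[OF V assms(1) lnode_sum[OF assms(2,3)] lnode_def[symmetric], of v] assms(2)
  by (cases "v \<in> C") (auto simp: lindices_def)

lemma lfac_bary_affine: "lfac C l i (bary V x) = x \<bullet> lfac_grad V C l i + lfac_const V C l i"
proof -
  have "x \<bullet> lfac_grad V C l i = (real l * (bgrad V (fst i) \<bullet> x) - real (snd i) * (\<Sum>v\<in>C. bgrad V v \<bullet> x)) / (real (snd i) + 1)"
    by (simp add: lfac_grad_def inner_diff_left inner_sum_left inner_commute[of x])
  moreover have "bary V x v = bary V 0 v + bgrad V v \<bullet> x" for v
    using bary_affine[OF V, of x v 0] by simp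
  ultimately show ?thesis
    by (simp add: lfac_const_def lfac_def sum.distrib ring_distribs add_divide_distrib diff_divide_distrib)
qed

lemma lfac_bary_has_derivative:
  "((\<lambda>x. lfac C l i (bary V x)) has_derivative (\<lambda>h. lfac_grad V C l i \<bullet> h)) (at x)"
  unfolding lfac_bary_affine by (auto intro!: derivative_eq_intros simp: inner_commute)

text \<open>The denominator j + 1 of the factor absorbs the growth of its numerator in j, so the
  bound does not depend on the factor.\<close>

lemma lfac_bary_grad_le:
  assumes "C \<subseteq> V" "\<And>v. norm (bgrad V v) \<le> B"
  shows "norm (lfac_grad V C l i)
     \<le> (real l + real DIM('a) + 1) * B"
proof -
  have B0: "B \<ge> 0" using assms(2) norm_ge_zero order_trans by blast
  have fC: "finite C" "card C \<le> Suc DIM('a)"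
    using assms(1) V full_simplex_finite[OF V] card_mono[of V C] finite_subset by (auto simp: full_simplex_def)
  define j where "j = real (snd i)"
  have j: "0 \<le> j" by (simp add: j_def)
  have "norm (\<Sum>v\<in>C. bgrad V v) \<le> (\<Sum>v\<in>C. B)" by (intro sum_norm_le assms(2))
  also have "\<dots> \<le> (real DIM('a) + 1) * B" using fC B0 by (simp add: mult_right_mono)
  finally have s: "norm (\<Sum>v\<in>C. bgrad V v) \<le> (real DIM('a) + 1) * B" .
  have "norm (real l *\<^sub>R bgrad V (fst i) - j *\<^sub>R (\<Sum>v\<in>C. bgrad V v)) \<le> real l * B + j * ((real DIM('a) + 1) * B)"
    using norm_triangle_ineq4[of "real l *\<^sub>R bgrad V (fst i)" "j *\<^sub>R (\<Sum>v\<in>C. bgrad V v)"]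
      mult_left_mono[OF assms(2)[of "fst i"], of "real l"] mult_left_mono[OF s j] j by simp
  also have "\<dots> \<le> (real l + real DIM('a) + 1) * B * (j + 1)"
    using j B0 by (simp add: algebra_simps)
  finally have "norm (real l *\<^sub>R bgrad V (fst i) - j *\<^sub>R (\<Sum>v\<in>C. bgrad V v)) / (j + 1) \<le> (real l + real DIM('a) + 1) * B"
    using j by (simp add: pos_divide_le_eq)
  then show ?thesis using j by (simp add: j_def lfac_grad_def)
qed

lemma Ck_lag_bary: "Ck k (\<lambda>x. lag C l \<gamma> (bary V x))"
  unfolding lag_def lfac_bary_affine by (intro Ck_prod Ck_affine)

lemma polyd_lag_bary:
  assumes "C \<subseteq> V" "\<gamma> \<in> lindices C l" shows "polyd l (\<lambda>x. lag C l \<gamma> (bary V x))"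
proof -
  have fC: "finite C" using assms full_simplex_finite[OF V] finite_subset by blast
  show ?thesis unfolding lag_def lfac_bary_affine
    using polyd_prod_affine[OF finite_lidx[OF fC, of \<gamma>], of "lfac_grad V C l" "lfac_const V C l"]
    by (simp add: card_lidx[OF fC assms(2)])
qed

lemma bary_sum_face_le: "C \<subseteq> V \<Longrightarrow> x \<in> convex hull V \<Longrightarrow> sum (bary V x) C \<le> 1"
  using sum_mono2[OF full_simplex_finite[OF V], of C "bary V x"] bary_props(2)[OF V] mem_simplex_iff[OF V]
  by auto

lemma grad_lag_bary_le:
  assumes C: "C \<subseteq> V" "\<gamma> \<in> lindices C l" "l > 0" and x: "x \<in> convex hull V" and B: "\<And>v. norm (bgrad V v) \<le> B"
  shows "norm (grad (\<lambda>x. lag C l \<gamma> (bary V x)) x) \<le> real l ^ (l + 1) * (real l + real DIM('a) + 1) * B"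
proof -
  have fC: "finite C" using assms full_simplex_finite[OF V] finite_subset by blast
  have B0: "B \<ge> 0" using B norm_ge_zero order_trans by blast
  have "norm (grad (\<lambda>x. \<Prod>i\<in>lidx C \<gamma>. lfac C l i (bary V x)) x)
     \<le> real (card (lidx C \<gamma>)) * ((real l + real DIM('a) + 1) * B) * real l ^ card (lidx C \<gamma>)"
    using C x B0 mem_simplex_iff[OF V] lfac_bary_grad_le[OF C(1) B] bary_sum_face_le[OF C(1) x]
    by (intro grad_prod_bound[where G = "lfac_grad V C l"] lfac_bary_has_derivative finite_lidx[OF fC] lfac_abs_le[OF fC C(2)]) auto
  then show ?thesis by (simp add: lag_def card_lidx[OF fC C(2)] mult_ac)
qed

text \<open>The weighted \<open>L\<^sup>2\<close> norm is bounded below on a small homothetic copy of the simplex next to the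
  node where the largest coefficient sits.\<close>

lemma weighted_lower_bound:
  assumes C: "C \<subseteq> V" and l: "l > 0" and g0: "\<gamma>0 \<in> lindices C l"
    and J: "\<And>\<gamma>. \<gamma> \<in> lindices C l \<Longrightarrow> \<bar>J \<gamma>\<bar> \<le> \<bar>J \<gamma>0\<bar>"
  shows "cw DIM('a) l * measure lebesgue (convex hull V) * (J \<gamma>0)\<^sup>2 \<le>
    (LINT x:interior (convex hull V)|lebesgue. ((\<Prod>v\<in>C. bary V x v) * (\<Sum>\<gamma>\<in>lindices C l. J \<gamma> * lag C l \<gamma> (bary V x)))\<^sup>2)"
proof -
  define d where "d = DIM('a)"
  define e where "e = node_eps d l"
  have e: "0 < e" "e \<le> 1" using node_eps by (auto simp: e_def)
  let ?K = "convex hull V"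
  have fV: "finite V" "card V = Suc d" using V full_simplex_finite[OF V] by (auto simp: full_simplex_def d_def)
  have fC: "finite C" "card C \<le> Suc d" using finite_subset[OF C fV(1)] card_mono[OF fV(1) C] fV(2) by auto
  define m where "m = (\<Sum>v\<in>V. (1 / real (Suc d)) *\<^sub>R v)"
  have bm: "bary V m v = 1 / real (Suc d)" if "v \<in> V" for v
    using bary_unique[OF V, of "\<lambda>v. 1 / real (Suc d)" m v] that fV by (simp add: m_def)
  define z where "z = lnode C l \<gamma>0"
  \<comment> \<open>This is T y = (1 - e) z + e (m + y) / 2. The node z keeps the copy within e in
    coordinates, the centroid m keeps it away from the boundary, and y runs through a copy of ratio
    e / 2.\<close>
  define T where "T y = (e / 2) *\<^sub>R y + ((1 - e) *\<^sub>R z + (e / 2) *\<^sub>R m)" for y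
  have bT: "bary V (T y) v = (1 - e) * bary V z v + e * ((bary V m v + bary V y v) / 2)" for y v
  proof -
    have "T y = z + e *\<^sub>R ((m + (1 / 2) *\<^sub>R (y - m)) - z)"
      by (simp add: T_def scaleR_diff_right scaleR_add_right scaleR_diff_left) (simp add: algebra_simps flip: scaleR_add_left)
    then show ?thesis by (simp only: bary_convex_combination[OF V]) (simp add: field_simps)
  qed
  have bz: "bary V z v = real (\<gamma>0 v) / real l" for v
    unfolding z_def by (rule bary_lnode[OF C g0 l])
  have lo: "e / (2 * (real d + 1)) \<le> bary V (T y) v" if "y \<in> ?K" "v \<in> V" for y v
  proof -
    have "0 \<le> (1 - e) * bary V z v" using e by (simp add: bz)
    moreover have "0 \<le> bary V y v" using that mem_simplex_iff[OF V] by auto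
    moreover have "e * ((1 / (real d + 1) + 0) / 2) \<le> e * ((bary V m v + bary V y v) / 2)"
      using e calculation(2) bm[OF that(2)] by (intro mult_left_mono divide_right_mono add_mono) (auto simp: add.commute)
    moreover have "e * ((1 / (real d + 1) + 0) / 2) = e / (2 * (real d + 1))" by simp
    ultimately show ?thesis unfolding bT by linarith
  qed
  define f where "f x = (\<Sum>\<gamma>\<in>lindices C l. J \<gamma> * lag C l \<gamma> (bary V x))" for x
  define P where "P x = (\<Prod>v\<in>C. bary V x v)" for x
  have TK: "T y \<in> interior ?K" if "y \<in> ?K" for y
    unfolding mem_interior_simplex_iff[OF V] using lo[OF that] e
    by (smt (verit) divide_pos_pos of_nat_0_le_iff)
  have Plo: "(e / (2 * (real d + 1))) ^ Suc d \<le> P (T y)" if y: "y \<in> ?K" for y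
  proof -
    have "(e / (2 * (real d + 1))) ^ Suc d \<le> (e / (2 * (real d + 1))) ^ card C"
      using fC e by (intro power_decreasing) (auto simp: divide_le_eq)
    also have "\<dots> = (\<Prod>v\<in>C. e / (2 * (real d + 1)))" by simp
    also have "\<dots> \<le> P (T y)" unfolding P_def using lo[OF y] C e by (intro prod_mono) auto
    finally show ?thesis .
  qed
  have flo: "\<bar>J \<gamma>0\<bar> / 2 \<le> \<bar>f (T y)\<bar>" if y: "y \<in> ?K" for y
  proof -
    have TyK: "T y \<in> ?K" using TK[OF y] interior_subset by blast
    have d1: "\<bar>bary V (T y) v - bary V z v\<bar> \<le> e" if v: "v \<in> V" for v
    proof -
      have "bary V (T y) v - bary V z v = e * ((bary V m v + bary V y v) / 2 - bary V z v)"
        unfolding bT by (simp add: algebra_simps)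
      moreover have "\<bar>(bary V m v + bary V y v) / 2 - bary V z v\<bar> \<le> 1"
      proof -
        have "0 \<le> bary V y v" "bary V y v \<le> 1" using y v mem_simplex_iff[OF V] bary_le_1[OF V y] by auto
        moreover have "0 \<le> bary V m v" "bary V m v \<le> 1" using bm[OF v] by (auto simp: divide_le_eq)
        moreover have "0 \<le> bary V z v" "bary V z v \<le> 1"
          using bz[of v] lindices_le[OF fC(1) g0, of v] l by (auto simp: divide_le_eq)
        ultimately show ?thesis by (rule abs_midpoint_diff_le)
      qed
      ultimately show ?thesis using e by (simp add: abs_mult mult_left_le)
    qed
    have sz: "sum (bary V z) C = 1" unfolding bz by (rule lnode_sum[OF g0 l])
    have d2: "\<bar>sum (bary V (T y)) C - sum (bary V z) C\<bar> \<le> e"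
    proof -
      have "sum (bary V (T y)) C = (1 - e) * sum (bary V z) C + e * ((sum (bary V m) C + sum (bary V y) C) / 2)"
        using bT C by (simp add: sum_distrib_left sum.distrib[symmetric] sum_divide_distrib subset_iff cong: sum.cong)
      moreover have "0 \<le> sum (bary V m) C" "0 \<le> sum (bary V y) C"
        using C y bm mem_simplex_iff[OF V] by (auto intro!: sum_nonneg simp: subset_iff)
      moreover have "sum (bary V (T y)) C \<le> 1" using bary_sum_face_le[OF C TyK] .
      ultimately show ?thesis using sz e by (simp add: abs_le_iff)
    qed
    have lagd: "\<bar>lag C l \<gamma> (bary V (T y)) - (if \<gamma> = \<gamma>0 then 1 else 0)\<bar> \<le> 2 * real l ^ (l + 2) * e" if g: "\<gamma> \<in> lindices C l" for \<gamma>
    proof -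
      have "lag C l \<gamma> (bary V z) = (if \<gamma> = \<gamma>0 then 1 else 0)"
        using lag_node[OF fC(1) l g g0] by (simp add: bz[abs_def])
      moreover have "\<bar>lag C l \<gamma> (bary V (T y)) - lag C l \<gamma> (bary V z)\<bar> \<le> 2 * real l ^ (l + 2) * e"
        using C d1 d2 TyK mem_simplex_iff[OF V] bary_sum_face_le[OF C TyK] sz bz
        by (intro lag_diff_le[OF fC(1) g l]) (auto simp: subset_iff)
      ultimately show ?thesis by simp
    qed
    \<comment> \<open>At the node the sum equals the largest coefficient. Every coefficient is
      bounded by it, so the deviations on the copy add up to at most half of it.\<close>
    have "\<bar>f (T y) - J \<gamma>0\<bar> = \<bar>\<Sum>\<gamma>\<in>lindices C l. J \<gamma> * (lag C l \<gamma> (bary V (T y)) - (if \<gamma> = \<gamma>0 then 1 else 0))\<bar>"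
      using g0 finite_lindices(1)[OF fC(1)]
      by (simp add: f_def right_diff_distrib sum_subtractf if_distrib[of "\<lambda>c. _ * c"] cong: if_cong)
    also have "\<dots> \<le> (\<Sum>\<gamma>\<in>lindices C l. \<bar>J \<gamma>0\<bar> * (2 * real l ^ (l + 2) * e))"
    proof (rule order_trans[OF sum_abs sum_mono])
      fix \<gamma> assume g: "\<gamma> \<in> lindices C l"
      show "\<bar>J \<gamma> * (lag C l \<gamma> (bary V (T y)) - (if \<gamma> = \<gamma>0 then 1 else 0))\<bar> \<le> \<bar>J \<gamma>0\<bar> * (2 * real l ^ (l + 2) * e)"
        unfolding abs_mult[of "J \<gamma>"] by (rule mult_mono[OF J[OF g] lagd[OF g]]) auto
    qed
    also have "\<dots> = real (card (lindices C l)) * (2 * real l ^ (l + 2) * e) * \<bar>J \<gamma>0\<bar>" by simp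
    also have "\<dots> \<le> 1 / 2 * \<bar>J \<gamma>0\<bar>"
    proof (rule mult_right_mono)
      have "real (card (lindices C l)) \<le> real (Suc l ^ card C)" using finite_lindices(2)[OF fC(1)] by (simp only: of_nat_le_iff)
      also have "\<dots> \<le> real (Suc l) ^ Suc d" using fC(2) power_increasing[of "card C" "Suc d" "real (Suc l)"] by simp
      finally have "real (card (lindices C l)) * (2 * real l ^ (l + 2) * e) \<le> real (Suc l) ^ Suc d * (2 * real (Suc l) ^ (l + 2) * e)"
        using e by (intro mult_mono mult_nonneg_nonneg power_mono) auto
      also have "\<dots> = 1 / 2" by (simp add: e_def node_eps_def del: power_Suc of_nat_Suc)
      finally show "real (card (lindices C l)) * (2 * real l ^ (l + 2) * e) \<le> 1 / 2" .
    qed simp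
    finally show ?thesis by linarith
  qed
  define c where "c = ((e / (2 * (real d + 1))) ^ Suc d / 2)\<^sup>2 * (J \<gamma>0)\<^sup>2"
  have clo: "c \<le> (P (T y) * f (T y))\<^sup>2" if y: "y \<in> ?K" for y
  proof -
    have "(e / (2 * (real d + 1))) ^ Suc d * (\<bar>J \<gamma>0\<bar> / 2) \<le> P (T y) * \<bar>f (T y)\<bar>"
      using Plo[OF y] flo[OF y] e by (intro mult_mono) (auto intro: order_trans[rotated] simp del: power_Suc)
    then have "((e / (2 * (real d + 1))) ^ Suc d * (\<bar>J \<gamma>0\<bar> / 2))\<^sup>2 \<le> (P (T y) * \<bar>f (T y)\<bar>)\<^sup>2"
      using e by (intro power_mono) (auto simp del: power_Suc)
    then show ?thesis by (simp add: c_def power_mult_distrib power_divide del: power_Suc)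
  qed
  have cont: "continuous_on UNIV (\<lambda>x. (P x * f x)\<^sup>2)"
    unfolding P_def f_def
    by (intro continuous_intros continuous_bary[OF V] Ck_imp_continuous_on[OF Ck_lag_bary[of 0]])
  have bK: "bounded ?K" using fV compact_imp_bounded finite_imp_compact_convex_hull by blast
  have Fi: "set_integrable lebesgue (interior ?K) (\<lambda>x. (P x * f x)\<^sup>2)"
    by (rule set_integrable_continuous_interior[OF bK cont])
  have TM: "T ` ?K \<in> lmeasurable" "measure lebesgue (T ` ?K) = (e / 2) ^ d * measure lebesgue ?K"
  proof -
    have "T ` ?K = (\<lambda>x. (e / 2) *\<^sub>R x + ((1 - e) *\<^sub>R z + (e / 2) *\<^sub>R m)) ` ?K" by (simp add: T_def)
    then show "measure lebesgue (T ` ?K) = (e / 2) ^ d * measure lebesgue ?K"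
      using measure_lebesgue_affine[of "e / 2" _ ?K] e by (simp add: d_def)
    have "convex (T ` ?K)"
      unfolding T_def[abs_def] using convex_affinity[OF convex_convex_hull, of "(1 - e) *\<^sub>R z + (e / 2) *\<^sub>R m" "e/2" V]
      by (simp add: add.commute)
    moreover have "bounded (T ` ?K)"
      using bounded_subset[OF bK, of "T ` ?K"] TK interior_subset by blast
    ultimately show "T ` ?K \<in> lmeasurable" using measurable_convex by blast
  qed
  have "cw DIM('a) l * measure lebesgue ?K * (J \<gamma>0)\<^sup>2 = c * measure lebesgue (T ` ?K)"
    by (simp add: TM cw_def c_def e_def d_def del: power_Suc)
  also have "\<dots> = (LINT x|lebesgue. c * indicator (T ` ?K) x)" using TM(1) by (simp add: fmeasurable_def)
  also have "\<dots> \<le> (LINT x|lebesgue. indicator (interior ?K) x *\<^sub>R (P x * f x)\<^sup>2)"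
  proof (rule integral_mono)
    show "integrable lebesgue (\<lambda>x. c * indicator (T ` ?K) x)"
      using TM(1) by (intro integrable_mult_right integrable_real_indicator) (auto simp: fmeasurable_def)
    show "integrable lebesgue (\<lambda>x. indicator (interior ?K) x *\<^sub>R (P x * f x)\<^sup>2)"
      using Fi by (simp add: set_integrable_def)
    show "c * indicator (T ` ?K) x \<le> indicator (interior ?K) x *\<^sub>R (P x * f x)\<^sup>2" for x
      using clo TK by (auto simp: indicator_def)
  qed
  finally show ?thesis unfolding P_def f_def set_lebesgue_integral_def .
qed

lemma lagrange_simplex:
  assumes "polyd l p" "l > 0"
  shows "p x = (\<Sum>\<gamma>\<in>lindices V l. p (lnode V l \<gamma>) * lag V l \<gamma> (bary V x))"
  using lagrange_interpolation[OF full_simplex_finite[OF V] assms(2,1) bary_props(2)[OF V], of x]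
  by (simp only: bary_props(3)[OF V])

lemma node_value_le:
  assumes p: "polyd l p" and l: "l > 0" and g: "\<gamma> \<in> lindices V l"
  shows "cw DIM('a) l * measure lebesgue (convex hull V) * (p (lnode V l \<gamma>))\<^sup>2 \<le> (LINT x:interior (convex hull V)|lebesgue. (p x)\<^sup>2)"
proof -
  have fV: "finite V" using full_simplex_finite[OF V] .
  define J where "J \<gamma> = p (lnode V l \<gamma>)" for \<gamma>
  have bK: "bounded (convex hull V)" using fV compact_imp_bounded finite_imp_compact_convex_hull by blast
  let ?M = "Max ((\<lambda>\<gamma>. \<bar>J \<gamma>\<bar>) ` lindices V l)"
  have "?M \<in> (\<lambda>\<gamma>. \<bar>J \<gamma>\<bar>) ` lindices V l" using g finite_lindices(1)[OF fV] by (intro Max_in) auto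
  then obtain \<gamma>0 where g0: "\<gamma>0 \<in> lindices V l" "?M = \<bar>J \<gamma>0\<bar>" by auto
  have max: "\<bar>J \<gamma>\<bar> \<le> \<bar>J \<gamma>0\<bar>" if "\<gamma> \<in> lindices V l" for \<gamma>
    unfolding g0(2)[symmetric] using that finite_lindices(1)[OF fV] by (intro Max_ge) auto
  have "(J \<gamma>)\<^sup>2 \<le> (J \<gamma>0)\<^sup>2" using max[OF g] by (simp add: abs_le_square_iff)
  then have "cw DIM('a) l * measure lebesgue (convex hull V) * (p (lnode V l \<gamma>))\<^sup>2 \<le> cw DIM('a) l * measure lebesgue (convex hull V) * (J \<gamma>0)\<^sup>2"
    using cw_pos[of "DIM('a)" l] by (intro mult_left_mono) (auto simp: J_def)
  also have "\<dots> \<le> (LINT x:interior (convex hull V)|lebesgue. ((\<Prod>v\<in>V. bary V x v) * (\<Sum>\<gamma>\<in>lindices V l. J \<gamma> * lag V l \<gamma> (bary V x)))\<^sup>2)"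
    by (rule weighted_lower_bound[OF subset_refl l g0(1), of J, OF max])
  also have "\<dots> = (LINT x:interior (convex hull V)|lebesgue. ((\<Prod>v\<in>V. bary V x v) * p x)\<^sup>2)"
    by (simp add: J_def lagrange_simplex[OF p l, symmetric])
  also have "\<dots> \<le> (LINT x:interior (convex hull V)|lebesgue. (p x)\<^sup>2)"
  proof (rule set_integral_mono)
    show "set_integrable lebesgue (interior (convex hull V)) (\<lambda>x. ((\<Prod>v\<in>V. bary V x v) * p x)\<^sup>2)"
      "set_integrable lebesgue (interior (convex hull V)) (\<lambda>x. (p x)\<^sup>2)"
      by (intro set_integrable_continuous_interior[OF bK] continuous_intros continuous_bary[OF V]
          Ck_imp_continuous_on[OF Ck_polyd[OF p, of 0]])+
    fix x assume "x \<in> interior (convex hull V)"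
    then have x: "x \<in> convex hull V" using interior_subset by blast
    have "0 \<le> (\<Prod>v\<in>V. bary V x v)" "(\<Prod>v\<in>V. bary V x v) \<le> 1"
      using x mem_simplex_iff[OF V] bary_le_1[OF V x] by (auto intro!: prod_nonneg prod_le_1)
    then have "((\<Prod>v\<in>V. bary V x v))\<^sup>2 \<le> 1" by (simp add: power_le_one)
    then show "((\<Prod>v\<in>V. bary V x v) * p x)\<^sup>2 \<le> (p x)\<^sup>2"
      by (simp add: power_mult_distrib mult_left_le_one_le)
  qed
  finally show ?thesis .
qed

lemma set_integral_le_const:
  fixes f :: "'a \<Rightarrow> real"
  assumes f: "continuous_on UNIV f" and c: "\<And>x. x \<in> interior (convex hull V) \<Longrightarrow> f x \<le> c"
  shows "(LINT x:interior (convex hull V)|lebesgue. f x) \<le> c * measure lebesgue (convex hull V)"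
proof -
  let ?K = "convex hull V"
  have bK: "bounded ?K" using full_simplex_finite[OF V] compact_imp_bounded finite_imp_compact_convex_hull by blast
  have "(LINT x:interior ?K|lebesgue. f x) \<le> (LINT x:interior ?K|lebesgue. c)"
    by (rule set_integral_mono[OF set_integrable_continuous_interior[OF bK f] set_integrable_const_bounded c])
      (use bK bounded_interior in auto)
  also have "\<dots> = c * measure lebesgue (interior ?K)"
    by (simp add: set_lebesgue_integral_def mult.commute)
  also have "measure lebesgue (interior ?K) = measure lebesgue ?K"
    by (rule measure_interior[OF bK negligible_convex_frontier[OF convex_convex_hull]])
  finally show ?thesis .
qed

text \<open>The converse of \<open>node_value_le\<close>, by Cauchy-Schwarz in the Lagrange
  expansion; n bounds the number of nodes. The second estimate is the inverse inequality, with B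
  carrying the factor 1 / h.\<close>

lemma node_bounds:
  assumes p: "polyd l p" and l: "l > 0" and B: "\<And>v. norm (bgrad V v) \<le> B"
  defines "n \<equiv> real (Suc l) ^ Suc DIM('a)"
  shows "(LINT x:interior (convex hull V)|lebesgue. (p x)\<^sup>2)
      \<le> n * (real l ^ l)\<^sup>2 * measure lebesgue (convex hull V) * (\<Sum>\<gamma>\<in>lindices V l. (p (lnode V l \<gamma>))\<^sup>2)"
    and "(LINT x:interior (convex hull V)|lebesgue. (norm (grad p x))\<^sup>2)
      \<le> n * (real l ^ (l + 1) * (real l + real DIM('a) + 1) * B)\<^sup>2 * measure lebesgue (convex hull V)
         * (\<Sum>\<gamma>\<in>lindices V l. (p (lnode V l \<gamma>))\<^sup>2)"
proof -
  have fV: "finite V" "card V = Suc DIM('a)" using V full_simplex_finite[OF V] by (auto simp: full_simplex_def)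
  note fl = finite_lindices[OF fV(1), of l]
  define J where "J \<gamma> = p (lnode V l \<gamma>)" for \<gamma>
  define S where "S = (\<Sum>\<gamma>\<in>lindices V l. (J \<gamma>)\<^sup>2)"
  have n: "real (card (lindices V l)) \<le> n"
    unfolding n_def of_nat_power[symmetric] of_nat_le_iff using fl(2) fV(2) by simp
  have n0: "n \<ge> 0" by (simp add: n_def)
  have gen: "(\<Sum>\<gamma>\<in>lindices V l. \<bar>J \<gamma>\<bar> * M)\<^sup>2 \<le> n * M\<^sup>2 * S" if "M \<ge> 0" for M
  proof -
    have "(\<Sum>\<gamma>\<in>lindices V l. \<bar>J \<gamma>\<bar> * M)\<^sup>2 \<le> real (card (lindices V l)) * (\<Sum>\<gamma>\<in>lindices V l. (\<bar>J \<gamma>\<bar> * M)\<^sup>2)"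
      by (rule power2_sum_le[OF fl(1)])
    also have "(\<Sum>\<gamma>\<in>lindices V l. (\<bar>J \<gamma>\<bar> * M)\<^sup>2) = M\<^sup>2 * S"
      by (simp add: S_def power_mult_distrib sum_distrib_left mult.commute)
    also have "real (card (lindices V l)) * (M\<^sup>2 * S) \<le> n * (M\<^sup>2 * S)"
      using n by (intro mult_right_mono) (auto simp: S_def intro!: mult_nonneg_nonneg sum_nonneg)
    finally show ?thesis by (simp add: mult.assoc)
  qed
  have pe: "p = (\<lambda>x. \<Sum>\<gamma>\<in>lindices V l. J \<gamma> * lag V l \<gamma> (bary V x))"
    unfolding J_def by (rule ext) (rule lagrange_simplex[OF p l])
  have "(LINT x:interior (convex hull V)|lebesgue. (p x)\<^sup>2) \<le> (n * (real l ^ l)\<^sup>2 * S) * measure lebesgue (convex hull V)"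
  proof (rule set_integral_le_const)
    show "continuous_on UNIV (\<lambda>x. (p x)\<^sup>2)"
      by (intro continuous_intros Ck_imp_continuous_on[OF Ck_polyd[OF p, of 0]])
    fix x assume "x \<in> interior (convex hull V)"
    then have x: "x \<in> convex hull V" using interior_subset by blast
    have "\<bar>p x\<bar> \<le> (\<Sum>\<gamma>\<in>lindices V l. \<bar>J \<gamma>\<bar> * real l ^ l)"
      unfolding pe
      using x mem_simplex_iff[OF V] bary_sum_face_le[OF subset_refl x]
      by (intro order_trans[OF sum_abs sum_mono])
        (auto simp: abs_mult intro!: mult_left_mono lag_abs_le[OF fV(1) _ _ _ l])
    then have "(p x)\<^sup>2 \<le> (\<Sum>\<gamma>\<in>lindices V l. \<bar>J \<gamma>\<bar> * real l ^ l)\<^sup>2"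
      using power_mono[of "\<bar>p x\<bar>" _ 2] by simp
    also have "\<dots> \<le> n * (real l ^ l)\<^sup>2 * S" by (rule gen) simp
    finally show "(p x)\<^sup>2 \<le> n * (real l ^ l)\<^sup>2 * S" .
  qed
  then show "(LINT x:interior (convex hull V)|lebesgue. (p x)\<^sup>2)
      \<le> n * (real l ^ l)\<^sup>2 * measure lebesgue (convex hull V) * (\<Sum>\<gamma>\<in>lindices V l. (p (lnode V l \<gamma>))\<^sup>2)"
    by (simp add: S_def J_def mult_ac)
  have B0: "B \<ge> 0" using B norm_ge_zero order_trans by blast
  define M where "M = real l ^ (l + 1) * (real l + real DIM('a) + 1) * B"
  have M0: "M \<ge> 0" using B0 by (simp add: M_def)
  have "(LINT x:interior (convex hull V)|lebesgue. (norm (grad p x))\<^sup>2) \<le> (n * M\<^sup>2 * S) * measure lebesgue (convex hull V)"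
  proof (rule set_integral_le_const)
    show "continuous_on UNIV (\<lambda>x. (norm (grad p x))\<^sup>2)"
      by (intro continuous_intros Ck_continuous_grad[OF Ck_polyd[OF p, of "Suc 0"]])
    fix x assume "x \<in> interior (convex hull V)"
    then have x: "x \<in> convex hull V" using interior_subset by blast
    have "(p has_derivative (\<lambda>h. (\<Sum>\<gamma>\<in>lindices V l. J \<gamma> *\<^sub>R grad (\<lambda>x. lag V l \<gamma> (bary V x)) x) \<bullet> h)) (at x)"
      unfolding pe
      by (rule has_derivative_eq_rhs, (rule derivative_intros Ck_has_derivative_grad[OF Ck_lag_bary[of "Suc 0"]])+)
        (auto simp: inner_sum_left)
    then have "grad p x = (\<Sum>\<gamma>\<in>lindices V l. J \<gamma> *\<^sub>R grad (\<lambda>x. lag V l \<gamma> (bary V x)) x)"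
      by (rule grad_eqI)
    also have "norm \<dots> \<le> (\<Sum>\<gamma>\<in>lindices V l. \<bar>J \<gamma>\<bar> * M)"
    proof (rule sum_norm_le)
      fix \<gamma> assume "\<gamma> \<in> lindices V l"
      from mult_left_mono[OF grad_lag_bary_le[OF subset_refl this l x B] abs_ge_zero[of "J \<gamma>"]]
      show "norm (J \<gamma> *\<^sub>R grad (\<lambda>x. lag V l \<gamma> (bary V x)) x) \<le> \<bar>J \<gamma>\<bar> * M" by (simp only: norm_scaleR M_def)
    qed
    finally have "(norm (grad p x))\<^sup>2 \<le> (\<Sum>\<gamma>\<in>lindices V l. \<bar>J \<gamma>\<bar> * M)\<^sup>2" by (intro power_mono) auto
    also have "\<dots> \<le> n * M\<^sup>2 * S" by (rule gen[OF M0])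
    finally show "(norm (grad p x))\<^sup>2 \<le> n * M\<^sup>2 * S" .
  qed
  then show "(LINT x:interior (convex hull V)|lebesgue. (norm (grad p x))\<^sup>2)
      \<le> n * (real l ^ (l + 1) * (real l + real DIM('a) + 1) * B)\<^sup>2 * measure lebesgue (convex hull V)
         * (\<Sum>\<gamma>\<in>lindices V l. (p (lnode V l \<gamma>))\<^sup>2)"
    by (simp add: S_def J_def M_def mult_ac)
qed

end

section \<open>Moments against barycentric monomials\<close>

lemma set_integrable_mult_continuous:
  fixes u h :: "'a::euclidean_space \<Rightarrow> real"
  assumes "set_integrable lebesgue D u" "bounded D" "continuous_on UNIV h"
  shows "set_integrable lebesgue D (\<lambda>x. u x * h x)"
proof -
  obtain c r where cr: "D \<subseteq> cball c r" using assms(2) bounded_subset_cball by blast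
  have "bounded (h ` cball c r)"
    by (intro compact_imp_bounded compact_continuous_image continuous_on_subset[OF assms(3)]) auto
  then obtain B where "\<forall>y\<in>h ` cball c r. norm y \<le> B" using bounded_iff by blast
  then have "\<bar>h x\<bar> \<le> B" if "x \<in> D" for x using that cr by auto
  then show ?thesis
    by (rule set_integrable_mult_bounded[OF assms(1) continuous_borel_measurable_lebesgue[OF assms(3)]])
qed

lemma set_integral_abs_le:
  fixes f F :: "'a::euclidean_space \<Rightarrow> real"
  assumes "set_integrable lebesgue D f" "set_integrable lebesgue D F" "\<And>x. x \<in> D \<Longrightarrow> \<bar>f x\<bar> \<le> F x"
  shows "\<bar>LINT x:D|lebesgue. f x\<bar> \<le> (LINT x:D|lebesgue. F x)"
proof -
  have "\<bar>LINT x:D|lebesgue. f x\<bar> \<le> (LINT x|lebesgue. \<bar>indicator D x *\<^sub>R f x\<bar>)"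
    unfolding set_lebesgue_integral_def by (rule integral_abs_bound)
  also have "\<dots> \<le> (LINT x:D|lebesgue. F x)"
    unfolding set_lebesgue_integral_def using assms
    by (intro integral_mono integrable_abs) (auto simp: set_integrable_def indicator_def)
  finally show ?thesis .
qed

lemma set_integrable_norm_gradient:
  fixes g :: "'a::euclidean_space \<Rightarrow> 'a"
  assumes "set_integrable lebesgue D g" shows "set_integrable lebesgue D (\<lambda>x. norm (g x))"
proof -
  have "integrable lebesgue (\<lambda>x. norm (indicator D x *\<^sub>R g x))"
    using assms unfolding set_integrable_def by (rule integrable_norm)
  then show ?thesis by (simp add: set_integrable_def)
qed

definition bmono :: "'a set \<Rightarrow> ('a \<Rightarrow> nat) \<Rightarrow> ('a \<Rightarrow> real) \<Rightarrow> real" where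
  "bmono V \<alpha> t = (\<Prod>v\<in>V. t v ^ \<alpha> v)"

lemma bmono_upd:
  assumes "finite V" "v \<in> V" shows "bmono V (\<alpha>(v := Suc (\<alpha> v))) t = bmono V \<alpha> t * t v"
  using assms by (simp add: bmono_def prod.remove[of V v])

text \<open>A weighted mean of \<open>w\<close> is zero. The weight vanishes on the boundary to an order that lets
  \<open>ell_exchange\<close> below reach all test functions needed across a facet.\<close>

locale simplex_moments =
  fixes V :: "'a::euclidean_space set" and w :: "'a \<Rightarrow> real" and gw :: "'a \<Rightarrow> 'a" and h :: real and l :: nat
  assumes V: "full_simplex V" and wk: "weak_grad (interior (convex hull V)) w gw"
    and h: "\<And>p q. p \<in> V \<Longrightarrow> q \<in> V \<Longrightarrow> norm (p - q) \<le> h"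
    and normalised: "(LINT x:interior (convex hull V)|lebesgue. w x * (\<Prod>v\<in>V. bary V x v ^ (l + 2))) = 0"
begin

text \<open>The degree of the normalising weight. It is the common degree to which all monomials are
  raised, and the degrees of the facet test functions must stay below it.\<close>

definition N where "N = (l + 2) * Suc DIM('a)"
definition E where "E = (LINT x:interior (convex hull V)|lebesgue. norm (gw x))"
text \<open>The argument is a function of the coordinate vector, not of the point. Degrees then make
  sense, and \<open>ell_cong\<close> may replace the sum of the coordinates by 1.\<close>

definition ell where "ell r = (LINT x:interior (convex hull V)|lebesgue. w x * r (bary V x))"
definition cts where "cts r \<longleftrightarrow> continuous_on UNIV (\<lambda>x. r (bary V x) :: real)"

lemma fV: "finite V" "card V = Suc DIM('a)"
  using V full_simplex_finite[OF V] by (auto simp: full_simplex_def)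

lemma bK: "bounded (interior (convex hull V))"
  using compact_imp_bounded[OF finite_imp_compact_convex_hull[OF fV(1)]] bounded_interior by blast

lemma V_ne: "V \<noteq> {}" using fV by auto

lemma h0: "h \<ge> 0" using h V_ne by fastforce

lemma E0: "E \<ge> 0"
  unfolding E_def set_lebesgue_integral_def by (intro integral_nonneg_AE) auto

lemma wi: "set_integrable lebesgue (interior (convex hull V)) w" using wk by (simp add: weak_grad_def)

lemma gwi: "set_integrable lebesgue (interior (convex hull V)) gw" using wk by (simp add: weak_grad_def)

lemma ell_integrable: "cts r \<Longrightarrow> set_integrable lebesgue (interior (convex hull V)) (\<lambda>x. w x * r (bary V x))"
  unfolding cts_def by (rule set_integrable_mult_continuous[OF wi bK])

lemma ell_add: "cts r \<Longrightarrow> cts s \<Longrightarrow> ell (\<lambda>t. r t + s t) = ell r + ell s"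
  unfolding ell_def distrib_left by (intro set_integral_add(2) ell_integrable)

lemma ell_scale: "ell (\<lambda>t. c * r t) = c * ell r"
  unfolding ell_def mult.left_commute[of _ c] by (rule set_integral_mult_right)

lemma ell_sum: "(\<And>i. i \<in> I \<Longrightarrow> cts (r i)) \<Longrightarrow> ell (\<lambda>t. \<Sum>i\<in>I. r i t) = (\<Sum>i\<in>I. ell (r i))"
  unfolding ell_def sum_distrib_left by (intro set_integral_sum(2) ell_integrable)

lemma ell_lincomb:
  assumes "\<And>i. i \<in> I \<Longrightarrow> cts (r i)"
  shows "ell (\<lambda>t. \<Sum>i\<in>I. c i * r i t) = (\<Sum>i\<in>I. c i * ell (r i))"
proof -
  have "cts (\<lambda>t. c i * r i t)" if "i \<in> I" for i
    using assms[OF that] unfolding cts_def by (intro continuous_intros)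
  then show ?thesis by (simp add: ell_sum ell_scale)
qed

lemma ell_cong: "(\<And>t. sum t V = 1 \<Longrightarrow> r t = s t) \<Longrightarrow> ell r = ell s"
  unfolding ell_def using bary_props(2)[OF V] by simp

lemma cts_bmono: "cts (bmono V \<alpha>)"
  unfolding cts_def bmono_def by (intro continuous_intros continuous_bary[OF V])

lemma cts_mult: "cts r \<Longrightarrow> cts s \<Longrightarrow> cts (\<lambda>t. r t * s t)"
  unfolding cts_def by (rule continuous_on_mult)

lemma cts_linear: "cts (\<lambda>t. \<Sum>v\<in>V. c v * t v)"
  unfolding cts_def by (intro continuous_intros continuous_bary[OF V])

lemma centroid: obtains m where "\<And>v. v \<in> V \<Longrightarrow> 0 < bary V m v"
proof -
  have "bary V (\<Sum>v\<in>V. (1 / real (card V)) *\<^sub>R v) v = 1 / real (card V)" if "v \<in> V" for v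
    by (rule bary_unique[OF V _ refl that]) (use fV in simp)
  then show ?thesis using that fV by (metis of_nat_0_less_iff zero_less_Suc zero_less_divide_1_iff)
qed

text \<open>The field \<open>\<lambda>\<^sup>\<beta> (p - q)\<close> vanishes on the boundary of the simplex and its divergence is
  \<open>\<beta>\<^sub>p \<lambda>\<^sup>\<beta>\<^sup>-\<^sup>p - \<beta>\<^sub>q \<lambda>\<^sup>\<beta>\<^sup>-\<^sup>q\<close>. This replaces the inequality of Poincare and the trace inequality.\<close>

lemma ell_exchange:
  assumes pq: "p \<in> V" "q \<in> V" "p \<noteq> q" and b: "\<And>v. v \<in> V \<Longrightarrow> \<beta> v \<ge> 1"
  shows "\<bar>real (\<beta> p) * ell (bmono V (\<beta>(p := \<beta> p - 1))) - real (\<beta> q) * ell (bmono V (\<beta>(q := \<beta> q - 1)))\<bar> \<le> h * E"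
proof -
  let ?K = "convex hull V"
  define F where "F x = bmono V \<beta> (bary V x)" for x
  define f where "f x = (if x \<in> ?K then F x else 0)" for x
  obtain m where m: "\<And>v. v \<in> V \<Longrightarrow> 0 < bary V m v" using centroid by blast
  have cK: "compact ?K" using finite_imp_compact_convex_hull[OF fV(1)] .
  interpret K: pieces "{?K}" by standard (use cK in auto)
  have FC: "Ck k F" for k
  proof -
    have "F = (\<lambda>x. \<Prod>v\<in>V. \<Prod>i<\<beta> v. bary V x v)" by (auto simp: F_def bmono_def)
    then show ?thesis by (simp only:) (intro Ck_prod Ck_bary[OF V])
  qed
  have F0: "F x = 0" if xK: "x \<in> ?K" "x \<notin> interior ?K" for x
  proof -
    obtain v where v: "v \<in> V" "\<not> 0 < bary V x v"
      using xK(2) unfolding mem_interior_simplex_iff[OF V] by blast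
    then have "bary V x v = 0" using xK(1) unfolding mem_simplex_iff[OF V] by force
    then have "bary V x v ^ \<beta> v = 0" using b[OF v(1)] by simp
    then show ?thesis unfolding F_def bmono_def by (intro prod_zero bexI[OF _ v(1)] fV(1))
  qed
  have fc: "continuous_on UNIV f"
  proof -
    have "continuous_on ?K f"
      using Ck_imp_continuous_on[OF FC[of 0]]
      by (subst continuous_on_cong[OF refl, of ?K f F]) (auto simp: f_def)
    moreover have "continuous_on (- interior ?K) f"
      by (subst continuous_on_cong[OF refl, of _ f "\<lambda>x. 0"]) (auto simp: f_def F0)
    ultimately have "continuous_on (?K \<union> (- interior ?K)) f"
      using cK by (intro continuous_on_closed_Un) (auto intro: compact_imp_closed)
    moreover have "?K \<union> (- interior ?K) = UNIV" using interior_subset by blast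
    ultimately show ?thesis by simp
  qed
  have z: "(\<Sum>K\<in>{?K}. LINT x:interior K|lebesgue. w x * (grad F x \<bullet> (p - q)) + (gw x \<bullet> (p - q)) * F x) = 0"
  proof (rule K.weak_grad_pw[where p = "\<lambda>K. F" and f = f and m = m, OF _ fc _ _ wk])
    show "m + t *\<^sub>R (x - m) \<in> interior (\<Union>{?K})" if "x \<in> \<Union>{?K}" "0 < t" "t < 1" for x t
      unfolding Union_insert Union_empty Un_empty_right mem_interior_simplex_iff[OF V]
    proof
      fix v assume v: "v \<in> V"
      have "0 < (1 - t) * bary V m v + t * bary V x v"
        using that m[OF v] v mem_simplex_iff[OF V, of x] by (intro add_pos_nonneg mult_pos_pos mult_nonneg_nonneg) auto
      then show "0 < bary V (m + t *\<^sub>R (x - m)) v"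
        unfolding bary_convex_combination[OF V] by (simp add: algebra_simps)
    qed
  qed (use FC f_def in auto)
  have gF: "grad F x \<bullet> (p - q) = real (\<beta> p) * bmono V (\<beta>(p := \<beta> p - 1)) (bary V x) - real (\<beta> q) * bmono V (\<beta>(q := \<beta> q - 1)) (bary V x)" for x
  proof -
    have "grad F x \<bullet> (p - q) = (\<Sum>v\<in>V. ((real (\<beta> v) * bary V x v ^ (\<beta> v - 1)) *\<^sub>R bgrad V v \<bullet> (p - q)) * (\<Prod>u\<in>V - {v}. bary V x u ^ \<beta> u))"
      unfolding F_def bmono_def
      by (rule grad_prod) (auto intro!: has_derivative_eq_rhs[OF has_derivative_power[OF bary_has_derivative[OF V]]])
    also have "\<dots> = (\<Sum>v\<in>V. (if v = p then real (\<beta> p) * bmono V (\<beta>(p := \<beta> p - 1)) (bary V x) else 0)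
        - (if v = q then real (\<beta> q) * bmono V (\<beta>(q := \<beta> q - 1)) (bary V x) else 0))"
    proof (rule sum.cong[OF refl])
      fix v assume v: "v \<in> V"
      \<comment> \<open>Along the edge from q to p only the coordinates of p and q change, by 1 and
        -1, so two terms of the product rule survive.\<close>
      have 1: "bgrad V v \<bullet> (p - q) = (if v = p then 1 else 0) - (if v = q then 1 else 0)"
        using bary_affine[OF V, of p v q] bary_vertex[OF V pq(1) v] bary_vertex[OF V pq(2) v] by simp
      have 2: "bmono V (\<beta>(v := \<beta> v - 1)) (bary V x) = bary V x v ^ (\<beta> v - 1) * (\<Prod>u\<in>V - {v}. bary V x u ^ \<beta> u)"
        using v fV(1) by (simp add: bmono_def prod.remove[of V v])
      show "((real (\<beta> v) * bary V x v ^ (\<beta> v - 1)) *\<^sub>R bgrad V v \<bullet> (p - q)) * (\<Prod>u\<in>V - {v}. bary V x u ^ \<beta> u)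
        = (if v = p then real (\<beta> p) * bmono V (\<beta>(p := \<beta> p - 1)) (bary V x) else 0)
        - (if v = q then real (\<beta> q) * bmono V (\<beta>(q := \<beta> q - 1)) (bary V x) else 0)"
        using 2 pq(3) by (auto simp: 1)
    qed
    also have "\<dots> = real (\<beta> p) * bmono V (\<beta>(p := \<beta> p - 1)) (bary V x) - real (\<beta> q) * bmono V (\<beta>(q := \<beta> q - 1)) (bary V x)"
      using fV(1) pq by (simp add: sum_subtractf)
    finally show ?thesis .
  qed
  have Fc: "continuous_on UNIV F" by (rule Ck_imp_continuous_on[OF FC[of 0]])
  have i1: "set_integrable lebesgue (interior ?K) (\<lambda>x. w x * (grad F x \<bullet> (p - q)))"
    by (intro set_integrable_mult_continuous[OF wi bK] continuous_intros Ck_continuous_grad[OF FC])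
  have i2: "set_integrable lebesgue (interior ?K) (\<lambda>x. (gw x \<bullet> (p - q)) * F x)"
    by (rule set_integrable_mult_continuous[OF set_integrable_inner[OF gwi] bK Fc])
  have "(LINT x:interior ?K|lebesgue. w x * (grad F x \<bullet> (p - q)))
      = real (\<beta> p) * ell (bmono V (\<beta>(p := \<beta> p - 1))) - real (\<beta> q) * ell (bmono V (\<beta>(q := \<beta> q - 1)))"
    unfolding ell_def gF right_diff_distrib mult.left_commute[of _ "real _"]
    by (subst set_integral_diff(2)) (auto intro!: set_integrable_mult_right ell_integrable[unfolded ell_def] cts_bmono)
  then have "\<bar>real (\<beta> p) * ell (bmono V (\<beta>(p := \<beta> p - 1))) - real (\<beta> q) * ell (bmono V (\<beta>(q := \<beta> q - 1)))\<bar>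
      = \<bar>LINT x:interior ?K|lebesgue. (gw x \<bullet> (p - q)) * F x\<bar>"
    using z i1 i2 by (simp add: set_integral_add(2))
  also have "\<dots> \<le> (LINT x:interior ?K|lebesgue. h * norm (gw x))"
  proof (rule set_integral_abs_le[OF i2])
    show "set_integrable lebesgue (interior ?K) (\<lambda>x. h * norm (gw x))"
      by (intro set_integrable_mult_right set_integrable_norm_gradient gwi)
    fix x assume "x \<in> interior ?K"
    then have x: "x \<in> ?K" using interior_subset by blast
    have "\<bar>F x\<bar> \<le> 1"
      unfolding F_def bmono_def abs_prod using x mem_simplex_iff[OF V] bary_le_1[OF V x]
      by (intro prod_le_1) (auto intro!: power_le_one)
    moreover have "\<bar>gw x \<bullet> (p - q)\<bar> \<le> norm (gw x) * h"
      using Cauchy_Schwarz_ineq2[of "gw x" "p - q"] mult_left_mono[OF h[OF pq(1,2)] norm_ge_zero[of "gw x"]] by linarith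
    ultimately have "\<bar>(gw x \<bullet> (p - q)) * F x\<bar> \<le> (norm (gw x) * h) * 1"
      unfolding abs_mult using h0 by (intro mult_mono) auto
    then show "\<bar>(gw x \<bullet> (p - q)) * F x\<bar> \<le> h * norm (gw x)" by (simp add: mult.commute)
  qed
  finally show ?thesis by (simp add: E_def)
qed

text \<open>\<open>ell_exchange\<close> starts from a monomial with all exponents positive and
  lowers one of them, so it reaches exactly the monomials with at most one exponent 0.\<close>

definition one_zero where
  "one_zero \<alpha> \<longleftrightarrow> (\<forall>v\<in>V. \<forall>u\<in>V. \<alpha> v = (0::nat) \<and> \<alpha> u = 0 \<longrightarrow> v = u)"

text \<open>Exponents are moved one unit at a time from a vertex above l + 2 to one below, until the
  normalising weight is reached, where the moment is 0. Each exchange costs a factor of at most N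
  and one more term h E; the excess over l + 2 counts the moves.\<close>

lemma ell_top_degree:
  assumes "one_zero \<alpha>" "sum \<alpha> V = N"
  shows "\<bar>ell (bmono V \<alpha>)\<bar> \<le> real (N + 1) ^ (\<Sum>v\<in>V. \<alpha> v - (l + 2)) * (h * E)"
  using assms
proof (induction "\<Sum>v\<in>V. \<alpha> v - (l + 2)" arbitrary: \<alpha>)
  case 0
  then have le: "\<alpha> v \<le> l + 2" if "v \<in> V" for v using that fV(1) by (simp add: sum_eq_0_iff)
  have "\<alpha> v = l + 2" if v: "v \<in> V" for v
  proof (rule ccontr)
    assume "\<alpha> v \<noteq> l + 2"
    then have "sum \<alpha> V < (\<Sum>v\<in>V. l + 2)"
      using le v fV(1) by (intro sum_strict_mono_ex1) (auto intro!: bexI[of _ v] le_neq_trans)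
    then show False using "0.prems" fV by (simp add: N_def)
  qed
  then have "ell (bmono V \<alpha>) = 0" using normalised by (simp add: ell_def bmono_def)
  then show ?case using h0 E0 by simp
next
  case (Suc s)
  have "\<exists>q\<in>V. \<alpha> q > l + 2"
  proof (rule ccontr)
    assume "\<not> ?thesis"
    then have "(\<Sum>v\<in>V. \<alpha> v - (l + 2)) = 0" by (intro sum.neutral) (auto simp: not_less)
    then show False using Suc.hyps(2) by simp
  qed
  then obtain q where q: "q \<in> V" "\<alpha> q > l + 2" by blast
  have "\<exists>p\<in>V. \<alpha> p < l + 2"
  proof (rule ccontr)
    assume "\<not> ?thesis"
    then have "(\<Sum>v\<in>V. l + 2) < sum \<alpha> V"
      using q fV(1) by (intro sum_strict_mono_ex1) (auto simp: not_less)
    then show False using Suc.prems fV by (simp add: N_def)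
  qed
  \<comment> \<open>A vertex with exponent 0, if there is one, is the one to be raised first: then
    all exponents of \<open>\<beta>\<close> are positive, as the exchange requires.\<close>
  then obtain p where p: "p \<in> V" "\<alpha> p < l + 2" "(\<exists>v\<in>V. \<alpha> v = 0) \<longrightarrow> \<alpha> p = 0"
    by (metis add_pos_pos less_add_same_cancel2 zero_less_numeral less_numeral_extra(3) trans_less_add2)
  have pq: "p \<noteq> q" using p q by auto
  define \<beta> where "\<beta> = \<alpha>(p := Suc (\<alpha> p))"
  have b: "\<beta> v \<ge> 1" if "v \<in> V" for v
    using that p Suc.prems(1) unfolding \<beta>_def one_zero_def by (cases "v = p") (auto simp: Suc_le_eq)
  define \<alpha>' where "\<alpha>' = \<beta>(q := \<beta> q - 1)"
  have oz: "one_zero \<alpha>'"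
  proof -
    have "\<alpha>' v \<ge> 1" if "v \<in> V" for v using b[OF that] q pq by (auto simp: \<alpha>'_def \<beta>_def)
    then show ?thesis by (force simp: one_zero_def)
  qed
  have "sum \<beta> V = Suc (sum \<alpha> V)" using p(1) fV(1) by (simp add: \<beta>_def sum.remove[of V p])
  moreover have "Suc (sum \<alpha>' V) = sum \<beta> V"
    using q b[OF q(1)] fV(1) by (simp add: \<alpha>'_def sum.remove[of V q])
  ultimately have sum': "sum \<alpha>' V = N" using Suc.prems by simp
  have s': "(\<Sum>v\<in>V. \<alpha>' v - (l + 2)) = s"
  proof -
    have "(\<Sum>v\<in>V. \<alpha> v - (l + 2)) = (\<Sum>v\<in>V. (\<alpha>' v - (l + 2)) + (if v = q then 1 else 0))"
      using p q pq by (intro sum.cong) (auto simp: \<alpha>'_def \<beta>_def)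
    also have "\<dots> = Suc (\<Sum>v\<in>V. \<alpha>' v - (l + 2))" using q fV(1) by (simp add: sum.distrib)
    finally show ?thesis using Suc.hyps(2) by simp
  qed
  have IH: "\<bar>ell (bmono V \<alpha>')\<bar> \<le> real (N + 1) ^ s * (h * E)"
    using Suc.hyps(1)[of \<alpha>'] s' oz sum' by simp
  have "\<beta>(p := \<beta> p - 1) = \<alpha>" by (auto simp: \<beta>_def)
  then have ex: "\<bar>real (\<beta> p) * ell (bmono V \<alpha>) - real (\<beta> q) * ell (bmono V \<alpha>')\<bar> \<le> h * E"
    using ell_exchange[OF p(1) q(1) pq, of \<beta>] b by (simp add: \<alpha>'_def)
  have "\<beta> q \<le> N"
    using pq q(1) fV(1) Suc.prems(2) member_le_sum[of q V \<alpha>] by (simp add: \<beta>_def)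
  then have bq: "real (\<beta> q) \<le> real N" by simp
  have bp: "1 \<le> real (\<beta> p)" using b[OF p(1)] by simp
  have hE: "h * E \<ge> 0" using h0 E0 by simp
  have "\<bar>ell (bmono V \<alpha>)\<bar> \<le> real (\<beta> p) * \<bar>ell (bmono V \<alpha>)\<bar>" using mult_right_mono[OF bp, of "\<bar>ell (bmono V \<alpha>)\<bar>"] by simp
  also have "\<dots> \<le> real (\<beta> q) * \<bar>ell (bmono V \<alpha>')\<bar> + h * E"
    using ex abs_triangle_ineq2[of "real (\<beta> p) * ell (bmono V \<alpha>)" "real (\<beta> q) * ell (bmono V \<alpha>')"] by (simp add: abs_mult)
  also have "\<dots> \<le> real N * (real (N + 1) ^ s * (h * E)) + 1 * (h * E)"
  proof -
    have "real (\<beta> q) * \<bar>ell (bmono V \<alpha>')\<bar> \<le> real N * (real (N + 1) ^ s * (h * E))"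
      by (intro mult_mono[OF bq IH]) auto
    then show ?thesis by simp
  qed
  also have "\<dots> \<le> real N * (real (N + 1) ^ s * (h * E)) + real (N + 1) ^ s * (h * E)"
    using hE by (intro add_left_mono mult_right_mono one_le_power) auto
  also have "\<dots> = real (N + 1) ^ Suc s * (h * E)" by (simp add: algebra_simps)
  finally show ?case using Suc.hyps(2) by simp
qed

definition Cg where "Cg = real (Suc DIM('a)) ^ N * real (N + 1) ^ N"

text \<open>A monomial of lower degree is multiplied by the sum of the coordinates, which is 1,
  until its degree is N. Each multiplication produces d + 1 monomials and creates no new zero
  exponents.\<close>

lemma ell_bmono_le:
  assumes "one_zero \<alpha>" "sum \<alpha> V \<le> N" shows "\<bar>ell (bmono V \<alpha>)\<bar> \<le> Cg * (h * E)"
proof -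
  have hE: "h * E \<ge> 0" using h0 E0 by simp
  have "\<bar>ell (bmono V \<alpha>)\<bar> \<le> real (Suc DIM('a)) ^ k * (real (N + 1) ^ N * (h * E))"
    if "one_zero \<alpha>" "sum \<alpha> V + k = N" for \<alpha> k
    using that
  proof (induction k arbitrary: \<alpha>)
    case 0
    have "(\<Sum>v\<in>V. \<alpha> v - (l + 2)) \<le> N" using 0 sum_mono[of V "\<lambda>v. \<alpha> v - (l + 2)" \<alpha>] by simp
    then have "real (N + 1) ^ (\<Sum>v\<in>V. \<alpha> v - (l + 2)) * (h * E) \<le> real (N + 1) ^ N * (h * E)"
      using hE by (intro mult_right_mono power_increasing) auto
    then show ?case using ell_top_degree[of \<alpha>] 0 by simp
  next
    case (Suc k)
    have "ell (bmono V \<alpha>) = ell (\<lambda>t. \<Sum>v\<in>V. bmono V (\<alpha>(v := Suc (\<alpha> v))) t)"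
      by (rule ell_cong) (simp add: bmono_upd[OF fV(1)] flip: sum_distrib_left)
    also have "\<dots> = (\<Sum>v\<in>V. ell (bmono V (\<alpha>(v := Suc (\<alpha> v)))))" by (rule ell_sum[OF cts_bmono])
    finally have "\<bar>ell (bmono V \<alpha>)\<bar> \<le> (\<Sum>v\<in>V. \<bar>ell (bmono V (\<alpha>(v := Suc (\<alpha> v))))\<bar>)" by simp
    also have "\<dots> \<le> (\<Sum>v\<in>V. real (Suc DIM('a)) ^ k * (real (N + 1) ^ N * (h * E)))"
    proof (rule sum_mono)
      fix v assume v: "v \<in> V"
      have "one_zero (\<alpha>(v := Suc (\<alpha> v)))" using Suc.prems(1) by (auto simp: one_zero_def)
      moreover have "sum (\<alpha>(v := Suc (\<alpha> v))) V + k = N"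
        using Suc.prems(2) v fV(1) by (simp add: sum.remove[of V v])
      ultimately show "\<bar>ell (bmono V (\<alpha>(v := Suc (\<alpha> v))))\<bar> \<le> real (Suc DIM('a)) ^ k * (real (N + 1) ^ N * (h * E))"
        by (rule Suc.IH)
    qed
    finally show ?case using fV(2) by (simp add: mult.assoc)
  qed
  from this[OF assms(1), of "N - sum \<alpha> V"] assms(2)
  have "\<bar>ell (bmono V \<alpha>)\<bar> \<le> real (Suc DIM('a)) ^ (N - sum \<alpha> V) * (real (N + 1) ^ N * (h * E))" by simp
  also have "\<dots> \<le> real (Suc DIM('a)) ^ N * (real (N + 1) ^ N * (h * E))"
    using hE by (intro mult_right_mono power_increasing) auto
  finally show ?thesis by (simp add: Cg_def mult.assoc)
qed

definition lin_form where
  "lin_form M f \<longleftrightarrow> (\<exists>c. (\<forall>t. f t = (\<Sum>v\<in>V. c v * t v)) \<and> (\<forall>v\<in>V. \<bar>c v\<bar> \<le> M))"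

text \<open>Each linear form is expanded into d + 1 coordinates with coefficients at most M, and
  every coordinate is absorbed by the monomial.\<close>

lemma ell_products:
  assumes I: "finite I" and f: "\<And>i. i \<in> I \<Longrightarrow> lin_form M (f i)"
    and a: "one_zero \<alpha>" "sum \<alpha> V + card I \<le> N" and M: "M \<ge> 0"
  shows "\<bar>ell (\<lambda>t. bmono V \<alpha> t * (\<Prod>i\<in>I. f i t))\<bar> \<le> (real (Suc DIM('a)) * M) ^ card I * (Cg * (h * E))"
    and "cts (\<lambda>t. \<Prod>i\<in>I. f i t)"
proof -
  have c: "cts (f i)" if lf: "lin_form M (f i)" for i
  proof -
    obtain c where "\<And>t. f i t = (\<Sum>v\<in>V. c v * t v)" using lf by (auto simp: lin_form_def)
    then have "f i = (\<lambda>t. \<Sum>v\<in>V. c v * t v)" by (rule ext)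
    then show ?thesis using cts_linear by simp
  qed
  have pc: "cts (\<lambda>t. \<Prod>i\<in>J. f i t)" if "\<And>i. i \<in> J \<Longrightarrow> lin_form M (f i)" for J
    using that by (induction J rule: infinite_finite_induct) (auto simp: cts_mult c, auto simp: cts_def)
  show "cts (\<lambda>t. \<Prod>i\<in>I. f i t)" by (rule pc[OF f])
  show "\<bar>ell (\<lambda>t. bmono V \<alpha> t * (\<Prod>i\<in>I. f i t))\<bar> \<le> (real (Suc DIM('a)) * M) ^ card I * (Cg * (h * E))"
    using I f a
  proof (induction I arbitrary: \<alpha> rule: finite_induct)
    case empty
    then show ?case using ell_bmono_le by simp
  next
    case (insert i I)
    obtain c where c: "\<And>t. f i t = (\<Sum>v\<in>V. c v * t v)" "\<And>v. v \<in> V \<Longrightarrow> \<bar>c v\<bar> \<le> M"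
      using insert.prems(1)[of i] by (auto simp: lin_form_def)
    have cI: "cts (\<lambda>t. bmono V \<alpha> t * (\<Prod>i\<in>I. f i t))" for \<alpha>
      using insert.prems(1) by (intro cts_mult cts_bmono pc) auto
    have "(\<lambda>t. bmono V \<alpha> t * (\<Prod>j\<in>insert i I. f j t)) = (\<lambda>t. \<Sum>v\<in>V. c v * (bmono V (\<alpha>(v := Suc (\<alpha> v))) t * (\<Prod>j\<in>I. f j t)))"
    proof
      fix t
      have "(\<Sum>v\<in>V. c v * (bmono V (\<alpha>(v := Suc (\<alpha> v))) t * (\<Prod>j\<in>I. f j t))) = (\<Sum>v\<in>V. c v * t v) * (bmono V \<alpha> t * (\<Prod>j\<in>I. f j t))"
        unfolding sum_distrib_right by (intro sum.cong) (auto simp: bmono_upd[OF fV(1)] mult_ac)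
      then show "bmono V \<alpha> t * (\<Prod>j\<in>insert i I. f j t) = (\<Sum>v\<in>V. c v * (bmono V (\<alpha>(v := Suc (\<alpha> v))) t * (\<Prod>j\<in>I. f j t)))"
        using insert.hyps by (simp add: c(1) mult_ac)
    qed
    then have "ell (\<lambda>t. bmono V \<alpha> t * (\<Prod>j\<in>insert i I. f j t)) = (\<Sum>v\<in>V. c v * ell (\<lambda>t. bmono V (\<alpha>(v := Suc (\<alpha> v))) t * (\<Prod>j\<in>I. f j t)))"
      by (simp only: ell_lincomb[OF cI])
    also have "\<bar>\<dots>\<bar> \<le> (\<Sum>v\<in>V. M * ((real (Suc DIM('a)) * M) ^ card I * (Cg * (h * E))))"
    proof (rule order_trans[OF sum_abs sum_mono])
      fix v assume v: "v \<in> V"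
      have oz: "one_zero (\<alpha>(v := Suc (\<alpha> v)))" using insert.prems(2) by (auto simp: one_zero_def)
      have sm: "sum (\<alpha>(v := Suc (\<alpha> v))) V + card I \<le> N"
        using insert.prems(3) insert.hyps v fV(1) by (simp add: sum.remove[of V v])
      have "\<bar>ell (\<lambda>t. bmono V (\<alpha>(v := Suc (\<alpha> v))) t * (\<Prod>j\<in>I. f j t))\<bar> \<le> (real (Suc DIM('a)) * M) ^ card I * (Cg * (h * E))"
        by (rule insert.IH[OF _ oz sm]) (use insert.prems(1) in simp)
      then show "\<bar>c v * ell (\<lambda>t. bmono V (\<alpha>(v := Suc (\<alpha> v))) t * (\<Prod>j\<in>I. f j t))\<bar> \<le> M * ((real (Suc DIM('a)) * M) ^ card I * (Cg * (h * E)))"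
        unfolding abs_mult using c(2)[OF v] M by (intro mult_mono) auto
    qed
    also have "\<dots> = (real (Suc DIM('a)) * M) ^ card (insert i I) * (Cg * (h * E))"
      using insert.hyps fV(2) by (simp add: mult_ac)
    finally show ?case .
  qed
qed

end

section \<open>Two simplices sharing a facet\<close>

definition tidx :: "'a set \<Rightarrow> ('a \<Rightarrow> nat) \<Rightarrow> ('a \<times> nat) set" where
  "tidx C \<gamma> = lidx C (\<lambda>v. \<gamma> v + 2)"

text \<open>Positions 0 and 1 at a vertex are two copies of its coordinate; the factors of the
  Lagrange function follow, shifted by 2.\<close>

definition tfac :: "'a set \<Rightarrow> nat \<Rightarrow> 'a \<times> nat \<Rightarrow> ('a \<Rightarrow> real) \<Rightarrow> real" where
  "tfac C l i t = (if snd i < 2 then t (fst i) else lfac C l (fst i, snd i - 2) t)"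

text \<open>The squared bubble of the facet times a Lagrange function. The square leaves one copy of
  each coordinate when a factor is differentiated, so that \<open>one_zero\<close> holds; it also
  makes the jump, tested with itself, the integral of a square.\<close>

definition tchi :: "'a set \<Rightarrow> nat \<Rightarrow> ('a \<Rightarrow> nat) \<Rightarrow> ('a \<Rightarrow> real) \<Rightarrow> real" where
  "tchi C l \<gamma> t = (\<Prod>i\<in>tidx C \<gamma>. tfac C l i t)"

definition tgrad :: "'a::euclidean_space set \<Rightarrow> 'a set \<Rightarrow> nat \<Rightarrow> 'a \<times> nat \<Rightarrow> 'a" where
  "tgrad V C l i = (if snd i < 2 then bgrad V (fst i) else lfac_grad V C l (fst i, snd i - 2))"

lemma finite_tidx: "finite C \<Longrightarrow> finite (tidx C \<gamma>)"
  by (simp add: tidx_def finite_lidx)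

lemma card_tidx: "finite C \<Longrightarrow> \<gamma> \<in> lindices C l \<Longrightarrow> card (tidx C \<gamma>) = 2 * card C + l"
  by (simp add: tidx_def lidx_def lindices_def sum.distrib del: add_2_eq_Suc add_2_eq_Suc')

lemma tchi_eq:
  assumes "finite C" shows "tchi C l \<gamma> t = (\<Prod>v\<in>C. t v)\<^sup>2 * lag C l \<gamma> t"
proof -
  have "tchi C l \<gamma> t = (\<Prod>v\<in>C. \<Prod>j<\<gamma> v + 2. tfac C l (v, j) t)"
    unfolding tchi_def tidx_def lidx_def using assms by (subst prod.Sigma) (auto simp: case_prod_unfold)
  also have "\<dots> = (\<Prod>v\<in>C. t v * (t v * (\<Prod>j<\<gamma> v. lfac C l (v, j) t)))"
    by (intro prod.cong refl) (simp add: prod.lessThan_Suc_shift tfac_def del: prod.lessThan_Suc)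
  also have "\<dots> = (\<Prod>v\<in>C. t v)\<^sup>2 * (\<Prod>v\<in>C. \<Prod>j<\<gamma> v. lfac C l (v, j) t)"
    by (simp add: prod.distrib power2_eq_square mult.assoc)
  also have "(\<Prod>v\<in>C. \<Prod>j<\<gamma> v. lfac C l (v, j) t) = lag C l \<gamma> t"
    unfolding lag_def lidx_def using assms by (subst prod.Sigma) (auto simp: case_prod_unfold)
  finally show ?thesis .
qed

lemma tfac_bary_has_derivative:
  assumes "full_simplex V"
  shows "((\<lambda>x. tfac C l i (bary V x)) has_derivative (\<lambda>h. tgrad V C l i \<bullet> h)) (at x)"
  unfolding tfac_def tgrad_def
  by (auto intro: bary_has_derivative[OF assms] lfac_bary_has_derivative[OF assms])

lemma tgrad_le:
  fixes V :: "'a::euclidean_space set"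
  assumes "full_simplex V" "C \<subseteq> V" "\<And>v. norm (bgrad V v) \<le> B"
  shows "norm (tgrad V C l i) \<le> (real l + real DIM('a) + 1) * B"
proof -
  have "B \<ge> 0" using assms(3) norm_ge_zero order_trans by blast
  then have "1 * B \<le> (real l + real DIM('a) + 1) * B" by (intro mult_right_mono) auto
  then show ?thesis
    using assms(3)[of "fst i"] lfac_bary_grad_le[OF assms, where i = "(fst i, snd i - 2)"] by (auto simp: tgrad_def)
qed

lemma Ck_tchi: "full_simplex V \<Longrightarrow> Ck k (\<lambda>x. tchi C l \<gamma> (bary V x))"
proof -
  assume V: "full_simplex V"
  have "Ck k (\<lambda>x. tfac C l i (bary V x))" for i
    unfolding tfac_def lfac_bary_affine[OF V] using Ck_bary[OF V] Ck_affine by (cases "snd i < 2") auto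
  then show ?thesis unfolding tchi_def by (intro Ck_prod)
qed

lemma tchi_cong: "finite C \<Longrightarrow> (\<And>v. v \<in> C \<Longrightarrow> t v = t' v) \<Longrightarrow> tchi C l \<gamma> t = tchi C l \<gamma> t'"
  by (simp add: tchi_eq lag_cong[of C t t'])

context simplex_moments
begin

lemma lin_form_coord: assumes v: "v \<in> V" and M: "(M :: real) \<ge> 1" shows "lin_form M (\<lambda>t. t v)"
proof -
  define c :: "'a \<Rightarrow> real" where "c u = (if u = v then 1 else 0)" for u
  have "t v = (\<Sum>u\<in>V. c u * t u)" for t :: "'a \<Rightarrow> real"
  proof -
    have "(\<Sum>u\<in>V. c u * t u) = (\<Sum>u\<in>V. if u = v then t v else 0)" by (intro sum.cong) (auto simp: c_def)
    then show ?thesis using v fV(1) by simp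
  qed
  moreover have "\<forall>u\<in>V. \<bar>c u\<bar> \<le> M" using M by (auto simp: c_def)
  ultimately show ?thesis unfolding lin_form_def by blast
qed

lemma lin_form_lfac:
  assumes "C \<subseteq> V" "fst i \<in> C" "l > 0" shows "lin_form (real l) (lfac C l i)"
  unfolding lin_form_def
proof (intro exI conjI allI ballI)
  define j where "j = real (snd i)"
  define c where "c u = ((if u = fst i then real l else 0) - (if u \<in> C then j else 0)) / (j + 1)" for u
  have j: "j \<ge> 0" by (simp add: j_def)
  fix t :: "'a \<Rightarrow> real"
  have fi: "fst i \<in> V" using assms by auto
  have "(\<Sum>u\<in>V. c u * t u) = ((\<Sum>u\<in>V. (if u = fst i then real l * t u else 0)) - (\<Sum>u\<in>V. if u \<in> C then j * t u else 0)) / (j + 1)"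
    unfolding c_def sum_subtractf[symmetric] sum_divide_distrib
    by (intro sum.cong) (auto simp: left_diff_distrib diff_divide_distrib)
  also have "(\<Sum>u\<in>V. (if u = fst i then real l * t u else 0)) = real l * t (fst i)" using fi fV(1) by simp
  also have "(\<Sum>u\<in>V. if u \<in> C then j * t u else 0) = j * sum t C"
    using assms(1) fV(1) by (simp add: sum.If_cases Int_absorb1 sum_distrib_left)
  finally show "lfac C l i t = (\<Sum>u\<in>V. c u * t u)" by (simp add: lfac_def j_def)
  fix u
  have "\<bar>(if u = fst i then real l else 0) - (if u \<in> C then j else 0)\<bar> \<le> real l * (j + 1)"
  proof -
    have "j \<le> real l * j" "real l \<ge> 1" using assms(3) j by (auto simp: mult_le_cancel_right1)
    moreover have "0 \<le> real l * j" using j by simp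
    ultimately show ?thesis using j by (auto simp: abs_le_iff algebra_simps)
  qed
  then show "\<bar>c u\<bar> \<le> real l" unfolding c_def using j by (simp add: pos_divide_le_eq)
qed

lemma lin_form_tfac: "C \<subseteq> V \<Longrightarrow> i \<in> tidx C \<gamma> \<Longrightarrow> l > 0 \<Longrightarrow> lin_form (real l) (tfac C l i)"
proof -
  assume a: "C \<subseteq> V" "i \<in> tidx C \<gamma>" "l > 0"
  then have "fst i \<in> C" by (auto simp: tidx_def lidx_def)
  then show ?thesis
    using a lin_form_coord[of "fst i" "real l"] lin_form_lfac[OF a(1) _ a(3), of "(fst i, snd i - 2)"]
    by (cases "snd i < 2") (auto simp: tfac_def[abs_def])
qed

definition Ct where "Ct = (real (Suc DIM('a)) * real l) ^ N * Cg"

lemma Ct0: "Ct \<ge> 0" by (simp add: Ct_def Cg_def)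

text \<open>One copy of each facet coordinate is transferred from S to the monomial. Its exponents
  are then positive on C and only that of the opposite vertex can be 0, so
  \<open>ell_products\<close> applies to the remaining factors.\<close>

lemma ell_tfac_le:
  assumes VC: "V = insert a C" "a \<notin> C" and l: "l > 0" and S: "S \<subseteq> tidx C \<gamma>"
    and ex: "\<And>v. v \<in> C \<Longrightarrow> \<exists>c<2. (v, c) \<in> S" and le: "sum \<alpha> V + card S \<le> N"
  shows "\<bar>ell (\<lambda>t. bmono V \<alpha> t * (\<Prod>i\<in>S. tfac C l i t))\<bar> \<le> Ct * (h * E)"
    and "cts (\<lambda>t. bmono V \<alpha> t * (\<Prod>i\<in>S. tfac C l i t))"
proof -
  have fC: "finite C" using VC fV(1) by simp
  have fS: "finite S" using S finite_tidx[OF fC] finite_subset by blast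
  obtain \<kappa> where k: "\<And>v. v \<in> C \<Longrightarrow> \<kappa> v < 2 \<and> (v, \<kappa> v) \<in> S" using ex by metis
  \<comment> \<open>The transferred copies, one for every vertex of the facet.\<close>
  define D where "D = (\<lambda>v. (v, \<kappa> v)) ` C"
  have D: "D \<subseteq> S" "card D = card C" using k by (auto simp: D_def intro!: card_image inj_onI)
  define \<alpha>' where "\<alpha>' v = \<alpha> v + (if v \<in> C then 1 else 0)" for v
  have oz: "one_zero \<alpha>'" unfolding one_zero_def \<alpha>'_def using VC by auto
  have "sum \<alpha>' V = sum \<alpha> V + card C"
    using VC fC by (simp add: \<alpha>'_def sum.distrib sum.If_cases)
  moreover have "card (S - D) = card S - card C" "card C \<le> card S"
    using D fS card_mono[OF fS D(1)] finite_subset[OF D(1) fS] by (auto simp: card_Diff_subset)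
  ultimately have le': "sum \<alpha>' V + card (S - D) \<le> N" using le by simp
  have lf: "lin_form (real l) (tfac C l i)" if "i \<in> S - D" for i
    using lin_form_tfac[of C i \<gamma>] VC S l that by blast
  have eq: "(\<lambda>t. bmono V \<alpha> t * (\<Prod>i\<in>S. tfac C l i t)) = (\<lambda>t. bmono V \<alpha>' t * (\<Prod>i\<in>S - D. tfac C l i t))"
  proof
    fix t
    have "(\<Prod>i\<in>S. tfac C l i t) = (\<Prod>i\<in>S - D. tfac C l i t) * (\<Prod>i\<in>D. tfac C l i t)"
      by (rule prod.subset_diff[OF D(1) fS])
    moreover have "(\<Prod>i\<in>D. tfac C l i t) = (\<Prod>v\<in>C. t v)"
      unfolding D_def using k by (subst prod.reindex) (auto simp: inj_on_def tfac_def)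
    moreover have "bmono V \<alpha>' t = bmono V \<alpha> t * (\<Prod>v\<in>C. t v)"
    proof -
      have "bmono V \<alpha>' t = (\<Prod>v\<in>V. t v ^ \<alpha> v * (if v \<in> C then t v else 1))"
        unfolding bmono_def \<alpha>'_def by (intro prod.cong) (auto simp: power_add)
      also have "\<dots> = bmono V \<alpha> t * (\<Prod>v\<in>V. if v \<in> C then t v else 1)" by (simp add: bmono_def prod.distrib)
      also have "(\<Prod>v\<in>V. if v \<in> C then t v else 1) = (\<Prod>v\<in>C. t v)" using VC fC by (simp add: prod.If_cases Int_absorb1 subset_insertI)
      finally show ?thesis .
    qed
    ultimately show "bmono V \<alpha> t * (\<Prod>i\<in>S. tfac C l i t) = bmono V \<alpha>' t * (\<Prod>i\<in>S - D. tfac C l i t)" by simp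
  qed
  have fSD: "finite (S - D)" using fS by simp
  note ep = ell_products[OF fSD lf oz le']
  have 1: "1 \<le> real (Suc DIM('a)) * real l" using l mult_mono[of 1 "real (Suc DIM('a))" 1 "real l"] by simp
  have "\<bar>ell (\<lambda>t. bmono V \<alpha> t * (\<Prod>i\<in>S. tfac C l i t))\<bar> \<le> (real (Suc DIM('a)) * real l) ^ card (S - D) * (Cg * (h * E))"
    unfolding eq by (rule ep(1)) auto
  also have "\<dots> \<le> (real (Suc DIM('a)) * real l) ^ N * (Cg * (h * E))"
    using h0 E0 1 le' by (intro mult_right_mono power_increasing) (auto simp: Cg_def)
  finally show "\<bar>ell (\<lambda>t. bmono V \<alpha> t * (\<Prod>i\<in>S. tfac C l i t))\<bar> \<le> Ct * (h * E)" by (simp add: Ct_def mult.assoc)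
  show "cts (\<lambda>t. bmono V \<alpha> t * (\<Prod>i\<in>S. tfac C l i t))"
    unfolding eq by (intro cts_mult cts_bmono ep(2)) auto
qed

text \<open>The product rule for \<open>tchi\<close> times a coordinate has 2 d + l + 1 terms, and l
  + d + 1 times B bounds the gradient of each factor.\<close>

definition Cd where "Cd = (2 * real DIM('a) + real l + 1) * (real l + real DIM('a) + 1) * Ct"

lemma Cd0: "Cd \<ge> 0" unfolding Cd_def using Ct0 by (intro mult_nonneg_nonneg) auto

text \<open>In every term of the product rule at most one copy of a facet coordinate is lost, so
  each term is a moment that \<open>ell_tfac_le\<close> controls.\<close>

lemma test_gradient_bound:
  assumes VC: "V = insert a C" "a \<notin> C" and l: "l > 0" and g: "\<gamma> \<in> lindices C l" and v: "v \<in> C"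
    and B: "\<And>v. norm (bgrad V v) \<le> B"
  shows "\<bar>LINT x:interior (convex hull V)|lebesgue. w x * (grad (\<lambda>x. tchi C l \<gamma> (bary V x) * bary V x v) x \<bullet> e)\<bar>
    \<le> Cd * (B * norm e) * (h * E)"
proof -
  have fC: "finite C" "card C = DIM('a)" using VC fV by auto
  define I where "I = tidx C \<gamma>"
  have fI: "finite I" "card I = 2 * DIM('a) + l" unfolding I_def using fC card_tidx[OF fC(1) g] finite_tidx[OF fC(1)] by auto
  have cI: "(u, c) \<in> I" if "u \<in> C" "c < 2" for u c using that by (auto simp: I_def tidx_def lidx_def)
  have B0: "B \<ge> 0" using B norm_ge_zero order_trans by blast
  define G where "G = tgrad V C l"
  \<comment> \<open>The exponent vector of the extra coordinate of v, which turns that factor into a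
    monomial.\<close>
  define one where "one = (\<lambda>u. if u = v then 1 else 0 :: nat)"
  define r where "r S t = bmono V one t * (\<Prod>i\<in>S. tfac C l i t)" for S t
  define r0 where "r0 t = bmono V (\<lambda>u. 0) t * (\<Prod>i\<in>I. tfac C l i t)" for t
  have vV: "v \<in> V" using v VC by simp
  have so: "sum one V = 1" using vV fV(1) by (simp add: one_def)
  have bo: "bmono V one t = t v" for t
    using vV fV(1) by (simp add: bmono_def one_def if_distrib[of "\<lambda>k. _ ^ k"] cong: if_cong)
  \<comment> \<open>This degree count, together with the next line, is what the exponent l + 2 of
    the normalising weight has to allow.\<close>
  have "2 * DIM('a) + l \<le> N" by (simp add: N_def)
  moreover have "1 + (2 * DIM('a) + l - 1) \<le> N" by (simp add: N_def)
  ultimately have N: "sum one V + card (I - {i}) \<le> N" "sum (\<lambda>u. 0) V + card I \<le> N" if "i \<in> I" for i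
    using fI so that by (auto simp: card_Diff_singleton)
  have ri: "\<bar>ell (r (I - {i}))\<bar> \<le> Ct * (h * E)" "cts (r (I - {i}))" if i: "i \<in> I" for i
  proof -
    have ex: "\<exists>c<2. (u, c) \<in> I - {i}" if "u \<in> C" for u
      using cI[OF that, of 0] cI[OF that, of 1] by (cases "i = (u, 0)") force+
    have sub: "I - {i} \<subseteq> tidx C \<gamma>" by (auto simp: I_def)
    show "\<bar>ell (r (I - {i}))\<bar> \<le> Ct * (h * E)" "cts (r (I - {i}))"
      unfolding r_def[abs_def] by (rule ell_tfac_le[OF VC l sub ex N(1)[OF i]]; assumption)+
  qed
  have r0: "\<bar>ell r0\<bar> \<le> Ct * (h * E)" "cts r0"
  proof -
    have ex: "\<exists>c<2. (u, c) \<in> I" if "u \<in> C" for u using cI[OF that, of 0] by force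
    have sub: "I \<subseteq> tidx C \<gamma>" by (auto simp: I_def)
    have le: "sum (\<lambda>u. 0) V + card I \<le> N" using fI \<open>2 * DIM('a) + l \<le> N\<close> by simp
    show "\<bar>ell r0\<bar> \<le> Ct * (h * E)" "cts r0"
      unfolding r0_def[abs_def] by (rule ell_tfac_le[OF VC l sub ex le]; assumption)+
  qed
  define R where "R t = (\<Sum>i\<in>I. (G i \<bullet> e) * r (I - {i}) t) + (bgrad V v \<bullet> e) * r0 t" for t
  have gr: "grad (\<lambda>x. tchi C l \<gamma> (bary V x) * bary V x v) x \<bullet> e = R (bary V x)" for x
  proof -
    have "grad (\<lambda>x. tchi C l \<gamma> (bary V x) * bary V x v) x \<bullet> e
        = tchi C l \<gamma> (bary V x) * (bgrad V v \<bullet> e) + (grad (\<lambda>x. tchi C l \<gamma> (bary V x)) x \<bullet> e) * bary V x v"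
      by (rule grad_inner[OF has_derivative_mult[OF Ck_has_derivative_grad[OF Ck_tchi[OF V, of "Suc 0"]] bary_has_derivative[OF V]]])
    moreover have "grad (\<lambda>x. tchi C l \<gamma> (bary V x)) x \<bullet> e = (\<Sum>i\<in>I. (G i \<bullet> e) * (\<Prod>j\<in>I - {i}. tfac C l j (bary V x)))"
      unfolding tchi_def I_def[symmetric] G_def
      by (rule grad_prod[OF tfac_bary_has_derivative[OF V]])
    ultimately show ?thesis
      by (simp add: R_def r_def r0_def bo tchi_def I_def[symmetric] sum_distrib_left mult_ac bmono_def[of V "\<lambda>u. 0"])
  qed
  have "(LINT x:interior (convex hull V)|lebesgue. w x * (grad (\<lambda>x. tchi C l \<gamma> (bary V x) * bary V x v) x \<bullet> e)) = ell R"
    unfolding gr ell_def ..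
  also have "ell R = (\<Sum>i\<in>I. (G i \<bullet> e) * ell (r (I - {i}))) + (bgrad V v \<bullet> e) * ell r0"
  proof -
    have "cts (\<lambda>t. \<Sum>i\<in>I. (G i \<bullet> e) * r (I - {i}) t)" "cts (\<lambda>t. (bgrad V v \<bullet> e) * r0 t)"
      using ri(2) r0(2) unfolding cts_def by (auto intro!: continuous_intros)
    then show ?thesis unfolding R_def[abs_def] by (simp add: ell_add ell_lincomb[OF ri(2)] ell_scale)
  qed
  also have "\<bar>\<dots>\<bar> \<le> (\<Sum>i\<in>I. ((real l + real DIM('a) + 1) * B * norm e) * (Ct * (h * E))) + ((real l + real DIM('a) + 1) * B * norm e) * (Ct * (h * E))"
  proof (rule order_trans[OF abs_triangle_ineq add_mono])
    have m: "\<bar>z \<bullet> e\<bar> \<le> (real l + real DIM('a) + 1) * B * norm e" if "norm z \<le> (real l + real DIM('a) + 1) * B" for z :: 'a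
      using Cauchy_Schwarz_ineq2[of z e] mult_right_mono[OF that, of "norm e"] by simp
    have 0: "0 \<le> (real l + real DIM('a) + 1) * B * norm e" using B0 by simp
    show "\<bar>\<Sum>i\<in>I. (G i \<bullet> e) * ell (r (I - {i}))\<bar> \<le> (\<Sum>i\<in>I. ((real l + real DIM('a) + 1) * B * norm e) * (Ct * (h * E)))"
    proof (rule order_trans[OF sum_abs sum_mono])
      fix i assume i: "i \<in> I"
      have "norm (G i) \<le> (real l + real DIM('a) + 1) * B" unfolding G_def using VC by (intro tgrad_le[OF V _ B]) auto
      from mult_mono[OF m[OF this] ri(1)[OF i] 0] show "\<bar>(G i \<bullet> e) * ell (r (I - {i}))\<bar> \<le> ((real l + real DIM('a) + 1) * B * norm e) * (Ct * (h * E))"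
        by (simp only: abs_mult abs_ge_zero)
    qed
    have "norm (bgrad V v) \<le> (real l + real DIM('a) + 1) * B"
      using B[of v] mult_right_mono[of 1 "real l + real DIM('a) + 1" B] B0 by simp
    from mult_mono[OF m[OF this] r0(1) 0] show "\<bar>(bgrad V v \<bullet> e) * ell r0\<bar> \<le> ((real l + real DIM('a) + 1) * B * norm e) * (Ct * (h * E))"
      by (simp only: abs_mult abs_ge_zero)
  qed
  also have "\<dots> = Cd * (B * norm e) * (h * E)" using fI by (simp add: Cd_def algebra_simps)
  finally show ?thesis .
qed

lemma test_flux_bound:
  assumes VC: "V = insert a C" "a \<notin> C" and l: "l > 0" and g: "\<gamma> \<in> lindices C l" and v: "v \<in> C"
  shows "\<bar>LINT x:interior (convex hull V)|lebesgue. (gw x \<bullet> e) * (tchi C l \<gamma> (bary V x) * bary V x v)\<bar> \<le> norm e * real l ^ l * E"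
proof -
  have fC: "finite C" using VC fV by auto
  have "\<bar>LINT x:interior (convex hull V)|lebesgue. (gw x \<bullet> e) * (tchi C l \<gamma> (bary V x) * bary V x v)\<bar>
     \<le> (LINT x:interior (convex hull V)|lebesgue. (norm e * real l ^ l) * norm (gw x))"
  proof (rule set_integral_abs_le)
    show "set_integrable lebesgue (interior (convex hull V)) (\<lambda>x. (gw x \<bullet> e) * (tchi C l \<gamma> (bary V x) * bary V x v))"
      by (intro set_integrable_mult_continuous[OF set_integrable_inner[OF gwi] bK] continuous_on_mult
         Ck_imp_continuous_on[OF Ck_tchi[OF V, of 0]] continuous_bary[OF V])
    show "set_integrable lebesgue (interior (convex hull V)) (\<lambda>x. (norm e * real l ^ l) * norm (gw x))"
      by (intro set_integrable_mult_right set_integrable_norm_gradient gwi)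
    fix x assume "x \<in> interior (convex hull V)"
    then have x: "x \<in> convex hull V" using interior_subset by blast
    have b: "0 \<le> bary V x u" "bary V x u \<le> 1" if "u \<in> V" for u
      using x that mem_simplex_iff[OF V] bary_le_1[OF V x] by auto
    have "0 \<le> (\<Prod>v\<in>C. bary V x v)" "(\<Prod>v\<in>C. bary V x v) \<le> 1" using b VC by (auto intro!: prod_nonneg prod_le_1)
    then have "(\<Prod>v\<in>C. bary V x v)\<^sup>2 \<le> 1" by (simp add: power_le_one)
    moreover have "\<bar>lag C l \<gamma> (bary V x)\<bar> \<le> real l ^ l"
      using b VC bary_sum_face_le[OF V _ x, of C] by (intro lag_abs_le[OF fC g _ _ l]) auto
    ultimately have "\<bar>tchi C l \<gamma> (bary V x)\<bar> \<le> 1 * real l ^ l"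
      unfolding tchi_eq[OF fC] abs_mult by (intro mult_mono) auto
    then have "\<bar>tchi C l \<gamma> (bary V x)\<bar> * \<bar>bary V x v\<bar> \<le> real l ^ l * 1"
      using b[of v] v VC by (intro mult_mono) auto
    then have "\<bar>gw x \<bullet> e\<bar> * (\<bar>tchi C l \<gamma> (bary V x)\<bar> * \<bar>bary V x v\<bar>) \<le> (norm (gw x) * norm e) * real l ^ l"
      using Cauchy_Schwarz_ineq2[of "gw x" e] by (intro mult_mono) auto
    then show "\<bar>(gw x \<bullet> e) * (tchi C l \<gamma> (bary V x) * bary V x v)\<bar> \<le> (norm e * real l ^ l) * norm (gw x)"
      by (simp add: abs_mult mult_ac)
  qed
  then show ?thesis by (simp add: E_def)
qed

end

text \<open>That the opposite vertices lie on different sides of the facet is not assumed;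
  \<open>interior_patch\<close> derives it from \<open>meet\<close>.\<close>

locale adjacent =
  fixes a a' :: "'a::euclidean_space" and C :: "'a set"
  assumes W: "full_simplex (insert a C)" and W': "full_simplex (insert a' C)" and aC: "a \<notin> C" "a' \<notin> C"
    and meet: "convex hull (insert a C) \<inter> convex hull (insert a' C) = convex hull C"
begin

lemma adjacent_sym: "adjacent a' a C"
  using W W' aC meet by unfold_locales (auto simp: Int_commute)

abbreviation K where "K \<equiv> convex hull (insert a C)"
abbreviation K' where "K' \<equiv> convex hull (insert a' C)"

lemma fC: "finite C" "card C = DIM('a)" "C \<noteq> {}"
proof -
  show 1: "finite C" using full_simplex_finite[OF W] by simp
  then show 2: "card C = DIM('a)" using W aC by (simp add: full_simplex_def)
  then show "C \<noteq> {}" by auto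
qed

lemma bary_common:
  assumes "x \<in> convex hull C" shows "v \<in> C \<Longrightarrow> bary (insert a C) x v = bary (insert a' C) x v"
    "bary (insert a C) x a = 0"
proof -
  note f = bary_face[OF W' subset_insertI assms]
  show "v \<in> C \<Longrightarrow> bary (insert a C) x v = bary (insert a' C) x v"
    using bary_subset(1)[OF W subset_insertI f(2,3)] by simp
  show "bary (insert a C) x a = 0" using bary_face(1)[OF W subset_insertI assms aC(1)] .
qed

text \<open>Only points of the facet itself need an argument. The coordinate of a' is a fixed
  negative multiple \<open>\<kappa>\<close> of that of a, so near such a point every point belongs
  to K or to K', according to the sign.\<close>

lemma interior_patch:
  assumes x: "x \<in> K" "\<And>v. v \<in> C \<Longrightarrow> 0 < bary (insert a C) x v"
  shows "x \<in> interior (K \<union> K')"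
proof (cases "bary (insert a C) x a > 0")
  case True
  then have "x \<in> interior K" using x mem_interior_simplex_iff[OF W] by simp
  then show ?thesis using interior_mono[of K "K \<union> K'"] by blast
next
  case False
  then have xa: "bary (insert a C) x a = 0" using x(1) mem_simplex_iff[OF W] by force
  have xF: "x \<in> convex hull C"
  proof -
    have "sum (bary (insert a C) x) C = 1" "(\<Sum>v\<in>C. bary (insert a C) x v *\<^sub>R v) = x"
      using bary_props(2,3)[OF W, of x] fC aC xa by simp_all
    moreover have "\<forall>v\<in>C. 0 \<le> bary (insert a C) x v" using x(2) by (simp add: less_imp_le)
    ultimately show ?thesis unfolding convex_hull_finite[OF fC(1)] by blast
  qed
  then have xb: "0 < bary (insert a' C) x v" if "v \<in> C" for v using bary_common(1)[OF xF that] x(2)[OF that] by simp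
  have xa': "bary (insert a' C) x a' = 0" using adjacent.bary_common(2)[OF adjacent_sym xF] .
  define \<kappa> where "\<kappa> = bary (insert a' C) a a'"
  have rel: "bary (insert a' C) y a' = bary (insert a C) y a * \<kappa>" for y
  \<comment> \<open>The coordinate of a' vanishes at all vertices in C, so as an affine function it
    is determined by its value at a.\<close>
  proof -
    define G where "G = bgrad (insert a' C) a'"
    have y: "y - x = (\<Sum>v\<in>insert a C. bary (insert a C) y v *\<^sub>R (v - x))"
      using bary_props(2,3)[OF W, of y] by (simp add: scaleR_diff_right sum_subtractf flip: scaleR_sum_left)
    have b: "bary (insert a' C) v a' = G \<bullet> (v - x)" for v
      using bary_affine[OF W', of v a' x] xa' by (simp add: G_def)
    have "bary (insert a' C) y a' = (\<Sum>v\<in>insert a C. bary (insert a C) y v * bary (insert a' C) v a')"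
      unfolding b by (subst y) (simp add: inner_sum_right)
    also have "\<dots> = bary (insert a C) y a * \<kappa>"
      using fC aC bary_vertex[OF W', of _ a'] by (simp add: \<kappa>_def) (rule sum.neutral, auto)
    finally show ?thesis .
  qed
  have O: "open (\<Inter>v\<in>C. {y. 0 < bary (insert a' C) y v})"
    using fC by (intro open_INT ballI open_Collect_less continuous_bary[OF W'] continuous_on_const) auto
  have O': "open (\<Inter>v\<in>C. {y. 0 < bary (insert a C) y v})"
    using fC by (intro open_INT ballI open_Collect_less continuous_bary[OF W] continuous_on_const) auto
  \<comment> \<open>If \<open>\<kappa>\<close> were nonnegative, a point slightly inside K on the
    segment from x to a would also lie in K' and hence in the facet, although its coordinate of a is
    positive.\<close>
  have k: "\<kappa> < 0"
  proof (rule ccontr)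
    assume "\<not> \<kappa> < 0"
    have "((\<lambda>s::real. x + s *\<^sub>R (a - x)) \<longlongrightarrow> x + 0 *\<^sub>R (a - x)) (at_right 0)" by (intro tendsto_intros)
    moreover have "x + 0 *\<^sub>R (a - x) \<in> (\<Inter>v\<in>C. {y. 0 < bary (insert a' C) y v})" using xb by simp
    ultimately have "eventually (\<lambda>s. x + s *\<^sub>R (a - x) \<in> (\<Inter>v\<in>C. {y. 0 < bary (insert a' C) y v})) (at_right 0)"
      using topological_tendstoD[OF _ O] by blast
    moreover have "eventually (\<lambda>s::real. s \<in> {0<..<1}) (at_right 0)"
      by (rule eventually_at_right_real) simp
    ultimately have "eventually (\<lambda>s. s \<in> {0<..<1} \<and> x + s *\<^sub>R (a - x) \<in> (\<Inter>v\<in>C. {y. 0 < bary (insert a' C) y v})) (at_right 0)"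
      by eventually_elim simp
    from eventually_happens'[OF _ this] obtain s where s: "0 < s" "s < 1"
      and yb: "\<And>v. v \<in> C \<Longrightarrow> 0 < bary (insert a' C) (x + s *\<^sub>R (a - x)) v"
      by auto
    define y where "y = x + s *\<^sub>R (a - x)"
    have ya: "bary (insert a C) y a = s"
      unfolding y_def bary_convex_combination[OF W] xa using bary_vertex[OF W, of a a] by simp
    have "x \<in> K" "a \<in> K" using x hull_inc[of a "insert a C"] by auto
    then have "(1 - s) *\<^sub>R x + s *\<^sub>R a \<in> K" using s by (intro convexD_alt) auto
    then have "y \<in> K" by (simp add: y_def algebra_simps)
    moreover have "y \<in> K'"
      unfolding mem_simplex_iff[OF W'] using yb rel[of y] ya s \<open>\<not> \<kappa> < 0\<close> by (auto simp: y_def[symmetric] intro: less_imp_le)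
    ultimately have "y \<in> convex hull C" using meet by blast
    then show False using bary_common(2) ya s by simp
  qed
  let ?O = "(\<Inter>v\<in>C. {y. 0 < bary (insert a' C) y v}) \<inter> (\<Inter>v\<in>C. {y. 0 < bary (insert a C) y v})"
  have "y \<in> K \<union> K'" if y: "y \<in> ?O" for y
  proof (cases "bary (insert a C) y a \<ge> 0")
    case True
    then show ?thesis using y mem_simplex_iff[OF W] by (auto intro: less_imp_le)
  next
    case False
    then have "bary (insert a' C) y a' \<ge> 0" using rel[of y] k by (simp add: mult_nonpos_nonpos)
    then show ?thesis using y mem_simplex_iff[OF W'] by (auto intro: less_imp_le)
  qed
  moreover have "x \<in> ?O" using x xb by simp
  moreover have "open ?O" using O O' by (rule open_Int)
  ultimately show ?thesis by (meson interiorI subsetI)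
qed

end

lemma grad_mult:
  assumes "Ck (Suc 0) f" "Ck (Suc 0) g"
  shows "grad (\<lambda>x. f x * g x) x \<bullet> e = f x * (grad g x \<bullet> e) + (grad f x \<bullet> e) * g x"
  by (rule grad_inner[OF has_derivative_mult[OF assms[THEN Ck_has_derivative_grad]]])

lemma grad_diff:
  assumes "Ck (Suc 0) f" "Ck (Suc 0) g"
  shows "grad (\<lambda>x. f x - g x) x = grad f x - grad g x"
  by (rule grad_eqI)
    (use has_derivative_diff[OF assms[THEN Ck_has_derivative_grad]] in \<open>simp add: inner_diff_left\<close>)

lemma Ck_diff: "Ck k f \<Longrightarrow> Ck k g \<Longrightarrow> Ck k (\<lambda>x. f x - g x)"
  using Ck_add[of k f "\<lambda>x. -1 * g x"] Ck_mult[OF Ck_const[of k "-1"], of g] by simp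

lemma Ck_sum: "(\<And>i. i \<in> I \<Longrightarrow> Ck k (f i)) \<Longrightarrow> Ck k (\<lambda>x. \<Sum>i\<in>I. f i x)"
  by (induction I rule: infinite_finite_induct) (auto intro: Ck_const Ck_add)

text \<open>The factors are linear forms thanks to the term with the coordinate sum. This
  homogeneity is what makes Euler's identity available.\<close>

lemma lag_scale:
  assumes "finite C" "\<gamma> \<in> lindices C l" shows "lag C l \<gamma> (\<lambda>v. s * t v) = s ^ l * lag C l \<gamma> t"
proof -
  have "lfac C l i (\<lambda>v. s * t v) = s * lfac C l i t" for i
    by (simp add: lfac_def sum_distrib_left[symmetric] right_diff_distrib mult.left_commute)
  then show ?thesis by (simp add: lag_def prod.distrib card_lidx[OF assms])
qed

text \<open>Applied with w = u - p and gw = g - grad p, so that the sums give back u and g. The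
  first two integrals are bounded by moments and fluxes, the third by the divergence
  identity.\<close>

lemma (in simplex_moments) integral_split:
  assumes q: "Ck (Suc 0) q" and p: "Ck (Suc 0) p"
  defines "I \<equiv> interior (convex hull V)"
  shows "(LINT x:I|lebesgue. (w x + p x) * (grad q x \<bullet> e) + ((gw x + grad p x) \<bullet> e) * q x)
    = (LINT x:I|lebesgue. w x * (grad q x \<bullet> e)) + (LINT x:I|lebesgue. (gw x \<bullet> e) * q x)
      + (LINT x:I|lebesgue. p x * (grad q x \<bullet> e) + (grad p x \<bullet> e) * q x)"
proof -
  note gc = Ck_continuous_grad[OF q] Ck_continuous_grad[OF p] Ck_imp_continuous_on[OF q] Ck_imp_continuous_on[OF p]
  have i1: "set_integrable lebesgue I (\<lambda>x. w x * (grad q x \<bullet> e))"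
    unfolding I_def by (intro set_integrable_mult_continuous[OF wi bK] continuous_intros gc)
  have i2: "set_integrable lebesgue I (\<lambda>x. (gw x \<bullet> e) * q x)"
    unfolding I_def by (intro set_integrable_mult_continuous[OF set_integrable_inner[OF gwi] bK] gc)
  have i3: "set_integrable lebesgue I (\<lambda>x. p x * (grad q x \<bullet> e) + (grad p x \<bullet> e) * q x)"
    unfolding I_def using compact_imp_bounded[OF finite_imp_compact_convex_hull[OF fV(1)]]
    by (intro set_integrable_continuous_interior continuous_intros gc)
  have "(w x + p x) * (grad q x \<bullet> e) + ((gw x + grad p x) \<bullet> e) * q x
      = (w x * (grad q x \<bullet> e) + (gw x \<bullet> e) * q x) + (p x * (grad q x \<bullet> e) + (grad p x \<bullet> e) * q x)" for x
    by (simp add: inner_add_left algebra_simps)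
  then show ?thesis by (simp only: set_integral_add[OF i1 i2] set_integral_add[OF set_integral_add(1)[OF i1 i2] i3])
qed

context adjacent
begin

lemma interior_Int_facet: "x \<in> interior K \<Longrightarrow> x \<notin> convex hull C"
  using bary_common(2) mem_interior_simplex_iff[OF W] by fastforce

lemma pieces_pair: "pieces {K, K'}" and K_neq: "K \<noteq> K'"
proof -
  have d: "interior K \<inter> interior K' = {}"
    using interior_Int_facet meet interior_subset by blast
  \<comment> \<open>An instance with zero functions, made only to obtain a point with positive
    coordinates.\<close>
  have "simplex_moments (insert a C) (\<lambda>x. 0) (\<lambda>x. 0) (diameter (insert a C)) 0"
    by unfold_locales
      (use W full_simplex_finite[OF W] in \<open>auto simp: weak_grad_def set_integrable_def set_lebesgue_integral_def
        intro!: diameter_bounded_bound[of "insert a C", unfolded dist_norm] finite_imp_bounded\<close>)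
  then obtain m where m: "\<And>v. v \<in> insert a C \<Longrightarrow> 0 < bary (insert a C) m v"
    using simplex_moments.centroid by blast
  then have "m \<in> interior K" using mem_interior_simplex_iff[OF W] by blast
  then show "K \<noteq> K'" using d by auto
  show "pieces {K, K'}"
    by standard (use d fC in \<open>auto intro!: finite_imp_compact_convex_hull\<close>)
qed

text \<open>The two functions agree on the common facet and vanish on all other facets. Glued and
  extended by 0 they form a continuous function, to which the piecewise integration by parts
  applies.\<close>

lemma pair_formula:
  assumes q: "Ck (Suc 0) q" and q': "Ck (Suc 0) q'"
    and agree: "\<And>x. x \<in> convex hull C \<Longrightarrow> q x = q' x"
    and van: "\<And>x v. x \<in> K \<Longrightarrow> v \<in> C \<Longrightarrow> bary (insert a C) x v = 0 \<Longrightarrow> q x = 0"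
    and van': "\<And>x v. x \<in> K' \<Longrightarrow> v \<in> C \<Longrightarrow> bary (insert a' C) x v = 0 \<Longrightarrow> q' x = 0"
  shows "(LINT x:interior K|lebesgue. grad q x \<bullet> e) + (LINT x:interior K'|lebesgue. grad q' x \<bullet> e) = 0"
    and "weak_grad \<Omega> u g \<Longrightarrow> open \<Omega> \<Longrightarrow> interior (K \<union> K') \<subseteq> \<Omega> \<Longrightarrow>
      (LINT x:interior K|lebesgue. u x * (grad q x \<bullet> e) + (g x \<bullet> e) * q x)
      + (LINT x:interior K'|lebesgue. u x * (grad q' x \<bullet> e) + (g x \<bullet> e) * q' x) = 0"
proof -
  interpret P: pieces "{K, K'}" by (rule pieces_pair)
  define f where "f x = (if x \<in> K then q x else if x \<in> K' then q' x else 0)" for x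
  define p where "p X = (if X = K then q else q')" for X
  have p: "Ck (Suc 0) (p X)" if "X \<in> {K, K'}" for X using q q' by (simp add: p_def)
  have fK': "f x = q' x" if "x \<in> K'" for x
    using that agree meet by (auto simp: f_def)
  have fp: "f x = p X x" if "X \<in> {K, K'}" "x \<in> X" for X x
    using that fK' by (cases "X = K") (auto simp: p_def f_def)
  have f0: "f x = 0" if "x \<notin> \<Union>{K, K'}" for x using that by (simp add: f_def)
  have cK: "closed K" "closed K'" using fC by (auto intro!: compact_imp_closed finite_imp_compact_convex_hull)
  have z: "f x = 0" if x: "x \<notin> interior (K \<union> K')" for x
  proof (cases "x \<in> K")
    case True
    then obtain v where v: "v \<in> C" "\<not> 0 < bary (insert a C) x v" using interior_patch x by blast
    then have "bary (insert a C) x v = 0" using True mem_simplex_iff[OF W] by force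
    then show ?thesis using van[OF True v(1)] True by (simp add: f_def)
  next
    case False
    show ?thesis
    proof (cases "x \<in> K'")
      case True
      then obtain v where v: "v \<in> C" "\<not> 0 < bary (insert a' C) x v"
        using adjacent.interior_patch[OF adjacent_sym True] x by (metis Un_commute)
      then have "bary (insert a' C) x v = 0" using True mem_simplex_iff[OF W'] by force
      then show ?thesis using van'[OF True v(1)] fK'[OF True] by simp
    qed (use False in \<open>simp add: f_def\<close>)
  qed
  have fc: "continuous_on UNIV f"
  proof -
    have "continuous_on K f"
      using Ck_imp_continuous_on[OF q] by (subst continuous_on_cong[OF refl, of K f q]) (auto simp: f_def)
    moreover have "continuous_on K' f"
      using Ck_imp_continuous_on[OF q'] by (subst continuous_on_cong[OF refl, of K' f q']) (auto simp: fK')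
    ultimately have "continuous_on (K \<union> K') f" using cK by (intro continuous_on_closed_Un)
    moreover have "continuous_on (- interior (K \<union> K')) f"
      by (subst continuous_on_cong[OF refl, of _ f "\<lambda>x. 0"]) (auto simp: z)
    ultimately have "continuous_on (K \<union> K' \<union> (- interior (K \<union> K'))) f"
      using cK continuous_on_closed_Un[of "K \<union> K'" "- interior (K \<union> K')" f] by auto
    moreover have "K \<union> K' \<union> (- interior (K \<union> K')) = UNIV" using interior_subset by blast
    ultimately show ?thesis by simp
  qed
  note hyps = p fc fp f0
  have "(\<Sum>X\<in>{K, K'}. LINT x:interior X|lebesgue. grad (p X) x \<bullet> e) = 0"
    by (rule P.integral_pw_grad_eq_0[of p f]) (use hyps in auto)
  then show "(LINT x:interior K|lebesgue. grad q x \<bullet> e) + (LINT x:interior K'|lebesgue. grad q' x \<bullet> e) = 0"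
    using K_neq by (simp add: p_def)
  assume wk: "weak_grad \<Omega> u g" "open \<Omega>" "interior (K \<union> K') \<subseteq> \<Omega>"
  \<comment> \<open>The barycentre of the common facet. It lies in both elements, so by convexity
    the patch is star-shaped about it, and the positive facet coordinates of m put the dilated
    points into the interior.\<close>
  define m where "m = (\<Sum>v\<in>C. (1 / real (card C)) *\<^sub>R v)"
  have m1: "(\<Sum>v\<in>C. 1 / real (card C)) = 1" using fC by simp
  have bm: "0 < bary (insert a C) m v" "0 < bary (insert a' C) m v" if "v \<in> C" for v
    using that bary_subset(1)[OF W subset_insertI m1 m_def[symmetric] that]
      bary_subset(1)[OF W' subset_insertI m1 m_def[symmetric] that] fC by (auto simp: card_gt_0_iff)
  have mC: "m \<in> convex hull C"
    unfolding convex_hull_finite[OF fC(1)]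
    by (intro CollectI exI[of _ "\<lambda>v. 1 / real (card C)"] conjI ballI m1 m_def[symmetric]) simp
  then have mK: "m \<in> K" "m \<in> K'" using meet by auto
  have star: "m + t *\<^sub>R (x - m) \<in> interior (\<Union>{K, K'})" if x: "x \<in> \<Union>{K, K'}" and t: "0 < t" "t < 1" for x t
  proof -
    have cv: "m + t *\<^sub>R (x - m) = (1 - t) *\<^sub>R m + t *\<^sub>R x" by (simp add: algebra_simps)
    have pos: "0 < c + t * (c' - c)" if "0 < c" "0 \<le> c'" for c c' :: real
      using add_pos_nonneg[of "(1 - t) * c" "t * c'"] that t by (simp add: algebra_simps)
    show ?thesis
    proof (cases "x \<in> K")
      case True
      have "m + t *\<^sub>R (x - m) \<in> K" unfolding cv using t mK True by (intro convexD_alt) auto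
      then have "m + t *\<^sub>R (x - m) \<in> interior (K \<union> K')"
        by (rule interior_patch) (use True bm mem_simplex_iff[OF W] in \<open>auto simp: bary_convex_combination[OF W] intro!: pos\<close>)
      then show ?thesis by simp
    next
      case False
      then have xK': "x \<in> K'" using x by auto
      have "m + t *\<^sub>R (x - m) \<in> K'" unfolding cv using t mK xK' by (intro convexD_alt) auto
      then have "m + t *\<^sub>R (x - m) \<in> interior (K' \<union> K)"
        by (rule adjacent.interior_patch[OF adjacent_sym])
          (use xK' bm mem_simplex_iff[OF W'] in \<open>auto simp: bary_convex_combination[OF W'] intro!: pos\<close>)
      then show ?thesis by (simp add: Un_commute)
    qed
  qed
  have "(\<Sum>X\<in>{K, K'}. LINT x:interior X|lebesgue. u x * (grad (p X) x \<bullet> e) + (g x \<bullet> e) * p X x) = 0"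
    by (rule P.weak_grad_pw[of p f \<Omega> u g m]) (use hyps wk star in auto)
  then show "(LINT x:interior K|lebesgue. u x * (grad q x \<bullet> e) + (g x \<bullet> e) * q x)
      + (LINT x:interior K'|lebesgue. u x * (grad q' x \<bullet> e) + (g x \<bullet> e) * q' x) = 0"
    using K_neq by (simp add: p_def)
qed

text \<open>Euler's identity for homogeneous functions, in divergence form.\<close>

lemma euler_divergence:
  assumes H: "Ck (Suc 0) H" and hom: "\<And>s. s > 0 \<Longrightarrow> H (a + s *\<^sub>R (x - a)) = s ^ k * H x"
  shows "(\<Sum>v\<in>C. grad (\<lambda>x. H x * bary (insert a C) x v) x \<bullet> (v - a)) = (real DIM('a) + real k) * H x"
proof -
  let ?V = "insert a C"
  \<comment> \<open>On the edge from a to v the coordinate of v rises from 0 to 1; summed over C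
    this contributes the dimension.\<close>
  have 1: "bgrad ?V v \<bullet> (v - a) = 1" if v: "v \<in> C" for v
  proof -
    have "v \<noteq> a" using v aC by auto
    then show ?thesis
      using bary_affine[OF W, of v v a] bary_vertex[OF W, of v v] bary_vertex[OF W, of a v] v by simp
  qed
  have xa: "(\<Sum>v\<in>C. bary ?V x v *\<^sub>R (v - a)) = x - a"
  proof -
    have "(\<Sum>v\<in>?V. bary ?V x v *\<^sub>R (v - a)) = x - a"
      using bary_props(2,3)[OF W, of x] by (simp add: scaleR_diff_right sum_subtractf flip: scaleR_sum_left)
    then show ?thesis using fC aC by simp
  qed
  have eu: "grad H x \<bullet> (x - a) = real k * H x"
  proof -
    have "((\<lambda>s. H (a + s *\<^sub>R (x - a))) has_derivative (\<lambda>s. grad H x \<bullet> (s *\<^sub>R (x - a)))) (at 1)"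
      by (rule has_derivative_compose[of "\<lambda>s. a + s *\<^sub>R (x - a)" "\<lambda>s. s *\<^sub>R (x - a)" 1 UNIV H])
        (use Ck_has_derivative_grad[OF H, of x] in \<open>auto intro!: derivative_eq_intros\<close>)
    moreover have "(\<lambda>s. grad H x \<bullet> (s *\<^sub>R (x - a))) = (*) (grad H x \<bullet> (x - a))" by (auto simp: mult.commute)
    ultimately have "((\<lambda>s. H (a + s *\<^sub>R (x - a))) has_real_derivative (grad H x \<bullet> (x - a))) (at 1)"
      by (simp add: has_field_derivative_def)
    moreover have "((\<lambda>s. H (a + s *\<^sub>R (x - a))) has_real_derivative (real k * H x)) (at 1)"
    proof -
      have "((\<lambda>s. s ^ k * H x) has_real_derivative (real k * H x)) (at 1)"
        by (auto intro!: derivative_eq_intros)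
      then show ?thesis
        by (rule has_field_derivative_transform_within_open[of _ _ _ "{0<..}"]) (auto simp: hom)
    qed
    ultimately show ?thesis by (rule DERIV_unique)
  qed
  have "grad (\<lambda>x. H x * bary ?V x v) x \<bullet> (v - a) = H x + bary ?V x v * (grad H x \<bullet> (v - a))" if v: "v \<in> C" for v
    using grad_mult[OF H Ck_bary[OF W], of v x "v - a"] grad_inner[OF bary_has_derivative[OF W], of v x "v - a"] 1[OF v] by simp
  then have "(\<Sum>v\<in>C. grad (\<lambda>x. H x * bary ?V x v) x \<bullet> (v - a)) = real (card C) * H x + grad H x \<bullet> (\<Sum>v\<in>C. bary ?V x v *\<^sub>R (v - a))"
    by (simp add: sum.distrib inner_sum_right)
  then show ?thesis unfolding xa eu fC(2) by (simp add: distrib_right)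
qed

text \<open>The jump on the facet is extended homogeneously about \<open>a\<close>. Testing with
  \<open>(\<Prod>v. \<lambda>\<^sub>v)\<^sup>2 lag\<^sub>\<gamma> \<lambda>\<^sub>v (v - a)\<close>, which vanishes on the boundary of the patch, Euler's identity turns the
  facet term into an integral over the element, so that no trace on the facet is needed.\<close>

lemma jump_estimate:
  assumes \<Omega>: "open \<Omega>" "interior (K \<union> K') \<subseteq> \<Omega>" and wk: "weak_grad \<Omega> u g" and l: "l > 0"
    and p: "polyd l p" and p': "polyd l p'"
    and sm: "simplex_moments (insert a C) (\<lambda>x. u x - p x) (\<lambda>x. g x - grad p x) h l"
    and sm': "simplex_moments (insert a' C) (\<lambda>x. u x - p' x) (\<lambda>x. g x - grad p' x) h' l"
    and B: "\<And>v. norm (bgrad (insert a C) v) \<le> B" "\<And>v. norm (bgrad (insert a' C) v) \<le> B'" "B * h \<le> \<beta>" "B' * h' \<le> \<beta>"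
    and g: "\<gamma> \<in> lindices C l"
  defines "E \<equiv> LINT x:interior K|lebesgue. norm (g x - grad p x)"
    and "E' \<equiv> LINT x:interior K'|lebesgue. norm (g x - grad p' x)"
  shows "cw DIM('a) l * measure lebesgue K * \<bar>p (lnode C l \<gamma>) - p' (lnode C l \<gamma>)\<bar>
    \<le> real (Suc l) ^ Suc DIM('a) * (real DIM('a) * (simplex_moments.Cd TYPE('a) l * \<beta> + real l ^ l)) * (h * (E + E'))"
proof -
  let ?V = "insert a C" and ?V' = "insert a' C"
  interpret M: simplex_moments ?V "\<lambda>x. u x - p x" "\<lambda>x. g x - grad p x" h l by (rule sm)
  interpret M': simplex_moments ?V' "\<lambda>x. u x - p' x" "\<lambda>x. g x - grad p' x" h' l by (rule sm')
  have EE: "M.E = E" "M'.E = E'" by (simp_all add: M.E_def M'.E_def E_def E'_def)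
  have E0: "E \<ge> 0" "E' \<ge> 0" using M.E0 M'.E0 EE by auto
  have \<beta>0: "\<beta> \<ge> 0" using B(3) B(1)[of a] norm_ge_zero[of "bgrad ?V a"] M.h0 mult_nonneg_nonneg[of B h] by linarith
  define T where "T = real DIM('a) * (M.Cd * \<beta> + real l ^ l) * (h * (E + E'))"
  define J where "J \<gamma> = p (lnode C l \<gamma>) - p' (lnode C l \<gamma>)" for \<gamma>
  define Jt where "Jt x = (\<Sum>\<gamma>\<in>lindices C l. J \<gamma> * lag C l \<gamma> (bary ?V x))" for x
  have Jtc: "Ck k Jt" for k unfolding Jt_def by (intro Ck_sum Ck_mult Ck_const Ck_lag_bary[OF W])
  \<comment> \<open>On the facet the coordinates of the two elements agree and the degree l
    interpolant of p - p' is exact. Thus p - Jt and p' match there and form a continuous function on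
    the patch.\<close>
  have Jtf: "p x - Jt x = p' x" if x: "x \<in> convex hull C" for x
  proof -
    note f = bary_face(2,3)[OF W subset_insertI x]
    have "p x = (\<Sum>\<gamma>\<in>lindices C l. p (lnode C l \<gamma>) * lag C l \<gamma> (bary ?V x))"
      using lagrange_interpolation[OF fC(1) l p f(1)] f(2) by simp
    moreover have "p' x = (\<Sum>\<gamma>\<in>lindices C l. p' (lnode C l \<gamma>) * lag C l \<gamma> (bary ?V x))"
      using lagrange_interpolation[OF fC(1) l p' f(1)] f(2) by simp
    ultimately show ?thesis by (simp add: Jt_def J_def left_diff_distrib sum_subtractf)
  qed
  define X where "X \<gamma> x = tchi C l \<gamma> (bary ?V x)" for \<gamma> x
  define X' where "X' \<gamma> x = tchi C l \<gamma> (bary ?V' x)" for \<gamma> x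
  have Xc: "Ck k (X \<gamma>)" "Ck k (X' \<gamma>)" for k \<gamma>
    unfolding X_def X'_def by (rule Ck_tchi[OF W], rule Ck_tchi[OF W'])
  have H: "\<bar>LINT x:interior K|lebesgue. Jt x * X \<gamma> x\<bar> \<le> T" if g: "\<gamma> \<in> lindices C l" for \<gamma>
  proof -
    define q where "q v x = X \<gamma> x * bary ?V x v" for v x
    define q' where "q' v x = X' \<gamma> x * bary ?V' x v" for v x
    have qc: "Ck k (q v)" "Ck k (q' v)" for k v
      unfolding q_def q'_def by (intro Ck_mult Xc Ck_bary[OF W], intro Ck_mult Xc Ck_bary[OF W'])
    have agree: "q v x = q' v x" if "v \<in> C" "x \<in> convex hull C" for v x
      using bary_common(1)[OF that(2)] tchi_cong[OF fC(1), of "bary ?V x" "bary ?V' x"] that(1)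
      by (simp add: q_def q'_def X_def X'_def)
    have van0: "tchi C l \<gamma> t = 0" if "v \<in> C" "t v = 0" for v t
      using that fC(1) by (auto simp: tchi_eq)
    have van: "q v x = 0" if "u \<in> C" "bary ?V x u = 0" for u v x using van0[of u "bary ?V x"] that by (simp add: q_def X_def)
    have van': "q' v x = 0" if "u \<in> C" "bary ?V' x u = 0" for u v x using van0[of u "bary ?V' x"] that by (simp add: q'_def X'_def)
    have bound: "\<bar>LINT x:interior K|lebesgue. grad (\<lambda>x. Jt x * q v x) x \<bullet> (v - a)\<bar>
       \<le> (M.Cd * \<beta> + real l ^ l) * (h * (E + E'))" if v: "v \<in> C" for v
    proof -
      define e where "e = v - a"
      have eh: "norm e \<le> h" unfolding e_def using M.h[of v a] v by simp
      have ci: "set_integrable lebesgue (interior K) f" "set_integrable lebesgue (interior K') f"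
        if "continuous_on UNIV f" for f :: "'a \<Rightarrow> real"
        using set_integrable_continuous_interior[OF compact_imp_bounded[OF finite_imp_compact_convex_hull] that] fC by auto
      note gc = Ck_continuous_grad[OF Ck_polyd[OF p, of "Suc 0"]] Ck_continuous_grad[OF Ck_polyd[OF p', of "Suc 0"]]
        Ck_continuous_grad[OF qc(1)[of "Suc 0" v]] Ck_continuous_grad[OF qc(2)[of "Suc 0" v]]
        Ck_continuous_grad[OF Jtc[of "Suc 0"]]
        Ck_imp_continuous_on[OF qc(1)[of 0 v]] Ck_imp_continuous_on[OF qc(2)[of 0 v]]
        Ck_imp_continuous_on[OF Jtc[of 0]] Ck_imp_continuous_on[OF Ck_polyd[OF p, of 0]] Ck_imp_continuous_on[OF Ck_polyd[OF p', of 0]]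
      have A: "(LINT x:interior K|lebesgue. u x * (grad (q v) x \<bullet> e) + (g x \<bullet> e) * q v x)
        + (LINT x:interior K'|lebesgue. u x * (grad (q' v) x \<bullet> e) + (g x \<bullet> e) * q' v x) = 0"
        by (rule pair_formula(2)[OF qc agree[OF v] van van' wk \<Omega>])
      \<comment> \<open>The purely polynomial identity for p - Jt and p'. Its difference from the
        identity for u isolates the integral of the derivative of Jt q and leaves only the errors u
        - p and u - p'.\<close>
      have "Ck (Suc 0) (\<lambda>x. (p x - Jt x) * q v x)" "Ck (Suc 0) (\<lambda>x. p' x * q' v x)"
        by (intro Ck_mult Ck_diff Ck_polyd[OF p] Ck_polyd[OF p'] Jtc qc)+
      then have "(LINT x:interior K|lebesgue. grad (\<lambda>x. (p x - Jt x) * q v x) x \<bullet> e)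
          + (LINT x:interior K'|lebesgue. grad (\<lambda>x. p' x * q' v x) x \<bullet> e) = 0"
        by (rule pair_formula(1)) (use Jtf agree[OF v] van van' in auto)
      moreover have "grad (\<lambda>x. (p x - Jt x) * q v x) x \<bullet> e
        = (p x * (grad (q v) x \<bullet> e) + (grad p x \<bullet> e) * q v x) - grad (\<lambda>x. Jt x * q v x) x \<bullet> e" for x
        using grad_mult[OF Ck_diff[OF Ck_polyd[OF p] Jtc] qc(1), of v x e] grad_mult[OF Jtc qc(1), of v x e]
          grad_diff[OF Ck_polyd[OF p] Jtc, of x] by (simp add: inner_diff_left algebra_simps)
      moreover have "grad (\<lambda>x. p' x * q' v x) x \<bullet> e = p' x * (grad (q' v) x \<bullet> e) + (grad p' x \<bullet> e) * q' v x" for x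
        by (rule grad_mult[OF Ck_polyd[OF p'] qc(2)])
      moreover have gJq: "continuous_on UNIV (\<lambda>x. grad (\<lambda>x. Jt x * q v x) x \<bullet> e)"
        unfolding grad_mult[OF Jtc qc(1)] by (intro continuous_intros gc)
      moreover have "(LINT x:interior K|lebesgue. (p x * (grad (q v) x \<bullet> e) + (grad p x \<bullet> e) * q v x) - grad (\<lambda>x. Jt x * q v x) x \<bullet> e)
        = (LINT x:interior K|lebesgue. p x * (grad (q v) x \<bullet> e) + (grad p x \<bullet> e) * q v x) - (LINT x:interior K|lebesgue. grad (\<lambda>x. Jt x * q v x) x \<bullet> e)"
        by (intro set_integral_diff(2) ci gJq continuous_intros gc)
      ultimately have Beq: "(LINT x:interior K|lebesgue. p x * (grad (q v) x \<bullet> e) + (grad p x \<bullet> e) * q v x)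
          - (LINT x:interior K|lebesgue. grad (\<lambda>x. Jt x * q v x) x \<bullet> e)
          + (LINT x:interior K'|lebesgue. p' x * (grad (q' v) x \<bullet> e) + (grad p' x \<bullet> e) * q' v x) = 0" by simp
      note split = M.integral_split[OF qc(1) Ck_polyd[OF p], of v e, unfolded diff_add_cancel]
      note split' = M'.integral_split[OF qc(2) Ck_polyd[OF p'], of v e, unfolded diff_add_cancel]
      have b1: "\<bar>LINT x:interior K|lebesgue. (u x - p x) * (grad (q v) x \<bullet> e)\<bar> \<le> M.Cd * (B * norm e) * (h * E)"
        unfolding q_def X_def EE(1)[symmetric] by (rule M.test_gradient_bound[OF refl aC(1) l g v B(1)])
      have b1': "\<bar>LINT x:interior K'|lebesgue. (u x - p' x) * (grad (q' v) x \<bullet> e)\<bar> \<le> M.Cd * (B' * norm e) * (h' * E')"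
        unfolding q'_def X'_def EE(2)[symmetric] by (rule M'.test_gradient_bound[OF refl aC(2) l g v B(2)])
      have b2: "\<bar>LINT x:interior K|lebesgue. ((g x - grad p x) \<bullet> e) * q v x\<bar> \<le> norm e * real l ^ l * E"
        unfolding q_def X_def EE(1)[symmetric] by (rule M.test_flux_bound[OF refl aC(1) l g v])
      have b2': "\<bar>LINT x:interior K'|lebesgue. ((g x - grad p' x) \<bullet> e) * q' v x\<bar> \<le> norm e * real l ^ l * E'"
        unfolding q'_def X'_def EE(2)[symmetric] by (rule M'.test_flux_bound[OF refl aC(2) l g v])
      have B0: "B \<ge> 0" "B' \<ge> 0" using B(1)[of a] B(2)[of a] norm_ge_zero order_trans by blast+
      have c1: "M.Cd * (B * norm e) * (h * E) \<le> M.Cd * \<beta> * (h * E)"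
        using mult_left_mono[OF eh B0(1)] B(3) M.Cd0 M.h0 E0 by (intro mult_right_mono mult_left_mono) auto
      \<comment> \<open>The diameter of the neighbour occurs only in the product B' h', which is
        bounded by \<open>\<beta>\<close>. The length of the edge in K supplies the factor h, so the
        two diameters are never compared.\<close>
      have c1': "M.Cd * (B' * norm e) * (h' * E') \<le> M.Cd * \<beta> * (h * E')"
      proof -
        have "M.Cd * (B' * norm e) * (h' * E') = M.Cd * (B' * h') * (norm e * E')" by simp
        also have "\<dots> \<le> M.Cd * \<beta> * (h * E')"
          using B(4) M.Cd0 M'.h0 M.h0 \<beta>0 E0 eh B0 by (intro mult_mono mult_left_mono mult_right_mono mult_nonneg_nonneg) auto
        finally show ?thesis .
      qed
      have c2: "norm e * real l ^ l * E \<le> h * real l ^ l * E" "norm e * real l ^ l * E' \<le> h * real l ^ l * E'"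
        using eh E0 by (auto intro!: mult_right_mono)
      have "(M.Cd * \<beta> + real l ^ l) * (h * (E + E')) = M.Cd * \<beta> * (h * E) + M.Cd * \<beta> * (h * E') + h * real l ^ l * E + h * real l ^ l * E'"
        by (simp add: algebra_simps)
      then show ?thesis using A Beq split split' b1 b1' b2 b2' c1 c1' c2 unfolding e_def[symmetric] by linarith
    qed
    have gsum: "(\<Sum>v\<in>C. grad (\<lambda>x. Jt x * q v x) x \<bullet> (v - a)) = (real DIM('a) + real (2 * DIM('a) + 2 * l)) * (Jt x * X \<gamma> x)" for x
    proof -
      \<comment> \<open>The degree is l from the jump, 2 d from the squared bubble and l from the
        Lagrange function.\<close>
      have hom: "(\<lambda>x. Jt x * X \<gamma> x) (a + s *\<^sub>R (x - a)) = s ^ (2 * DIM('a) + 2 * l) * (\<lambda>x. Jt x * X \<gamma> x) x" for s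
      proof -
        have b: "bary ?V (a + s *\<^sub>R (x - a)) v = s * bary ?V x v" if "v \<in> C" for v
          using that aC bary_vertex[OF W, of a v] by (auto simp: bary_convex_combination[OF W])
        have lg: "lag C l \<delta> (bary ?V (a + s *\<^sub>R (x - a))) = s ^ l * lag C l \<delta> (bary ?V x)" if "\<delta> \<in> lindices C l" for \<delta>
          using lag_cong[of C "bary ?V (a + s *\<^sub>R (x - a))" "\<lambda>v. s * bary ?V x v"] b lag_scale[OF fC(1) that, of s "bary ?V x"] by simp
        have "Jt (a + s *\<^sub>R (x - a)) = s ^ l * Jt x"
          by (simp add: Jt_def lg sum_distrib_left mult.left_commute)
        moreover have "X \<gamma> (a + s *\<^sub>R (x - a)) = (s ^ DIM('a))\<^sup>2 * s ^ l * X \<gamma> x"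
          using fC(2) by (simp add: X_def tchi_eq[OF fC(1)] lg[OF g] b prod.distrib power_mult_distrib cong: prod.cong)
        ultimately show ?thesis by (simp add: power_add power_mult power2_eq_square power_mult_distrib mult_ac)
      qed
      have "Ck (Suc 0) (\<lambda>x. Jt x * X \<gamma> x)" by (intro Ck_mult Jtc Xc)
      from euler_divergence[OF this hom] show ?thesis by (simp add: q_def mult.assoc)
    qed
    have qi: "set_integrable lebesgue (interior K) (\<lambda>x. grad (\<lambda>x. Jt x * q v x) x \<bullet> (v - a))" for v
      by (intro set_integrable_continuous_interior[OF compact_imp_bounded[OF finite_imp_compact_convex_hull]]
          continuous_intros Ck_continuous_grad[OF Ck_mult[OF Jtc qc(1), of "Suc 0"]]) (use fC in auto)
    have "(real DIM('a) + real (2 * DIM('a) + 2 * l)) * (LINT x:interior K|lebesgue. Jt x * X \<gamma> x)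
        = (LINT x:interior K|lebesgue. \<Sum>v\<in>C. grad (\<lambda>x. Jt x * q v x) x \<bullet> (v - a))"
      unfolding gsum by simp
    also have "\<dots> = (\<Sum>v\<in>C. LINT x:interior K|lebesgue. grad (\<lambda>x. Jt x * q v x) x \<bullet> (v - a))"
      by (rule set_integral_sum(2)[OF qi])
    also have "\<bar>\<dots>\<bar> \<le> (\<Sum>v\<in>C. (M.Cd * \<beta> + real l ^ l) * (h * (E + E')))"
      by (rule order_trans[OF sum_abs sum_mono[OF bound]])
    also have "\<dots> = T" by (simp add: T_def fC(2))
    finally have "(real DIM('a) + real (2 * DIM('a) + 2 * l)) * \<bar>LINT x:interior K|lebesgue. Jt x * X \<gamma> x\<bar> \<le> T"
      by (simp add: abs_mult)
    \<comment> \<open>The factor from Euler's identity is at least 1 and is discarded.\<close>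
    moreover have "1 * \<bar>LINT x:interior K|lebesgue. Jt x * X \<gamma> x\<bar> \<le> (real DIM('a) + real (2 * DIM('a) + 2 * l)) * \<bar>LINT x:interior K|lebesgue. Jt x * X \<gamma> x\<bar>"
    proof (rule mult_right_mono)
      have "1 \<le> real DIM('a)" using DIM_positive[where 'a = 'a] by (simp add: Suc_le_eq)
      then show "1 \<le> real DIM('a) + real (2 * DIM('a) + 2 * l)" by linarith
    qed simp
    ultimately show ?thesis by linarith
  qed
  note fl = finite_lindices[OF fC(1), of l]
  define n where "n = real (Suc l) ^ Suc DIM('a)"
  have n: "real (card (lindices C l)) \<le> n"
  proof -
    have "real (card (lindices C l)) \<le> real (Suc l ^ card C)" using fl(2) by (simp only: of_nat_le_iff)
    also have "\<dots> \<le> n" unfolding n_def fC(2) of_nat_power by (intro power_increasing) auto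
    finally show ?thesis .
  qed
  let ?Mx = "Max ((\<lambda>\<gamma>. \<bar>J \<gamma>\<bar>) ` lindices C l)"
  have "?Mx \<in> (\<lambda>\<gamma>. \<bar>J \<gamma>\<bar>) ` lindices C l" using g fl(1) by (intro Max_in) auto
  then obtain \<gamma>0 where g0: "\<gamma>0 \<in> lindices C l" "?Mx = \<bar>J \<gamma>0\<bar>" by auto
  have max: "\<bar>J \<gamma>\<bar> \<le> \<bar>J \<gamma>0\<bar>" if "\<gamma> \<in> lindices C l" for \<gamma>
    unfolding g0(2)[symmetric] using that fl(1) by (intro Max_ge) auto
  have T0: "T \<ge> 0" unfolding T_def using M.Cd0 \<beta>0 M.h0 E0 by (intro mult_nonneg_nonneg add_nonneg_nonneg) auto
  have "cw DIM('a) l * measure lebesgue K * (J \<gamma>0)\<^sup>2 \<le> (LINT x:interior K|lebesgue. ((\<Prod>v\<in>C. bary ?V x v) * Jt x)\<^sup>2)"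
    unfolding Jt_def by (rule weighted_lower_bound[OF W subset_insertI l g0(1), of J, OF max])
  also have "\<dots> = (LINT x:interior K|lebesgue. \<Sum>\<gamma>\<in>lindices C l. J \<gamma> * (Jt x * X \<gamma> x))"
  proof -
    \<comment> \<open>Weighting the test functions by the jump coefficients reproduces Jt, so the
      sum of the tested integrals is the integral that \<open>weighted_lower_bound\<close> estimates
      from below.\<close>
    have "((\<Prod>v\<in>C. bary ?V x v) * Jt x)\<^sup>2 = (\<Sum>\<gamma>\<in>lindices C l. J \<gamma> * (Jt x * X \<gamma> x))" for x
    proof -
      have "(\<Sum>\<gamma>\<in>lindices C l. J \<gamma> * (Jt x * X \<gamma> x)) = ((\<Prod>v\<in>C. bary ?V x v)\<^sup>2 * Jt x) * (\<Sum>\<gamma>\<in>lindices C l. J \<gamma> * lag C l \<gamma> (bary ?V x))"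
        unfolding X_def tchi_eq[OF fC(1)] sum_distrib_left by (intro sum.cong) auto
      then have "(\<Sum>\<gamma>\<in>lindices C l. J \<gamma> * (Jt x * X \<gamma> x)) = ((\<Prod>v\<in>C. bary ?V x v)\<^sup>2 * Jt x) * Jt x"
        by (simp only: Jt_def[of x, symmetric])
      then show ?thesis by (simp add: power2_eq_square mult_ac)
    qed
    then show ?thesis by simp
  qed
  also have "\<dots> = (\<Sum>\<gamma>\<in>lindices C l. J \<gamma> * (LINT x:interior K|lebesgue. Jt x * X \<gamma> x))"
    by (subst set_integral_sum(2))
      (auto intro!: set_integrable_mult_right set_integrable_continuous_interior[OF compact_imp_bounded[OF finite_imp_compact_convex_hull]]
        continuous_on_mult Ck_imp_continuous_on[OF Jtc[of 0]] Ck_imp_continuous_on[OF Xc(1)[of 0]] simp: fC)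
  also have "\<dots> \<le> (\<Sum>\<gamma>\<in>lindices C l. \<bar>J \<gamma>0\<bar> * T)"
  proof (rule sum_mono)
    fix \<gamma> assume g: "\<gamma> \<in> lindices C l"
    have "J \<gamma> * (LINT x:interior K|lebesgue. Jt x * X \<gamma> x) \<le> \<bar>J \<gamma>\<bar> * \<bar>LINT x:interior K|lebesgue. Jt x * X \<gamma> x\<bar>"
      using abs_ge_self abs_mult by metis
    also have "\<dots> \<le> \<bar>J \<gamma>0\<bar> * T" by (rule mult_mono[OF max[OF g] H[OF g]]) auto
    finally show "J \<gamma> * (LINT x:interior K|lebesgue. Jt x * X \<gamma> x) \<le> \<bar>J \<gamma>0\<bar> * T" .
  qed
  also have "\<dots> = real (card (lindices C l)) * (\<bar>J \<gamma>0\<bar> * T)" by simp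
  also have "\<dots> \<le> n * (\<bar>J \<gamma>0\<bar> * T)" using n T0 by (intro mult_right_mono) auto
  finally have 1: "cw DIM('a) l * measure lebesgue K * \<bar>J \<gamma>0\<bar> * \<bar>J \<gamma>0\<bar> \<le> n * T * \<bar>J \<gamma>0\<bar>"
    by (simp add: power2_eq_square mult_ac)
  have nT: "0 \<le> n * T" using T0 by (simp add: n_def)
  have "cw DIM('a) l * measure lebesgue K * \<bar>J \<gamma>0\<bar> \<le> n * T"
  proof (cases "J \<gamma>0 = 0")
    case False
    then show ?thesis using 1 mult_le_cancel_right[of "cw DIM('a) l * measure lebesgue K * \<bar>J \<gamma>0\<bar>" "\<bar>J \<gamma>0\<bar>" "n * T"] by simp
  qed (use nT in simp)
  moreover have "cw DIM('a) l * measure lebesgue K * \<bar>J \<gamma>\<bar> \<le> cw DIM('a) l * measure lebesgue K * \<bar>J \<gamma>0\<bar>"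
    using max[OF g] cw_pos[of "DIM('a)" l] by (intro mult_left_mono) auto
  ultimately have "cw DIM('a) l * measure lebesgue K * \<bar>J \<gamma>\<bar> \<le> n * T" by linarith
  then show ?thesis by (simp add: J_def n_def T_def mult.assoc)
qed

end

section \<open>Meshes\<close>

definition verts :: "'a::euclidean_space set \<Rightarrow> 'a set" where
  "verts K = {v. v extreme_point_of K}"

definition vol :: "'a::euclidean_space set \<Rightarrow> real" where "vol K = measure lebesgue K"

lemma face_hull_unique:
  assumes "\<not> affine_dependent (C :: 'a::euclidean_space set)" "\<not> affine_dependent C'" "convex hull C = convex hull C'"
  shows "C = C'"
  using extreme_point_of_convex_hull_affine_independent[OF assms(1)]
    extreme_point_of_convex_hull_affine_independent[OF assms(2)] assms(3) by auto

locale mesh =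
  fixes \<T> :: "'a::euclidean_space set set" and \<Omega> :: "'a set" and \<sigma> :: real
  assumes dom: "polyhedral_domain \<Omega>" and conf: "conforming_mesh \<T> \<Omega>"
    and shape: "shape_bounded \<sigma> \<T>" and \<sigma>: "\<sigma> > 0"
begin

lemma fT: "finite \<T>" and UT: "\<Union>\<T> = closure \<Omega>"
  using conf by (auto simp: conforming_mesh_def triangulation_def)

lemma \<Omega>: "open \<Omega>" "bounded \<Omega>" "\<Omega> \<noteq> {}" "connected \<Omega>" "interior (closure \<Omega>) = \<Omega>"
  using dom by (auto simp: polyhedral_domain_def)

lemma elem:
  assumes "K \<in> \<T>" shows "full_simplex (verts K)" "convex hull (verts K) = K"
proof -
  obtain C where C: "\<not> affine_dependent C" "int (card C) = int DIM('a) + 1" "K = convex hull C"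
    using assms conf by (auto simp: conforming_mesh_def simplex_def)
  have "verts K = C"
    using extreme_point_of_convex_hull_affine_independent[OF C(1)] C(3) by (auto simp: verts_def)
  then show "full_simplex (verts K)" "convex hull (verts K) = K" using C by (auto simp: full_simplex_def)
qed

lemma finite_verts: "K \<in> \<T> \<Longrightarrow> finite (verts K)"
  using elem(1) full_simplex_finite by blast

lemma compact_elem: "K \<in> \<T> \<Longrightarrow> compact K"
  using elem(2) finite_imp_compact_convex_hull[OF finite_verts] by metis

lemma convex_elem: "K \<in> \<T> \<Longrightarrow> convex K"
  using elem(2) convex_convex_hull by metis

text \<open>As a face of K the intersection is spanned by vertices of K, as a face of K' by vertices
  of K'. Affinely independent sets are recovered from their hulls as extreme points, so both sets
  coincide.\<close>

lemma elem_meet: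
  assumes "K \<in> \<T>" "K' \<in> \<T>"
  obtains C where "C \<subseteq> verts K" "C \<subseteq> verts K'" "K \<inter> K' = convex hull C" "\<not> affine_dependent C"
proof -
  have t: "(X \<inter> Y) face_of X" if "X \<in> \<T>" "Y \<in> \<T>" for X Y
    using conf that by (simp add: conforming_mesh_def triangulation_def)
  have f: "(K \<inter> K') face_of K" "(K \<inter> K') face_of K'"
    using t[OF assms] t[OF assms(2,1)] by (simp_all add: Int_commute)
  have ai: "\<not> affine_dependent (verts K)" "\<not> affine_dependent (verts K')"
    using elem(1) assms by (auto simp: full_simplex_def)
  obtain C where C: "C \<subseteq> verts K" "K \<inter> K' = convex hull C"
    using face_of_convex_hull_affine_independent[OF ai(1), of "K \<inter> K'"] elem(2)[OF assms(1)] f(1) by auto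
  obtain C' where C': "C' \<subseteq> verts K'" "K \<inter> K' = convex hull C'"
    using face_of_convex_hull_affine_independent[OF ai(2), of "K \<inter> K'"] elem(2)[OF assms(2)] f(2) by auto
  have "\<not> affine_dependent C" "\<not> affine_dependent C'"
    using ai C C' affine_dependent_subset by blast+
  then have "C = C'" by (rule face_hull_unique) (use C C' in simp)
  then show ?thesis using that C C' \<open>\<not> affine_dependent C\<close> by blast
qed

lemma mem_interior_elem_iff: "K \<in> \<T> \<Longrightarrow> x \<in> interior K \<longleftrightarrow> (\<forall>v\<in>verts K. 0 < bary (verts K) x v)"
  using mem_interior_simplex_iff[OF elem(1), of K x] elem(2) by simp

lemma interior_face_full:
  assumes "K \<in> \<T>" "C \<subseteq> verts K" "x \<in> interior K" "x \<in> convex hull C" shows "C = verts K"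
proof (rule ccontr)
  assume "C \<noteq> verts K"
  then obtain v where v: "v \<in> verts K" "v \<notin> C" using assms(2) by blast
  then show False
    using bary_face(1)[OF elem(1)[OF assms(1)] assms(2,4) v(2)] assms(3) mem_interior_elem_iff[OF assms(1)] by force
qed

text \<open>An interior point lies on no proper face, so the common face has all vertices of K. Both
  elements have the same number of vertices and are therefore equal.\<close>

lemma interior_meet: "K \<in> \<T> \<Longrightarrow> K' \<in> \<T> \<Longrightarrow> x \<in> interior K \<Longrightarrow> x \<in> K' \<Longrightarrow> K = K'"
proof -
  assume *: "K \<in> \<T>" "K' \<in> \<T>" "x \<in> interior K" "x \<in> K'"
  obtain C where C: "C \<subseteq> verts K" "C \<subseteq> verts K'" "K \<inter> K' = convex hull C" "\<not> affine_dependent C"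
    by (rule elem_meet[OF *(1,2)])
  have "x \<in> K \<inter> K'" using *(3,4) interior_subset[of K] by auto
  then have "x \<in> convex hull C" using C(3) by simp
  then have "C = verts K" by (rule interior_face_full[OF *(1) C(1) *(3)])
  then have "verts K \<subseteq> verts K'" using C by simp
  moreover have "card (verts K) = card (verts K')" using elem(1) * by (simp add: full_simplex_def)
  ultimately have "verts K = verts K'" using card_subset_eq[OF finite_verts[OF *(2)]] by blast
  then show ?thesis using elem(2) * by metis
qed

sublocale pieces \<T>
proof
  show "interior K \<inter> interior J = {}" if "K \<in> \<T>" "J \<in> \<T>" "J \<noteq> K" for K J
    using interior_meet[OF that(1,2)] that(3) interior_subset[of J] by blast
qed (use fT compact_elem convex_elem in auto)

lemma interior_elem_subset: "K \<in> \<T> \<Longrightarrow> interior K \<subseteq> \<Omega>"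
  using UT \<Omega>(5) interior_mono[of K "closure \<Omega>"] by blast

lemma \<Omega>_subset: "\<Omega> \<subseteq> \<Union>\<T>" using UT closure_subset by simp

lemma interior_elem_ne: "K \<in> \<T> \<Longrightarrow> interior K \<noteq> {}"
proof -
  assume K: "K \<in> \<T>"
  have m1: "(\<Sum>v\<in>verts K. 1 / real (card (verts K))) = 1"
    using elem(1)[OF K] by (simp add: full_simplex_def)
  define m where "m = (\<Sum>v\<in>verts K. (1 / real (card (verts K))) *\<^sub>R v)"
  have "0 < bary (verts K) m v" if "v \<in> verts K" for v
    using bary_unique[OF elem(1)[OF K] m1 m_def[symmetric] that] elem(1)[OF K] by (simp add: full_simplex_def)
  then show ?thesis using mem_interior_elem_iff[OF K] by blast
qed

section \<open>Consequences of the shape bound\<close>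

lemma bounded_elem: "K \<in> \<T> \<Longrightarrow> bounded K" using compact_elem compact_imp_bounded by blast

lemma dist_le_diameter: "K \<in> \<T> \<Longrightarrow> x \<in> K \<Longrightarrow> y \<in> K \<Longrightarrow> norm (x - y) \<le> diameter K"
  using diameter_bounded_bound[OF bounded_elem] by (metis dist_norm)

text \<open>A ball with more than half of the supremal diameter avoids the question whether the
  supremum is attained. That half, and the passage from diameter to radius, give the factor
  4.\<close>

lemma shape_ball:
  assumes K: "K \<in> \<T>"
  obtains c r where "cball c r \<subseteq> K" "r > 0" "diameter K \<le> 4 * \<sigma> * r"
proof -
  define S where "S = {diameter (cball x r) | x r. 0 \<le> r \<and> cball x r \<subseteq> K}"
  have dc: "diameter (cball x r) = 2 * r" if "0 \<le> r" for x :: 'a and r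
    using that by (simp add: diameter_cball)
  have bdd: "bdd_above S"
    unfolding bdd_above_def S_def
    using diameter_subset[OF _ bounded_elem[OF K]] by (intro exI[of _ "diameter K"]) blast
  obtain x where "x \<in> interior K" using interior_elem_ne[OF K] by blast
  then obtain e where e: "e > 0" "cball x e \<subseteq> K" by (meson mem_interior_cball)
  then have "2 * e \<in> S" unfolding S_def
    by (intro CollectI exI[of _ x] exI[of _ e]) (use dc[of e x] e in simp)
  have IS: "inball_diameter K = Sup S" by (simp only: inball_diameter_def S_def)
  from cSup_upper[OF \<open>2 * e \<in> S\<close> bdd] have "2 * e \<le> inball_diameter K" by (simp only: IS)
  then have pos: "inball_diameter K > 0" using e by linarith
  have "S \<noteq> {}" using \<open>2 * e \<in> S\<close> by blast
  then obtain s where s: "s \<in> S" "inball_diameter K / 2 < s"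
  proof -
    have "inball_diameter K / 2 < Sup S" using pos IS by simp
    from less_cSupE[OF this \<open>S \<noteq> {}\<close>] that show ?thesis by blast
  qed
  then obtain c r where cr: "0 \<le> r" "cball c r \<subseteq> K" "s = 2 * r" using dc by (auto simp: S_def)
  have "diameter K \<le> \<sigma> * inball_diameter K"
    using shape K pos by (auto simp: shape_bounded_def divide_le_eq)
  also have "\<dots> \<le> \<sigma> * (4 * r)" using s cr \<sigma> by (intro mult_left_mono) auto
  finally show ?thesis using that[of c r] cr s pos by (auto simp: mult_ac)
qed

lemma diameter_pos: "K \<in> \<T> \<Longrightarrow> diameter K > 0"
proof -
  assume K: "K \<in> \<T>"
  obtain c r where cr: "cball c r \<subseteq> K" "r > 0" using shape_ball[OF K] by blast
  have "2 * r \<le> diameter K"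
    using diameter_subset[OF cr(1) bounded_elem[OF K]] cr by (simp add: diameter_cball)
  then show ?thesis using cr by simp
qed

lemma bgrad_le: "K \<in> \<T> \<Longrightarrow> norm (bgrad (verts K) v) \<le> 4 * \<sigma> / diameter K"
proof -
  assume K: "K \<in> \<T>"
  obtain c r where cr: "cball c r \<subseteq> K" "r > 0" "diameter K \<le> 4 * \<sigma> * r" using shape_ball[OF K] by blast
  have "norm (bgrad (verts K) v) \<le> 1 / r" using bgrad_norm_le[OF elem(1)[OF K]] elem(2)[OF K] cr by simp
  also have "\<dots> \<le> 4 * \<sigma> / diameter K" using cr diameter_pos[OF K] \<sigma> by (simp add: field_simps)
  finally show ?thesis .
qed

lemma vol_bounds:
  assumes K: "K \<in> \<T>"
  shows "vol K \<le> unit_ball_vol (real DIM('a)) * diameter K ^ DIM('a)" "unit_ball_vol (real DIM('a)) * (diameter K / (4 * \<sigma>)) ^ DIM('a) \<le> vol K" "vol K > 0"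
proof -
  obtain c r where cr: "cball c r \<subseteq> K" "r > 0" "diameter K \<le> 4 * \<sigma> * r" using shape_ball[OF K] by blast
  have lm: "K \<in> lmeasurable" using compact_elem[OF K] by (rule lmeasurable_compact)
  have w0: "unit_ball_vol (real DIM('a)) > 0" by (rule unit_ball_vol_pos) simp
  have "c \<in> K" using cr by auto
  then have "K \<subseteq> cball c (diameter K)" using dist_le_diameter[OF K] by (auto simp: dist_norm)
  then have "vol K \<le> measure lebesgue (cball c (diameter K))"
    unfolding vol_def using lm by (intro measure_mono_fmeasurable) auto
  also have "\<dots> = unit_ball_vol (real DIM('a)) * diameter K ^ DIM('a)" using diameter_pos[OF K] by (simp add: content_cball)
  finally show "vol K \<le> unit_ball_vol (real DIM('a)) * diameter K ^ DIM('a)" .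
  have "unit_ball_vol (real DIM('a)) * (diameter K / (4 * \<sigma>)) ^ DIM('a) \<le> unit_ball_vol (real DIM('a)) * r ^ DIM('a)"
    using cr diameter_pos[OF K] \<sigma> w0 by (intro mult_left_mono power_mono) (auto simp: field_simps)
  also have "\<dots> = measure lebesgue (cball c r)" using cr by (simp add: content_cball)
  also have "\<dots> \<le> vol K"
    unfolding vol_def using lm cr by (intro measure_mono_fmeasurable) auto
  finally show 2: "unit_ball_vol (real DIM('a)) * (diameter K / (4 * \<sigma>)) ^ DIM('a) \<le> vol K" .
  have "0 < unit_ball_vol (real DIM('a)) * (diameter K / (4 * \<sigma>)) ^ DIM('a)" using w0 diameter_pos[OF K] \<sigma> by simp
  then show "vol K > 0" using 2 by linarith
qed

section \<open>Neighbouring elements and node patches\<close>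

definition adj where "adj K K' \<longleftrightarrow> K \<in> \<T> \<and> K' \<in> \<T> \<and> (K \<inter> K') facet_of K"

lemma adj_adjacent:
  assumes "adj K K'"
  obtains a a' C where "adjacent a a' C" "verts K = insert a C" "verts K' = insert a' C" "K \<inter> K' = convex hull C"
proof -
  have KT: "K \<in> \<T>" "K' \<in> \<T>" and fc: "(K \<inter> K') facet_of K" using assms by (auto simp: adj_def)
  obtain C where C: "C \<subseteq> verts K" "C \<subseteq> verts K'" "K \<inter> K' = convex hull C" "\<not> affine_dependent C"
    by (rule elem_meet[OF KT])
  have "aff_dim (convex hull C) = aff_dim K - 1" using fc C by (simp add: facet_of_def)
  moreover have "aff_dim K = int DIM('a)"
    using aff_dim_convex_hull[of "verts K"] elem[OF KT(1)] aff_dim_affine_independent[of "verts K"]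
    by (simp add: full_simplex_def)
  moreover have "aff_dim (convex hull C) = int (card C) - 1"
    using aff_dim_convex_hull[of C] aff_dim_affine_independent[OF C(4)] by simp
  ultimately have cC: "card C = DIM('a)" by simp
  have fin: "finite C" using C finite_verts[OF KT(1)] finite_subset by blast
  have "card (verts K - C) = 1" "card (verts K' - C) = 1"
    using cC C(1,2) fin elem(1)[OF KT(1)] elem(1)[OF KT(2)] by (auto simp: card_Diff_subset full_simplex_def)
  then obtain a a' where "verts K - C = {a}" "verts K' - C = {a'}" by (auto simp: card_1_singleton_iff)
  then have aa: "verts K = insert a C" "verts K' = insert a' C" "a \<notin> C" "a' \<notin> C" using C by auto
  have "adjacent a a' C"
    using elem[OF KT(1)] elem[OF KT(2)] aa C(3) by unfold_locales auto
  then show ?thesis using that aa C by blast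
qed

lemma adj_sym: "adj K K' \<Longrightarrow> adj K' K"
proof -
  assume a: "adj K K'"
  then have KT: "K \<in> \<T>" "K' \<in> \<T>" and fc: "(K \<inter> K') facet_of K" by (auto simp: adj_def)
  have d: "aff_dim X = int DIM('a)" if "X \<in> \<T>" for X
    using aff_dim_convex_hull[of "verts X"] elem[OF that] aff_dim_affine_independent[of "verts X"]
    by (simp add: full_simplex_def)
  have "(K' \<inter> K) face_of K'" using conf KT by (auto simp: conforming_mesh_def triangulation_def)
  then show ?thesis using fc KT d by (simp add: adj_def facet_of_def Int_commute)
qed

lemma adj_neq: "adj K K' \<Longrightarrow> K \<noteq> K'"
  by (auto simp: adj_def facet_of_def)

text \<open>In dimension at least 2 the facet has two vertices u and w. The coordinate of u drops
  from 1 to 0 along the edge between them, whose length is at most the diameter of K', while its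
  gradient is bounded by 4 \<open>\<sigma>\<close> over the diameter of K.\<close>

lemma adj_diameter:
  assumes "adj K K'" "DIM('a) \<ge> 2" shows "diameter K \<le> 4 * \<sigma> * diameter K'"
proof -
  obtain a a' C where C: "adjacent a a' C" "verts K = insert a C" "verts K' = insert a' C"
    using adj_adjacent[OF assms(1)] by metis
  have KT: "K \<in> \<T>" "K' \<in> \<T>" using assms by (auto simp: adj_def)
  have "card C \<ge> 2" using adjacent.fC(2)[OF C(1)] assms(2) by simp
  then obtain u w where uw: "u \<in> C" "w \<in> C" "u \<noteq> w"
    by (metis card_le_Suc0_iff_eq card.infinite not_less_eq_eq numeral_2_eq_2 zero_le)
  have "bary (verts K) u u = bary (verts K) w u + bgrad (verts K) u \<bullet> (u - w)"
    by (rule bary_affine[OF elem(1)[OF KT(1)]])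
  then have "1 = bgrad (verts K) u \<bullet> (u - w)"
    using uw C bary_vertex[OF elem(1)[OF KT(1)], of u u] bary_vertex[OF elem(1)[OF KT(1)], of w u] by simp
  also have "\<dots> \<le> norm (bgrad (verts K) u) * norm (u - w)" by (rule norm_cauchy_schwarz)
  also have "\<dots> \<le> 4 * \<sigma> / diameter K * diameter K'"
  proof (rule mult_mono[OF bgrad_le[OF KT(1)]])
    have "u \<in> K'" "w \<in> K'" using uw C hull_inc[of _ "verts K'"] elem(2)[OF KT(2)] by auto
    then show "norm (u - w) \<le> diameter K'" by (rule dist_le_diameter[OF KT(2)])
  qed (use \<sigma> diameter_pos[OF KT(1)] in auto)
  finally show ?thesis using diameter_pos[OF KT(1)] by (simp add: field_simps)
qed

definition patch where "patch z = {K \<in> \<T>. z \<in> K}"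

lemma finite_patch: "finite (patch z)" using fT by (simp add: patch_def)

text \<open>With R the smallest diameter in the patch, each element contains a ball of radius R / (4
  \<open>\<sigma>\<close>) within distance R of z. These balls are disjoint, and comparing volumes
  gives the count.\<close>

lemma card_patch: "real (card (patch z)) \<le> (4 * \<sigma>) ^ DIM('a)"
proof (cases "patch z = {}")
  case False
  define R where "R = Min (diameter ` patch z)"
  have Rm: "R \<le> diameter K" if "K \<in> patch z" for K
    unfolding R_def using that finite_patch by (intro Min_le) auto
  have "R \<in> diameter ` patch z" unfolding R_def using finite_patch False by (intro Min_in) auto
  then have R: "R > 0" using diameter_pos by (auto simp: patch_def)
  have "\<exists>c. ball c (R / (4 * \<sigma>)) \<subseteq> interior K \<inter> cball z R" if K: "K \<in> patch z" for K
  proof -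
    have KT: "K \<in> \<T>" "z \<in> K" using K by (auto simp: patch_def)
    obtain c r where cr: "cball c r \<subseteq> K" "r > 0" "diameter K \<le> 4 * \<sigma> * r" using shape_ball[OF KT(1)] by blast
    \<comment> \<open>The inscribed ball is contracted towards z by this factor. Convexity keeps it
      in K, and an element of diameter h is contracted to one of diameter R.\<close>
    define t where "t = R / diameter K"
    have t: "0 < t" "t \<le> 1" using R Rm[OF K] diameter_pos[OF KT(1)] by (auto simp: t_def)
    have tr: "R / (4 * \<sigma>) \<le> t * r" using cr diameter_pos[OF KT(1)] \<sigma> R by (simp add: t_def field_simps)
    have sub: "y \<in> K \<inter> cball z R" if y: "y \<in> ball (z + t *\<^sub>R (c - z)) (R / (4 * \<sigma>))" for y
    proof -
      define y' where "y' = z + (1 / t) *\<^sub>R (y - z)"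
      have "y' - c = (1 / t) *\<^sub>R (y - (z + t *\<^sub>R (c - z)))" using t by (simp add: y'_def algebra_simps)
      then have "norm (y' - c) = norm (y - (z + t *\<^sub>R (c - z))) / t" using t by simp
      also have "\<dots> \<le> t * r / t" using y tr t by (intro divide_right_mono) (auto simp: dist_norm norm_minus_commute)
      finally have "y' \<in> cball c r" using t by (simp add: dist_norm norm_minus_commute)
      then have y'K: "y' \<in> K" using cr by blast
      have yy: "y = (1 - t) *\<^sub>R z + t *\<^sub>R y'" using t by (simp add: y'_def algebra_simps)
      have "y \<in> K" unfolding yy using t KT y'K convex_elem[OF KT(1)] by (intro convexD_alt) auto
      moreover have "norm (z - y) = t * norm (z - y')" using t by (simp add: y'_def norm_minus_commute)
      moreover have "t * norm (z - y') \<le> t * diameter K" using dist_le_diameter[OF KT y'K] t by (intro mult_left_mono) auto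
      ultimately show ?thesis using diameter_pos[OF KT(1)] by (simp add: t_def dist_norm)
    qed
    then have "ball (z + t *\<^sub>R (c - z)) (R / (4 * \<sigma>)) \<subseteq> interior K" by (intro interior_maximal) auto
    then show ?thesis using sub by blast
  qed
  then obtain c where c: "\<And>K. K \<in> patch z \<Longrightarrow> ball (c K) (R / (4 * \<sigma>)) \<subseteq> interior K \<inter> cball z R" by metis
  have w0: "unit_ball_vol (real DIM('a)) > 0" by (rule unit_ball_vol_pos) simp
  have dj: "disjoint_family_on (\<lambda>K. ball (c K) (R / (4 * \<sigma>))) (patch z)"
    unfolding disjoint_family_on_def
  proof (intro ballI impI)
    fix K K' assume "K \<in> patch z" "K' \<in> patch z" "K \<noteq> K'"
    then have "interior K \<inter> interior K' = {}" using disjoint by (auto simp: patch_def)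
    then show "ball (c K) (R / (4 * \<sigma>)) \<inter> ball (c K') (R / (4 * \<sigma>)) = {}"
      using c[OF \<open>K \<in> patch z\<close>] c[OF \<open>K' \<in> patch z\<close>] by blast
  qed
  have "real (card (patch z)) * (unit_ball_vol (real DIM('a)) * (R / (4 * \<sigma>)) ^ DIM('a)) = (\<Sum>K\<in>patch z. measure lebesgue (ball (c K) (R / (4 * \<sigma>))))"
    using R \<sigma> by (simp add: content_ball)
  also have "\<dots> = measure lebesgue (\<Union>K\<in>patch z. ball (c K) (R / (4 * \<sigma>)))"
  proof (intro measure_finite_Union[symmetric] finite_patch dj)
    show "emeasure lebesgue (ball (c K) (R / (4 * \<sigma>))) \<noteq> \<infinity>" for K
      using emeasure_lborel_ball_finite[of "c K" "R / (4 * \<sigma>)"] by auto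
  qed auto
  also have "\<dots> \<le> measure lebesgue (cball z R)"
  proof (rule measure_mono_fmeasurable)
    show "(\<Union>K\<in>patch z. ball (c K) (R / (4 * \<sigma>))) \<subseteq> cball z R" using c by blast
  qed (use finite_patch in auto)
  also have "\<dots> = unit_ball_vol (real DIM('a)) * R ^ DIM('a)" using R by (simp add: content_cball)
  finally have "real (card (patch z)) * (1 / (4 * \<sigma>)) ^ DIM('a) * (unit_ball_vol (real DIM('a)) * R ^ DIM('a)) \<le> 1 * (unit_ball_vol (real DIM('a)) * R ^ DIM('a))"
    by (simp add: power_divide mult_ac)
  then have "real (card (patch z)) * (1 / (4 * \<sigma>)) ^ DIM('a) \<le> 1"
    using w0 R by (subst (asm) mult_le_cancel_right_pos) auto
  then show ?thesis using \<sigma> by (simp add: power_divide divide_le_eq)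
qed (use \<sigma> in simp)

text \<open>Each element at z has an interior point different from z, to the left or to the right.
  Two elements with such points on the same side overlap by convexity and are equal, so three
  elements cannot be distinct.\<close>

lemma patch_1d:
  assumes d: "DIM('a) = 1" and K: "K1 \<in> patch z" "K2 \<in> patch z" "K3 \<in> patch z"
  shows "K1 = K2 \<or> K1 = K3 \<or> K2 = K3"
proof -
  obtain b :: 'a where b: "Basis = {b}" using d card_1_singletonE by metis
  have nb: "norm b = 1" by (rule norm_Basis) (simp add: b)
  have rep: "(x \<bullet> b) *\<^sub>R b = x" for x using euclidean_representation[of x, unfolded b] by simp
  have "\<exists>t. t \<noteq> 0 \<and> z + t *\<^sub>R b \<in> interior X" if X: "X \<in> patch z" for X
  proof -
    have XT: "X \<in> \<T>" using X by (simp add: patch_def)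
    obtain x where "x \<in> interior X" using interior_elem_ne[OF XT] by blast
    then obtain e where e: "e > 0" "ball x e \<subseteq> X" using mem_interior by blast
    have s: "ball x e \<subseteq> interior X" using e(2) by (intro interior_maximal) auto
    \<comment> \<open>Two distinct interior points are kept at hand, since one of them may be z
      itself.\<close>
    have "x \<in> ball x e" "x + (e / 2) *\<^sub>R b \<in> ball x e" using e nb by (auto simp: dist_norm)
    moreover have "x = z + ((x - z) \<bullet> b) *\<^sub>R b" "x + (e / 2) *\<^sub>R b = z + ((x - z) \<bullet> b + e / 2) *\<^sub>R b"
      using rep[of "x - z"] by (simp_all add: scaleR_add_left)
    moreover have "(x - z) \<bullet> b \<noteq> 0 \<or> (x - z) \<bullet> b + e / 2 \<noteq> 0" using e by auto
    ultimately show ?thesis using s by (metis subsetD)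
  qed
  then obtain t where t: "\<And>X. X \<in> patch z \<Longrightarrow> t X \<noteq> 0 \<and> z + t X *\<^sub>R b \<in> interior X" by metis
  have same: "X = Y" if XY: "X \<in> patch z" "Y \<in> patch z" and s: "t X * t Y > 0" "\<bar>t X\<bar> \<le> \<bar>t Y\<bar>" for X Y
  proof -
    have XT: "X \<in> \<T>" "Y \<in> \<T>" "z \<in> Y" using XY by (auto simp: patch_def)
    define q where "q = t X / t Y"
    have q: "0 \<le> q" "q \<le> 1"
      using s t[OF XY(2)] by (auto simp: q_def zero_less_mult_iff divide_le_eq_1 zero_le_divide_iff)
    have "z + t Y *\<^sub>R b \<in> Y" using t[OF XY(2)] interior_subset by blast
    then have "(1 - q) *\<^sub>R z + q *\<^sub>R (z + t Y *\<^sub>R b) \<in> Y"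
      using q XT convex_elem[OF XT(2)] by (intro convexD_alt) auto
    moreover have "(1 - q) *\<^sub>R z + q *\<^sub>R (z + t Y *\<^sub>R b) = z + t X *\<^sub>R b"
      using t[OF XY(2)] by (simp add: q_def algebra_simps)
    ultimately have "z + t X *\<^sub>R b \<in> Y" by simp
    then show ?thesis by (rule interior_meet[OF XT(1,2) conjunct2[OF t[OF XY(1)]]])
  qed
  have sgn: "X = Y" if XY: "X \<in> patch z" "Y \<in> patch z" and s: "t X * t Y > 0" for X Y
    using same[OF XY s] same[OF XY(2,1)] s by (metis linear mult.commute)
  have "t K1 * t K2 > 0 \<or> t K1 * t K3 > 0 \<or> t K2 * t K3 > 0"
    using t[OF K(1)] t[OF K(2)] t[OF K(3)] by (auto simp: zero_less_mult_iff)
  then show ?thesis using sgn K by blast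
qed

end

subsection \<open>Nodal interpolation\<close>

lemma lindices_mono:
  assumes "finite W" "C \<subseteq> W" "\<gamma> \<in> lindices C l"
  shows "\<gamma> \<in> lindices W l" "lnode W l \<gamma> = lnode C l \<gamma>"
proof -
  have z: "\<gamma> v = 0" if "v \<in> W - C" for v using assms(3) that by (simp add: lindices_def)
  have "sum \<gamma> W = sum \<gamma> C" using z by (intro sum.mono_neutral_right assms) auto
  then show "\<gamma> \<in> lindices W l" using assms by (auto simp: lindices_def)
  show "lnode W l \<gamma> = lnode C l \<gamma>"
    unfolding lnode_def using z by (intro sum.mono_neutral_right assms) auto
qed

lemma lnode_face:
  fixes W :: "'a::euclidean_space set"
  assumes W: "full_simplex W" "C \<subseteq> W" and g: "\<gamma> \<in> lindices W l" and l: "l > 0" and z: "lnode W l \<gamma> \<in> convex hull C"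
  shows "\<gamma> \<in> lindices C l" "lnode C l \<gamma> = lnode W l \<gamma>"
proof -
  have fW: "finite W" using full_simplex_finite[OF W(1)] .
  have 0: "\<gamma> v = 0" if "v \<notin> C" for v
    using bary_lnode[OF W(1) subset_refl g l, of v] bary_face(1)[OF W z that] l by simp
  have "sum \<gamma> C = sum \<gamma> W" using 0 by (intro sum.mono_neutral_left fW W) auto
  then show *: "\<gamma> \<in> lindices C l" using g 0 by (simp add: lindices_def)
  show "lnode C l \<gamma> = lnode W l \<gamma>" using lindices_mono(2)[OF fW W(2) *] by simp
qed

lemma lnode_mem_hull: "finite W \<Longrightarrow> \<gamma> \<in> lindices W l \<Longrightarrow> l > 0 \<Longrightarrow> lnode W l \<gamma> \<in> convex hull W"
  unfolding convex_hull_finite lnode_def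
  using lnode_sum[of \<gamma> W l] by (intro CollectI exI[of _ "\<lambda>v. real (\<gamma> v) / real l"]) auto

definition lint :: "nat \<Rightarrow> ('a::euclidean_space \<Rightarrow> real) \<Rightarrow> 'a set \<Rightarrow> 'a \<Rightarrow> real" where
  "lint l val W x = (\<Sum>\<gamma>\<in>lindices W l. val (lnode W l \<gamma>) * lag W l \<gamma> (bary W x))"

lemma polyd_lint: "full_simplex W \<Longrightarrow> polyd l (lint l val W)"
  unfolding lint_def[abs_def] by (intro polyd_sum polyd_scale polyd_lag_bary) auto

text \<open>A Lagrange function whose index is positive at a vertex off the face contains the
  coordinate of that vertex as a factor and vanishes on the face. The trace is thus determined by
  the nodes of the face.\<close>

lemma lint_face:
  fixes W :: "'a::euclidean_space set"
  assumes W: "full_simplex W" "C \<subseteq> W" and x: "x \<in> convex hull C"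
  shows "lint l val W x = (\<Sum>\<gamma>\<in>lindices C l. val (lnode C l \<gamma>) * lag C l \<gamma> (bary W x))"
proof -
  have fW: "finite W" using full_simplex_finite[OF W(1)] .
  note b = bary_face[OF W x]
  have "lint l val W x = (\<Sum>\<gamma>\<in>lindices C l. val (lnode W l \<gamma>) * lag W l \<gamma> (bary W x))"
    unfolding lint_def
  proof (rule sum.mono_neutral_right[OF finite_lindices(1)[OF fW]])
    show "lindices C l \<subseteq> lindices W l" using lindices_mono(1)[OF fW W(2)] by blast
    show "\<forall>\<gamma>\<in>lindices W l - lindices C l. val (lnode W l \<gamma>) * lag W l \<gamma> (bary W x) = 0"
    proof
      fix \<gamma> assume g: "\<gamma> \<in> lindices W l - lindices C l"
      have "\<exists>v\<in>W - C. \<gamma> v > 0"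
      proof (rule ccontr)
        assume n: "\<not> ?thesis"
        then have "sum \<gamma> C = sum \<gamma> W" by (intro sum.mono_neutral_left fW W) auto
        moreover have "\<gamma> v = 0" if "v \<notin> C" for v
          using n g that by (cases "v \<in> W") (auto simp: lindices_def)
        ultimately have "\<gamma> \<in> lindices C l" using g by (simp add: lindices_def)
        then show False using g by simp
      qed
      then obtain v where v: "v \<in> W" "v \<notin> C" "\<gamma> v > 0" by blast
      have "(v, 0) \<in> lidx W \<gamma>" using v by (simp add: lidx_def)
      moreover have "lfac W l (v, 0) (bary W x) = 0" using b(1)[OF v(2)] by (simp add: lfac_def)
      ultimately have "lag W l \<gamma> (bary W x) = 0" unfolding lag_def by (intro prod_zero finite_lidx[OF fW]) auto
      then show "val (lnode W l \<gamma>) * lag W l \<gamma> (bary W x) = 0" by simp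
    qed
  qed
  also have "\<dots> = (\<Sum>\<gamma>\<in>lindices C l. val (lnode C l \<gamma>) * lag C l \<gamma> (bary W x))"
  proof (rule sum.cong[OF refl])
    fix \<gamma> assume g: "\<gamma> \<in> lindices C l"
    have "lidx W \<gamma> = lidx C \<gamma>" using g W(2) by (auto simp: lidx_def lindices_def)
    moreover have "sum (bary W x) W = sum (bary W x) C" using b(2) bary_props(2)[OF W(1)] by simp
    ultimately have "lag W l \<gamma> (bary W x) = lag C l \<gamma> (bary W x)" by (simp add: lag_def lfac_def)
    then show "val (lnode W l \<gamma>) * lag W l \<gamma> (bary W x) = val (lnode C l \<gamma>) * lag C l \<gamma> (bary W x)"
      using lindices_mono(2)[OF fW W(2) g] by simp
  qed
  finally show ?thesis .
qed

lemma lint_lnode: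
  assumes W: "full_simplex W" and g: "\<gamma> \<in> lindices W l" and l: "l > 0"
  shows "lint l val W (lnode W l \<gamma>) = val (lnode W l \<gamma>)"
proof -
  have fW: "finite W" using full_simplex_finite[OF W] .
  have "bary W (lnode W l \<gamma>) = (\<lambda>v. real (\<gamma> v) / real l)"
    using bary_lnode[OF W subset_refl g l] by (rule ext)
  then have "lint l val W (lnode W l \<gamma>) = (\<Sum>\<delta>\<in>lindices W l. val (lnode W l \<delta>) * (if \<delta> = \<gamma> then 1 else 0))"
    using lag_node[OF fW l _ g] by (simp add: lint_def cong: sum.cong)
  also have "\<dots> = (\<Sum>\<delta>\<in>lindices W l. if \<delta> = \<gamma> then val (lnode W l \<gamma>) else 0)" by (intro sum.cong) auto
  also have "\<dots> = val (lnode W l \<gamma>)" using g finite_lindices(1)[OF fW] by simp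
  finally show ?thesis .
qed

lemma polyd_eq_lint: "full_simplex W \<Longrightarrow> polyd l q \<Longrightarrow> l > 0 \<Longrightarrow> q x = lint l q W x"
  unfolding lint_def by (rule lagrange_simplex)

lemma element_nodes_eq: "element_nodes l K = lnode (verts K) l ` lindices (verts K) l"
proof
  show "lnode (verts K) l ` lindices (verts K) l \<subseteq> element_nodes l K"
    by (auto simp: element_nodes_def lnode_def lindices_def verts_def)
  show "element_nodes l K \<subseteq> lnode (verts K) l ` lindices (verts K) l"
  proof
    fix z assume "z \<in> element_nodes l K"
    then obtain \<alpha> :: "'a \<Rightarrow> nat" where a: "z = (\<Sum>v\<in>verts K. (real (\<alpha> v) / real l) *\<^sub>R v)" "sum \<alpha> (verts K) = l"
      by (auto simp: element_nodes_def verts_def)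
    define \<gamma> where "\<gamma> v = (if v \<in> verts K then \<alpha> v else 0)" for v
    have "\<gamma> \<in> lindices (verts K) l" using a by (auto simp: lindices_def \<gamma>_def cong: sum.cong)
    moreover have "z = lnode (verts K) l \<gamma>" unfolding a(1) lnode_def by (intro sum.cong) (auto simp: \<gamma>_def)
    ultimately show "z \<in> lnode (verts K) l ` lindices (verts K) l" by blast
  qed
qed

context mesh
begin

text \<open>A mesh node that lies in K lies on the face common to K and the element that produced
  it. Its index is supported on that face and is therefore an index of K as well.\<close>

lemma node_of_elem:
  assumes l: "l > 0" and z: "z \<in> nodes l \<T>" and K: "K \<in> \<T>" "z \<in> K"
  obtains \<gamma> where "\<gamma> \<in> lindices (verts K) l" "z = lnode (verts K) l \<gamma>"
proof -
  obtain K0 \<gamma> where K0: "K0 \<in> \<T>" "\<gamma> \<in> lindices (verts K0) l" "z = lnode (verts K0) l \<gamma>"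
    using z by (auto simp: nodes_def element_nodes_eq)
  obtain C where C: "C \<subseteq> verts K0" "C \<subseteq> verts K" "K0 \<inter> K = convex hull C" "\<not> affine_dependent C"
    by (rule elem_meet[OF K0(1) K(1)])
  have "z \<in> K0" using lnode_mem_hull[OF finite_verts[OF K0(1)] K0(2) l] elem(2)[OF K0(1)] K0(3) by simp
  then have "lnode (verts K0) l \<gamma> \<in> convex hull C" using C(3) K K0(3) by auto
  note f = lnode_face[OF elem(1)[OF K0(1)] C(1) K0(2) l this]
  have "\<gamma> \<in> lindices (verts K) l" "lnode (verts K) l \<gamma> = z"
    using lindices_mono[OF finite_verts[OF K(1)] C(2) f(1)] f(2) K0(3) by auto
  then show ?thesis using that by blast
qed

lemma lnode_mem: "K \<in> \<T> \<Longrightarrow> \<gamma> \<in> lindices (verts K) l \<Longrightarrow> l > 0 \<Longrightarrow> lnode (verts K) l \<gamma> \<in> K"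
  using lnode_mem_hull[OF finite_verts] elem(2) by metis

lemma lnode_nodes: "K \<in> \<T> \<Longrightarrow> \<gamma> \<in> lindices (verts K) l \<Longrightarrow> lnode (verts K) l \<gamma> \<in> nodes l \<T>"
  by (auto simp: nodes_def element_nodes_eq)

definition nint where "nint l val x = lint l val (verts (SOME K. K \<in> \<T> \<and> x \<in> K)) x"

text \<open>On a common face the coordinate vectors of both elements agree and only nodes of the
  face contribute, so the element chosen in \<open>nint\<close> is immaterial. Continuity of the
  interpolant follows.\<close>

lemma nint_eq:
  assumes "K \<in> \<T>" "x \<in> K" shows "nint l val x = lint l val (verts K) x"
proof -
  define K' where "K' = (SOME K. K \<in> \<T> \<and> x \<in> K)"
  have K': "K' \<in> \<T> \<and> x \<in> K'" unfolding K'_def by (rule someI[of _ K]) (use assms in blast)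
  obtain C where C: "C \<subseteq> verts K" "C \<subseteq> verts K'" "K \<inter> K' = convex hull C" "\<not> affine_dependent C"
    using K' by (auto intro: elem_meet[OF assms(1), of K'])
  have x: "x \<in> convex hull C" using C(3) assms K' by auto
  have "bary (verts K) x v = bary (verts K') x v" for v
  proof (cases "v \<in> C")
    case True
    then show ?thesis
      using bary_subset(1)[OF elem(1)[OF assms(1)] C(1) bary_face(2,3)[OF elem(1) C(2) x]] K' by simp
  next
    case False
    then show ?thesis
      using bary_face(1)[OF elem(1)[OF assms(1)] C(1) x] bary_face(1)[OF elem(1) C(2) x] K' by simp
  qed
  then have "bary (verts K) x = bary (verts K') x" by (rule ext)
  then show ?thesis
    unfolding nint_def K'_def[symmetric]
    using lint_face[OF elem(1)[OF assms(1)] C(1) x, of l val] lint_face[OF elem(1) C(2) x, of l val] K' by simp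
qed

lemma continuous_on_elems:
  assumes "\<And>K. K \<in> \<T> \<Longrightarrow> continuous_on K v" shows "continuous_on \<Omega> v"
proof -
  have "continuous_on (\<Union>K\<in>\<T>. K) v"
    using assms fT compact_imp_closed[OF compact_elem] by (intro continuous_on_closed_Union) auto
  then show ?thesis using continuous_on_subset \<Omega>_subset by auto
qed

lemma nint_cpw: "nint l val \<in> cpw_poly l \<T> \<Omega>"
proof -
  have "continuous_on K (nint l val)" if K: "K \<in> \<T>" for K
    using Ck_imp_continuous_on[OF Ck_polyd[OF polyd_lint[OF elem(1)[OF K]], of 0], of K l val]
    by (subst continuous_on_cong[OF refl, of K _ "lint l val (verts K)"]) (auto simp: nint_eq[OF K])
  moreover have "nint l val \<in> Poly l K" if K: "K \<in> \<T>" for K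
    unfolding Poly_iff using polyd_lint[OF elem(1)[OF K]] nint_eq[OF K] by blast
  ultimately show ?thesis using continuous_on_elems by (auto simp: cpw_poly_def)
qed

lemma nint_node:
  assumes "l > 0" "z \<in> nodes l \<T>" shows "nint l val z = val z"
proof -
  obtain K \<gamma> where K: "K \<in> \<T>" "\<gamma> \<in> lindices (verts K) l" "z = lnode (verts K) l \<gamma>"
    using assms by (auto simp: nodes_def element_nodes_eq)
  then show ?thesis
    using nint_eq[OF K(1) lnode_mem[OF K(1,2) assms(1)]] lint_lnode[OF elem(1)[OF K(1)] K(2) assms(1)] by simp
qed

text \<open>A Lagrange function is a product of nonconstant affine functions on the whole space, so
  its zeros lie on finitely many hyperplanes.\<close>

lemma lag_zero_negligible:
  assumes K: "K \<in> \<T>" and l: "l > 0"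
  shows "negligible {x. lag (verts K) l \<gamma> (bary (verts K) x) = 0}"
proof -
  have fv: "finite (verts K)" using finite_verts[OF K] .
  have "negligible {x. lfac (verts K) l i (bary (verts K) x) = 0}" if i: "i \<in> lidx (verts K) \<gamma>" for i
  proof -
    have iv: "fst i \<in> verts K" using i by (auto simp: lidx_def)
    have "{x. lfac (verts K) l i (bary (verts K) x) = 0}
       \<subseteq> {x. bgrad (verts K) (fst i) \<bullet> x = real (snd i) / real l - bary (verts K) 0 (fst i)}"
    proof
      fix x assume "x \<in> {x. lfac (verts K) l i (bary (verts K) x) = 0}"
      then have "real l * bary (verts K) x (fst i) - real (snd i) = 0"
        by (simp add: lfac_def bary_props(2)[OF elem(1)[OF K]] add_eq_0_iff)
      then have "bary (verts K) x (fst i) = real (snd i) / real l" using l by (simp add: field_simps)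
      then show "x \<in> {x. bgrad (verts K) (fst i) \<bullet> x = real (snd i) / real l - bary (verts K) 0 (fst i)}"
        using bary_affine[OF elem(1)[OF K], of x "fst i" 0] by simp
    qed
    then show ?thesis
      using negligible_hyperplane[of "bgrad (verts K) (fst i)"] bgrad_nonzero[OF elem(1)[OF K] iv] negligible_subset by blast
  qed
  then have "negligible (\<Union>i\<in>lidx (verts K) \<gamma>. {x. lfac (verts K) l i (bary (verts K) x) = 0})"
    using finite_lidx[OF fv] by (intro negligible_Union) auto
  moreover have "{x. lag (verts K) l \<gamma> (bary (verts K) x) = 0} = (\<Union>i\<in>lidx (verts K) \<gamma>. {x. lfac (verts K) l i (bary (verts K) x) = 0})"
    using finite_lidx[OF fv] by (auto simp: lag_def)
  ultimately show ?thesis by simp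
qed

text \<open>Reduces the support of the nodal basis function to membership of z. The chosen function
  has prescribed values at all nodes, so on each element it is the local Lagrange function of z, or
  0 if z is not in the element.\<close>

lemma node_patch_iff:
  assumes l: "l > 0" and z: "z \<in> nodes l \<T>" and K: "K \<in> \<T>"
  shows "K \<subseteq> node_patch l \<T> \<Omega> z \<longleftrightarrow> z \<in> K"
proof -
  define \<delta> where "\<delta> y = (if y = z then 1 else 0 :: real)" for y
  define \<phi> where "\<phi> = nodal_basis l \<T> \<Omega> z"
  have "nint l \<delta> \<in> cpw_poly l \<T> \<Omega> \<and> (\<forall>y\<in>nodes l \<T>. nint l \<delta> y = (if y = z then 1 else 0))"
    using nint_cpw nint_node[OF l] by (auto simp: \<delta>_def)
  then have \<phi>: "\<phi> \<in> cpw_poly l \<T> \<Omega> \<and> (\<forall>y\<in>nodes l \<T>. \<phi> y = (if y = z then 1 else 0))"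
    unfolding \<phi>_def nodal_basis_def
    by (rule someI[of "\<lambda>\<phi>. \<phi> \<in> cpw_poly l \<T> \<Omega> \<and> (\<forall>y\<in>nodes l \<T>. \<phi> y = (if y = z then 1 else 0))"])
  have \<phi>K: "\<phi> x = lint l \<delta> (verts X) x" if X: "X \<in> \<T>" "x \<in> X" for X x
  proof -
    obtain q where q: "polyd l q" "\<And>x. x \<in> X \<Longrightarrow> \<phi> x = q x"
      using \<phi> X(1) by (auto simp: cpw_poly_def Poly_iff)
    have "q (lnode (verts X) l \<gamma>) = \<delta> (lnode (verts X) l \<gamma>)" if g: "\<gamma> \<in> lindices (verts X) l" for \<gamma>
      using q(2)[OF lnode_mem[OF X(1) g l]] \<phi> lnode_nodes[OF X(1) g] by (simp add: \<delta>_def)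
    then have "lint l q (verts X) x = lint l \<delta> (verts X) x" by (simp add: lint_def cong: sum.cong)
    then show ?thesis using q X polyd_eq_lint[OF elem(1)[OF X(1)] q(1) l] by simp
  qed
  have np: "node_patch l \<T> \<Omega> z = closure {x \<in> closure \<Omega>. \<phi> x \<noteq> 0}"
    by (simp add: node_patch_def supp_in_def \<phi>_def)
  show ?thesis
  proof
    assume sub: "K \<subseteq> node_patch l \<T> \<Omega> z"
    have "node_patch l \<T> \<Omega> z \<subseteq> \<Union>(patch z)"
      unfolding np
    proof (rule closure_minimal)
      show "closed (\<Union>(patch z))"
        using finite_patch compact_imp_closed[OF compact_elem] by (intro closed_Union) (auto simp: patch_def)
      show "{x \<in> closure \<Omega>. \<phi> x \<noteq> 0} \<subseteq> \<Union>(patch z)"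
      proof
        fix x assume x: "x \<in> {x \<in> closure \<Omega>. \<phi> x \<noteq> 0}"
        then obtain X where X: "X \<in> \<T>" "x \<in> X" using UT by blast
        have "z \<in> X"
        proof (rule ccontr)
          assume "z \<notin> X"
          then have "\<delta> (lnode (verts X) l \<gamma>) = 0" if "\<gamma> \<in> lindices (verts X) l" for \<gamma>
            using lnode_mem[OF X(1) that l] by (auto simp: \<delta>_def)
          then have "lint l \<delta> (verts X) x = 0" by (simp add: lint_def)
          then show False using \<phi>K[OF X] x by simp
        qed
        then show "x \<in> \<Union>(patch z)" using X by (auto simp: patch_def)
      qed
    qed
    moreover obtain x where x: "x \<in> interior K" using interior_elem_ne[OF K] by blast
    ultimately obtain X where X: "X \<in> \<T>" "z \<in> X" "x \<in> X" using sub interior_subset by (fastforce simp: patch_def)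
    then show "z \<in> K" using interior_meet[OF K X(1) x] by simp
  next
    assume zK: "z \<in> K"
    obtain \<gamma> where g: "\<gamma> \<in> lindices (verts K) l" "z = lnode (verts K) l \<gamma>" by (rule node_of_elem[OF l z K zK])
    have fv: "finite (verts K)" using finite_verts[OF K] .
    have "\<delta> (lnode (verts K) l \<gamma>') = (if \<gamma>' = \<gamma> then 1 else 0)" if g': "\<gamma>' \<in> lindices (verts K) l" for \<gamma>'
    proof (cases "lnode (verts K) l \<gamma>' = z")
      case True
      have "\<gamma>' v = \<gamma> v" for v
        using bary_lnode[OF elem(1)[OF K] subset_refl g' l, of v] bary_lnode[OF elem(1)[OF K] subset_refl g(1) l, of v] True g(2) l by simp
      then show ?thesis using True by (auto simp: \<delta>_def)
    qed (use g(2) in \<open>auto simp: \<delta>_def\<close>)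
    then have "lint l \<delta> (verts K) x = (\<Sum>\<gamma>'\<in>lindices (verts K) l. if \<gamma>' = \<gamma> then lag (verts K) l \<gamma> (bary (verts K) x) else 0)" for x
      unfolding lint_def by (intro sum.cong) auto
    then have lag: "lint l \<delta> (verts K) x = lag (verts K) l \<gamma> (bary (verts K) x)" for x
      using g(1) finite_lindices(1)[OF fv] by simp
    have "interior K \<subseteq> node_patch l \<T> \<Omega> z"
    proof
      fix x assume x: "x \<in> interior K"
      show "x \<in> node_patch l \<T> \<Omega> z"
        unfolding np
      proof (rule closure_iff_nhds_not_empty[THEN iffD2], intro allI impI)
        fix A N assume N: "N \<subseteq> A" and N2: "open N" "x \<in> N"
        \<comment> \<open>Zeros of the Lagrange function form a null set, so points with nonzero
          value are dense in the interior of K.\<close>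
        have "\<not> negligible (N \<inter> interior K)" using N2 x by (intro open_not_negligible) auto
        then obtain y where y: "y \<in> N" "y \<in> interior K" "lag (verts K) l \<gamma> (bary (verts K) y) \<noteq> 0"
          using negligible_subset[OF lag_zero_negligible[OF K l, of \<gamma>], of "N \<inter> interior K"] by blast
        have "y \<in> closure \<Omega>" using y interior_subset UT K by blast
        moreover have "\<phi> y \<noteq> 0" using \<phi>K[OF K] y lag interior_subset[of K] by auto
        ultimately show "{x \<in> closure \<Omega>. \<phi> x \<noteq> 0} \<inter> A \<noteq> {}" using y N by blast
      qed
    qed
    then have "closure (interior K) \<subseteq> node_patch l \<T> \<Omega> z" unfolding np by (intro closure_minimal) auto
    then show "K \<subseteq> node_patch l \<T> \<Omega> z"
      using convex_closure_interior[OF convex_elem[OF K] interior_elem_ne[OF K]] closure_subset by auto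
  qed
qed

subsection \<open>Monotone paths of bounded length\<close>

text \<open>The square counts ordered pairs of elements in a patch; \<open>ratio\<close> is the
  largest change of diameter along a path of that length.\<close>

definition npath where "npath = (nat \<lceil>(4 * \<sigma>) ^ DIM('a)\<rceil>)\<^sup>2"
definition ratio where "ratio = max 1 (4 * \<sigma>) ^ npath"

lemma card_patch_npath: "(card (patch z))\<^sup>2 \<le> npath"
proof -
  have "card (patch z) \<le> nat \<lceil>(4 * \<sigma>) ^ DIM('a)\<rceil>"
    using card_patch[of z] by linarith
  then show ?thesis unfolding npath_def by (intro power_mono) auto
qed

abbreviation aval where "aval a K \<equiv> element_value a K"

text \<open>A shortest monotone path visits no pair of neighbours twice, so its length is at most
  \<^const>\<open>npath\<close>. Diameters of neighbours are comparable only in dimension at least two; on the line a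
  node has at most two elements, and \<open>K\<^sub>z\<close> is the one of larger weight.\<close>

lemma node_path:
  fixes W :: "'a set \<Rightarrow> real"
  assumes qm: "quasi_monotone l \<T> \<Omega> a" and l: "l > 0" and z: "z \<in> nodes l \<T>"
    and c: "c \<ge> 1" and W0: "\<And>K. K \<in> \<T> \<Longrightarrow> W K > 0"
    and W: "\<And>K K'. K \<in> \<T> \<Longrightarrow> K' \<in> \<T> \<Longrightarrow> diameter K \<le> ratio * diameter K' \<Longrightarrow> diameter K' \<le> ratio * diameter K
       \<Longrightarrow> aval a K \<le> aval a K' \<Longrightarrow> W K \<le> c * W K'"
  obtains Kz where "Kz \<in> patch z"
    and "\<And>K. K \<in> patch z \<Longrightarrow> \<exists>n\<le>npath. \<exists>f. f 0 = K \<and> f n = Kz \<and>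
       (\<forall>i\<le>n. f i \<in> patch z \<and> W K \<le> c * W (f i)) \<and> (\<forall>i<n. adj (f i) (f (Suc i)))"
proof -
  define R where "R = {(K, K'). K \<in> patch z \<and> K' \<in> patch z \<and> adj K K' \<and> aval a K \<le> aval a K'}"
  have Rs: "R \<subseteq> patch z \<times> patch z" by (auto simp: R_def)
  have fR: "finite R" using Rs finite_patch finite_subset by blast
  have "card R \<le> card (patch z \<times> patch z)" using Rs finite_patch by (intro card_mono) auto
  then have cR: "card R \<le> npath" using card_patch_npath[of z] by (simp add: card_cartesian_product power2_eq_square)
  have ne: "patch z \<noteq> {}"
    using z lnode_mem[OF _ _ l] by (fastforce simp: nodes_def element_nodes_eq patch_def)
  have conn: "(K, K') \<in> R\<^sup>*" if KK: "K \<in> patch z" "K' \<in> patch z" "aval a K \<le> aval a K'" for K K'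
  proof -
    have "K \<in> \<T>" "K' \<in> \<T>" "z \<in> K" "z \<in> K'" using KK by (auto simp: patch_def)
    then obtain m P where P: "monotone_path \<T> \<Omega> a (node_patch l \<T> \<Omega> z) m P K K'"
      using qm z KK(3) node_patch_iff[OF l z] unfolding quasi_monotone_def by blast
    have Pm: "P n \<in> patch z" if "n \<le> m" for n
      using P that node_patch_iff[OF l z] by (auto simp: monotone_path_def patch_def)
    have "(K, P n) \<in> R\<^sup>*" if "n \<le> m" for n
      using that
    proof (induction n)
      case 0
      then show ?case using P by (simp add: monotone_path_def)
    next
      case (Suc n)
      have T: "P n \<in> \<T>" "P (Suc n) \<in> \<T>" using Pm[of n] Pm[of "Suc n"] Suc.prems by (auto simp: patch_def)
      have fc: "P n \<inter> P (Suc n) \<in> interior_faces \<T> \<Omega>" "aval a (P n) \<le> aval a (P (Suc n))"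
        using P Suc.prems by (auto simp: monotone_path_def)
      \<comment> \<open>An interior face is known to be a facet of some element only. All elements
        have full dimension, so the dimension count carries over to \<open>P n\<close>.\<close>
      then obtain X where X: "X \<in> \<T>" "(P n \<inter> P (Suc n)) facet_of X" by (auto simp: interior_faces_def)
      have d: "aff_dim X = int DIM('a)" if "X \<in> \<T>" for X
        using aff_dim_convex_hull[of "verts X"] elem[OF that] aff_dim_affine_independent[of "verts X"]
        by (simp add: full_simplex_def)
      have "(P n \<inter> P (Suc n)) face_of P n" using conf T by (simp add: conforming_mesh_def triangulation_def)
      then have "adj (P n) (P (Suc n))" using X T d[OF X(1)] d[OF T(1)] by (simp add: adj_def facet_of_def)
      then have "(P n, P (Suc n)) \<in> R" using fc Pm[of n] Pm[of "Suc n"] Suc.prems by (simp add: R_def)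
      then show ?case using Suc by (meson Suc_leD rtrancl.rtrancl_into_rtrancl)
    qed
    then show ?thesis using P by (auto simp: monotone_path_def)
  qed
  show ?thesis
  proof (cases "DIM('a) \<ge> 2")
    case True
    define M where "M = Max (aval a ` patch z)"
    have "M \<in> aval a ` patch z" unfolding M_def using finite_patch ne by (intro Max_in) auto
    then obtain Kz where Kz: "Kz \<in> patch z" "aval a Kz = M" by auto
    have max: "aval a K \<le> aval a Kz" if "K \<in> patch z" for K
      unfolding Kz(2) M_def using that finite_patch by (intro Max_ge) auto
    show ?thesis
    proof (rule that[OF Kz(1)])
      fix K assume K: "K \<in> patch z"
      have "(K, Kz) \<in> (\<Union>n\<in>{n. n \<le> card R}. R ^^ n)"
        using conn[OF K Kz(1) max[OF K]] rtrancl_finite_eq_relpow[OF fR] by simp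
      then obtain n where n: "n \<le> card R" "(K, Kz) \<in> R ^^ n" by blast
      then obtain f where f: "f 0 = K" "f n = Kz" "\<And>i. i < n \<Longrightarrow> (f i, f (Suc i)) \<in> R"
        unfolding relpow_fun_conv by blast
      have fp: "f i \<in> patch z" if "i \<le> n" for i
        using that f K by (cases i) (auto simp: R_def)
      define A where "A = max 1 (4 * \<sigma>)"
      have A: "A \<ge> 1" "4 * \<sigma> \<le> A" by (auto simp: A_def)
      \<comment> \<open>Diameters of neighbours differ by at most the factor A per step, and the
        coefficient does not decrease, so every element of the path is comparable with its
        start.\<close>
      have st: "aval a K \<le> aval a (f i) \<and> diameter K \<le> A ^ i * diameter (f i) \<and> diameter (f i) \<le> A ^ i * diameter K" if "i \<le> n" for i
        using that
      proof (induction i)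
        case (Suc i)
        then have IH: "aval a K \<le> aval a (f i)" "diameter K \<le> A ^ i * diameter (f i)" "diameter (f i) \<le> A ^ i * diameter K" by auto
        have r: "(f i, f (Suc i)) \<in> R" using f(3) Suc.prems by simp
        then have ad: "adj (f i) (f (Suc i))" "aval a (f i) \<le> aval a (f (Suc i))" by (auto simp: R_def)
        have T: "f i \<in> \<T>" "f (Suc i) \<in> \<T>" using ad(1) by (auto simp: adj_def)
        have "diameter (f i) \<le> A * diameter (f (Suc i))" "diameter (f (Suc i)) \<le> A * diameter (f i)"
          by (rule order_trans[OF adj_diameter[OF ad(1) True] mult_right_mono[OF A(2) less_imp_le[OF diameter_pos[OF T(2)]]]],
            rule order_trans[OF adj_diameter[OF adj_sym[OF ad(1)] True] mult_right_mono[OF A(2) less_imp_le[OF diameter_pos[OF T(1)]]]])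
        then have "A ^ i * diameter (f i) \<le> A ^ i * (A * diameter (f (Suc i)))" "diameter (f (Suc i)) \<le> A * (A ^ i * diameter K)"
          using IH(3) A by (auto intro!: mult_left_mono intro: order_trans[OF _ mult_left_mono])
        then show ?case using IH ad(2) by (simp add: mult_ac)
      qed (use f in simp)
      have "W K \<le> c * W (f i)" if i: "i \<le> n" for i
      proof (rule W)
        have T: "K \<in> \<T>" "f i \<in> \<T>" using K fp[OF i] by (auto simp: patch_def)
        then show "K \<in> \<T>" "f i \<in> \<T>" by auto
        have "A ^ i \<le> ratio" unfolding ratio_def A_def[symmetric] using i n cR A by (intro power_increasing) auto
        then have "A ^ i * diameter (f i) \<le> ratio * diameter (f i)" "A ^ i * diameter K \<le> ratio * diameter K"
          using diameter_pos T by (auto intro!: mult_right_mono less_imp_le)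
        then show "diameter K \<le> ratio * diameter (f i)" "diameter (f i) \<le> ratio * diameter K" "aval a K \<le> aval a (f i)"
          using st[OF i] by auto
      qed
      then show "\<exists>n\<le>npath. \<exists>f. f 0 = K \<and> f n = Kz \<and> (\<forall>i\<le>n. f i \<in> patch z \<and> W K \<le> c * W (f i)) \<and> (\<forall>i<n. adj (f i) (f (Suc i)))"
        using f fp n cR by (intro exI[of _ n] conjI exI[of _ f]) (auto simp: R_def)
    qed
  next
    case False
    then have d1: "DIM('a) = 1" using DIM_positive[where 'a = 'a] by linarith
    define M where "M = Max (W ` patch z)"
    have "M \<in> W ` patch z" unfolding M_def using finite_patch ne by (intro Max_in) auto
    then obtain Kz where Kz: "Kz \<in> patch z" "W Kz = M" by auto
    have max: "W K \<le> W Kz" if "K \<in> patch z" for K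
      unfolding Kz(2) M_def using that finite_patch by (intro Max_ge) auto
    have cW: "W K \<le> c * W K'" if "K' \<in> \<T>" "W K \<le> W K'" for K K'
      using mult_right_mono[OF c less_imp_le[OF W0[OF that(1)]]] that(2) by simp
    show ?thesis
    proof (rule that[OF Kz(1)])
      fix K assume K: "K \<in> patch z"
      have T: "K \<in> \<T>" "Kz \<in> \<T>" using K Kz by (auto simp: patch_def)
      show "\<exists>n\<le>npath. \<exists>f. f 0 = K \<and> f n = Kz \<and> (\<forall>i\<le>n. f i \<in> patch z \<and> W K \<le> c * W (f i)) \<and> (\<forall>i<n. adj (f i) (f (Suc i)))"
      proof (cases "K = Kz")
        case True
        then show ?thesis using K cW[OF T(1)] by (intro exI[of _ 0] conjI exI[of _ "\<lambda>i. K"]) auto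
      next
        case False
        \<comment> \<open>At most two elements meet at z, so the first step of any path that leaves
          X must arrive at Y.\<close>
        have step: "adj X Y" if XY: "X \<in> patch z" "Y \<in> patch z" "X \<noteq> Y" "aval a X \<le> aval a Y" for X Y
        proof -
          obtain U where U: "(X, U) \<in> R" using conn[OF XY(1,2,4)] XY(3) by (meson converse_rtranclE)
          then have "X \<noteq> U" "U \<in> patch z" using adj_neq by (auto simp: R_def)
          then have "U = Y" using patch_1d[OF d1 XY(1) _ XY(2), of U] XY(3) by auto
          then show ?thesis using U by (simp add: R_def)
        qed
        have "adj K Kz" using step[OF K Kz(1) False] step[OF Kz(1) K] False adj_sym by (metis linear)
        moreover have "1 \<le> npath"
          using card_patch_npath[of z] ne finite_patch[of z] by (metis One_nat_def Suc_leI card_gt_0_iff le_trans zero_less_power)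
        ultimately show ?thesis
          using K Kz cW[OF T(1), of K] cW[OF T(2) max[OF K]]
          by (intro exI[of _ 1] conjI exI[of _ "\<lambda>i. if i = 0 then K else Kz"]) auto
      qed
    qed
  qed
qed

end

section \<open>Elementwise errors\<close>

definition sq_on :: "'a::euclidean_space set \<Rightarrow> ('a \<Rightarrow> 'b::euclidean_space) \<Rightarrow> real" where
  "sq_on K f = (LINT x:interior K|lebesgue. (norm (f x))\<^sup>2)"

lemma sq_on_nonneg [simp]: "0 \<le> sq_on K f"
  unfolding sq_on_def set_lebesgue_integral_def by (intro integral_nonneg_AE) auto

lemma sq_on_cong: "(\<And>x. x \<in> interior K \<Longrightarrow> norm (f x) = norm (g x)) \<Longrightarrow> sq_on K f = sq_on K g"
  unfolding sq_on_def set_lebesgue_integral_def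
  by (intro Bochner_Integration.integral_cong) (auto simp: indicator_def)

lemma open_sets_lebesgue: "open D \<Longrightarrow> D \<in> sets lebesgue"
  using borel_open sets_completionI_sets sets_lborel by metis

lemma interior_sets_lebesgue [simp]: "interior K \<in> sets lebesgue"
  by (simp add: open_sets_lebesgue)

lemma L2_sq_integrable:
  fixes f :: "'a::euclidean_space \<Rightarrow> 'b::euclidean_space"
  shows "f \<in> L2 (interior K) \<Longrightarrow> set_integrable lebesgue (interior K) (\<lambda>x. (norm (f x))\<^sup>2)"
  using L2_iff[of "interior K" f] by simp

lemma L2_open_subset:
  fixes f :: "'a::euclidean_space \<Rightarrow> 'b::euclidean_space"
  assumes f: "f \<in> L2 D" and D: "D \<in> sets lebesgue" "open D'" "D' \<subseteq> D" shows "f \<in> L2 D'"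
proof -
  have D': "D' \<in> sets lebesgue" using D open_sets_lebesgue by blast
  have m: "(\<lambda>x. indicator D x *\<^sub>R f x) \<in> borel_measurable lebesgue" "set_integrable lebesgue D (\<lambda>x. (norm (f x))\<^sup>2)"
    using f L2_iff[OF D(1)] by auto
  have "(\<lambda>x. indicator D' x *\<^sub>R (indicator D x *\<^sub>R f x)) \<in> borel_measurable lebesgue"
    by (rule borel_measurable_scaleR[OF borel_measurable_indicator[OF D'] m(1)])
  moreover have "(\<lambda>x. indicator D' x *\<^sub>R (indicator D x *\<^sub>R f x)) = (\<lambda>x. indicator D' x *\<^sub>R f x)"
    using D(3) by (intro ext) (auto simp: indicator_def)
  ultimately have "(\<lambda>x. indicator D' x *\<^sub>R f x) \<in> borel_measurable lebesgue" by metis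
  then show ?thesis
    unfolding L2_iff[OF D'] using set_integrable_subset[OF m(2) D' D(3)] by simp
qed

lemma L2_continuous:
  fixes f :: "'a::euclidean_space \<Rightarrow> 'b::euclidean_space"
  assumes K: "compact K" and f: "continuous_on UNIV f" shows "f \<in> L2 (interior K)"
proof -
  have "bounded (f ` K)"
    using continuous_on_subset[OF f] K by (intro compact_imp_bounded compact_continuous_image) auto
  then obtain B where "\<And>x. x \<in> K \<Longrightarrow> norm (f x) \<le> B" by (auto simp: bounded_iff)
  moreover have "f \<in> borel_measurable lebesgue"
    using borel_measurable_continuous_onI[OF f] by (simp add: measurable_completion)
  ultimately show ?thesis
    using interior_subset[of K] bounded_interior[OF compact_imp_bounded[OF K]]
    by (intro L2_bounded[of _ _ B] borel_measurable_scaleR borel_measurable_indicator) auto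
qed

lemma sq_on_diff_le:
  fixes f g :: "'a::euclidean_space \<Rightarrow> 'b::euclidean_space"
  assumes f: "f \<in> L2 (interior K)" and g: "g \<in> L2 (interior K)"
  shows "sq_on K (\<lambda>x. f x - g x) \<le> 2 * sq_on K f + 2 * sq_on K g"
proof -
  have i: "set_integrable lebesgue (interior K) (\<lambda>x. (norm (f x))\<^sup>2)" "set_integrable lebesgue (interior K) (\<lambda>x. (norm (g x))\<^sup>2)"
    "set_integrable lebesgue (interior K) (\<lambda>x. (norm (f x - g x))\<^sup>2)"
    by (rule L2_sq_integrable[OF f], rule L2_sq_integrable[OF g], rule L2_sq_integrable[OF L2_diff[OF f g interior_sets_lebesgue]])
  have i2: "set_integrable lebesgue (interior K) (\<lambda>x. 2 * (norm (f x))\<^sup>2)" "set_integrable lebesgue (interior K) (\<lambda>x. 2 * (norm (g x))\<^sup>2)"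
    using i by auto
  have "sq_on K (\<lambda>x. f x - g x) \<le> (LINT x:interior K|lebesgue. 2 * (norm (f x))\<^sup>2 + 2 * (norm (g x))\<^sup>2)"
    unfolding sq_on_def by (intro set_integral_mono i set_integral_add(1) i2 norm_diff_sq_le)
  also have "\<dots> = 2 * sq_on K f + 2 * sq_on K g"
    unfolding sq_on_def using set_integral_add(2)[OF i2] by simp
  finally show ?thesis .
qed

text \<open>Cauchy-Schwarz against the constant 1: the integral of (|g| - t)^2 is a nonnegative
  quadratic in t, with its minimum at t = E / vol K.\<close>

lemma integral_norm_sq_le:
  fixes g :: "'a::euclidean_space \<Rightarrow> 'a"
  assumes g: "g \<in> L2 (interior K)" and K: "bounded K" and v: "measure lebesgue (interior K) = vol K"
  shows "(LINT x:interior K|lebesgue. norm (g x))\<^sup>2 \<le> vol K * sq_on K g"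
proof -
  define E where "E = (LINT x:interior K|lebesgue. norm (g x))"
  have bi: "bounded (interior K)" using K bounded_interior by blast
  have i1: "set_integrable lebesgue (interior K) (\<lambda>x. norm (g x))"
    by (rule set_integrable_norm_gradient[OF L2_imp_set_integrable[OF g interior_sets_lebesgue bi]])
  have i2: "set_integrable lebesgue (interior K) (\<lambda>x. (norm (g x))\<^sup>2)"
    by (rule L2_sq_integrable[OF g])
  have i3: "set_integrable lebesgue (interior K) (\<lambda>x. c)" for c :: real
    by (rule set_integrable_const_bounded[OF interior_sets_lebesgue bi])
  have c: "(LINT x:interior K|lebesgue. c) = c * vol K" for c :: real
    using v bounded_set_imp_lmeasurable[OF bi interior_sets_lebesgue]
    by (simp add: set_lebesgue_integral_def mult.commute)
  have q: "0 \<le> t\<^sup>2 * vol K - 2 * t * E + sq_on K g" for t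
  proof -
    have "0 \<le> (LINT x:interior K|lebesgue. (norm (g x) - t)\<^sup>2)"
      unfolding set_lebesgue_integral_def by (intro integral_nonneg_AE) auto
    also have "\<dots> = (LINT x:interior K|lebesgue. ((norm (g x))\<^sup>2 + t\<^sup>2) - 2 * t * norm (g x))"
      by (simp add: power2_diff algebra_simps)
    also have "\<dots> = sq_on K g + t\<^sup>2 * vol K - 2 * t * E"
      using set_integral_diff(2)[OF set_integral_add(1)[OF i2 i3[of "t\<^sup>2"]] set_integrable_mult_right[OF i1, of "2 * t"]]
        set_integral_add(2)[OF i2 i3[of "t\<^sup>2"]] c[of "t\<^sup>2"] by (simp add: sq_on_def E_def)
    finally show ?thesis by simp
  qed
  have "E\<^sup>2 \<le> vol K * sq_on K g"
  proof (cases "vol K = 0")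
    case True
    have "E \<le> 0"
    proof (rule ccontr)
      assume "\<not> E \<le> 0"
      \<comment> \<open>Without a quadratic term this choice of t gives the value -1.\<close>
      then show False using q[of "(sq_on K g + 1) / (2 * E)"] True by (simp add: field_simps)
    qed
    moreover have "E \<ge> 0" unfolding E_def set_lebesgue_integral_def by (intro integral_nonneg_AE) auto
    ultimately show ?thesis using True by simp
  next
    case False
    then have "vol K > 0" by (simp add: vol_def less_le)
    then show ?thesis using q[of "E / vol K"] by (simp add: field_simps power2_eq_square)
  qed
  then show ?thesis by (simp add: E_def)
qed

lemma power2_diff_le: "(x - y)\<^sup>2 \<le> 2 * (x - z)\<^sup>2 + 2 * (z - y)\<^sup>2" for x y z :: real
  using sum_squares_bound[of "x - z" "z - y"] power2_sum[of "x - z" "z - y"] by simp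

context mesh
begin

lemma measure_interior_elem: "K \<in> \<T> \<Longrightarrow> measure lebesgue (interior K) = vol K"
  unfolding vol_def
  by (rule measure_interior[OF bounded_elem negligible_convex_frontier[OF convex_elem]])

text \<open>D may be anything between the union of the open elements and the union of the closed
  ones, as the frontiers are null sets. This serves the domain as well as the face patches.\<close>

lemma sq_on_pieces:
  fixes f :: "'a \<Rightarrow> 'b::euclidean_space"
  assumes S: "\<S> \<subseteq> \<T>" and D: "(\<Union>K\<in>\<S>. interior K) \<subseteq> D" "D \<subseteq> \<Union>\<S>"
    and f: "\<And>K. K \<in> \<S> \<Longrightarrow> f \<in> L2 (interior K)"
  shows "(L2_norm_on D f)\<^sup>2 = (\<Sum>K\<in>\<S>. sq_on K f)"
proof -
  define U where "U = (\<Union>K\<in>\<S>. interior K)"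
  have fS: "finite \<S>" using S fT finite_subset by blast
  have "negligible (\<Union>K\<in>\<S>. frontier K)"
    using fS S negligible_convex_frontier[OF convex_elem] by (intro negligible_Union) auto
  moreover have "D - U \<subseteq> (\<Union>K\<in>\<S>. frontier K)"
  proof
    fix x assume x: "x \<in> D - U"
    then obtain K where K: "K \<in> \<S>" "x \<in> K" using D(2) by blast
    then have "x \<in> frontier K" using x closure_subset[of K] by (auto simp: U_def frontier_def)
    then show "x \<in> (\<Union>K\<in>\<S>. frontier K)" using K by blast
  qed
  ultimately have n: "negligible (D - U)" using negligible_subset by blast
  have U: "U \<in> sets lebesgue" unfolding U_def by (intro open_sets_lebesgue open_UN) auto
  have "U \<union> (D - U) \<in> sets lebesgue" using U negligible_imp_sets[OF n] by blast
  moreover have "U \<union> (D - U) = D" using D by (auto simp: U_def)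
  ultimately have Dm: "D \<in> sets lebesgue" by simp
  have i: "set_integrable lebesgue (interior K) (\<lambda>x. (norm (f x))\<^sup>2)" if "K \<in> \<S>" for K
    by (rule L2_sq_integrable[OF f[OF that]])
  have UD: "U \<subseteq> D" using D(1) by (simp add: U_def)
  have dj: "disjoint_family_on interior \<S>"
    unfolding disjoint_family_on_def using S interior_meet interior_subset by blast
  have iU: "set_integrable lebesgue U (\<lambda>x. (norm (f x))\<^sup>2)"
    unfolding U_def by (rule set_integrable_UN[OF fS i]) auto
  have AE: "AE x in lebesgue. indicator D x *\<^sub>R (norm (f x))\<^sup>2 = indicator U x *\<^sub>R (norm (f x))\<^sup>2"
    by (rule AE_I'[OF n[unfolded negligible_iff_null_sets]]) (use UD in \<open>auto simp: indicator_def split: if_splits\<close>)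
  have "(L2_norm_on D f)\<^sup>2 = (LINT x:D|lebesgue. (norm (f x))\<^sup>2)" by (rule L2_norm_on_sq[OF Dm])
  also have "\<dots> = (LINT x:U|lebesgue. (norm (f x))\<^sup>2)"
    unfolding set_lebesgue_integral_def
  proof (rule integral_cong_AE[OF _ _ AE])
    show "(\<lambda>x. indicator U x *\<^sub>R (norm (f x))\<^sup>2) \<in> borel_measurable lebesgue"
      using iU borel_measurable_integrable by (auto simp: set_integrable_def)
    then show "(\<lambda>x. indicator D x *\<^sub>R (norm (f x))\<^sup>2) \<in> borel_measurable lebesgue"
      by (rule borel_measurable_AE) (rule AE_mp[OF AE], simp)
  qed
  also have "\<dots> = (\<Sum>K\<in>\<S>. sq_on K f)"
    unfolding sq_on_def U_def using i by (intro set_integral_finite_Union fS dj) auto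
  finally show ?thesis .
qed

subsection \<open>Averaging along monotone paths\<close>

text \<open>Squared path length from telescoping, 2 for the two ends of each jump, (4
  \<open>\<sigma>\<close>)^d elements at a node, and (l + 1)^(d + 1) nodes in an element.\<close>

definition path_const where
  "path_const l = 2 * (real npath)\<^sup>2 * ((4 * \<sigma>) ^ DIM('a) * real (Suc l) ^ Suc DIM('a))"

lemma path_const_nonneg: "0 \<le> path_const l" using \<sigma> by (simp add: path_const_def)

lemma inj_on_lnode: "K \<in> \<T> \<Longrightarrow> l > 0 \<Longrightarrow> inj_on (lnode (verts K) l) (lindices (verts K) l)"
proof (intro inj_onI ext)
  fix \<gamma> \<gamma>' v
  assume K: "K \<in> \<T>" "l > 0" and g: "\<gamma> \<in> lindices (verts K) l" "\<gamma>' \<in> lindices (verts K) l"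
    and e: "lnode (verts K) l \<gamma> = lnode (verts K) l \<gamma>'"
  then show "\<gamma> v = \<gamma>' v"
    using bary_lnode[OF elem(1)[OF K(1)] subset_refl g(1) K(2), of v] bary_lnode[OF elem(1)[OF K(1)] subset_refl g(2) K(2), of v]
    by simp
qed

text \<open>The common core of both upper bounds. The weight \<open>W\<close> measures nodal values
  on an element and E / W is the matching bound for a jump. The value taken at z is that of the
  local polynomial on the final element \<open>Kz\<close>.\<close>

lemma node_average:
  fixes W E :: "'a set \<Rightarrow> real" and \<pi> :: "'a set \<Rightarrow> 'a \<Rightarrow> real"
  assumes qm: "quasi_monotone l \<T> \<Omega> a" and l: "l > 0"
    and c: "c \<ge> 1" and W0: "\<And>K. K \<in> \<T> \<Longrightarrow> W K > 0"
    and W: "\<And>K K'. K \<in> \<T> \<Longrightarrow> K' \<in> \<T> \<Longrightarrow> diameter K \<le> ratio * diameter K' \<Longrightarrow> diameter K' \<le> ratio * diameter K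
       \<Longrightarrow> aval a K \<le> aval a K' \<Longrightarrow> W K \<le> c * W K'"
    and E: "\<And>K. K \<in> \<T> \<Longrightarrow> 0 \<le> E K" and D: "D \<ge> 0"
    and jump: "\<And>K K' z. adj K K' \<Longrightarrow> z \<in> nodes l \<T> \<Longrightarrow> z \<in> K \<Longrightarrow> z \<in> K' \<Longrightarrow>
       (\<pi> K z - \<pi> K' z)\<^sup>2 \<le> D * (E K / W K + E K' / W K')"
  obtains val where
    "(\<Sum>K\<in>\<T>. W K * (\<Sum>\<gamma>\<in>lindices (verts K) l. (\<pi> K (lnode (verts K) l \<gamma>) - val (lnode (verts K) l \<gamma>))\<^sup>2))
      \<le> path_const l * (c * D) * (\<Sum>K\<in>\<T>. E K)"
proof -
  define N where "N = real npath"
  define G where "G z = (\<Sum>K\<in>patch z. E K)" for z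
  have G0: "G z \<ge> 0" for z unfolding G_def using E by (intro sum_nonneg) (auto simp: patch_def)
  have "\<exists>val. \<forall>K\<in>patch z. W K * (\<pi> K z - val)\<^sup>2 \<le> 2 * N\<^sup>2 * (c * D) * G z" if z: "z \<in> nodes l \<T>" for z
  proof -
    obtain Kz where Kz: "Kz \<in> patch z" "\<And>K. K \<in> patch z \<Longrightarrow> \<exists>n\<le>npath. \<exists>f. f 0 = K \<and> f n = Kz \<and>
       (\<forall>i\<le>n. f i \<in> patch z \<and> W K \<le> c * W (f i)) \<and> (\<forall>i<n. adj (f i) (f (Suc i)))"
      by (rule node_path[where W = W, OF qm l z c W0 W]) (assumption+, rule that)
    have "W K * (\<pi> K z - \<pi> Kz z)\<^sup>2 \<le> 2 * N\<^sup>2 * (c * D) * G z" if K: "K \<in> patch z" for K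
    proof -
      obtain n f where n: "n \<le> npath" and f: "f 0 = K" "f n = Kz" "\<And>i. i \<le> n \<Longrightarrow> f i \<in> patch z"
        "\<And>i. i \<le> n \<Longrightarrow> W K \<le> c * W (f i)" "\<And>i. i < n \<Longrightarrow> adj (f i) (f (Suc i))"
        using Kz(2)[OF K] by blast
      have KT: "K \<in> \<T>" using K by (simp add: patch_def)
      \<comment> \<open>Moving the weight from K to the element on the path cancels the denominator,
        which belongs to that element.\<close>
      have EW: "W K * (E (f i) / W (f i)) \<le> c * G z" if i: "i \<le> n" for i
      proof -
        have T: "f i \<in> \<T>" using f(3)[OF i] by (simp add: patch_def)
        have "W K * (E (f i) / W (f i)) \<le> c * W (f i) * (E (f i) / W (f i))"
          using f(4)[OF i] E[OF T] W0[OF T] by (intro mult_right_mono) auto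
        also have "\<dots> = c * E (f i)" using W0[OF T] by simp
        also have "\<dots> \<le> c * G z" unfolding G_def
          using c f(3)[OF i] E finite_patch by (intro mult_left_mono member_le_sum) (auto simp: patch_def)
        finally show ?thesis .
      qed
      have st: "W K * (\<pi> (f i) z - \<pi> (f (Suc i)) z)\<^sup>2 \<le> 2 * (c * D) * G z" if i: "i < n" for i
      proof -
        have "z \<in> f i" "z \<in> f (Suc i)" using f(3)[of i] f(3)[of "Suc i"] i by (auto simp: patch_def)
        then have "W K * (\<pi> (f i) z - \<pi> (f (Suc i)) z)\<^sup>2
            \<le> W K * (D * (E (f i) / W (f i) + E (f (Suc i)) / W (f (Suc i))))"
          using W0[OF KT] jump[OF f(5)[OF i] z] by (intro mult_left_mono) auto
        also have "\<dots> = D * (W K * (E (f i) / W (f i)) + W K * (E (f (Suc i)) / W (f (Suc i))))"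
          by (simp add: algebra_simps)
        also have "\<dots> \<le> D * (c * G z + c * G z)"
          using EW[of i] EW[of "Suc i"] i D by (intro mult_left_mono add_mono) auto
        finally show ?thesis by (simp add: algebra_simps)
      qed
      \<comment> \<open>Cauchy-Schwarz on the telescoping sum costs one factor n, and the number of
        its terms costs the other.\<close>
      have "\<pi> K z - \<pi> Kz z = (\<Sum>i<n. \<pi> (f i) z - \<pi> (f (Suc i)) z)"
        using sum_lessThan_telescope'[of "\<lambda>i. \<pi> (f i) z" n] f(1,2) by simp
      then have "(\<pi> K z - \<pi> Kz z)\<^sup>2 \<le> real n * (\<Sum>i<n. (\<pi> (f i) z - \<pi> (f (Suc i)) z)\<^sup>2)"
        using power2_sum_le[of "{..<n}" "\<lambda>i. \<pi> (f i) z - \<pi> (f (Suc i)) z"] by simp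
      then have "W K * (\<pi> K z - \<pi> Kz z)\<^sup>2 \<le> W K * (real n * (\<Sum>i<n. (\<pi> (f i) z - \<pi> (f (Suc i)) z)\<^sup>2))"
        using W0[OF KT] by (intro mult_left_mono) auto
      also have "\<dots> = real n * (\<Sum>i<n. W K * (\<pi> (f i) z - \<pi> (f (Suc i)) z)\<^sup>2)"
        by (simp add: sum_distrib_left algebra_simps)
      also have "\<dots> \<le> real n * (\<Sum>i<n. 2 * (c * D) * G z)"
        using st by (intro mult_left_mono sum_mono) auto
      also have "\<dots> = (real n)\<^sup>2 * (2 * (c * D) * G z)" by (simp add: power2_eq_square)
      also have "\<dots> \<le> N\<^sup>2 * (2 * (c * D) * G z)"
        unfolding N_def using n c D G0 by (intro mult_right_mono power_mono) auto
      finally show ?thesis by (simp add: mult_ac)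
    qed
    then show ?thesis by blast
  qed
  then obtain val where val: "\<And>z K. z \<in> nodes l \<T> \<Longrightarrow> K \<in> patch z \<Longrightarrow> W K * (\<pi> K z - val z)\<^sup>2 \<le> 2 * N\<^sup>2 * (c * D) * G z"
    by metis
  define P where "P = (4 * \<sigma>) ^ DIM('a)"
  define n where "n = real (Suc l) ^ Suc DIM('a)"
  have P0: "P \<ge> 0" using \<sigma> by (simp add: P_def)
  have fN: "finite (nodes l \<T>)"
    unfolding nodes_def element_nodes_eq using fT finite_lindices(1)[OF finite_verts] by auto
  have en: "element_nodes l K = {z \<in> nodes l \<T>. z \<in> K}" if K: "K \<in> \<T>" for K
  proof (intro equalityI subsetI)
    fix z assume "z \<in> element_nodes l K"
    then show "z \<in> {z \<in> nodes l \<T>. z \<in> K}"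
      using lnode_mem[OF K _ l] lnode_nodes[OF K] by (auto simp: element_nodes_eq)
  next
    fix z assume "z \<in> {z \<in> nodes l \<T>. z \<in> K}"
    then have z: "z \<in> nodes l \<T>" "z \<in> K" by auto
    show "z \<in> element_nodes l K"
      unfolding element_nodes_eq by (rule node_of_elem[OF l z(1) K z(2)]) blast
  qed
  have cn: "real (card (element_nodes l K)) \<le> n" if K: "K \<in> \<T>" for K
  proof -
    have "card (element_nodes l K) \<le> Suc l ^ Suc DIM('a)"
      using card_image_le[OF finite_lindices(1)[OF finite_verts[OF K]], of "lnode (verts K) l" l]
        finite_lindices(2)[OF finite_verts[OF K], of l] elem(1)[OF K] by (simp add: element_nodes_eq full_simplex_def)
    then have "real (card (element_nodes l K)) \<le> real (Suc l ^ Suc DIM('a))" by (rule of_nat_mono)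
    then show ?thesis by (simp only: n_def of_nat_power)
  qed
  \<comment> \<open>By \<open>en\<close> the nodes of K are the mesh nodes lying in K, so the pairs
    of node and element can be summed in either order.\<close>
  have swap: "(\<Sum>K\<in>\<T>. \<Sum>z\<in>element_nodes l K. h K z) = (\<Sum>z\<in>nodes l \<T>. \<Sum>K\<in>patch z. h K z)" for h :: "'a set \<Rightarrow> 'a \<Rightarrow> real"
  proof -
    have "(\<Sum>K\<in>\<T>. \<Sum>z\<in>element_nodes l K. h K z) = (\<Sum>K\<in>\<T>. \<Sum>z\<in>{z \<in> nodes l \<T>. z \<in> K}. h K z)"
      using en by (intro sum.cong) auto
    also have "\<dots> = (\<Sum>z\<in>nodes l \<T>. \<Sum>K\<in>patch z. h K z)"
      unfolding patch_def by (rule sum.swap_restrict[OF fT fN])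
    finally show ?thesis .
  qed
  show ?thesis
  proof (rule that[of val])
    have "(\<Sum>K\<in>\<T>. W K * (\<Sum>\<gamma>\<in>lindices (verts K) l. (\<pi> K (lnode (verts K) l \<gamma>) - val (lnode (verts K) l \<gamma>))\<^sup>2))
      = (\<Sum>K\<in>\<T>. \<Sum>z\<in>element_nodes l K. W K * (\<pi> K z - val z)\<^sup>2)"
      unfolding sum_distrib_left
      by (intro sum.cong[OF refl]) (simp add: element_nodes_eq sum.reindex[OF inj_on_lnode[OF _ l]])
    also have "\<dots> = (\<Sum>z\<in>nodes l \<T>. \<Sum>K\<in>patch z. W K * (\<pi> K z - val z)\<^sup>2)" by (rule swap)
    also have "\<dots> \<le> (\<Sum>z\<in>nodes l \<T>. 2 * N\<^sup>2 * (c * D) * P * G z)"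
    proof (rule sum_mono)
      fix z assume z: "z \<in> nodes l \<T>"
      have "(\<Sum>K\<in>patch z. W K * (\<pi> K z - val z)\<^sup>2) \<le> (\<Sum>K\<in>patch z. 2 * N\<^sup>2 * (c * D) * G z)"
        using val[OF z] by (intro sum_mono)
      also have "\<dots> = real (card (patch z)) * (2 * N\<^sup>2 * (c * D) * G z)" by simp
      also have "\<dots> \<le> P * (2 * N\<^sup>2 * (c * D) * G z)"
        unfolding P_def using card_patch G0 c D by (intro mult_right_mono) auto
      finally show "(\<Sum>K\<in>patch z. W K * (\<pi> K z - val z)\<^sup>2) \<le> 2 * N\<^sup>2 * (c * D) * P * G z" by (simp add: mult_ac)
    qed
    also have "\<dots> = 2 * N\<^sup>2 * (c * D) * P * (\<Sum>K\<in>\<T>. \<Sum>z\<in>element_nodes l K. E K)"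
      unfolding swap G_def by (simp add: sum_distrib_left)
    also have "\<dots> \<le> 2 * N\<^sup>2 * (c * D) * P * (\<Sum>K\<in>\<T>. n * E K)"
      using cn E c D P0 by (intro mult_left_mono sum_mono) (auto intro!: mult_right_mono)
    also have "\<dots> = path_const l * (c * D) * (\<Sum>K\<in>\<T>. E K)"
      unfolding sum_distrib_left[symmetric] path_const_def N_def[symmetric] P_def[symmetric] n_def[symmetric]
      by (simp only: mult_ac)
    finally show "(\<Sum>K\<in>\<T>. W K * (\<Sum>\<gamma>\<in>lindices (verts K) l. (\<pi> K (lnode (verts K) l \<gamma>) - val (lnode (verts K) l \<gamma>))\<^sup>2))
      \<le> path_const l * (c * D) * (\<Sum>K\<in>\<T>. E K)" .
  qed
qed

end

subsection \<open>Gradient errors\<close>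

lemma sq_on_AE_cong:
  fixes f g :: "'a::euclidean_space \<Rightarrow> 'b::euclidean_space"
  assumes n: "negligible {x \<in> interior K. f x \<noteq> g x}" and g: "g \<in> L2 (interior K)"
  shows "sq_on K f = sq_on K g"
  unfolding sq_on_def set_lebesgue_integral_def
proof (rule integral_cong_AE)
  have AE: "AE x in lebesgue. indicator (interior K) x *\<^sub>R (norm (f x))\<^sup>2 = indicator (interior K) x *\<^sub>R (norm (g x))\<^sup>2"
    by (rule AE_I'[OF n[unfolded negligible_iff_null_sets]]) (auto simp: indicator_def split: if_splits)
  then show "AE x in lebesgue. indicator (interior K) x *\<^sub>R (norm (f x))\<^sup>2 = indicator (interior K) x *\<^sub>R (norm (g x))\<^sup>2" .
  show "(\<lambda>x. indicator (interior K) x *\<^sub>R (norm (g x))\<^sup>2) \<in> borel_measurable lebesgue"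
    using L2_sq_integrable[OF g] borel_measurable_integrable by (auto simp: set_integrable_def)
  then show "(\<lambda>x. indicator (interior K) x *\<^sub>R (norm (f x))\<^sup>2) \<in> borel_measurable lebesgue"
    by (rule borel_measurable_AE) (rule AE_mp[OF AE], simp)
qed

lemma sq_on_scale:
  assumes "\<And>x. x \<in> interior K \<Longrightarrow> s x = c"
  shows "sq_on K (\<lambda>x. s x *\<^sub>R f x) = c\<^sup>2 * sq_on K f"
proof -
  have "sq_on K (\<lambda>x. s x *\<^sub>R f x) = (LINT x:interior K|lebesgue. c\<^sup>2 * (norm (f x))\<^sup>2)"
    unfolding sq_on_def set_lebesgue_integral_def using assms
    by (intro Bochner_Integration.integral_cong) (auto simp: indicator_def power_mult_distrib)
  then show ?thesis by (simp add: sq_on_def)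
qed

lemma L2_scale:
  fixes f :: "'a::euclidean_space \<Rightarrow> 'b::euclidean_space"
  assumes f: "f \<in> L2 (interior K)" and s: "\<And>x. x \<in> interior K \<Longrightarrow> s x = c"
  shows "(\<lambda>x. s x *\<^sub>R f x) \<in> L2 (interior K)"
proof -
  have "(\<lambda>x. indicator (interior K) x *\<^sub>R s x *\<^sub>R f x) = (\<lambda>x. c *\<^sub>R (indicator (interior K) x *\<^sub>R f x))"
    using s by (intro ext) (auto simp: indicator_def)
  moreover have "(\<lambda>x. c *\<^sub>R (indicator (interior K) x *\<^sub>R f x)) \<in> borel_measurable lebesgue"
    by (rule borel_measurable_scaleR[OF borel_measurable_const]) (use f L2_iff[OF interior_sets_lebesgue, of f K] in simp)
  moreover have "set_integrable lebesgue (interior K) (\<lambda>x. c\<^sup>2 * (norm (f x))\<^sup>2)"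
    using L2_sq_integrable[OF f] by simp
  moreover have "set_integrable lebesgue (interior K) (\<lambda>x. c\<^sup>2 * (norm (f x))\<^sup>2)
      \<longleftrightarrow> set_integrable lebesgue (interior K) (\<lambda>x. (norm (s x *\<^sub>R f x))\<^sup>2)"
    using s by (intro set_integrable_cong) (auto simp: power_mult_distrib)
  ultimately show ?thesis unfolding L2_iff[OF interior_sets_lebesgue] by simp
qed

lemma weak_grad_cong:
  assumes wk: "weak_grad D u g" and e: "\<And>x. x \<in> D \<Longrightarrow> u x = v x" "\<And>x. x \<in> D \<Longrightarrow> g x = h x"
  shows "weak_grad D v h"
proof -
  have "set_integrable lebesgue D u \<longleftrightarrow> set_integrable lebesgue D v" "set_integrable lebesgue D g \<longleftrightarrow> set_integrable lebesgue D h"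
    by (rule set_integrable_cong[OF refl refl e(1)], assumption, rule set_integrable_cong[OF refl refl e(2)], assumption)
  moreover have "(LINT x:D|lebesgue. u x * (grad \<phi> x \<bullet> b)) = (LINT x:D|lebesgue. v x * (grad \<phi> x \<bullet> b))"
    "(LINT x:D|lebesgue. (g x \<bullet> b) * \<phi> x) = (LINT x:D|lebesgue. (h x \<bullet> b) * \<phi> x)" for \<phi> b
    unfolding set_lebesgue_integral_def using e
    by (auto intro!: Bochner_Integration.integral_cong simp: indicator_def)
  ultimately show ?thesis using wk unfolding weak_grad_def by simp
qed

lemma weak_grad_Ck:
  assumes K: "compact K" "convex K" and q: "Ck (Suc 0) q"
  shows "weak_grad (interior K) q (grad q)"
proof -
  interpret P: pieces "{K}" using K by unfold_locales auto
  have "weak_grad (interior K) q (pw_grad {K} (\<lambda>_. q))"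
    using q Ck_imp_continuous_on[OF q] interior_subset compact_imp_bounded[OF K(1)] bounded_interior
    by (intro P.pw_weak_grad) auto
  then show ?thesis by (rule weak_grad_cong) (auto simp: pw_grad_def)
qed

lemma full_simplex_weight_pos:
  assumes V: "full_simplex V" and ne: "interior (convex hull V) \<noteq> {}"
  shows "0 < (LINT x:interior (convex hull V)|lebesgue. \<Prod>v\<in>V. bary V x v ^ k)"
proof -
  let ?I = "interior (convex hull V)"
  let ?f = "\<lambda>x. \<Prod>v\<in>V. bary V x v ^ k"
  have pos: "x \<in> ?I \<Longrightarrow> 0 < ?f x" for x
    using mem_interior_simplex_iff[OF V] by (auto intro!: prod_pos)
  have b: "bounded (convex hull V)"
    using full_simplex_finite[OF V] finite_imp_compact_convex_hull compact_imp_bounded by blast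
  have i: "set_integrable lebesgue ?I ?f"
    by (intro set_integrable_continuous_interior[OF b] continuous_intros continuous_bary[OF V])
  have nn: "AE x in lebesgue. 0 \<le> indicator ?I x *\<^sub>R ?f x"
    using pos by (intro AE_I2) (auto simp: indicator_def less_imp_le)
  have "(LINT x:?I|lebesgue. ?f x) \<noteq> 0"
  proof
    assume "(LINT x:?I|lebesgue. ?f x) = 0"
    then have "AE x in lebesgue. indicator ?I x *\<^sub>R ?f x = 0"
      using integral_nonneg_eq_0_iff_AE[OF i[unfolded set_integrable_def] nn] by (simp add: set_lebesgue_integral_def)
    then have "AE x in lebesgue. x \<notin> ?I" by (rule AE_mp) (use pos in \<open>fastforce simp: indicator_def\<close>)
    then have "negligible ?I" by (simp add: negligible_iff_null_sets AE_iff_null_sets)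
    then show False using open_not_negligible[OF open_interior ne] by blast
  qed
  moreover have "0 \<le> (LINT x:?I|lebesgue. ?f x)"
    unfolding set_lebesgue_integral_def by (rule integral_nonneg_AE[OF nn])
  ultimately show ?thesis by simp
qed

context mesh
begin

text \<open>Volumes compare up to \<open>ratio\<close>^d (4 \<open>\<sigma>\<close>)^d, and the
  squared diameter in the gradient weight adds \<open>ratio\<close>^2. The maximum with 1 meets the
  requirement on c in \<open>node_average\<close>.\<close>

definition comp_const where "comp_const = max 1 (ratio ^ (DIM('a) + 2) * (4 * \<sigma>) ^ DIM('a))"

lemma comp_const_ge: "1 \<le> comp_const" by (simp add: comp_const_def)

lemma ratio_ge: "1 \<le> ratio" by (simp add: ratio_def)

lemma vol_compare:
  assumes K: "K \<in> \<T>" "K' \<in> \<T>" and d: "diameter K \<le> ratio * diameter K'"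
  shows "vol K \<le> ratio ^ DIM('a) * (4 * \<sigma>) ^ DIM('a) * vol K'"
proof -
  let ?b = "unit_ball_vol (real DIM('a))"
  have "vol K \<le> ?b * diameter K ^ DIM('a)" by (rule vol_bounds[OF K(1)])
  also have "\<dots> \<le> ?b * (ratio * diameter K') ^ DIM('a)"
    using d diameter_pos[OF K(1)] by (intro mult_left_mono power_mono) auto
  also have "\<dots> = ratio ^ DIM('a) * (4 * \<sigma>) ^ DIM('a) * (?b * (diameter K' / (4 * \<sigma>)) ^ DIM('a))"
    using \<sigma> by (simp add: power_mult_distrib power_divide)
  also have "\<dots> \<le> ratio ^ DIM('a) * (4 * \<sigma>) ^ DIM('a) * vol K'"
    using vol_bounds(2)[OF K(2)] ratio_ge \<sigma> by (intro mult_left_mono) auto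
  finally show ?thesis .
qed

text \<open>A constant can be added without changing the gradient; here it is chosen as the weighted
  mean of u - q, so that the weighted moment of u - p vanishes. The weight has positive integral
  because it is positive inside the element.\<close>

lemma simplex_moments_normalise:
  assumes K: "K \<in> \<T>" and wk: "weak_grad (interior K) u g" and q: "polyd n q"
  obtains p where "polyd n p" "grad p = grad q" "simplex_moments (verts K) (\<lambda>x. u x - p x) (\<lambda>x. g x - grad p x) (diameter K) l"
proof -
  let ?V = "verts K"
  let ?f = "\<lambda>x. \<Prod>v\<in>?V. bary ?V x v ^ (l + 2)"
  note V = elem[OF K]
  define I where "I = (LINT x:interior K|lebesgue. ?f x)"
  have I: "I > 0" using full_simplex_weight_pos[OF V(1), of "l + 2"] V(2) interior_elem_ne[OF K] by (simp add: I_def)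
  define c where "c = (LINT x:interior K|lebesgue. (u x - q x) * ?f x) / I"
  define p where "p x = q x + c" for x
  have p: "polyd n p" unfolding p_def[abs_def] by (intro polyd_add q polyd_const)
  have g: "grad p = grad q"
  proof
    fix x
    have "(p has_derivative (\<lambda>h. grad q x \<bullet> h)) (at x)"
      unfolding p_def[abs_def]
      using has_derivative_add[OF Ck_has_derivative_grad[OF Ck_polyd[OF q]] has_derivative_const[of c]] by simp
    then show "grad p x = grad q x" by (rule grad_eqI)
  qed
  have wq: "weak_grad (interior K) (\<lambda>x. u x - r x) (\<lambda>x. g x - grad r x)" if "polyd n r" for r
    by (rule weak_grad_diff[OF wk weak_grad_Ck[OF compact_elem[OF K] convex_elem[OF K] Ck_polyd[OF that]]])
  have cf: "continuous_on UNIV ?f" by (intro continuous_intros continuous_bary[OF V(1)])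
  have b: "bounded (interior K)" using bounded_elem[OF K] bounded_interior by blast
  have i1: "set_integrable lebesgue (interior K) (\<lambda>x. (u x - q x) * ?f x)"
    using wq[OF q] by (intro set_integrable_mult_continuous[OF _ b cf]) (simp add: weak_grad_def)
  have i2: "set_integrable lebesgue (interior K) (\<lambda>x. c * ?f x)"
    using set_integrable_continuous_interior[OF bounded_elem[OF K] cf] by simp
  have "(LINT x:interior K|lebesgue. (u x - p x) * ?f x) = (LINT x:interior K|lebesgue. (u x - q x) * ?f x - c * ?f x)"
    by (simp add: p_def algebra_simps)
  also have "\<dots> = 0" using set_integral_diff(2)[OF i1 i2] I by (simp add: c_def I_def)
  finally have z: "(LINT x:interior K|lebesgue. (u x - p x) * ?f x) = 0" .
  have "simplex_moments ?V (\<lambda>x. u x - p x) (\<lambda>x. g x - grad p x) (diameter K) l"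
  proof
    show "full_simplex ?V" by (rule V)
    show "weak_grad (interior (convex hull ?V)) (\<lambda>x. u x - p x) (\<lambda>x. g x - grad p x)" using wq[OF p] V(2) by simp
    show "norm (x - y) \<le> diameter K" if "x \<in> ?V" "y \<in> ?V" for x y
      using dist_le_diameter[OF K] that hull_subset[of ?V convex] V(2) by blast
    show "(LINT x:interior (convex hull ?V)|lebesgue. (u x - p x) * ?f x) = 0" using z V(2) by simp
  qed
  then show ?thesis using that p g by blast
qed

lemma interior_adj_subset: "adj K K' \<Longrightarrow> interior (K \<union> K') \<subseteq> \<Omega>"
  using interior_mono[of "K \<union> K'" "closure \<Omega>"] \<Omega>(5) UT by (auto simp: adj_def)

definition jump_const where
  "jump_const l = real (Suc l) ^ Suc DIM('a) * (real DIM('a) * (simplex_moments.Cd TYPE('a) l * (4 * \<sigma>) + real l ^ l)) / cw DIM('a) l"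

lemma L2_interior_elem:
  fixes f :: "'a \<Rightarrow> 'b::euclidean_space"
  assumes "f \<in> L2 \<Omega>" "K \<in> \<T>" shows "f \<in> L2 (interior K)"
  by (rule L2_open_subset[OF assms(1) open_sets_lebesgue[OF \<Omega>(1)] open_interior interior_elem_subset[OF assms(2)]])

lemma L2_interior_polyd:
  "K \<in> \<T> \<Longrightarrow> polyd n p \<Longrightarrow> p \<in> L2 (interior K)" "K \<in> \<T> \<Longrightarrow> polyd n p \<Longrightarrow> grad p \<in> L2 (interior K)"
  using L2_continuous[OF compact_elem Ck_imp_continuous_on[OF Ck_polyd[of n p 0]]]
    L2_continuous[OF compact_elem Ck_continuous_grad[OF Ck_polyd[of n p "Suc 0"]]] by auto

text \<open>The jump estimate is used from both sides: the smaller of the two quotients of diameter and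
  volume then suffices, and the sizes of the neighbours need not be comparable.\<close>

lemma jump_bound:
  assumes wk: "weak_grad \<Omega> u g" and g: "g \<in> L2 \<Omega>" and l: "l > 0" and a: "adj K K'"
    and p: "polyd l p" "polyd l p'"
    and sm: "simplex_moments (verts K) (\<lambda>x. u x - p x) (\<lambda>x. g x - grad p x) (diameter K) l"
      "simplex_moments (verts K') (\<lambda>x. u x - p' x) (\<lambda>x. g x - grad p' x) (diameter K') l"
    and z: "z \<in> nodes l \<T>" "z \<in> K" "z \<in> K'"
  shows "(p z - p' z)\<^sup>2 \<le> 2 * (jump_const l)\<^sup>2 * ((diameter K)\<^sup>2 / vol K * sq_on K (\<lambda>x. g x - grad p x)
     + (diameter K')\<^sup>2 / vol K' * sq_on K' (\<lambda>x. g x - grad p' x))"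
proof -
  have T: "K \<in> \<T>" "K' \<in> \<T>" using a by (auto simp: adj_def)
  obtain b b' C where C: "adjacent b b' C" "verts K = insert b C" "verts K' = insert b' C" "K \<inter> K' = convex hull C"
    by (rule adj_adjacent[OF a])
  interpret A: adjacent b b' C by (rule C)
  interpret A': adjacent b' b C by (rule A.adjacent_sym)
  have H: "convex hull (insert b C) = K" "convex hull (insert b' C) = K'" using elem(2)[OF T(1)] elem(2)[OF T(2)] C by auto
  obtain \<gamma> where "\<gamma> \<in> lindices (verts K) l" "z = lnode (verts K) l \<gamma>" by (rule node_of_elem[OF l z(1) T(1) z(2)])
  then have \<gamma>: "\<gamma> \<in> lindices C l" "lnode C l \<gamma> = z"
    using lnode_face[OF elem(1)[OF T(1)], of C \<gamma> l] C(2,4) z l by auto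
  define E where "E = (LINT x:interior K|lebesgue. norm (g x - grad p x))"
  define E' where "E' = (LINT x:interior K'|lebesgue. norm (g x - grad p' x))"
  define A where "A = real (Suc l) ^ Suc DIM('a) * (real DIM('a) * (simplex_moments.Cd TYPE('a) l * (4 * \<sigma>) + real l ^ l))"
  have B: "4 * \<sigma> / diameter X * diameter X \<le> 4 * \<sigma>" if "X \<in> \<T>" for X using diameter_pos[OF that] by simp
  have s: "interior (K \<union> K') \<subseteq> \<Omega>" "interior (K' \<union> K) \<subseteq> \<Omega>" using interior_adj_subset[OF a] by (auto simp: Un_commute)
  have 1: "cw DIM('a) l * vol K * \<bar>p z - p' z\<bar> \<le> A * (diameter K * (E + E'))"
    using A.jump_estimate[OF \<Omega>(1) _ wk l p sm[unfolded C(2,3)] bgrad_le[OF T(1), unfolded C(2)] bgrad_le[OF T(2), unfolded C(3)] B[OF T(1)] B[OF T(2)] \<gamma>(1)]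
    unfolding H \<gamma>(2) E_def E'_def A_def vol_def using s by blast
  have 2: "cw DIM('a) l * vol K' * \<bar>p z - p' z\<bar> \<le> A * (diameter K' * (E + E'))"
    \<comment> \<open>The same estimate with the roles of the two elements exchanged; it bounds the
      same jump with the diameter and volume of K'.\<close>
    using A'.jump_estimate[OF \<Omega>(1) _ wk l p(2,1) sm(2,1)[unfolded C(2,3)] bgrad_le[OF T(2), unfolded C(3)] bgrad_le[OF T(1), unfolded C(2)] B[OF T(2)] B[OF T(1)] \<gamma>(1)]
    unfolding H \<gamma>(2) E_def E'_def A_def vol_def using s by (simp only: add.commute abs_minus_commute)
  define j where "j = \<bar>p z - p' z\<bar>"
  define J where "J = jump_const l"
  have JA: "J = A / cw DIM('a) l" by (simp add: J_def jump_const_def A_def)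
  have v: "vol K > 0" "vol K' > 0" "cw DIM('a) l > 0" using vol_bounds(3) T cw_pos by auto
  define r where "r = diameter K / vol K"
  define r' where "r' = diameter K' / vol K'"
  have r: "r > 0" "r' > 0" using v diameter_pos T by (auto simp: r_def r'_def)
  have E0: "E \<ge> 0" "E' \<ge> 0" unfolding E_def E'_def set_lebesgue_integral_def by (auto intro!: integral_nonneg_AE)
  interpret S: simplex_moments "verts K" "\<lambda>x. u x - p x" "\<lambda>x. g x - grad p x" "diameter K" l by (rule sm)
  have J0: "J \<ge> 0" unfolding JA A_def using S.Cd0 v(3) \<sigma> by auto
  have j1: "j \<le> J * r * (E + E')" using 1 v by (simp add: JA r_def j_def field_simps)
  have j2: "j \<le> J * r' * (E + E')" using 2 v by (simp add: JA r'_def j_def field_simps)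
  \<comment> \<open>The smaller of r and r' multiplies both E and E' and is at most the quotient
    that belongs to each of them.\<close>
  have "j \<le> J * (r * E + r' * E')"
  proof (cases "r \<le> r'")
    case True
    then have "J * (r * (E + E')) \<le> J * (r * E + r' * E')"
      using J0 E0 by (intro mult_left_mono) (auto simp: distrib_left intro: mult_right_mono)
    then show ?thesis using j1 by (simp add: mult_ac)
  next
    case False
    then have "J * (r' * (E + E')) \<le> J * (r * E + r' * E')"
      using J0 E0 by (intro mult_left_mono) (auto simp: distrib_left intro: mult_right_mono)
    then show ?thesis using j2 by (simp add: mult_ac)
  qed
  then have "j\<^sup>2 \<le> (J * (r * E + r' * E'))\<^sup>2" by (intro power_mono) (auto simp: j_def)
  also have "\<dots> = J\<^sup>2 * (r * E + r' * E')\<^sup>2" by (simp add: power_mult_distrib)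
  also have "\<dots> \<le> J\<^sup>2 * (2 * (r * E)\<^sup>2 + 2 * (r' * E')\<^sup>2)"
    using sum_squares_bound[of "r * E" "r' * E'"] by (intro mult_left_mono) (auto simp: power2_sum)
  also have "\<dots> \<le> J\<^sup>2 * (2 * (r\<^sup>2 * (vol K * sq_on K (\<lambda>x. g x - grad p x))) + 2 * (r'\<^sup>2 * (vol K' * sq_on K' (\<lambda>x. g x - grad p' x))))"
  proof -
    have "E\<^sup>2 \<le> vol K * sq_on K (\<lambda>x. g x - grad p x)" unfolding E_def
      by (rule integral_norm_sq_le[OF L2_diff[OF L2_interior_elem[OF g T(1)] L2_interior_polyd(2)[OF T(1) p(1)] interior_sets_lebesgue] bounded_elem[OF T(1)] measure_interior_elem[OF T(1)]])
    moreover have "E'\<^sup>2 \<le> vol K' * sq_on K' (\<lambda>x. g x - grad p' x)" unfolding E'_def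
      by (rule integral_norm_sq_le[OF L2_diff[OF L2_interior_elem[OF g T(2)] L2_interior_polyd(2)[OF T(2) p(2)] interior_sets_lebesgue] bounded_elem[OF T(2)] measure_interior_elem[OF T(2)]])
    ultimately show ?thesis unfolding power_mult_distrib
      by (intro mult_left_mono add_mono) auto
  qed
  also have "\<dots> = 2 * J\<^sup>2 * ((diameter K)\<^sup>2 / vol K * sq_on K (\<lambda>x. g x - grad p x) + (diameter K')\<^sup>2 / vol K' * sq_on K' (\<lambda>x. g x - grad p' x))"
  proof -
    have r2: "r\<^sup>2 * (vol K * s) = (diameter K)\<^sup>2 / vol K * s" "r'\<^sup>2 * (vol K' * s) = (diameter K')\<^sup>2 / vol K' * s" for s
      using v by (auto simp: r_def r'_def power2_eq_square field_simps)
    show ?thesis unfolding r2 by (simp only: distrib_left mult_ac)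
  qed
  finally show ?thesis by (simp add: j_def J_def)
qed

text \<open>The nodal values of the difference are exactly p - val, so \<open>node_bounds\<close>
  estimates it by the sum that \<open>node_average\<close> controls. The gradient bound has the
  factor 1 / h^2 extracted to match the gradient weight.\<close>

lemma interpolation_difference:
  fixes val :: "'a \<Rightarrow> real"
  assumes l: "l > 0" and K: "K \<in> \<T>" and p: "polyd l p"
  defines "q \<equiv> \<lambda>x. p x - lint l val (verts K) x"
  defines "n \<equiv> real (Suc l) ^ Suc DIM('a)" and "S \<equiv> (\<Sum>\<gamma>\<in>lindices (verts K) l. (p (lnode (verts K) l \<gamma>) - val (lnode (verts K) l \<gamma>))\<^sup>2)"
  shows "polyd l q" "sq_on K q \<le> n * (real l ^ l)\<^sup>2 * (vol K * S)"
    "sq_on K (grad q) \<le> n * (real l ^ (l + 1) * (real l + real DIM('a) + 1) * (4 * \<sigma>))\<^sup>2 * (vol K / (diameter K)\<^sup>2 * S)"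
proof -
  note V = elem[OF K]
  show q: "polyd l q"
    unfolding q_def using polyd_add[OF p polyd_scale[OF polyd_lint[OF V(1), of l val], of "-1"]] by simp
  have S: "(\<Sum>\<gamma>\<in>lindices (verts K) l. (q (lnode (verts K) l \<gamma>))\<^sup>2) = S"
    unfolding S_def q_def using lint_lnode[OF V(1) _ l] by (intro sum.cong) auto
  note b = node_bounds[OF V(1) q l bgrad_le[OF K], unfolded V(2) S, folded vol_def n_def]
  show "sq_on K q \<le> n * (real l ^ l)\<^sup>2 * (vol K * S)" using b(1) by (simp add: sq_on_def mult_ac)
  have "sq_on K (grad q) \<le> n * (real l ^ (l + 1) * (real l + real DIM('a) + 1) * (4 * \<sigma> / diameter K))\<^sup>2 * vol K * S"
    using b(2) by (simp add: sq_on_def)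
  also have "\<dots> = n * (real l ^ (l + 1) * (real l + real DIM('a) + 1) * (4 * \<sigma>))\<^sup>2 * (vol K / (diameter K)\<^sup>2 * S)"
    by (simp only: power_mult_distrib power_divide times_divide_eq_left times_divide_eq_right mult_ac)
  finally show "sq_on K (grad q) \<le> n * (real l ^ (l + 1) * (real l + real DIM('a) + 1) * (4 * \<sigma>))\<^sup>2 * (vol K / (diameter K)\<^sup>2 * S)" .
qed

definition grad_const where
  "grad_const l = 2 + 2 * (real (Suc l) ^ Suc DIM('a) * (real l ^ (l + 1) * (real l + real DIM('a) + 1) * (4 * \<sigma>))\<^sup>2
     * (path_const l * (comp_const * (2 * (jump_const l)\<^sup>2))))"

lemma grad_quasi_interpolation:
  assumes qm: "quasi_monotone l \<T> \<Omega> a" and l: "l > 0" and a: "\<And>K. K \<in> \<T> \<Longrightarrow> aval a K > 0"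
    and wk: "weak_grad \<Omega> u g" and g: "g \<in> L2 \<Omega>" and p: "\<And>K. K \<in> \<T> \<Longrightarrow> polyd l (p K)"
  obtains val where "(\<Sum>K\<in>\<T>. aval a K * sq_on K (\<lambda>x. g x - grad (lint l val (verts K)) x))
    \<le> grad_const l * (\<Sum>K\<in>\<T>. aval a K * sq_on K (\<lambda>x. g x - grad (p K) x))"
proof -
  \<comment> \<open>The given polynomials enter through their gradients, so each may be replaced by
    its normalised translate.\<close>
  have "\<exists>r. polyd l r \<and> grad r = grad (p K) \<and> simplex_moments (verts K) (\<lambda>x. u x - r x) (\<lambda>x. g x - grad r x) (diameter K) l"
    if K: "K \<in> \<T>" for K
    by (rule simplex_moments_normalise[OF K weak_grad_subset[OF wk open_interior interior_elem_subset[OF K]] p[OF K], where l = l]) blast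
  then obtain \<pi> where \<pi>: "\<And>K. K \<in> \<T> \<Longrightarrow> polyd l (\<pi> K)" "\<And>K. K \<in> \<T> \<Longrightarrow> grad (\<pi> K) = grad (p K)"
    "\<And>K. K \<in> \<T> \<Longrightarrow> simplex_moments (verts K) (\<lambda>x. u x - \<pi> K x) (\<lambda>x. g x - grad (\<pi> K) x) (diameter K) l"
    by metis
  \<comment> \<open>With this weight the coefficient cancels in E / W, which becomes h^2 / vol times
    the squared gradient error, precisely the quantity in \<open>jump_bound\<close>.\<close>
  define W where "W K = aval a K * (vol K / (diameter K)\<^sup>2)" for K
  define E where "E K = aval a K * sq_on K (\<lambda>x. g x - grad (p K) x)" for K
  define D where "D = 2 * (jump_const l)\<^sup>2"
  have W0: "W K > 0" if "K \<in> \<T>" for K using a[OF that] vol_bounds(3)[OF that] diameter_pos[OF that] by (simp add: W_def)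
  have E0: "E K \<ge> 0" if "K \<in> \<T>" for K using a[OF that] by (simp add: E_def)
  have comp: "W K \<le> comp_const * W K'"
    if T: "K \<in> \<T>" "K' \<in> \<T>" and d: "diameter K \<le> ratio * diameter K'" "diameter K' \<le> ratio * diameter K"
      and aa: "aval a K \<le> aval a K'" for K K'
  proof -
    let ?c = "ratio ^ DIM('a) * (4 * \<sigma>) ^ DIM('a)"
    note p = diameter_pos[OF T(1)] diameter_pos[OF T(2)] vol_bounds(3)[OF T(1)] vol_bounds(3)[OF T(2)] a[OF T(1)] a[OF T(2)]
    have "1 / (diameter K)\<^sup>2 \<le> ratio\<^sup>2 / (diameter K')\<^sup>2"
      using power_mono[OF d(2), of 2] p by (simp add: power_mult_distrib field_simps)
    then have "vol K * (1 / (diameter K)\<^sup>2) \<le> (?c * vol K') * (ratio\<^sup>2 / (diameter K')\<^sup>2)"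
      using vol_compare[OF T d(1)] p by (intro mult_mono) auto
    also have "\<dots> = ratio ^ (DIM('a) + 2) * (4 * \<sigma>) ^ DIM('a) * (vol K' / (diameter K')\<^sup>2)"
      by (simp add: power_add power2_eq_square)
    also have "\<dots> \<le> comp_const * (vol K' / (diameter K')\<^sup>2)"
      using p unfolding comp_const_def by (intro mult_right_mono) auto
    finally have "aval a K * (vol K / (diameter K)\<^sup>2) \<le> aval a K' * (comp_const * (vol K' / (diameter K')\<^sup>2))"
      using aa p by (intro mult_mono) auto
    then show ?thesis by (simp add: W_def mult_ac)
  qed
  have jump: "(\<pi> K z - \<pi> K' z)\<^sup>2 \<le> D * (E K / W K + E K' / W K')"
    if ad: "adj K K'" and z: "z \<in> nodes l \<T>" "z \<in> K" "z \<in> K'" for K K' z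
  proof -
    have T: "K \<in> \<T>" "K' \<in> \<T>" using ad by (auto simp: adj_def)
    have e: "E X / W X = (diameter X)\<^sup>2 / vol X * sq_on X (\<lambda>x. g x - grad (\<pi> X) x)" if "X \<in> \<T>" for X
      using a[OF that] by (simp add: E_def W_def \<pi>(2)[OF that])
    show ?thesis unfolding e[OF T(1)] e[OF T(2)] D_def
      by (rule jump_bound[OF wk g l ad \<pi>(1)[OF T(1)] \<pi>(1)[OF T(2)] \<pi>(3)[OF T(1)] \<pi>(3)[OF T(2)] z])
  qed
  have D0: "D \<ge> 0" by (simp add: D_def)
  have "\<exists>val. (\<Sum>K\<in>\<T>. W K * (\<Sum>\<gamma>\<in>lindices (verts K) l. (\<pi> K (lnode (verts K) l \<gamma>) - val (lnode (verts K) l \<gamma>))\<^sup>2))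
      \<le> path_const l * (comp_const * D) * (\<Sum>K\<in>\<T>. E K)"
    by (rule node_average[where W = W and E = E and \<pi> = \<pi>, OF qm l comp_const_ge W0 comp E0 D0 jump]) (assumption | rule exI)+
  then obtain val where val: "(\<Sum>K\<in>\<T>. W K * (\<Sum>\<gamma>\<in>lindices (verts K) l. (\<pi> K (lnode (verts K) l \<gamma>) - val (lnode (verts K) l \<gamma>))\<^sup>2))
      \<le> path_const l * (comp_const * D) * (\<Sum>K\<in>\<T>. E K)" by blast
  define S where "S K = (\<Sum>\<gamma>\<in>lindices (verts K) l. (\<pi> K (lnode (verts K) l \<gamma>) - val (lnode (verts K) l \<gamma>))\<^sup>2)" for K
  define B where "B = real (Suc l) ^ Suc DIM('a) * (real l ^ (l + 1) * (real l + real DIM('a) + 1) * (4 * \<sigma>))\<^sup>2"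
  have B0: "B \<ge> 0" by (simp add: B_def)
  have "aval a K * sq_on K (\<lambda>x. g x - grad (lint l val (verts K)) x) \<le> 2 * E K + 2 * B * (W K * S K)" if K: "K \<in> \<T>" for K
  proof -
    let ?q = "\<lambda>x. \<pi> K x - lint l val (verts K) x"
    note q = interpolation_difference[OF l K \<pi>(1)[OF K], where val = val, folded S_def B_def]
    let ?d = "\<lambda>x. g x - grad (\<pi> K) x"
    have gq: "grad ?q x = grad (\<pi> K) x - grad (lint l val (verts K)) x" for x
      by (rule grad_diff[OF Ck_polyd[OF \<pi>(1)[OF K]] Ck_polyd[OF polyd_lint[OF elem(1)[OF K]]]])
    have "sq_on K (\<lambda>x. g x - grad (lint l val (verts K)) x) = sq_on K (\<lambda>x. ?d x - (- grad ?q x))"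
      by (intro sq_on_cong) (simp add: gq)
    also have "\<dots> \<le> 2 * sq_on K ?d + 2 * sq_on K (\<lambda>x. - grad ?q x)"
    proof (rule sq_on_diff_le)
      show "?d \<in> L2 (interior K)"
        by (rule L2_diff[OF L2_interior_elem[OF g K] L2_interior_polyd(2)[OF K \<pi>(1)[OF K]] interior_sets_lebesgue])
      show "(\<lambda>x. - grad ?q x) \<in> L2 (interior K)"
        using L2_scale[OF L2_interior_polyd(2)[OF K q(1)], of "\<lambda>x. -1" "-1"] by simp
    qed
    also have "sq_on K (\<lambda>x. - grad ?q x) = sq_on K (grad ?q)" by (intro sq_on_cong) simp
    also have "2 * sq_on K ?d + 2 * sq_on K (grad ?q) \<le> 2 * sq_on K ?d + 2 * (B * (vol K / (diameter K)\<^sup>2 * S K))"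
      using q(3) by simp
    finally have "aval a K * sq_on K (\<lambda>x. g x - grad (lint l val (verts K)) x)
        \<le> aval a K * (2 * sq_on K ?d + 2 * (B * (vol K / (diameter K)\<^sup>2 * S K)))"
      using a[OF K] by (intro mult_left_mono) auto
    also have "\<dots> = 2 * E K + 2 * B * (W K * S K)"
      by (simp only: E_def W_def \<pi>(2)[OF K] distrib_left mult_ac)
    finally show ?thesis .
  qed
  then have "(\<Sum>K\<in>\<T>. aval a K * sq_on K (\<lambda>x. g x - grad (lint l val (verts K)) x))
      \<le> (\<Sum>K\<in>\<T>. 2 * E K + 2 * B * (W K * S K))" by (rule sum_mono)
  also have "\<dots> = 2 * (\<Sum>K\<in>\<T>. E K) + 2 * B * (\<Sum>K\<in>\<T>. W K * S K)"
    by (simp add: sum.distrib sum_distrib_left)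
  also have "\<dots> \<le> 2 * (\<Sum>K\<in>\<T>. E K) + 2 * B * (path_const l * (comp_const * D) * (\<Sum>K\<in>\<T>. E K))"
    using val B0 unfolding S_def by (intro add_left_mono mult_left_mono) auto
  also have "\<dots> = grad_const l * (\<Sum>K\<in>\<T>. E K)"
    unfolding grad_const_def B_def[symmetric] D_def[symmetric] by (simp add: distrib_left distrib_right mult_ac)
  finally show ?thesis using that unfolding E_def by blast
qed

lemma grad_const_pos: "grad_const l > 0"
  unfolding grad_const_def using path_const_nonneg comp_const_ge
  by (intro add_pos_nonneg mult_nonneg_nonneg) auto

section \<open>Facets and interior facets\<close>

lemma facet_in_patch:
  assumes "F facet_of K"
  obtains z where "z \<in> F" "{K \<in> \<T>. F facet_of K} \<subseteq> patch z"
  using assms facet_of_imp_subset by (fastforce simp: facet_of_def patch_def)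

text \<open>A facet is not empty, so all its elements lie in the patch of one of its points.\<close>

lemma card_facet_elems: "K \<in> \<T> \<Longrightarrow> F facet_of K \<Longrightarrow> real (card {K \<in> \<T>. F facet_of K}) \<le> (4 * \<sigma>) ^ DIM('a)"
proof -
  assume "F facet_of K"
  then obtain z where z: "{K \<in> \<T>. F facet_of K} \<subseteq> patch z" using facet_in_patch by blast
  have "real (card {K \<in> \<T>. F facet_of K}) \<le> real (card (patch z))"
    using card_mono[OF finite_patch z] by simp
  then show ?thesis using card_patch[of z] by simp
qed

lemma elem_facets:
  assumes K: "K \<in> \<T>" shows "finite {F. F facet_of K}" "card {F. F facet_of K} \<le> 2 ^ Suc DIM('a)"
proof -
  have s: "{F. F facet_of K} \<subseteq> (\<lambda>C. convex hull C) ` Pow (verts K)"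
  proof
    fix F assume "F \<in> {F. F facet_of K}"
    then have "F face_of convex hull (verts K)" using elem(2)[OF K] by (simp add: facet_of_def)
    then show "F \<in> (\<lambda>C. convex hull C) ` Pow (verts K)"
      using face_of_convex_hull_affine_independent[of "verts K" F] elem(1)[OF K] by (auto simp: full_simplex_def)
  qed
  have f: "finite ((\<lambda>C. convex hull C) ` Pow (verts K))" using finite_verts[OF K] by simp
  show "finite {F. F facet_of K}" by (rule finite_subset[OF s f])
  have "card {F. F facet_of K} \<le> card (Pow (verts K))"
    using card_mono[OF f s] card_image_le[of "Pow (verts K)" "\<lambda>C. convex hull C"] finite_verts[OF K] by simp
  then show "card {F. F facet_of K} \<le> 2 ^ Suc DIM('a)"
    using card_Pow[OF finite_verts[OF K]] elem(1)[OF K] by (simp add: full_simplex_def)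
qed

lemma finite_interior_faces: "finite (interior_faces \<T> \<Omega>)"
proof (rule finite_subset)
  show "interior_faces \<T> \<Omega> \<subseteq> (\<Union>K\<in>\<T>. {F. F facet_of K})" by (auto simp: interior_faces_def)
  show "finite (\<Union>K\<in>\<T>. {F. F facet_of K})" using fT elem_facets by auto
qed

text \<open>The barycentre of the common facet is an interior point of the union of the two elements
  and hence of the domain, so the facet is not contained in the frontier.\<close>

lemma adj_interior_face: assumes "adj K K'" shows "K \<inter> K' \<in> interior_faces \<T> \<Omega>"
proof -
  have T: "K \<in> \<T>" "(K \<inter> K') facet_of K" using assms by (auto simp: adj_def)
  obtain b b' C where C: "adjacent b b' C" "verts K = insert b C" "verts K' = insert b' C" "K \<inter> K' = convex hull C"
    by (rule adj_adjacent[OF assms])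
  interpret A: adjacent b b' C by (rule C)
  have H: "convex hull (insert b C) = K" "convex hull (insert b' C) = K'"
    using elem(2)[of K] elem(2)[of K'] assms C(2,3) by (auto simp: adj_def)
  define t where "t v = (if v \<in> C then 1 / real (card C) else 0)" for v
  define x where "x = (\<Sum>v\<in>C. t v *\<^sub>R v)"
  have t1: "sum t C = 1" using A.fC by (simp add: t_def)
  have b: "bary (insert b C) x v = t v" if "v \<in> C" for v
    using bary_subset(1)[OF A.W subset_insertI t1 x_def[symmetric] that] .
  have xC: "x \<in> convex hull C"
    unfolding convex_hull_finite[OF A.fC(1)] x_def using t1 by (intro CollectI exI[of _ t]) (auto simp: t_def)
  have cp: "card C > 0" using A.fC by (simp add: card_gt_0_iff)
  have "x \<in> interior (convex hull (insert b C) \<union> convex hull (insert b' C))"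
    using xC C(4) H b cp by (intro A.interior_patch) (auto simp: t_def)
  then have "x \<in> \<Omega>" using interior_adj_subset[OF assms] H by auto
  then have "x \<notin> frontier \<Omega>" using \<Omega>(1) by (simp add: frontier_def interior_open)
  then show ?thesis using T xC C(4) by (auto simp: interior_faces_def)
qed

text \<open>If all facets of K were on the frontier, the interior of K would be open and closed in
  the domain and thus equal to it. Then K would be the only element and own the interior facet whose
  existence is assumed.\<close>

lemma ex_interior_facet:
  assumes ne: "interior_faces \<T> \<Omega> \<noteq> {}" and K: "K \<in> \<T>"
  shows "\<exists>F\<in>interior_faces \<T> \<Omega>. F facet_of K"
proof (rule ccontr)
  assume n: "\<not> ?thesis"
  have "polyhedron K" using polytope_imp_polyhedron[OF polytope_convex_hull[OF finite_verts[OF K]]] elem(2)[OF K] by simp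
  then have "rel_frontier K = \<Union>{F. F facet_of K}" by (rule rel_frontier_of_polyhedron)
  moreover have "\<Union>{F. F facet_of K} \<subseteq> frontier \<Omega>" using n K by (auto simp: interior_faces_def)
  moreover have "rel_interior K = interior K" by (rule rel_interior_nonempty_interior[OF interior_elem_ne[OF K]])
  ultimately have fr: "K - interior K \<subseteq> frontier \<Omega>"
    using compact_imp_closed[OF compact_elem[OF K]] by (simp add: rel_frontier_def)
  have "frontier \<Omega> \<inter> \<Omega> = {}" using \<Omega>(1) by (auto simp: frontier_def interior_open)
  then have e: "interior K = \<Omega> \<inter> K" using fr interior_subset[of K] interior_elem_subset[OF K] by blast
  have "openin (top_of_set \<Omega>) (interior K)" using interior_elem_subset[OF K] by (intro open_subset) auto
  moreover have "closedin (top_of_set \<Omega>) (interior K)"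
    unfolding e by (rule closedin_closed_Int[OF compact_imp_closed[OF compact_elem[OF K]]])
  ultimately have eq: "interior K = \<Omega>" using \<Omega>(4) interior_elem_ne[OF K] unfolding connected_clopen by blast
  have "K' = K" if K': "K' \<in> \<T>" for K'
  proof -
    obtain x where x: "x \<in> interior K'" using interior_elem_ne[OF K'] by blast
    then have "x \<in> K" using interior_elem_subset[OF K'] eq interior_subset[of K] by blast
    then show ?thesis using interior_meet[OF K' K x] by simp
  qed
  moreover obtain F K' where "F \<in> interior_faces \<T> \<Omega>" "K' \<in> \<T>" "F facet_of K'"
    using ne unfolding interior_faces_def by blast
  ultimately show False using n by blast
qed

end

subsection \<open>Errors on face patches\<close>

lemma L2_cong:
  fixes f :: "'a::euclidean_space \<Rightarrow> 'b::euclidean_space"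
  assumes "f \<in> L2 (interior K)" "\<And>x. x \<in> interior K \<Longrightarrow> f x = g x" shows "g \<in> L2 (interior K)"
proof -
  have "(\<lambda>x. indicator (interior K) x *\<^sub>R f x) = (\<lambda>x. indicator (interior K) x *\<^sub>R g x)"
    using assms(2) by (intro ext) (auto simp: indicator_def)
  moreover have "set_integrable lebesgue (interior K) (\<lambda>x. (norm (f x))\<^sup>2) \<longleftrightarrow> set_integrable lebesgue (interior K) (\<lambda>x. (norm (g x))\<^sup>2)"
    using assms(2) by (intro set_integrable_cong) auto
  ultimately show ?thesis using assms(1) unfolding L2_iff[OF interior_sets_lebesgue] by simp
qed

context mesh
begin

lemma cpw_elem:
  assumes "v \<in> cpw_poly l \<T> \<Omega>" "K \<in> \<T>"
  obtains q where "polyd l q" "\<And>x. x \<in> K \<Longrightarrow> v x = q x"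
proof -
  have "v \<in> Poly l K" using assms by (simp add: cpw_poly_def)
  then obtain q where "polyd l q" "\<forall>x\<in>K. v x = q x" unfolding Poly_iff by blast
  then show ?thesis using that[of q] by simp
qed

lemma cpw_error_L2:
  assumes u: "u \<in> L2 \<Omega>" and v: "v \<in> cpw_poly l \<T> \<Omega>" and K: "K \<in> \<T>"
  shows "(\<lambda>x. u x - v x) \<in> L2 (interior K)"
proof -
  obtain q where q: "polyd l q" "\<And>x. x \<in> K \<Longrightarrow> v x = q x" using cpw_elem[OF v K] by blast
  show ?thesis
    by (rule L2_cong[OF L2_diff[OF L2_interior_elem[OF u K] L2_interior_polyd(1)[OF K q(1)] interior_sets_lebesgue]])
      (use q(2) interior_subset in force)
qed

lemma face_error:
  assumes "u \<in> L2 \<Omega>" "v \<in> cpw_poly l \<T> \<Omega>"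
  shows "(L2_norm_on (face_patch \<T> F) (\<lambda>x. u x - v x))\<^sup>2 = (\<Sum>K\<in>{K \<in> \<T>. F facet_of K}. sq_on K (\<lambda>x. u x - v x))"
proof (rule sq_on_pieces)
  show "(\<Union>K\<in>{K \<in> \<T>. F facet_of K}. interior K) \<subseteq> face_patch \<T> F"
    unfolding face_patch_def using interior_subset by blast
qed (use cpw_error_L2[OF assms] in \<open>auto simp: face_patch_def\<close>)

lemma domain_error:
  assumes "u \<in> L2 \<Omega>" "v \<in> cpw_poly l \<T> \<Omega>"
  shows "(L2_norm_on \<Omega> (\<lambda>x. u x - v x))\<^sup>2 = (\<Sum>K\<in>\<T>. sq_on K (\<lambda>x. u x - v x))"
  by (rule sq_on_pieces) (use interior_elem_subset \<Omega>_subset cpw_error_L2[OF assms] in auto)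

definition l2_const where
  "l2_const l = (2 + 2 * (real (Suc l) ^ Suc DIM('a) * (real l ^ l)\<^sup>2 * (path_const l * (comp_const * (8 / cw DIM('a) l)))))
     * (4 * \<sigma>) ^ DIM('a)"

text \<open>The weight is \<open>vol\<close>, free of the coefficient; the monotone paths serve to
  connect the elements at a node through facets.\<close>

lemma L2_quasi_interpolation:
  assumes qm: "quasi_monotone l \<T> \<Omega> a" and l: "l > 0" and ne: "interior_faces \<T> \<Omega> \<noteq> {}"
    and u: "u \<in> L2 \<Omega>" and v: "\<And>F. F \<in> interior_faces \<T> \<Omega> \<Longrightarrow> v F \<in> cpw_poly l \<T> \<Omega>"
  obtains w where "w \<in> cpw_poly l \<T> \<Omega>" "(L2_norm_on \<Omega> (\<lambda>x. u x - w x))\<^sup>2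
    \<le> l2_const l * (\<Sum>F\<in>interior_faces \<T> \<Omega>. (L2_norm_on (face_patch \<T> F) (\<lambda>x. u x - v F x))\<^sup>2)"
proof -
  let ?I = "interior_faces \<T> \<Omega>"
  have "\<exists>q. polyd l q \<and> (\<forall>x\<in>K. v F x = q x)" if "F \<in> ?I" "K \<in> \<T>" for F K
    using cpw_elem[OF v[OF that(1)] that(2)] by metis
  then obtain \<xi> where \<xi>: "\<And>F K. F \<in> ?I \<Longrightarrow> K \<in> \<T> \<Longrightarrow> polyd l (\<xi> F K)"
    "\<And>F K x. F \<in> ?I \<Longrightarrow> K \<in> \<T> \<Longrightarrow> x \<in> K \<Longrightarrow> v F x = \<xi> F K x" by metis
  \<comment> \<open>Each element takes its polynomial from the approximation on one of its interior
    facets, chosen arbitrarily.\<close>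
  obtain fc where fc: "\<And>K. K \<in> \<T> \<Longrightarrow> fc K \<in> ?I" "\<And>K. K \<in> \<T> \<Longrightarrow> fc K facet_of K"
    using ex_interior_facet[OF ne] by metis
  define \<pi> where "\<pi> K = \<xi> (fc K) K" for K
  define e where "e F = (L2_norm_on (face_patch \<T> F) (\<lambda>x. u x - v F x))\<^sup>2" for F
  \<comment> \<open>Summing over all interior facets of K makes \<open>E K\<close> a bound for the
    error on K of the chosen polynomial and also of the approximation on any facet that is met by a
    path.\<close>
  define E where "E K = (\<Sum>F\<in>{F \<in> ?I. F facet_of K}. e F)" for K
  have e0: "e F \<ge> 0" for F by (simp add: e_def)
  have E0: "E K \<ge> 0" for K unfolding E_def by (intro sum_nonneg e0)
  have sq_le: "sq_on K (\<lambda>x. u x - \<xi> F K x) \<le> E K" if K: "K \<in> \<T>" and F: "F \<in> ?I" "F facet_of K" for K F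
  proof -
    have "sq_on K (\<lambda>x. u x - \<xi> F K x) = sq_on K (\<lambda>x. u x - v F x)"
      using \<xi>(2)[OF F(1) K] interior_subset[of K] by (intro sq_on_cong) auto
    also have "\<dots> \<le> e F"
      unfolding e_def face_error[OF u v[OF F(1)]] using K F fT by (intro member_le_sum) auto
    also have "\<dots> \<le> E K" unfolding E_def using F finite_interior_faces e0 by (intro member_le_sum) auto
    finally show ?thesis .
  qed
  have uL: "(\<lambda>x. u x - p x) \<in> L2 (interior K)" if "K \<in> \<T>" "polyd l p" for K p
    by (rule L2_diff[OF L2_interior_elem[OF u that(1)] L2_interior_polyd(1)[OF that] interior_sets_lebesgue])
  have diff: "sq_on K (\<lambda>x. p x - q x) \<le> 2 * sq_on K (\<lambda>x. u x - q x) + 2 * sq_on K (\<lambda>x. u x - p x)"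
    if K: "K \<in> \<T>" "polyd l p" "polyd l q" for K p q
    using sq_on_diff_le[OF uL[OF K(1,3)] uL[OF K(1,2)]] by simp
  define D where "D = 8 / cw DIM('a) l"
  have jump: "(\<pi> K z - \<pi> K' z)\<^sup>2 \<le> D * (E K / vol K + E K' / vol K')"
    if ad: "adj K K'" and z: "z \<in> nodes l \<T>" "z \<in> K" "z \<in> K'" for K K' z
  proof -
    define F where "F = K \<inter> K'"
    have F: "F \<in> ?I" using adj_interior_face[OF ad] by (simp add: F_def)
    \<comment> \<open>The approximation on the patch of F is continuous and has one value at z, with
      which the polynomials of both neighbours are compared. Two errors on X give 4 /
      \<open>cw\<close>, and the two neighbours give 8 / \<open>cw\<close>.\<close>
    have nv: "(\<pi> X z - v F z)\<^sup>2 \<le> 4 / cw DIM('a) l * (E X / vol X)" if X: "X \<in> \<T>" "z \<in> X" "F facet_of X" for X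
    proof -
      let ?q = "\<lambda>x. \<pi> X x - \<xi> F X x"
      obtain \<gamma> where g: "\<gamma> \<in> lindices (verts X) l" "z = lnode (verts X) l \<gamma>" by (rule node_of_elem[OF l z(1) X(1,2)])
      have p: "polyd l (\<pi> X)" unfolding \<pi>_def by (rule \<xi>(1)[OF fc(1)[OF X(1)] X(1)])
      have q: "polyd l ?q"
        using polyd_add[OF p polyd_scale[OF \<xi>(1)[OF F X(1)], of "-1"]] by simp
      have "cw DIM('a) l * vol X * (?q z)\<^sup>2 \<le> sq_on X ?q"
        using node_value_le[OF elem(1)[OF X(1)] q l g(1)] g(2) by (simp add: elem(2)[OF X(1)] vol_def sq_on_def)
      also have "\<dots> \<le> 2 * E X + 2 * E X"
        using diff[OF X(1) p \<xi>(1)[OF F X(1)]] sq_le[OF X(1) F X(3)] sq_le[OF X(1) fc(1)[OF X(1)] fc(2)[OF X(1)]]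
        by (simp add: \<pi>_def)
      finally show ?thesis
        using vol_bounds(3)[OF X(1)] cw_pos[of "DIM('a)" l] \<xi>(2)[OF F X(1,2)] by (simp add: field_simps)
    qed
    have T: "K \<in> \<T>" "K' \<in> \<T>" "F facet_of K" "F facet_of K'"
      using ad adj_sym[OF ad] by (auto simp: adj_def F_def Int_commute)
    have "(\<pi> K z - \<pi> K' z)\<^sup>2 \<le> 2 * (\<pi> K z - v F z)\<^sup>2 + 2 * (\<pi> K' z - v F z)\<^sup>2"
      using power2_diff_le[of "\<pi> K z" "\<pi> K' z" "v F z"] by (simp add: power2_commute)
    also have "\<dots> \<le> 2 * (4 / cw DIM('a) l * (E K / vol K)) + 2 * (4 / cw DIM('a) l * (E K' / vol K'))"
      using nv[OF T(1) z(2) T(3)] nv[OF T(2) z(3) T(4)] by simp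
    also have "\<dots> = D * (E K / vol K + E K' / vol K')" by (simp add: D_def distrib_left)
    finally show ?thesis .
  qed
  have comp: "vol K \<le> comp_const * vol K'"
    if T: "K \<in> \<T>" "K' \<in> \<T>" and d: "diameter K \<le> ratio * diameter K'" for K K'
  proof -
    have "ratio ^ DIM('a) * (4 * \<sigma>) ^ DIM('a) \<le> ratio ^ (DIM('a) + 2) * (4 * \<sigma>) ^ DIM('a)"
      using ratio_ge \<sigma> by (intro mult_right_mono power_increasing) auto
    also have "\<dots> \<le> comp_const" by (simp add: comp_const_def)
    finally have "ratio ^ DIM('a) * (4 * \<sigma>) ^ DIM('a) * vol K' \<le> comp_const * vol K'"
      using vol_bounds(3)[OF T(2)] by (intro mult_right_mono) auto
    then show ?thesis using vol_compare[OF T d] by simp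
  qed
  have D0: "D \<ge> 0" using cw_pos[of "DIM('a)" l] by (simp add: D_def)
  have "\<exists>val. (\<Sum>K\<in>\<T>. vol K * (\<Sum>\<gamma>\<in>lindices (verts K) l. (\<pi> K (lnode (verts K) l \<gamma>) - val (lnode (verts K) l \<gamma>))\<^sup>2))
      \<le> path_const l * (comp_const * D) * (\<Sum>K\<in>\<T>. E K)"
    by (rule node_average[where W = vol and E = E and \<pi> = \<pi>, OF qm l comp_const_ge vol_bounds(3) comp E0 D0 jump])
      (assumption | rule exI)+
  then obtain val where val: "(\<Sum>K\<in>\<T>. vol K * (\<Sum>\<gamma>\<in>lindices (verts K) l. (\<pi> K (lnode (verts K) l \<gamma>) - val (lnode (verts K) l \<gamma>))\<^sup>2))
      \<le> path_const l * (comp_const * D) * (\<Sum>K\<in>\<T>. E K)" by blast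
  define S where "S K = (\<Sum>\<gamma>\<in>lindices (verts K) l. (\<pi> K (lnode (verts K) l \<gamma>) - val (lnode (verts K) l \<gamma>))\<^sup>2)" for K
  define B where "B = real (Suc l) ^ Suc DIM('a) * (real l ^ l)\<^sup>2"
  have B0: "B \<ge> 0" by (simp add: B_def)
  define w where "w = nint l val"
  have w: "w \<in> cpw_poly l \<T> \<Omega>" unfolding w_def by (rule nint_cpw)
  have we: "sq_on K (\<lambda>x. u x - w x) \<le> 2 * E K + 2 * B * (vol K * S K)" if K: "K \<in> \<T>" for K
  proof -
    have p: "polyd l (\<pi> K)" unfolding \<pi>_def by (rule \<xi>(1)[OF fc(1)[OF K] K])
    let ?q = "\<lambda>x. \<pi> K x - lint l val (verts K) x"
    note q = interpolation_difference[OF l K p, where val = val, folded S_def B_def]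
    have "sq_on K (\<lambda>x. u x - w x) = sq_on K (\<lambda>x. (u x - \<pi> K x) - (-1) *\<^sub>R ?q x)"
      using nint_eq[OF K] interior_subset[of K] by (intro sq_on_cong) (auto simp: w_def)
    also have "\<dots> \<le> 2 * sq_on K (\<lambda>x. u x - \<pi> K x) + 2 * sq_on K (\<lambda>x. (-1) *\<^sub>R ?q x)"
      by (rule sq_on_diff_le[OF uL[OF K p] L2_scale[OF L2_interior_polyd(1)[OF K q(1)]]]) simp
    also have "sq_on K (\<lambda>x. (-1) *\<^sub>R ?q x) = sq_on K ?q" by (intro sq_on_cong) simp
    also have "2 * sq_on K (\<lambda>x. u x - \<pi> K x) + 2 * sq_on K ?q \<le> 2 * E K + 2 * B * (vol K * S K)"
      using q(2) sq_le[OF K fc(1)[OF K] fc(2)[OF K]] by (simp add: \<pi>_def)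
    finally show ?thesis .
  qed
  \<comment> \<open>Pairs of element and facet are summed the other way round, each facet lying in
    at most (4 \<open>\<sigma>\<close>)^d elements.\<close>
  have sE: "(\<Sum>K\<in>\<T>. E K) \<le> (4 * \<sigma>) ^ DIM('a) * (\<Sum>F\<in>?I. e F)"
  proof -
    have "(\<Sum>K\<in>\<T>. E K) = (\<Sum>F\<in>?I. \<Sum>K\<in>{K \<in> \<T>. F facet_of K}. e F)"
      unfolding E_def by (rule sum.swap_restrict[OF fT finite_interior_faces])
    also have "\<dots> \<le> (\<Sum>F\<in>?I. (4 * \<sigma>) ^ DIM('a) * e F)"
      using card_facet_elems e0 by (intro sum_mono) (auto simp: interior_faces_def intro!: mult_right_mono)
    finally show ?thesis by (simp add: sum_distrib_left)
  qed
  have "(L2_norm_on \<Omega> (\<lambda>x. u x - w x))\<^sup>2 \<le> (\<Sum>K\<in>\<T>. 2 * E K + 2 * B * (vol K * S K))"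
    unfolding domain_error[OF u w] using we by (rule sum_mono)
  also have "\<dots> = 2 * (\<Sum>K\<in>\<T>. E K) + 2 * B * (\<Sum>K\<in>\<T>. vol K * S K)"
    by (simp add: sum.distrib sum_distrib_left)
  also have "\<dots> \<le> 2 * (\<Sum>K\<in>\<T>. E K) + 2 * B * (path_const l * (comp_const * D) * (\<Sum>K\<in>\<T>. E K))"
    using val B0 unfolding S_def by (intro add_left_mono mult_left_mono) auto
  also have "\<dots> = (2 + 2 * (B * (path_const l * (comp_const * D)))) * (\<Sum>K\<in>\<T>. E K)"
    by (simp add: distrib_left distrib_right mult_ac)
  also have "\<dots> \<le> (2 + 2 * (B * (path_const l * (comp_const * D)))) * ((4 * \<sigma>) ^ DIM('a) * (\<Sum>F\<in>?I. e F))"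
    using B0 path_const_nonneg comp_const_ge D0 by (intro mult_left_mono sE add_nonneg_nonneg mult_nonneg_nonneg) auto
  also have "\<dots> = l2_const l * (\<Sum>F\<in>?I. e F)"
    unfolding l2_const_def B_def[symmetric] D_def[symmetric] by (simp only: mult_ac)
  finally show ?thesis using that w unfolding e_def by blast
qed

section \<open>Weighted gradient errors element by element\<close>

lemma aval_eq:
  assumes "elementwise_constant \<T> a" "K \<in> \<T>" "x \<in> interior K" shows "a x = aval a K"
proof -
  obtain c where c: "\<forall>x\<in>interior K. a x = c"
    using assms(1,2) by (auto simp: elementwise_constant_def constant_on_def)
  then have "aval a K = c" unfolding element_value_def using assms(3) by (intro the_equality) auto
  then show ?thesis using c assms(3) by simp
qed

lemma aval_pos:
  assumes "elementwise_constant \<T> a" "uniformly_positive \<Omega> a" "K \<in> \<T>" shows "aval a K > 0"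
proof -
  obtain x where x: "x \<in> interior K" using interior_elem_ne[OF assms(3)] by blast
  obtain \<delta> where "\<delta> > 0" "\<forall>x\<in>\<Omega>. \<delta> \<le> a x" using assms(2) by (auto simp: uniformly_positive_def)
  then have "a x > 0" using x interior_elem_subset[OF assms(3)] by force
  then show ?thesis using aval_eq[OF assms(1,3) x] by simp
qed

text \<open>Replaces the chosen \<open>wgrad\<close> by the explicit difference of g and the
  elementwise gradients, which by \<open>pw_weak_grad\<close> is a weak gradient of u - v. The
  coefficient is constant on each piece and moves out of the integral.\<close>

lemma grad_error_global:
  assumes ec: "elementwise_constant \<T> a" and ap: "\<And>K. K \<in> \<T> \<Longrightarrow> aval a K > 0"
    and wk: "weak_grad \<Omega> u g" and g: "g \<in> L2 \<Omega>" and v: "v \<in> cpw_poly l \<T> \<Omega>"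
    and q: "\<And>K. K \<in> \<T> \<Longrightarrow> polyd l (q K)" "\<And>K x. K \<in> \<T> \<Longrightarrow> x \<in> K \<Longrightarrow> v x = q K x"
  shows "(L2_norm_on \<Omega> (\<lambda>x. sqrt (a x) *\<^sub>R wgrad \<Omega> (\<lambda>y. u y - v y) x))\<^sup>2 = (\<Sum>K\<in>\<T>. aval a K * sq_on K (\<lambda>x. g x - grad (q K) x))"
proof -
  have C: "Ck (Suc 0) (q K)" if "K \<in> \<T>" for K by (rule Ck_polyd[OF q(1)[OF that]])
  have wv: "weak_grad \<Omega> v (pw_grad \<T> q)"
    by (rule pw_weak_grad[OF \<Omega>(1,2) \<Omega>_subset interior_elem_subset C]) (use v q(2) in \<open>auto simp: cpw_poly_def\<close>)
  let ?G = "\<lambda>x. g x - pw_grad \<T> q x"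
  have G: "?G \<in> L2 \<Omega>" by (rule L2_diff[OF g pw_grad_L2[OF \<Omega>(1,2) C] open_sets_lebesgue[OF \<Omega>(1)]])
  note wd = weak_grad_diff[OF wk wv]
  \<comment> \<open>That a weak gradient exists makes the chosen one square integrable, which the
    splitting over the elements requires.\<close>
  have "is_weak_gradient \<Omega> (\<lambda>y. u y - v y) (wgrad \<Omega> (\<lambda>y. u y - v y))"
    unfolding wgrad_def by (rule someI[of "is_weak_gradient \<Omega> (\<lambda>y. u y - v y)", OF weak_grad_imp_is_weak_gradient[OF \<Omega>(1) wd G]])
  then have wL: "wgrad \<Omega> (\<lambda>y. u y - v y) \<in> L2 \<Omega>" by (simp add: is_weak_gradient_def)
  have s: "sqrt (a x) = sqrt (aval a K)" if "K \<in> \<T>" "x \<in> interior K" for K x using aval_eq[OF ec that] by simp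
  have "(L2_norm_on \<Omega> (\<lambda>x. sqrt (a x) *\<^sub>R wgrad \<Omega> (\<lambda>y. u y - v y) x))\<^sup>2
     = (\<Sum>K\<in>\<T>. sq_on K (\<lambda>x. sqrt (a x) *\<^sub>R wgrad \<Omega> (\<lambda>y. u y - v y) x))"
    by (rule sq_on_pieces[OF subset_refl _ \<Omega>_subset])
      (use interior_elem_subset in blast, rule L2_scale[OF L2_interior_elem[OF wL] s])
  also have "\<dots> = (\<Sum>K\<in>\<T>. aval a K * sq_on K (\<lambda>x. g x - grad (q K) x))"
  proof (rule sum.cong[OF refl])
    fix K assume K: "K \<in> \<T>"
    have "sq_on K (\<lambda>x. sqrt (a x) *\<^sub>R wgrad \<Omega> (\<lambda>y. u y - v y) x) = (sqrt (aval a K))\<^sup>2 * sq_on K (wgrad \<Omega> (\<lambda>y. u y - v y))"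
      by (rule sq_on_scale[OF s[OF K]])
    also have "sq_on K (wgrad \<Omega> (\<lambda>y. u y - v y)) = sq_on K ?G"
      by (rule sq_on_AE_cong[OF negligible_subset[OF wgrad_ae_eq[OF \<Omega>(1,2) wd G]] L2_interior_elem[OF G K]])
        (use interior_elem_subset[OF K] in blast)
    also have "sq_on K ?G = sq_on K (\<lambda>x. g x - grad (q K) x)"
      using pw_grad_interior[OF fT K] disjoint[OF K] by (intro sq_on_cong) auto
    finally show "sq_on K (\<lambda>x. sqrt (a x) *\<^sub>R wgrad \<Omega> (\<lambda>y. u y - v y) x) = aval a K * sq_on K (\<lambda>x. g x - grad (q K) x)"
      using ap[OF K] by simp
  qed
  finally show ?thesis .
qed

lemma grad_error_local:
  assumes ec: "elementwise_constant \<T> a" and K: "K \<in> \<T>" and ap: "aval a K > 0"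
    and wk: "weak_grad \<Omega> u g" and g: "g \<in> L2 \<Omega>"
    and q: "polyd l q" "\<And>x. x \<in> K \<Longrightarrow> p x = q x"
  shows "(L2_norm_on (interior K) (\<lambda>x. sqrt (a x) *\<^sub>R wgrad (interior K) (\<lambda>y. u y - p y) x))\<^sup>2 = aval a K * sq_on K (\<lambda>x. g x - grad q x)"
proof -
  let ?G = "\<lambda>x. g x - grad q x"
  have "weak_grad (interior K) p (grad q)"
    by (rule weak_grad_cong[OF weak_grad_Ck[OF compact_elem[OF K] convex_elem[OF K] Ck_polyd[OF q(1)]]])
      (use q(2) interior_subset in force)+
  then have wd: "weak_grad (interior K) (\<lambda>x. u x - p x) ?G"
    by (rule weak_grad_diff[OF weak_grad_subset[OF wk open_interior interior_elem_subset[OF K]]])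
  have G: "?G \<in> L2 (interior K)"
    by (rule L2_diff[OF L2_interior_elem[OF g K] L2_interior_polyd(2)[OF K q(1)] interior_sets_lebesgue])
  have "(L2_norm_on (interior K) (\<lambda>x. sqrt (a x) *\<^sub>R wgrad (interior K) (\<lambda>y. u y - p y) x))\<^sup>2
      = sq_on K (\<lambda>x. sqrt (a x) *\<^sub>R wgrad (interior K) (\<lambda>y. u y - p y) x)"
    unfolding L2_norm_on_sq[OF interior_sets_lebesgue] sq_on_def ..
  also have "\<dots> = (sqrt (aval a K))\<^sup>2 * sq_on K (wgrad (interior K) (\<lambda>y. u y - p y))"
    using aval_eq[OF ec K] by (intro sq_on_scale) simp
  also have "sq_on K (wgrad (interior K) (\<lambda>y. u y - p y)) = sq_on K ?G"
    by (rule sq_on_AE_cong[OF wgrad_ae_eq[OF open_interior bounded_interior[OF bounded_elem[OF K]] wd G] G])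
  finally show ?thesis using ap by simp
qed

end

section \<open>The equivalence\<close>

lemma cINF_nonneg_lower:
  fixes f :: "'i \<Rightarrow> real"
  assumes "\<And>x. x \<in> A \<Longrightarrow> 0 \<le> f x" "x \<in> A" shows "(INF x\<in>A. f x) \<le> f x"
  using assms by (intro cINF_lower bdd_belowI2[of _ 0]) auto

text \<open>The infima need not be attained. Minimisers up to \<open>\<delta>\<close> are taken
  simultaneously for all indices, with a total error of at most \<open>\<epsilon>\<close>.\<close>

lemma le_sum_INF:
  fixes f :: "'i \<Rightarrow> 'b \<Rightarrow> real"
  assumes I: "finite I" and ne: "\<And>i. i \<in> I \<Longrightarrow> A i \<noteq> {}" and f: "\<And>i x. 0 \<le> f i x" and C: "C \<ge> 0"
    and X: "\<And>x. (\<And>i. i \<in> I \<Longrightarrow> x i \<in> A i) \<Longrightarrow> X \<le> C * (\<Sum>i\<in>I. f i (x i))"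
  shows "X \<le> C * (\<Sum>i\<in>I. INF x\<in>A i. f i x)"
proof (rule field_le_epsilon)
  fix \<epsilon> :: real assume \<epsilon>: "\<epsilon> > 0"
  \<comment> \<open>The added 1 keeps the denominator positive when C or the index set is
    trivial.\<close>
  define \<delta> where "\<delta> = \<epsilon> / (C * real (card I) + 1)"
  have p: "C * real (card I) + 1 > 0" using C by (intro add_nonneg_pos) auto
  have \<delta>: "\<delta> > 0" using \<epsilon> p by (simp add: \<delta>_def)
  have "\<exists>x. x \<in> A i \<and> f i x \<le> (INF x\<in>A i. f i x) + \<delta>" if i: "i \<in> I" for i
  proof -
    have "\<exists>y\<in>f i ` A i. y < (INF x\<in>A i. f i x) + \<delta>"
      using ne[OF i] \<delta> by (intro cInf_lessD) auto
    then show ?thesis by (auto intro: less_imp_le)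
  qed
  then obtain x where x: "\<And>i. i \<in> I \<Longrightarrow> x i \<in> A i" "\<And>i. i \<in> I \<Longrightarrow> f i (x i) \<le> (INF x\<in>A i. f i x) + \<delta>" by metis
  have "X \<le> C * (\<Sum>i\<in>I. f i (x i))" by (rule X[OF x(1)])
  also have "\<dots> \<le> C * (\<Sum>i\<in>I. (INF x\<in>A i. f i x) + \<delta>)" using x(2) C by (intro mult_left_mono sum_mono) auto
  also have "\<dots> = C * (\<Sum>i\<in>I. INF x\<in>A i. f i x) + C * real (card I) * \<delta>" by (simp add: sum.distrib distrib_left)
  also have "C * real (card I) * \<delta> \<le> (C * real (card I) + 1) * \<delta>" using \<delta> by (intro mult_right_mono) auto
  also have "\<dots> = \<epsilon>" using p by (simp add: \<delta>_def)
  finally show "X \<le> C * (\<Sum>i\<in>I. INF x\<in>A i. f i x) + \<epsilon>" by simp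
qed

lemma L2_norm_on_cong: "(\<And>x. x \<in> D \<Longrightarrow> f x = g x) \<Longrightarrow> L2_norm_on D f = L2_norm_on D g"
  unfolding L2_norm_on_def by (intro arg_cong[of _ _ sqrt] Bochner_Integration.integral_cong) auto

context mesh
begin

section \<open>The inequalities for the two infima\<close>

context
  fixes a u and l :: nat and \<beta> :: real
  assumes ec: "elementwise_constant \<T> a" and up: "uniformly_positive \<Omega> a" and \<beta>: "\<beta> > 0" and uH: "u \<in> H1 \<Omega>"
begin

abbreviation (input) "gerr v \<equiv> (L2_norm_on \<Omega> (\<lambda>x. sqrt (a x) *\<^sub>R wgrad \<Omega> (\<lambda>y. u y - v y) x))\<^sup>2"
abbreviation (input) "kerr K p \<equiv> (L2_norm_on (interior K) (\<lambda>x. sqrt (a x) *\<^sub>R wgrad (interior K) (\<lambda>y. u y - p y) x))\<^sup>2"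
abbreviation (input) "ferr D q \<equiv> \<beta> * (L2_norm_on D (\<lambda>x. u x - q x))\<^sup>2"

lemma H1_gradient:
  obtains g where "weak_grad \<Omega> u g" "g \<in> L2 \<Omega>" "u \<in> L2 \<Omega>"
proof -
  obtain g where g: "is_weak_gradient \<Omega> u g" and u: "u \<in> L2 \<Omega>" using uH by (auto simp: H1_def)
  have "weak_grad \<Omega> u g"
    by (rule is_weak_gradient_imp_weak_grad[OF \<Omega>(1,2) L2_imp_set_integrable[OF u open_sets_lebesgue[OF \<Omega>(1)] \<Omega>(2)] g])
  then show ?thesis using that g u by (simp add: is_weak_gradient_def)
qed

lemma cpw_ne: "cpw_poly l \<T> \<Omega> \<noteq> {}" using nint_cpw by blast

text \<open>The restrictions of a global v split its gradient error exactly. Although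
  \<open>wgrad\<close> is chosen separately on the domain and on each element, both errors are
  expressed by the same g.\<close>

lemma gradient_lower: "(\<Sum>K\<in>\<T>. INF p\<in>Poly l K. kerr K p) \<le> (INF v\<in>cpw_poly l \<T> \<Omega>. gerr v)"
proof (rule cINF_greatest[OF cpw_ne])
  fix v assume v: "v \<in> cpw_poly l \<T> \<Omega>"
  obtain g where g: "weak_grad \<Omega> u g" "g \<in> L2 \<Omega>" by (rule H1_gradient)
  have "\<exists>q. polyd l q \<and> (\<forall>x\<in>K. v x = q x)" if "K \<in> \<T>" for K using cpw_elem[OF v that] by metis
  then obtain q where q: "\<And>K. K \<in> \<T> \<Longrightarrow> polyd l (q K)" "\<And>K x. K \<in> \<T> \<Longrightarrow> x \<in> K \<Longrightarrow> v x = q K x" by metis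
  have "(\<Sum>K\<in>\<T>. INF p\<in>Poly l K. kerr K p) \<le> (\<Sum>K\<in>\<T>. kerr K v)"
    using v by (intro sum_mono cINF_nonneg_lower) (auto simp: cpw_poly_def)
  also have "\<dots> = (\<Sum>K\<in>\<T>. aval a K * sq_on K (\<lambda>x. g x - grad (q K) x))"
    by (intro sum.cong refl grad_error_local[OF ec _ aval_pos[OF ec up] g]) (use q in auto)
  also have "\<dots> = gerr v"
    by (rule grad_error_global[where q = q, OF ec aval_pos[OF ec up] g v q, symmetric])
  finally show "(\<Sum>K\<in>\<T>. INF p\<in>Poly l K. kerr K p) \<le> gerr v" .
qed

lemma L2_lower:
  "(\<Sum>F\<in>interior_faces \<T> \<Omega>. INF q\<in>restrictions (cpw_poly l \<T> \<Omega>) (face_patch \<T> F). ferr (face_patch \<T> F) q)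
    \<le> 2 ^ Suc DIM('a) * (INF w\<in>cpw_poly l \<T> \<Omega>. ferr \<Omega> w)" (is "?L \<le> _")
proof -
  have "?L / 2 ^ Suc DIM('a) \<le> (INF w\<in>cpw_poly l \<T> \<Omega>. ferr \<Omega> w)"
  proof (rule cINF_greatest[OF cpw_ne])
    fix w assume w: "w \<in> cpw_poly l \<T> \<Omega>"
    have u: "u \<in> L2 \<Omega>" using uH by (simp add: H1_def)
    have "?L \<le> (\<Sum>F\<in>interior_faces \<T> \<Omega>. ferr (face_patch \<T> F) w)"
      using w \<beta> by (intro sum_mono cINF_nonneg_lower) (auto simp: restrictions_def)
    also have "\<dots> = \<beta> * (\<Sum>F\<in>interior_faces \<T> \<Omega>. \<Sum>K\<in>{K \<in> \<T>. F facet_of K}. sq_on K (\<lambda>x. u x - w x))"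
      by (simp add: face_error[OF u w] sum_distrib_left)
    also have "\<dots> = \<beta> * (\<Sum>K\<in>\<T>. \<Sum>F\<in>{F \<in> interior_faces \<T> \<Omega>. F facet_of K}. sq_on K (\<lambda>x. u x - w x))"
      by (subst sum.swap_restrict[OF fT finite_interior_faces]) simp
    also have "\<dots> \<le> \<beta> * (\<Sum>K\<in>\<T>. 2 ^ Suc DIM('a) * sq_on K (\<lambda>x. u x - w x))"
    proof (intro mult_left_mono sum_mono)
      fix K assume K: "K \<in> \<T>"
      have "card {F \<in> interior_faces \<T> \<Omega>. F facet_of K} \<le> card {F. F facet_of K}"
        by (rule card_mono[OF elem_facets(1)[OF K]]) auto
      then have "card {F \<in> interior_faces \<T> \<Omega>. F facet_of K} \<le> 2 ^ Suc DIM('a)" using elem_facets(2)[OF K] by linarith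
      then have "real (card {F \<in> interior_faces \<T> \<Omega>. F facet_of K}) \<le> real (2 ^ Suc DIM('a))" by (rule of_nat_mono)
      then have "real (card {F \<in> interior_faces \<T> \<Omega>. F facet_of K}) * sq_on K (\<lambda>x. u x - w x) \<le> 2 ^ Suc DIM('a) * sq_on K (\<lambda>x. u x - w x)"
        by (intro mult_right_mono) auto
      then show "(\<Sum>F\<in>{F \<in> interior_faces \<T> \<Omega>. F facet_of K}. sq_on K (\<lambda>x. u x - w x)) \<le> 2 ^ Suc DIM('a) * sq_on K (\<lambda>x. u x - w x)"
        by simp
    qed (use \<beta> in simp)
    also have "\<dots> = 2 ^ Suc DIM('a) * ferr \<Omega> w"
      unfolding domain_error[OF u w] by (simp only: sum_distrib_left[symmetric] mult_ac)
    finally show "?L / 2 ^ Suc DIM('a) \<le> ferr \<Omega> w" by (simp add: divide_le_eq mult.commute)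
  qed
  then show ?thesis by (simp add: divide_le_eq mult.commute)
qed

lemma gradient_upper:
  assumes qm: "quasi_monotone l \<T> \<Omega> a" and l: "l > 0"
  shows "(INF v\<in>cpw_poly l \<T> \<Omega>. gerr v) \<le> grad_const l * (\<Sum>K\<in>\<T>. INF p\<in>Poly l K. kerr K p)"
proof (rule le_sum_INF[OF fT])
  show "Poly l K \<noteq> {}" for K :: "'a set" using Poly_iff[of "\<lambda>x. 0" l K] polyd_const[of l 0] by blast
  show "0 \<le> grad_const l" using grad_const_pos[of l] by simp
  show "0 \<le> kerr K p" for K p by simp
  fix p assume p: "\<And>K. K \<in> \<T> \<Longrightarrow> p K \<in> Poly l K"
  obtain g where g: "weak_grad \<Omega> u g" "g \<in> L2 \<Omega>" by (rule H1_gradient)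
  obtain q where q: "\<And>K. K \<in> \<T> \<Longrightarrow> polyd l (q K)" "\<And>K x. K \<in> \<T> \<Longrightarrow> x \<in> K \<Longrightarrow> p K x = q K x"
    using p unfolding Poly_iff by metis
  obtain val where val: "(\<Sum>K\<in>\<T>. aval a K * sq_on K (\<lambda>x. g x - grad (lint l val (verts K)) x))
    \<le> grad_const l * (\<Sum>K\<in>\<T>. aval a K * sq_on K (\<lambda>x. g x - grad (q K) x))"
    by (rule grad_quasi_interpolation[OF qm l aval_pos[OF ec up] g q(1)])
  have "(INF v\<in>cpw_poly l \<T> \<Omega>. gerr v) \<le> gerr (nint l val)"
    by (rule cINF_nonneg_lower[OF _ nint_cpw]) simp
  also have "\<dots> = (\<Sum>K\<in>\<T>. aval a K * sq_on K (\<lambda>x. g x - grad (lint l val (verts K)) x))"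
    by (rule grad_error_global[OF ec aval_pos[OF ec up] g nint_cpw polyd_lint[OF elem(1)] nint_eq])
  also have "\<dots> \<le> grad_const l * (\<Sum>K\<in>\<T>. kerr K (p K))"
    using val by (simp add: grad_error_local[OF ec _ aval_pos[OF ec up] g q] cong: sum.cong)
  finally show "(INF v\<in>cpw_poly l \<T> \<Omega>. gerr v) \<le> grad_const l * (\<Sum>K\<in>\<T>. kerr K (p K))" .
qed

lemma l2_const_nonneg: "0 \<le> l2_const l"
  unfolding l2_const_def using path_const_nonneg comp_const_ge cw_pos[of "DIM('a)" l] \<sigma>
  by (intro add_nonneg_nonneg mult_nonneg_nonneg) auto

lemma L2_upper:
  assumes qm: "quasi_monotone l \<T> \<Omega> a" and l: "l > 0" and ne: "interior_faces \<T> \<Omega> \<noteq> {}"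
  shows "(INF w\<in>cpw_poly l \<T> \<Omega>. ferr \<Omega> w) \<le> l2_const l *
    (\<Sum>F\<in>interior_faces \<T> \<Omega>. INF q\<in>restrictions (cpw_poly l \<T> \<Omega>) (face_patch \<T> F). ferr (face_patch \<T> F) q)"
proof (rule le_sum_INF[OF finite_interior_faces])
  show "restrictions (cpw_poly l \<T> \<Omega>) D \<noteq> {}" for D using cpw_ne by (auto simp: restrictions_def)
  show "0 \<le> l2_const l" by (rule l2_const_nonneg)
  show "0 \<le> ferr D q" for D q using \<beta> by simp
  fix q assume q: "\<And>F. F \<in> interior_faces \<T> \<Omega> \<Longrightarrow> q F \<in> restrictions (cpw_poly l \<T> \<Omega>) (face_patch \<T> F)"
  have u: "u \<in> L2 \<Omega>" using uH by (simp add: H1_def)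
  obtain v where v: "\<And>F. F \<in> interior_faces \<T> \<Omega> \<Longrightarrow> v F \<in> cpw_poly l \<T> \<Omega>"
    "\<And>F x. F \<in> interior_faces \<T> \<Omega> \<Longrightarrow> x \<in> face_patch \<T> F \<Longrightarrow> q F x = v F x"
    using q unfolding restrictions_def by (simp, metis)
  obtain w where w: "w \<in> cpw_poly l \<T> \<Omega>" "(L2_norm_on \<Omega> (\<lambda>x. u x - w x))\<^sup>2
    \<le> l2_const l * (\<Sum>F\<in>interior_faces \<T> \<Omega>. (L2_norm_on (face_patch \<T> F) (\<lambda>x. u x - v F x))\<^sup>2)"
    by (rule L2_quasi_interpolation[OF qm l ne u v(1)])
  have e: "(\<Sum>F\<in>interior_faces \<T> \<Omega>. (L2_norm_on (face_patch \<T> F) (\<lambda>x. u x - v F x))\<^sup>2)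
     = (\<Sum>F\<in>interior_faces \<T> \<Omega>. (L2_norm_on (face_patch \<T> F) (\<lambda>x. u x - q F x))\<^sup>2)"
    using v(2) by (intro sum.cong refl arg_cong[of _ _ "\<lambda>t. t\<^sup>2"] L2_norm_on_cong) auto
  have "(INF w\<in>cpw_poly l \<T> \<Omega>. ferr \<Omega> w) \<le> ferr \<Omega> w"
    using \<beta> by (intro cINF_nonneg_lower[OF _ w(1)]) simp
  also have "\<dots> \<le> \<beta> * (l2_const l * (\<Sum>F\<in>interior_faces \<T> \<Omega>. (L2_norm_on (face_patch \<T> F) (\<lambda>x. u x - q F x))\<^sup>2))"
    using w(2) \<beta> unfolding e by (intro mult_left_mono) auto
  also have "\<dots> = l2_const l * (\<Sum>F\<in>interior_faces \<T> \<Omega>. ferr (face_patch \<T> F) (q F))"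
    by (simp add: sum_distrib_left mult_ac)
  finally show "(INF w\<in>cpw_poly l \<T> \<Omega>. ferr \<Omega> w) \<le> l2_const l * (\<Sum>F\<in>interior_faces \<T> \<Omega>. ferr (face_patch \<T> F) (q F))" .
qed

lemma local_le_global: "1 / 2 ^ Suc DIM('a) * local_error l \<T> \<Omega> a \<beta> u \<le> global_error l \<T> \<Omega> a \<beta> u"
proof -
  let ?G = "INF v\<in>cpw_poly l \<T> \<Omega>. gerr v"
  \<comment> \<open>The gradient part holds with constant 1; nonnegativity lets it be weakened to
    the constant of the L2 part.\<close>
  have "0 \<le> ?G" by (rule cINF_greatest[OF cpw_ne]) simp
  then have "1 * ?G \<le> 2 ^ Suc DIM('a) * ?G" by (intro mult_right_mono one_le_power) auto
  then have "local_error l \<T> \<Omega> a \<beta> u \<le> 2 ^ Suc DIM('a) * global_error l \<T> \<Omega> a \<beta> u"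
    using gradient_lower L2_lower unfolding local_error_def global_error_def by (simp only: distrib_left)
  then show ?thesis by (simp add: field_simps)
qed

lemma global_le_local:
  assumes "quasi_monotone l \<T> \<Omega> a" "l > 0" "interior_faces \<T> \<Omega> \<noteq> {}" and C: "grad_const l \<le> C" "l2_const l \<le> C"
  shows "global_error l \<T> \<Omega> a \<beta> u \<le> C * local_error l \<T> \<Omega> a \<beta> u"
proof -
  let ?K = "\<Sum>K\<in>\<T>. INF p\<in>Poly l K. kerr K p"
  let ?F = "\<Sum>F\<in>interior_faces \<T> \<Omega>. INF q\<in>restrictions (cpw_poly l \<T> \<Omega>) (face_patch \<T> F). ferr (face_patch \<T> F) q"
  have "0 \<le> (INF p\<in>Poly l K. kerr K p)" for K
    using Poly_iff[of "\<lambda>x. 0" l K] polyd_const[of l 0] by (intro cINF_greatest) auto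
  then have "0 \<le> ?K" by (intro sum_nonneg)
  moreover have "0 \<le> (INF q\<in>restrictions (cpw_poly l \<T> \<Omega>) D. ferr D q)" for D
    using cpw_ne \<beta> by (intro cINF_greatest) (auto simp: restrictions_def)
  then have "0 \<le> ?F" by (intro sum_nonneg)
  ultimately have "grad_const l * ?K \<le> C * ?K" "l2_const l * ?F \<le> C * ?F" using C by (auto intro: mult_right_mono)
  then show ?thesis
    using gradient_upper[OF assms(1,2)] L2_upper[OF assms(1-3)]
    unfolding local_error_def global_error_def by (simp only: distrib_left)
qed

end

end

theorem proposition3p4:
  fixes l :: nat and \<sigma> :: real
  assumes "l \<ge> 1" and "\<sigma> > 0"
  shows "\<exists>c>0. \<exists>C>0. \<forall>(\<Omega> :: 'a::euclidean_space set) \<T> a \<beta> u.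
    polyhedral_domain \<Omega> \<and> conforming_mesh \<T> \<Omega> \<and> shape_bounded \<sigma> \<T> \<and>
    uniformly_positive \<Omega> a \<and> elementwise_constant \<T> a \<and> \<beta> > 0 \<and>
    quasi_monotone l \<T> \<Omega> a \<and> u \<in> H1 \<Omega> \<longrightarrow>
      c * local_error l \<T> \<Omega> a \<beta> u \<le> global_error l \<T> \<Omega> a \<beta> u \<and>
      (interior_faces \<T> \<Omega> \<noteq> {} \<longrightarrow>
        global_error l \<T> \<Omega> a \<beta> u \<le> C * local_error l \<T> \<Omega> a \<beta> u)"
proof (intro exI conjI)
  \<comment> \<open>Outside the locale these constants take only the space, \<open>\<sigma>\<close>
    and l as arguments, which is the claimed independence of the mesh, of a and of
    \<open>\<beta>\<close>.\<close>
  define C where "C = max 1 (max (mesh.grad_const TYPE('a) \<sigma> l) (mesh.l2_const TYPE('a) \<sigma> l))"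
  show "0 < (1 / 2 ^ Suc DIM('a) :: real)" by simp
  show "0 < C" by (simp add: C_def)
  show "\<forall>(\<Omega> :: 'a::euclidean_space set) \<T> a \<beta> u.
    polyhedral_domain \<Omega> \<and> conforming_mesh \<T> \<Omega> \<and> shape_bounded \<sigma> \<T> \<and>
    uniformly_positive \<Omega> a \<and> elementwise_constant \<T> a \<and> \<beta> > 0 \<and>
    quasi_monotone l \<T> \<Omega> a \<and> u \<in> H1 \<Omega> \<longrightarrow>
      1 / 2 ^ Suc DIM('a) * local_error l \<T> \<Omega> a \<beta> u \<le> global_error l \<T> \<Omega> a \<beta> u \<and>
      (interior_faces \<T> \<Omega> \<noteq> {} \<longrightarrow>
        global_error l \<T> \<Omega> a \<beta> u \<le> C * local_error l \<T> \<Omega> a \<beta> u)"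
  proof (intro allI impI, elim conjE)
    fix \<Omega> :: "'a set" and \<T> a and \<beta> :: real and u
    assume h: "polyhedral_domain \<Omega>" "conforming_mesh \<T> \<Omega>" "shape_bounded \<sigma> \<T>" "uniformly_positive \<Omega> a"
      "elementwise_constant \<T> a" "\<beta> > 0" "quasi_monotone l \<T> \<Omega> a" "u \<in> H1 \<Omega>"
    interpret mesh \<T> \<Omega> \<sigma> using h(1-3) assms(2) by unfold_locales
    show "1 / 2 ^ Suc DIM('a) * local_error l \<T> \<Omega> a \<beta> u \<le> global_error l \<T> \<Omega> a \<beta> u \<and>
      (interior_faces \<T> \<Omega> \<noteq> {} \<longrightarrow> global_error l \<T> \<Omega> a \<beta> u \<le> C * local_error l \<T> \<Omega> a \<beta> u)"
      using local_le_global[OF h(5,4,6,8)] global_le_local[OF h(5,4,6,8,7), of C] assms(1)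
      by (auto simp: C_def)
  qed
qed

end
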